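(* Let $(k,q)\in\{(1,4),(2,3)\}$ and let $X=(X_i)_{i\in\mathbb Z}$ be the Holroyd--Liggett stationary $k$-dependent proper $q$-coloring of $\mathbb Z$. Then for any $\epsilon>0$ there exists an i.i.d. process $Y=(Y_i)_{i\in\mathbb Z}$ with entropy $h(Y)<h(X)+\epsilon$ such that $X$ is a finitary factor of $Y$, where moreover the factor map may be taken to commute with all automorphisms of $\mathbb Z$ (translations and reflections).
   Context: The Holroyd--Liggett colorings. For a finite word $x=x_1\cdots x_n$ over $\{1,\dots,q\}$, call $x$ proper if $x_i\ne x_{i+1}$ for $1\le i<n$, and let $\hat x_i$ be the word obtained from $x$ by deleting the $i$-th letter. Define $B(\emptyset)=1$ and, for $n\ge 1$, $B(x)=\mathbf 1_{\{x\text{ proper}\}}\sum_{i=1}^n B(\hat x_i)$. For $(k,q)=(1,4)$ and for $(k,q)=(2,3)$, the Holroyd--Liggett coloring is the stationary process $X=(X_i)_{i\in\mathbb Z}$ with $\mathbb P((X_{m+1},\dots,X_{m+n})=x)=B(x)\big/\sum_{y\in\{1,\dots,q\}^n}B(y)$ for all $m\in\mathbb Z$, $n\ge1$, $x\in\{1,\dots,q\}^n$. It is known (Holroyd and Liggett) that these finite-dimensional distributions are consistent and that the process is $k$-dependent, i.e. $(X_i)_{i\in U}$ and $(X_j)_{j\in V}$ are independent whenever $|i-j|>k$ for all $i\in U$, $j\in V$; it is also invariant under reflections. Entropy: for a discrete random variable $Z$, $H(Z)=-\sum_z\mathbb P(Z=z)\log_2\mathbb P(Z=z)$; for a stationary process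 $X$, $h(X)=\inf_V H((X_v)_{v\in V})/|V|$ over finite non-empty $V\subset\mathbb Z$; for i.i.d. $Y$, $h(Y)=H(Y_0)$. Finitary factor: with $Y$ taking values in a countable set $T$, a factor map from $Y$ to $X$ is a measurable $\varphi:T^{\mathbb Z}\to\{1,\dots,q\}^{\mathbb Z}$, commuting with the action of the relevant group of automorphisms of $\mathbb Z$, such that $\varphi(Y)$ has the same distribution as $X$. It is finitary if almost surely there is a finite $r$ such that $\varphi(y')_0=\varphi(Y)_0$ for all $y'\in T^{\mathbb Z}$ agreeing with $Y$ on $\{-r,\dots,r\}$. *)

theory Defs
  imports "HOL-Probability.Probability"
begin

definition del_letter :: "nat \<Rightarrow> 'c list \<Rightarrow> 'c list" where
  "del_letter i x = take i x @ drop (Suc i) x"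

text \<open>Proper words are the lists satisfying \<^const>\<open>distinct_adj\<close>.\<close>

function HL_B :: "'c list \<Rightarrow> nat" where
  "HL_B x =
    (if x = [] then 1
     else if distinct_adj x then (\<Sum>i<length x. HL_B (del_letter i x))
     else 0)"
  by pat_completeness auto
termination
  by (relation "Wellfounded.measure length") (auto simp: del_letter_def)

declare HL_B.simps [simp del]

definition words :: "nat \<Rightarrow> nat \<Rightarrow> nat list set" where
  "words q n = {x. set x \<subseteq> {1..q} \<and> length x = n}"

text \<open>
  The law of a window does not depend on its position \<open>m\<close>, so stationarity is part of the
  definition. These laws determine the law of the process, so its further properties, such as
  \<open>k\<close>-dependence for \<open>(k, q) = (1, 4)\<close> and \<open>(k, q) = (2, 3)\<close>, are consequences and not required.
\<close>

definition HL_coloring :: "nat \<Rightarrow> 'a measure \<Rightarrow> (int \<Rightarrow> 'a \<Rightarrow> nat) \<Rightarrow> bool" where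
  "HL_coloring q M X \<longleftrightarrow>
    prob_space M \<and>
    (\<forall>i. X i \<in> M \<rightarrow>\<^sub>M count_space {1..q}) \<and>
    (\<forall>(m::int) (n::nat). n \<ge> 1 \<longrightarrow> (\<forall>x\<in>words q n.
      measure M {\<omega> \<in> space M. \<forall>i<n. X (m + 1 + int i) \<omega> = x ! i}
        = real (HL_B x) / real (\<Sum>y\<in>words q n. HL_B y)))"

text \<open>
  Entropies take values in \<open>[0, \<infinity>]\<close>: a random variable on a countable set may have infinite
  entropy, which a real-valued sum would turn into \<open>0\<close>. For a discrete \<open>Z\<close> all but countably
  many terms of the sum vanish.
\<close>

definition shannon_entropy :: "'a measure \<Rightarrow> ('a \<Rightarrow> 'b) \<Rightarrow> ennreal" where
  "shannon_entropy M Z =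
    (\<Sum>\<^sub>\<infinity>z. let p = measure M {\<omega> \<in> space M. Z \<omega> = z} in ennreal (- (p * log 2 p)))"

definition process_entropy :: "'a measure \<Rightarrow> (int \<Rightarrow> 'a \<Rightarrow> 'b) \<Rightarrow> ennreal" where
  "process_entropy M X =
    (INF V\<in>{V. finite V \<and> V \<noteq> {}}.
      shannon_entropy M (\<lambda>\<omega>. \<lambda>v\<in>V. X v \<omega>) / of_nat (card V))"

definition iid_process :: "'a measure \<Rightarrow> 't set \<Rightarrow> (int \<Rightarrow> 'a \<Rightarrow> 't) \<Rightarrow> bool" where
  "iid_process N T Y \<longleftrightarrow>
    prob_space N \<and> countable T \<and>
    prob_space.indep_vars N (\<lambda>_. count_space T) Y UNIV \<and>
    (\<forall>i. distr N (count_space T) (Y i) = distr N (count_space T) (Y 0))"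

text \<open>The product sigma-algebra on the sequences indexed by the integers with values in \<open>S\<close>.\<close>

abbreviation seq_space :: "'c set \<Rightarrow> (int \<Rightarrow> 'c) measure" where
  "seq_space S \<equiv> PiM UNIV (\<lambda>_. count_space S)"

definition int_automorphisms :: "(int \<Rightarrow> int) set" where
  "int_automorphisms = range (\<lambda>a i. a + i) \<union> range (\<lambda>a i. a - i)"

text \<open>
  A group element \<open>g\<close> acts on sequences by composition with its inverse; as \<open>G\<close> is closed under
  inverses, commuting with the action amounts to commuting with composition by each \<open>g \<in> G\<close>.
\<close>

definition factor_map ::
  "(int \<Rightarrow> int) set \<Rightarrow> 'b measure \<Rightarrow> 't set \<Rightarrow> (int \<Rightarrow> 'b \<Rightarrow> 't) \<Rightarrow>
   'a measure \<Rightarrow> 'c set \<Rightarrow> (int \<Rightarrow> 'a \<Rightarrow> 'c) \<Rightarrow> ((int \<Rightarrow> 't) \<Rightarrow> (int \<Rightarrow> 'c)) \<Rightarrow> bool" where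
  "factor_map G N T Y M S X \<phi> \<longleftrightarrow>
    \<phi> \<in> seq_space T \<rightarrow>\<^sub>M seq_space S \<and>
    (\<forall>g\<in>G. \<forall>y\<in>space (seq_space T). \<phi> (y \<circ> g) = \<phi> y \<circ> g) \<and>
    distr N (seq_space S) (\<lambda>\<omega>. \<phi> (\<lambda>i. Y i \<omega>)) = distr M (seq_space S) (\<lambda>\<omega> i. X i \<omega>)"

definition finitary ::
  "'b measure \<Rightarrow> 't set \<Rightarrow> (int \<Rightarrow> 'b \<Rightarrow> 't) \<Rightarrow> ((int \<Rightarrow> 't) \<Rightarrow> (int \<Rightarrow> 'c)) \<Rightarrow> bool" where
  "finitary N T Y \<phi> \<longleftrightarrow>
    (AE \<omega> in N. \<exists>r::nat. \<forall>y'\<in>space (seq_space T).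
      (\<forall>i\<in>{- int r..int r}. y' i = Y i \<omega>) \<longrightarrow> \<phi> y' 0 = \<phi> (\<lambda>i. Y i \<omega>) 0)"

end

theory Submission imports Defs
begin

text \<open>
  The source \<open>Y\<close> is a sparse decoration of the integers. A site is a supply, with probability
  \<open>1 / L\<close>, which carries a word of \<open>L\<close> letters with the law of \<open>X\<close>; or a fair bit of some level
  \<open>n\<close>; or a cutter of some level \<open>n\<close>; or, nearly always, nothing. The supplies have entropy
  \<open>H(X\<^sub>1, \<dots>, X\<^sub>L) / L\<close> per site, which tends to \<open>h(X)\<close>, and the rest is negligible.

  Cutters of level at least \<open>n\<close> divide the integers into cells of level \<open>n\<close>, which grow with \<open>n\<close>.
  Words of \<open>X\<close> separated by two letters are independent, so the colouring can be built cell by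
  cell if the walls between cells have at least two sites. At level \<open>0\<close> the supplied words are
  written one after the other into the cell and determine nearly all of its letters. When
  cells merge into a cell of level \<open>n + 1\<close>, the part of the colouring that is still undetermined is
  chosen from the bits of level \<open>n + 1\<close> by a transport plan between the uniform law of the bits and
  the conditional law of the colouring. With \<open>u\<close> undetermined letters at most \<open>q\<^sup>u\<close> of the bit words
  fail to determine the outcome, so a large cell with slightly more than \<open>2 * u\<close> bits is resolved
  with high probability. As the failures at level \<open>n\<close> are rarer than the bits of level \<open>n + 1\<close>, the
  cutters of level \<open>n + 1\<close> can be made so rare that the failures at that level are rarer still.

  The choices inside a cell respect reflections because the cell is first given an orientation,
  chosen from its unordered pair of type word and reversed type word; only palindromes have no
  orientation, and they are so rare that the cells with a palindromic type word can be skipped.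
\<close>

section \<open>Counting insertions\<close>

text \<open>The coupling is encoded as a density \<open>dens n\<close> with respect to the product
  of the laws of labels and letters. On thick type words its sum over letters is 1 for all labels
  (\<open>dens_norm\<close>), and its mean over labels is 1 for every word of positive weight
  (\<open>dens_average\<close>). So it is a law of the letters given the labels, with mean \<mu>.
  The factor map writes only letters on which all words of positive density agree. The probability
  that a window carries a given word then exceeds its weight by at most the expected number of
  unresolved sites in it, which tends to 0 along the levels.

  The obstacle is the order of choices. How far one must look to resolve a site depends on the law
  of the types, and this contains the rates of all later cutters. Every estimate is therefore
  uniform over the laws \<open>S\<close> with the right rates at the level concerned and
  \<open>tail n S \<le> 2 * c\<close>, so that cutter rates can be fixed one level at a time. The
  bit rates are fixed in advance and decay geometrically, which keeps their entropy small.

  Two bits for each open letter suffice because both colourings have at most 4 colours.\<close>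

lemma del_letter_append:
  "del_letter i (x @ y) =
    (if i < length x then del_letter i x @ y else x @ del_letter (i - length x) y)"
  by (simp add: del_letter_def Suc_diff_le)

lemma length_del_letter [simp]: "i < length x \<Longrightarrow> length (del_letter i x) = length x - 1"
  by (simp add: del_letter_def)

lemma del_letter_0 [simp]: "del_letter 0 (a # x) = x"
  by (simp add: del_letter_def)

lemma del_letter_Suc [simp]: "del_letter (Suc i) (a # x) = a # del_letter i x"
  by (simp add: del_letter_def)

lemma set_del_letter: "set (del_letter i x) \<subseteq> set x"
  by (auto simp: del_letter_def dest: in_set_takeD in_set_dropD)

lemma set_del_letter_subset: "set x \<subseteq> A \<Longrightarrow> set (del_letter i x) \<subseteq> A"
  using set_del_letter[of i x] by blast

lemma del_letter_rev:
  assumes "i < length x"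
  shows "del_letter i (rev x) = rev (del_letter (length x - 1 - i) x)"
proof -
  have "length x - Suc (length x - Suc i) = i" "Suc (length x - Suc i) = length x - i"
    using assms by auto
  then show ?thesis using assms
    by (simp add: del_letter_def take_rev drop_rev)
qed

lemma HL_B_Nil [simp]: "HL_B [] = 1"
  by (simp add: HL_B.simps)

lemma HL_B_improper: "\<not> distinct_adj x \<Longrightarrow> HL_B x = 0"
  by (subst HL_B.simps) auto

lemma HL_B_proper:
  "distinct_adj x \<Longrightarrow> x \<noteq> [] \<Longrightarrow> HL_B x = (\<Sum>i<length x. HL_B (del_letter i x))"
  by (subst HL_B.simps) auto

lemma HL_B_rev: "HL_B (rev x) = HL_B x"
proof (induction "length x" arbitrary: x rule: less_induct)
  case less
  show ?case
  proof (cases "x = [] \<or> \<not> distinct_adj x")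
    case True
    then show ?thesis by (auto simp: HL_B_improper)
  next
    case False
    then have x: "distinct_adj x" "x \<noteq> []" by auto
    have "HL_B (rev x) = (\<Sum>i<length x. HL_B (del_letter i (rev x)))"
      using x by (subst HL_B_proper) auto
    also have "\<dots> = (\<Sum>i<length x. HL_B (del_letter (length x - 1 - i) x))"
      using less x by (intro sum.cong) (auto simp: del_letter_rev)
    also have "\<dots> = (\<Sum>i<length x. HL_B (del_letter i x))"
      using sum.nat_diff_reindex[of "\<lambda>i. HL_B (del_letter i x)" "length x"] by simp
    finally show ?thesis using x by (simp add: HL_B_proper[of x])
  qed
qed

text \<open>The law forgets the letters of a gap by summing over them; independence across the gap
  amounts to this sum being a function of the two lengths times \<open>HL_B x * HL_B y\<close>.
  Integers are used because the recurrences below have negative terms.\<close>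

definition HL_S1 :: "nat \<Rightarrow> nat list \<Rightarrow> nat list \<Rightarrow> int" where
  "HL_S1 q x y = (\<Sum>a\<in>{1..q}. int (HL_B (x @ a # y)))"

definition HL_S2 :: "nat \<Rightarrow> nat list \<Rightarrow> nat list \<Rightarrow> int" where
  "HL_S2 q x y = (\<Sum>b\<in>{1..q}. HL_S1 q x (b # y))"

abbreviation iv :: "bool \<Rightarrow> int" where "iv \<equiv> of_bool"

lemma sum_lessThan_add:
  fixes f :: "nat \<Rightarrow> 'a::comm_monoid_add"
  shows "(\<Sum>i<m + n. f i) = (\<Sum>i<m. f i) + (\<Sum>j<n. f (m + j))"
  by (induction n) (auto simp: add.assoc)

lemma HL_B_insert:
  assumes "distinct_adj (x @ a # y)"
  shows "HL_B (x @ a # y) = (\<Sum>i<length x. HL_B (del_letter i x @ a # y)) + HL_B (x @ y)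
     + (\<Sum>j<length y. HL_B (x @ a # del_letter j y))"
proof -
  have "HL_B (x @ a # y) = (\<Sum>i<length x + Suc (length y). HL_B (del_letter i (x @ a # y)))"
    using HL_B_proper[OF assms] by simp
  also have "\<dots> = (\<Sum>i<length x. HL_B (del_letter i (x @ a # y)))
     + (\<Sum>j<Suc (length y). HL_B (del_letter (length x + j) (x @ a # y)))"
    by (rule sum_lessThan_add)
  also have "(\<Sum>j<Suc (length y). HL_B (del_letter (length x + j) (x @ a # y)))
     = HL_B (x @ y) + (\<Sum>j<length y. HL_B (x @ a # del_letter j y))"
    by (subst sum.lessThan_Suc_shift) (simp add: del_letter_append)
  finally show ?thesis by (simp add: del_letter_append)
qed

lemma butlast_eq_del_letter: "x \<noteq> [] \<Longrightarrow> del_letter (length x - 1) x = butlast x"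
  by (simp add: del_letter_def butlast_conv_take)

lemma last_del_letter: "i < length x - 1 \<Longrightarrow> last (del_letter i x) = last x"
  by (auto simp: del_letter_def last_append)

text \<open>Deleting a letter of \<open>x\<close> other than the last leaves the conflict of
  \<open>a\<close> with \<open>last x\<close> or \<open>hd y\<close> in place, so these terms
  vanish. Deleting the last one can help only if it was equal to \<open>a\<close>; then
  \<open>a\<close> takes its place and the word is \<open>x @ y\<close>.\<close>

lemma del_letter_sum_forbidden_left:
  assumes "distinct_adj x" "distinct_adj y" "\<not> distinct_adj (x @ a # y)"
  shows "(\<Sum>i<length x. int (HL_B (del_letter i x @ a # y))) = iv (x \<noteq> [] \<and> a = last x) * HL_B (x @ y)"
proof (cases "x = []")
  case False
  then obtain m where m: "length x = Suc m" by (cases x) auto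
  have forb: "a = last x \<or> (y \<noteq> [] \<and> a = hd y)"
    using assms False by (auto simp: distinct_adj_append_iff distinct_adj_Cons)
  have 0: "HL_B (del_letter i x @ a # y) = 0" if "i < m" for i
  proof -
    have "del_letter i x \<noteq> []" "last (del_letter i x) = last x"
      using that m by (auto simp: last_del_letter simp flip: length_0_conv)
    then show ?thesis using forb
      by (intro HL_B_improper) (auto simp: distinct_adj_append_iff distinct_adj_Cons)
  qed
  have "(\<Sum>i<length x. int (HL_B (del_letter i x @ a # y))) = HL_B (butlast x @ a # y)"
    using 0 butlast_eq_del_letter[OF False] by (simp add: m)
  also have "\<dots> = iv (x \<noteq> [] \<and> a = last x) * HL_B (x @ y)"
  proof (cases "a = last x")
    case True
    then have "butlast x @ a # y = x @ y" using False by (metis append.assoc append_Cons append_Nil append_butlast_last_id)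
    then show ?thesis using True False by (simp only: simp_thms of_bool_eq mult_1)
  next
    case False
    then have "\<not> distinct_adj (butlast x @ a # y)"
      using forb by (auto simp: distinct_adj_append_iff distinct_adj_Cons)
    then show ?thesis using False by (simp add: HL_B_improper)
  qed
  finally show ?thesis .
qed auto

lemma del_letter_sum_forbidden_right:
  assumes "distinct_adj x" "distinct_adj y" "\<not> distinct_adj (x @ a # y)"
  shows "(\<Sum>j<length y. int (HL_B (x @ a # del_letter j y))) = iv (y \<noteq> [] \<and> a = hd y) * HL_B (x @ y)"
proof -
  have "\<not> distinct_adj (rev (x @ a # y))" using assms(3) by (simp only: distinct_adj_rev) simp
  then have n: "\<not> distinct_adj (rev y @ a # rev x)" by simp
  have eq: "HL_B (x @ a # del_letter j y) = HL_B (del_letter (length y - 1 - j) (rev y) @ a # rev x)"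
    if "j < length y" for j
    using that HL_B_rev[of "x @ a # del_letter j y"] del_letter_rev[of "length y - 1 - j" y]
    by (simp add: Suc_diff_Suc)
  have "(\<Sum>j<length y. int (HL_B (x @ a # del_letter j y)))
      = (\<Sum>j<length y. int (HL_B (del_letter (length y - Suc j) (rev y) @ a # rev x)))"
    using eq by (intro sum.cong) auto
  also have "\<dots> = (\<Sum>j<length (rev y). int (HL_B (del_letter j (rev y) @ a # rev x)))"
    using sum.nat_diff_reindex[of "\<lambda>j. int (HL_B (del_letter j (rev y) @ a # rev x))" "length y"] by simp
  also have "\<dots> = iv (rev y \<noteq> [] \<and> a = last (rev y)) * HL_B (rev y @ rev x)"
    using assms n by (intro del_letter_sum_forbidden_left) auto
  also have "\<dots> = iv (y \<noteq> [] \<and> a = hd y) * HL_B (x @ y)"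
    using HL_B_rev[of "x @ y"] by (simp add: last_rev)
  finally show ?thesis .
qed

text \<open>
  Deleting the last letter of \<open>x\<close> or the first letter of \<open>y\<close> may make an inserted letter
  admissible that was not admissible before; these terms produce the negative contributions.
\<close>

lemma HL_S1_rec:
  assumes "distinct_adj x" "distinct_adj y" "set x \<subseteq> {1..q}" "set y \<subseteq> {1..q}"
  shows "HL_S1 q x y = (\<Sum>i<length x. HL_S1 q (del_letter i x) y)
     + (\<Sum>j<length y. HL_S1 q x (del_letter j y))
     + (int q - 2 * iv (x \<noteq> []) - 2 * iv (y \<noteq> [])) * HL_B (x @ y)"
proof -
  define L where "L a = (\<Sum>i<length x. int (HL_B (del_letter i x @ a # y)))" for a
  define R where "R a = (\<Sum>j<length y. int (HL_B (x @ a # del_letter j y)))" for a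
  define l where "l a = iv (x \<noteq> [] \<and> a = last x)" for a
  define r where "r a = iv (y \<noteq> [] \<and> a = hd y)" for a
  have *: "int (HL_B (x @ a # y)) = L a + R a + (1 - 2 * l a - 2 * r a) * HL_B (x @ y)" for a
  proof (cases "distinct_adj (x @ a # y)")
    case True
    then have "l a = 0" "r a = 0"
      by (auto simp: l_def r_def distinct_adj_append_iff distinct_adj_Cons)
    then show ?thesis using HL_B_insert[OF True] by (simp add: L_def R_def)
  next
    case False
    \<comment> \<open>A forbidden letter equals exactly one of its two neighbours, unless these are
      equal and \<open>x @ y\<close> is improper itself.\<close>
    have "(1 - l a - r a) * int (HL_B (x @ y)) = 0"
    proof (cases "distinct_adj (x @ y)")
      case True
      with False have "l a + r a = 1"
        by (auto simp: l_def r_def distinct_adj_append_iff distinct_adj_Cons)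
      then show ?thesis by simp
    qed (simp add: HL_B_improper)
    then have "l a * int (HL_B (x @ y)) + r a * int (HL_B (x @ y))
        + (1 - 2 * l a - 2 * r a) * int (HL_B (x @ y)) = 0"
      by (simp only: left_diff_distrib)
    moreover have "L a = l a * HL_B (x @ y)"
      using del_letter_sum_forbidden_left[OF assms(1,2) False] unfolding L_def l_def .
    moreover have "R a = r a * HL_B (x @ y)"
      using del_letter_sum_forbidden_right[OF assms(1,2) False] unfolding R_def r_def .
    ultimately show ?thesis using HL_B_improper[OF False] by (simp only: of_nat_0)
  qed
  have l: "(\<Sum>a\<in>{1..q}. l a) = iv (x \<noteq> [])"
  proof (cases "x = []")
    case False
    then have "last x \<in> {1..q}" using assms(3) last_in_set by blast
    then have "(\<Sum>a\<in>{1..q}. of_bool (a = last x) :: int) = 1" by (subst sum.mono_neutral_right[of _ "{last x}"]) auto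
    then show ?thesis using False by (simp add: l_def)
  qed (simp add: l_def)
  have r: "(\<Sum>a\<in>{1..q}. r a) = iv (y \<noteq> [])"
  proof (cases "y = []")
    case False
    then have "hd y \<in> {1..q}" using assms(4) hd_in_set by blast
    then have "(\<Sum>a\<in>{1..q}. of_bool (a = hd y) :: int) = 1" by (subst sum.mono_neutral_right[of _ "{hd y}"]) auto
    then show ?thesis using False by (simp add: r_def)
  qed (simp add: r_def)
  have "HL_S1 q x y = (\<Sum>a\<in>{1..q}. L a) + (\<Sum>a\<in>{1..q}. R a)
      + (\<Sum>a\<in>{1..q}. (1 - 2 * l a - 2 * r a)) * HL_B (x @ y)"
    unfolding HL_S1_def * by (simp add: sum.distrib sum_distrib_right)
  also have "(\<Sum>a\<in>{1..q}. (1 - 2 * l a - 2 * r a)) = int q - 2 * iv (x \<noteq> []) - 2 * iv (y \<noteq> [])"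
    by (simp only: sum_subtractf sum_distrib_left[symmetric] l r) simp
  also have "(\<Sum>a\<in>{1..q}. L a) = (\<Sum>i<length x. HL_S1 q (del_letter i x) y)"
    unfolding L_def HL_S1_def by (rule sum.swap)
  also have "(\<Sum>a\<in>{1..q}. R a) = (\<Sum>j<length y. HL_S1 q x (del_letter j y))"
    unfolding R_def HL_S1_def by (rule sum.swap)
  finally show ?thesis .
qed

lemma HL_S1_improper: "\<not> distinct_adj x \<or> \<not> distinct_adj y \<Longrightarrow> HL_S1 q x y = 0"
  unfolding HL_S1_def
  by (intro sum.neutral ballI) (auto simp: distinct_adj_append_iff distinct_adj_Cons intro!: HL_B_improper)

text \<open>Obtained by applying \<open>HL_S1_rec\<close> to \<open>b # y\<close> for each
  \<open>b\<close>, where deleting \<open>b\<close> itself returns \<open>HL_S1 q x y\<close>. If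
  \<open>b = hd y\<close> then \<open>b # y\<close> is improper and that recurrence does not apply;
  the term with \<open>r b\<close> corrects for this.\<close>

lemma HL_S2_rec:
  assumes x: "distinct_adj x" "set x \<subseteq> {1..q}" and y: "distinct_adj y" "set y \<subseteq> {1..q}"
  shows "HL_S2 q x y = (\<Sum>i<length x. HL_S2 q (del_letter i x) y)
     + (\<Sum>j<length y. HL_S2 q x (del_letter j y))
     + (2 * int q - 2 - 2 * iv (x \<noteq> []) - 2 * iv (y \<noteq> [])) * HL_S1 q x y"
proof -
  define L where "L b = (\<Sum>i<length x. HL_S1 q (del_letter i x) (b # y))" for b
  define R where "R b = (\<Sum>j<length y. HL_S1 q x (b # del_letter j y))" for b
  \<comment> \<open>The word \<open>b # y\<close> is never empty, so one 2 is always
    subtracted.\<close>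
  define c where "c = int q - 2 - 2 * iv (x \<noteq> [])"
  define r where "r b = iv (y \<noteq> [] \<and> b = hd y)" for b
  have *: "HL_S1 q x (b # y) = L b + R b + (1 - 2 * r b) * HL_S1 q x y + c * HL_B (x @ b # y)"
    if b: "b \<in> {1..q}" for b
  proof (cases "distinct_adj (b # y)")
    case True
    then have "r b = 0" by (auto simp: r_def distinct_adj_Cons)
    moreover have "HL_S1 q x (b # y) = L b + (\<Sum>j<length (b # y). HL_S1 q x (del_letter j (b # y)))
         + c * HL_B (x @ b # y)"
      using HL_S1_rec[OF x(1) True x(2)] b y by (simp add: L_def c_def)
    moreover have "(\<Sum>j<length (b # y). HL_S1 q x (del_letter j (b # y))) = HL_S1 q x y + R b"
      by (simp add: R_def sum.lessThan_Suc_shift del: sum.lessThan_Suc)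
    ultimately show ?thesis by simp
  next
    case False
    then have b: "y \<noteq> []" "b = hd y" using y by (auto simp: distinct_adj_Cons)
    then obtain y' where y': "y = b # y'" by (cases y) auto
    have "L b = 0" using False unfolding L_def by (intro sum.neutral) (auto simp: HL_S1_improper)
    moreover have "R b = HL_S1 q x y"
    proof -
      have "HL_S1 q x (b # b # del_letter j y') = 0" for j
        by (rule HL_S1_improper) auto
      then show ?thesis
        by (simp add: R_def y' sum.lessThan_Suc_shift del: sum.lessThan_Suc)
    qed
    moreover have "HL_S1 q x (b # y) = 0" "HL_B (x @ b # y) = 0"
      using False by (auto intro!: HL_S1_improper HL_B_improper)
    moreover have "r b = 1" using b by (simp add: r_def)
    ultimately show ?thesis by simp
  qed
  have r: "(\<Sum>b\<in>{1..q}. r b) = iv (y \<noteq> [])"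
  proof (cases "y = []")
    case False
    then have "hd y \<in> {1..q}" using y(2) hd_in_set by blast
    then have "(\<Sum>a\<in>{1..q}. of_bool (a = hd y) :: int) = 1" by (subst sum.mono_neutral_right[of _ "{hd y}"]) auto
    then show ?thesis using False by (simp add: r_def)
  qed (simp add: r_def)
  have "HL_S2 q x y = (\<Sum>b\<in>{1..q}. L b + R b + (1 - 2 * r b) * HL_S1 q x y + c * HL_B (x @ b # y))"
    unfolding HL_S2_def using * by (intro sum.cong) auto
  also have "\<dots> = (\<Sum>b\<in>{1..q}. L b) + (\<Sum>b\<in>{1..q}. R b)
      + (\<Sum>b\<in>{1..q}. (1 - 2 * r b)) * HL_S1 q x y + c * HL_S1 q x y"
  proof -
    have "(\<Sum>b\<in>{1..q}. c * int (HL_B (x @ b # y))) = c * HL_S1 q x y"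
      by (simp add: HL_S1_def sum_distrib_left)
    then show ?thesis by (simp only: sum.distrib sum_distrib_right)
  qed
  also have "(\<Sum>b\<in>{1..q}. (1 - 2 * r b)) = int q - 2 * iv (y \<noteq> [])"
    by (simp only: sum_subtractf sum_distrib_left[symmetric] r) simp
  also have "(\<Sum>b\<in>{1..q}. L b) = (\<Sum>i<length x. HL_S2 q (del_letter i x) y)"
    unfolding L_def HL_S2_def by (rule sum.swap)
  also have "(\<Sum>b\<in>{1..q}. R b) = (\<Sum>j<length y. HL_S2 q x (del_letter j y))"
    unfolding R_def HL_S2_def by (rule sum.swap)
  finally show ?thesis by (simp add: c_def algebra_simps)
qed

lemma HL_S1_rev: "HL_S1 q (rev y) (rev x) = HL_S1 q x y"
  unfolding HL_S1_def using HL_B_rev[of "x @ _ # y"] by (intro sum.cong) (simp_all)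

lemma sum_HL_B_del_letter: "distinct_adj x \<Longrightarrow> x \<noteq> [] \<Longrightarrow> (\<Sum>i<length x. int (HL_B (del_letter i x))) = HL_B x"
  by (subst HL_B_proper) auto

text \<open>The deletions of a proper word have total weight \<open>HL_B\<close>. An ansatz with a
  coefficient that depends on the lengths only therefore turns the recurrence for words into one for
  the numbers \<open>c m n\<close>, of Pascal type with source \<open>e\<close>.\<close>

lemma HL_recurrence_solution:
  fixes F E :: "nat list \<Rightarrow> nat list \<Rightarrow> int" and c e :: "nat \<Rightarrow> nat \<Rightarrow> int"
  assumes imp: "\<And>x y. \<not> distinct_adj x \<or> \<not> distinct_adj y \<Longrightarrow> F x y = 0"
    and F: "\<And>x y. distinct_adj x \<Longrightarrow> distinct_adj y \<Longrightarrow> set x \<subseteq> {1..q} \<Longrightarrow> set y \<subseteq> {1..q} \<Longrightarrow>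
      F x y = (\<Sum>i<length x. F (del_letter i x) y) + (\<Sum>j<length y. F x (del_letter j y)) + E x y"
    and E: "\<And>x y. distinct_adj x \<Longrightarrow> distinct_adj y \<Longrightarrow> set x \<subseteq> {1..q} \<Longrightarrow> set y \<subseteq> {1..q} \<Longrightarrow>
      E x y = e (length x) (length y) * HL_B x * HL_B y"
    and c: "\<And>m n. c m n = (if m = 0 then 0 else c (m - 1) n) + (if n = 0 then 0 else c m (n - 1)) + e m n"
    and "set x \<subseteq> {1..q}" "set y \<subseteq> {1..q}"
  shows "F x y = c (length x) (length y) * HL_B x * HL_B y"
  using assms(5,6)
proof (induction "length x + length y" arbitrary: x y rule: less_induct)
  case less
  show ?case
  proof (cases "distinct_adj x \<and> distinct_adj y")
    case True
    have 1: "(\<Sum>i<length x. F (del_letter i x) y) = (if length x = 0 then 0 else c (length x - 1) (length y)) * HL_B x * HL_B y"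
    proof (cases "x = []")
      case False
      have "(\<Sum>i<length x. F (del_letter i x) y) = (\<Sum>i<length x. c (length x - 1) (length y) * HL_B (del_letter i x) * HL_B y)"
        by (intro sum.cong refl, subst less) (use False less.prems set_del_letter_subset[of x "{1..q}"] in simp_all)
      also have "\<dots> = c (length x - 1) (length y) * (\<Sum>i<length x. int (HL_B (del_letter i x))) * HL_B y"
        by (simp add: sum_distrib_left sum_distrib_right)
      finally show ?thesis using sum_HL_B_del_letter[of x] False True by simp
    qed simp
    have 2: "(\<Sum>j<length y. F x (del_letter j y)) = (if length y = 0 then 0 else c (length x) (length y - 1)) * HL_B x * HL_B y"
    proof (cases "y = []")
      case False
      have "(\<Sum>i<length y. F x (del_letter i y)) = (\<Sum>i<length y. c (length x) (length y - 1) * HL_B x * HL_B (del_letter i y))"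
        by (intro sum.cong refl, subst less) (use False less.prems set_del_letter_subset[of y "{1..q}"] in simp_all)
      also have "\<dots> = c (length x) (length y - 1) * HL_B x * (\<Sum>i<length y. int (HL_B (del_letter i y)))"
        by (simp add: sum_distrib_left sum_distrib_right)
      finally show ?thesis using sum_HL_B_del_letter[of y] False True by simp
    qed simp
    show ?thesis using True less.prems
      by (subst c) (simp only: F E 1 2, simp only: distrib_right)
  qed (auto simp: imp HL_B_improper)
qed

text \<open>With \<open>x\<close> empty and three colours each step adds exactly
  \<open>HL_B y\<close>, as \<open>q - 2 = 1\<close>. These boundary values are the sources of the
  recurrence for two inserted letters.\<close>

lemma HL_S1_Nil_q3:
  assumes "set y \<subseteq> {1..3}"
  shows "HL_S1 3 [] y = int (length y + 3) * HL_B y"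
  using assms
proof (induction "length y" arbitrary: y rule: less_induct)
  case less
  show ?case
  proof (cases "distinct_adj y \<and> y \<noteq> []")
    case True
    have "(\<Sum>j<length y. HL_S1 3 [] (del_letter j y)) = (\<Sum>j<length y. int (length y + 2) * HL_B (del_letter j y))"
      by (intro sum.cong refl, subst less)
        (use True less.prems set_del_letter_subset[of y "{1..3}"] in \<open>simp_all\<close>)
    also have "\<dots> = int (length y + 2) * HL_B y"
      using sum_HL_B_del_letter[of y] True by (simp flip: sum_distrib_left)
    finally show ?thesis using HL_S1_rec[of "[]" y 3] True less.prems by (simp add: algebra_simps)
  next
    case False
    then consider "y = []" | "\<not> distinct_adj y" by blast
    then show ?thesis
    proof cases
      case 1
      then show ?thesis by (simp add: HL_S1_def HL_B_proper[of "[_]"])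
    qed (simp add: HL_S1_improper HL_B_improper)
  qed
qed

text \<open>For \<open>x\<close> and \<open>y\<close> both nonempty the source carries the factor
  \<open>q - 4 = 0\<close>, so the coefficients obey Pascal's rule. This is what makes four colours
  special for gaps of one letter.\<close>

lemma HL_S1_q4:
  assumes "set x \<subseteq> {1..4}" "set y \<subseteq> {1..4}"
  shows "HL_S1 4 x y = (2 * ((length x + length y + 2) choose (length x + 1))) * HL_B x * HL_B y"
proof -
  define c where "c m n = int (2 * ((m + n + 2) choose (m + 1)))" for m n
  define e where "e m n = (4 - 2 * iv (m \<noteq> 0) - 2 * iv (n \<noteq> 0))" for m n :: nat
  have "HL_S1 4 x y = c (length x) (length y) * HL_B x * HL_B y"
  proof (rule HL_recurrence_solution[where q=4 and E="\<lambda>x y. (int 4 - 2 * iv (x \<noteq> []) - 2 * iv (y \<noteq> [])) * int (HL_B (x @ y))" and e=e])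
    fix x y :: "nat list"
    show "(int 4 - 2 * iv (x \<noteq> []) - 2 * iv (y \<noteq> [])) * int (HL_B (x @ y)) = e (length x) (length y) * HL_B x * HL_B y"
      by (cases "x = []"; cases "y = []") (auto simp: e_def)
  next
    fix m n
    show "c m n = (if m = 0 then 0 else c (m - 1) n) + (if n = 0 then 0 else c m (n - 1)) + e m n"
    proof (cases m)
      case 0
      then show ?thesis by (cases n) (auto simp: c_def e_def)
    next
      case (Suc m')
      then show ?thesis
      proof (cases n)
        case 0
        have "Suc (Suc (Suc m')) choose Suc (Suc m') = Suc (Suc (Suc m'))"
          "Suc (Suc m') choose Suc m' = Suc (Suc m')"
          using binomial_symmetric[of "Suc (Suc m')" "Suc (Suc (Suc m'))"] binomial_symmetric[of "Suc m'" "Suc (Suc m')"] by auto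
        then show ?thesis using Suc 0 by (auto simp: c_def e_def)
      qed (auto simp: c_def e_def)
    qed
  qed (use assms HL_S1_improper HL_S1_rec in auto)
  then show ?thesis by (simp add: c_def)
qed

text \<open>With two inserted letters and both words nonempty the source carries the factor
  \<open>2 * q - 6\<close>, which vanishes for three colours, and Pascal's rule appears
  again.\<close>

lemma HL_S2_q3:
  assumes "set x \<subseteq> {1..3}" "set y \<subseteq> {1..3}"
  shows "HL_S2 3 x y = (2 * ((length x + length y + 4) choose (length x + 2))) * HL_B x * HL_B y"
proof -
  define c where "c m n = int (2 * ((m + n + 4) choose (m + 2)))" for m n
  \<comment> \<open>For two empty words the source is \<open>(2 * q - 2) * 3 = 12\<close>; for one
    empty word it is 2 times the boundary value of \<open>HL_S1_Nil_q3\<close>.\<close>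
  define e where "e m n = (if m = 0 then if n = 0 then 12 else 2 * (int n + 3) else if n = 0 then 2 * (int m + 3) else 0)" for m n :: nat
  have "HL_S2 3 x y = c (length x) (length y) * HL_B x * HL_B y"
  proof (rule HL_recurrence_solution[where q=3 and E="\<lambda>x y. (2 * int 3 - 2 - 2 * iv (x \<noteq> []) - 2 * iv (y \<noteq> [])) * HL_S1 3 x y" and e=e])
    fix x y :: "nat list" assume "set x \<subseteq> {1..3}" "set y \<subseteq> {1..3}"
    then show "(2 * int 3 - 2 - 2 * iv (x \<noteq> []) - 2 * iv (y \<noteq> [])) * HL_S1 3 x y = e (length x) (length y) * HL_B x * HL_B y"
      using HL_S1_Nil_q3[of y] HL_S1_Nil_q3[of "rev x"] HL_S1_rev[of 3 "rev x" "[]"] HL_B_rev[of x]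
      by (cases "x = []"; cases "y = []") (auto simp: e_def)
  next
    fix x y :: "nat list" assume "\<not> distinct_adj x \<or> \<not> distinct_adj y"
    then show "HL_S2 3 x y = 0"
      unfolding HL_S2_def by (intro sum.neutral) (auto intro!: HL_S1_improper simp: distinct_adj_Cons)
  next
    fix m n
    have b2: "2 * (Suc (Suc k) choose 2) = (k + 1) * (k + 2)" for k
      by (induction k) (auto simp: numeral_2_eq_2)
    have b3: "(Suc (Suc k) choose k) = (Suc (Suc k) choose 2)" for k
      using binomial_symmetric[of k "Suc (Suc k)"] by simp
    have b2': "2 * ((k + 4) choose 2) = (k + 3) * (k + 4)" for k
    proof -
      have "Suc (Suc (k + 2)) = k + 4" "k + 2 + 1 = k + 3" "k + 2 + 2 = k + 4" by simp_all
      then show ?thesis using b2[of "k + 2"] by (simp only:)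
    qed
    have b3': "((k + 4) choose (k + 2)) = ((k + 4) choose 2)" for k
    proof -
      have "Suc (Suc (k + 2)) = k + 4" by simp
      then show ?thesis using b3[of "k + 2"] by (simp only:)
    qed
    have c1: "c 0 n = (int n + 3) * (int n + 4)" for n
      using arg_cong[OF b2'[of n], of int] unfolding c_def by (simp add: numeral_2_eq_2)
    have c2: "c m 0 = (int m + 3) * (int m + 4)" for m
      using arg_cong[OF b2'[of m], of int] b3'[of m] unfolding c_def by (simp add: numeral_2_eq_2)
    show "c m n = (if m = 0 then 0 else c (m - 1) n) + (if n = 0 then 0 else c m (n - 1)) + e m n"
    proof (cases m)
      case 0
      then show ?thesis using c1[of n] c1[of "n - 1"] by (cases n) (auto simp: e_def algebra_simps)
    next
      case (Suc m')
      then show ?thesis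
      proof (cases n)
        case 0
        then show ?thesis using c2[of m] c2[of "m - 1"] Suc by (auto simp: e_def algebra_simps)
      qed (auto simp: c_def e_def eval_nat_numeral)
    qed
  qed (use assms HL_S2_rec in auto)
  then show ?thesis by (simp add: c_def)
qed

section \<open>Window laws of the two colourings\<close>

lemma words_0 [simp]: "words q 0 = {[]}"
  by (auto simp: words_def)

lemma finite_words [simp]: "finite (words q n)"
  unfolding words_def using finite_lists_length_eq[of "{1..q}" n] by simp

lemma words_iff: "x \<in> words q n \<longleftrightarrow> length x = n \<and> set x \<subseteq> {1..q}"
  by (auto simp: words_def)

lemma sum_words_Suc:
  fixes f :: "nat list \<Rightarrow> 'a::comm_monoid_add"
  shows "(\<Sum>x\<in>words q (Suc n). f x) = (\<Sum>a\<in>{1..q}. \<Sum>x\<in>words q n. f (a # x))"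
proof -
  have "words q (Suc n) = (\<lambda>(a, x). a # x) ` ({1..q} \<times> words q n)"
    unfolding words_def
  proof (intro equalityI subsetI)
    fix x assume "x \<in> {x. set x \<subseteq> {1..q} \<and> length x = Suc n}"
    then show "x \<in> (\<lambda>(a, x). a # x) ` ({1..q} \<times> {x. set x \<subseteq> {1..q} \<and> length x = n})"
      by (cases x) (auto intro!: rev_image_eqI)
  qed auto
  moreover have inj: "inj_on (\<lambda>(a, x). a # x) ({1..q} \<times> words q n)" by (auto simp: inj_on_def)
  ultimately show ?thesis
    using sum.reindex[OF inj, of f] by (simp add: sum.cartesian_product case_prod_unfold comp_def)
qed

lemma sum_words_add:
  fixes f :: "nat list \<Rightarrow> 'a::comm_monoid_add"
  shows "(\<Sum>x\<in>words q (m + n). f x) = (\<Sum>x\<in>words q m. \<Sum>y\<in>words q n. f (x @ y))"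
  by (induction m arbitrary: f) (simp_all add: sum_words_Suc)

lemma sum_words_rev:
  fixes f :: "nat list \<Rightarrow> 'a::comm_monoid_add"
  shows "(\<Sum>x\<in>words q n. f (rev x)) = (\<Sum>x\<in>words q n. f x)"
  by (rule sum.reindex_bij_witness[of _ rev rev]) (auto simp: words_def)

text \<open>
  Both colourings are treated alike: a one-dependent process is also two-dependent.
\<close>

locale twodep =
  fixes q :: nat and \<mu> :: "nat list \<Rightarrow> real"
  assumes nonneg: "\<mu> x \<ge> 0"
    and outside: "\<not> set x \<subseteq> {1..q} \<Longrightarrow> \<mu> x = 0"
    and Nil: "\<mu> [] = 1"
    and sum_snoc: "(\<Sum>a\<in>{1..q}. \<mu> (x @ [a])) = \<mu> x"
    and rev: "\<mu> (rev x) = \<mu> x"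
    and dep: "(\<Sum>a\<in>{1..q}. \<Sum>b\<in>{1..q}. \<mu> (x @ [a, b] @ y)) = \<mu> x * \<mu> y"
begin

lemma sum_append: "(\<Sum>y\<in>words q n. \<mu> (x @ y)) = \<mu> x"
proof (induction n arbitrary: x)
  case (Suc n)
  have "(\<Sum>y\<in>words q (Suc n). \<mu> (x @ y)) = (\<Sum>a\<in>{1..q}. \<Sum>y\<in>words q n. \<mu> ((x @ [a]) @ y))"
    by (simp add: sum_words_Suc)
  then show ?case by (simp only: Suc sum_snoc)
qed simp

lemma sum_prepend: "(\<Sum>y\<in>words q n. \<mu> (y @ x)) = \<mu> x"
proof -
  have "(\<Sum>y\<in>words q n. \<mu> (y @ x)) = (\<Sum>y\<in>words q n. \<mu> (rev y @ x))"
    by (rule sum_words_rev[symmetric])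
  also have "\<dots> = (\<Sum>y\<in>words q n. \<mu> (rev x @ y))"
    using rev[of "rev x @ _"] by (intro sum.cong) auto
  finally show ?thesis by (simp add: sum_append rev)
qed

lemma sum_words: "(\<Sum>y\<in>words q n. \<mu> y) = 1"
  using sum_append[of "[]" n] Nil by simp

lemma sum_gap: "(\<Sum>c\<in>words q 2. \<mu> (x @ c @ y)) = \<mu> x * \<mu> y"
  using dep[of x y] by (simp add: numeral_2_eq_2 sum_words_Suc)

lemma append_le1: "\<mu> (x @ y) \<le> \<mu> x"
proof (cases "set y \<subseteq> {1..q}")
  case True
  then show ?thesis
    using sum_append[of x "length y"]
      member_le_sum[of y "words q (length y)" "\<lambda>y. \<mu> (x @ y)"] nonneg by (simp add: words_iff)
qed (use outside[of "x @ y"] nonneg in auto)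

lemma append_le2: "\<mu> (x @ y) \<le> \<mu> y"
  using append_le1[of "List.rev y" "List.rev x"] rev[of "x @ y"] rev[of y] by simp

lemma pos_appendD: "\<mu> (x @ y) > 0 \<Longrightarrow> \<mu> x > 0" "\<mu> (x @ y) > 0 \<Longrightarrow> \<mu> y > 0"
  using append_le1[of x y] append_le2[of x y] by auto

lemma pos_words: "\<mu> x > 0 \<Longrightarrow> x \<in> words q (length x)"
  using outside[of x] by (auto simp: words_def)

lemma le_1: "\<mu> x \<le> 1"
  using append_le1[of "[]" x] Nil by simp

end

definition HL_Z :: "nat \<Rightarrow> nat \<Rightarrow> nat" where
  "HL_Z q n = (\<Sum>y\<in>words q n. HL_B y)"

definition HL_mu :: "nat \<Rightarrow> nat list \<Rightarrow> real" where
  "HL_mu q x = (if set x \<subseteq> {1..q} then HL_B x / HL_Z q (length x) else 0)"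

text \<open>Summed over all words, the insertion identities show that the normalisers satisfy
  \<open>HL_Z q (Suc n) = c n * HL_Z q n\<close> and
  \<open>HL_Z q (m + 2 + n) = d m n * HL_Z q m * HL_Z q n\<close>. The coefficients cancel in the
  quotients, and the counting identities become consistency and independence.\<close>

lemma twodep_HL_muI:
  assumes c: "\<And>n. c n > 0"
    and snoc: "\<And>x. set x \<subseteq> {1..q} \<Longrightarrow> HL_S1 q x [] = int (c (length x)) * HL_B x"
    and dep: "\<And>x y. set x \<subseteq> {1..q} \<Longrightarrow> set y \<subseteq> {1..q} \<Longrightarrow>
      HL_S2 q x y = int (d (length x) (length y)) * HL_B x * HL_B y"
  shows "twodep q (HL_mu q)"
proof
  have snoc': "(\<Sum>a\<in>{1..q}. HL_B (x @ [a])) = c (length x) * HL_B x" if "set x \<subseteq> {1..q}" for x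
  proof -
    have "int (\<Sum>a\<in>{1..q}. HL_B (x @ [a])) = int (c (length x) * HL_B x)"
      using snoc[OF that] unfolding HL_S1_def by simp
    then show ?thesis by (simp only: of_nat_eq_iff)
  qed
  have dep': "(\<Sum>b\<in>{1..q}. \<Sum>a\<in>{1..q}. HL_B (x @ [a, b] @ y)) = d (length x) (length y) * HL_B x * HL_B y"
    if "set x \<subseteq> {1..q}" "set y \<subseteq> {1..q}" for x y
  proof -
    have "int (\<Sum>b\<in>{1..q}. \<Sum>a\<in>{1..q}. HL_B (x @ [a, b] @ y)) = int (d (length x) (length y) * HL_B x * HL_B y)"
      using dep[OF that] by (simp add: HL_S2_def HL_S1_def)
    then show ?thesis by (simp only: of_nat_eq_iff)
  qed
  have Z: "HL_Z q (Suc n) = c n * HL_Z q n" for n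
  proof -
    have "HL_Z q (Suc n) = (\<Sum>x\<in>words q n. \<Sum>a\<in>{1..q}. HL_B (x @ [a]))"
      using sum_words_add[of HL_B q n 1] by (simp add: HL_Z_def sum_words_Suc)
    also have "\<dots> = c n * HL_Z q n"
      unfolding HL_Z_def sum_distrib_left using snoc' by (intro sum.cong) (auto simp: words_def)
    finally show ?thesis .
  qed
  have Zpos: "HL_Z q n > 0" for n
    by (induction n) (simp add: HL_Z_def, simp add: Z c)
  have Z2: "HL_Z q (m + 2 + n) = d m n * HL_Z q m * HL_Z q n" for m n
  proof -
    have "HL_Z q (m + 2 + n) = (\<Sum>x\<in>words q m. \<Sum>w\<in>words q 2. \<Sum>y\<in>words q n. HL_B (x @ w @ y))"
      by (simp only: HL_Z_def sum_words_add append_assoc)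
    also have "\<dots> = (\<Sum>x\<in>words q m. \<Sum>y\<in>words q n. \<Sum>w\<in>words q 2. HL_B (x @ w @ y))"
      by (intro sum.cong refl sum.swap)
    also have "\<dots> = (\<Sum>x\<in>words q m. \<Sum>y\<in>words q n. d m n * HL_B x * HL_B y)"
    proof (intro sum.cong refl)
      fix x y assume xy: "x \<in> words q m" "y \<in> words q n"
      have "(\<Sum>w\<in>words q 2. HL_B (x @ w @ y)) = (\<Sum>a\<in>{1..q}. \<Sum>b\<in>{1..q}. HL_B (x @ [a, b] @ y))"
        by (simp add: numeral_2_eq_2 sum_words_Suc)
      also have "\<dots> = (\<Sum>b\<in>{1..q}. \<Sum>a\<in>{1..q}. HL_B (x @ [a, b] @ y))" by (rule sum.swap)
      finally show "(\<Sum>w\<in>words q 2. HL_B (x @ w @ y)) = d m n * HL_B x * HL_B y"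
        using dep' xy by (simp add: words_def)
    qed
    also have "\<dots> = d m n * (HL_Z q m * HL_Z q n)"
      unfolding HL_Z_def sum_product by (simp add: sum_distrib_left mult.assoc)
    finally show ?thesis by (simp only: mult.assoc)
  qed
  fix x y
  show "HL_mu q x \<ge> 0" by (simp add: HL_mu_def)
  show "\<not> set x \<subseteq> {1..q} \<Longrightarrow> HL_mu q x = 0" by (simp add: HL_mu_def)
  show "HL_mu q [] = 1" by (simp add: HL_mu_def HL_Z_def)
  show "HL_mu q (rev x) = HL_mu q x" by (simp add: HL_mu_def HL_B_rev)
  show "(\<Sum>a\<in>{1..q}. HL_mu q (x @ [a])) = HL_mu q x"
  proof (cases "set x \<subseteq> {1..q}")
    case True
    then have "(\<Sum>a\<in>{1..q}. HL_mu q (x @ [a])) = real (\<Sum>a\<in>{1..q}. HL_B (x @ [a])) / HL_Z q (Suc (length x))"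
      unfolding of_nat_sum sum_divide_distrib by (intro sum.cong) (auto simp: HL_mu_def)
    then show ?thesis using True c[of "length x"] by (simp only: snoc'[OF True] Z) (simp add: HL_mu_def)
  qed (simp add: HL_mu_def)
  show "(\<Sum>a\<in>{1..q}. \<Sum>b\<in>{1..q}. HL_mu q (x @ [a, b] @ y)) = HL_mu q x * HL_mu q y"
  proof (cases "set x \<subseteq> {1..q} \<and> set y \<subseteq> {1..q}")
    case True
    have "(\<Sum>a\<in>{1..q}. \<Sum>b\<in>{1..q}. HL_mu q (x @ [a, b] @ y)) = (\<Sum>b\<in>{1..q}. \<Sum>a\<in>{1..q}. HL_mu q (x @ [a, b] @ y))"
      by (rule sum.swap)
    also have "\<dots> = real (\<Sum>b\<in>{1..q}. \<Sum>a\<in>{1..q}. HL_B (x @ [a, b] @ y)) / HL_Z q (length x + 2 + length y)"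
      unfolding of_nat_sum sum_divide_distrib using True by (intro sum.cong) (auto simp: HL_mu_def)
    also have "\<dots> = HL_mu q x * HL_mu q y"
    proof -
      have "d (length x) (length y) > 0"
        using Z2[of "length x" "length y"] Zpos[of "length x + 2 + length y"] by (auto intro!: gr0I)
      then show ?thesis using True by (simp only: dep'[of x y] Z2) (simp add: HL_mu_def)
    qed
    finally show ?thesis .
  next
    case False
    then show ?thesis unfolding HL_mu_def by (auto simp: HL_mu_def)
  qed
qed

lemma twodep_HL_mu:
  assumes "(k, q) \<in> {(1, 4), (2, 3)}"
  shows "twodep q (HL_mu q)"
proof (cases "q = 4")
  case True
  define C where "C m n = 2 * ((m + n + 2) choose (m + 1))" for m n :: nat
  show ?thesis unfolding True
  proof (rule twodep_HL_muI)
    show "C n 0 > 0" for n by (simp add: C_def)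
    show "HL_S1 4 x [] = int (C (length x) 0) * HL_B x" if "set x \<subseteq> {1..4}" for x
      using HL_S1_q4[OF that, of "[]"] by (simp add: C_def algebra_simps)
    \<comment> \<open>Four colours are independent across one letter already. In a gap of two
      letters the second one, \<open>b\<close>, is counted as the first letter of the right word and
      then summed out, which uses \<open>HL_S1_q4\<close> again with an empty left word.\<close>
    show "HL_S2 4 x y = int (C (length x) (Suc (length y)) * C 0 (length y)) * HL_B x * HL_B y"
      if "set x \<subseteq> {1..4}" "set y \<subseteq> {1..4}" for x y
    proof -
      have "HL_S2 4 x y = (\<Sum>b\<in>{1..4}. C (length x) (Suc (length y)) * HL_B x * HL_B (b # y))"
        unfolding HL_S2_def of_nat_sum
        using that HL_S1_q4[OF that(1), of "_ # y"] by (intro sum.cong) (auto simp: C_def)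
      also have "\<dots> = C (length x) (Suc (length y)) * HL_B x * HL_S1 4 [] y"
        by (simp add: HL_S1_def sum_distrib_left)
      also have "HL_S1 4 [] y = C 0 (length y) * HL_B y"
        using HL_S1_q4[of "[]" y] that by (simp add: C_def)
      finally show ?thesis by simp
    qed
  qed
next
  case False
  then have q: "q = 3" using assms by auto
  show ?thesis unfolding q
  proof (rule twodep_HL_muI)
    show "n + 3 > 0" for n :: nat by simp
    show "HL_S1 3 x [] = int (length x + 3) * HL_B x" if "set x \<subseteq> {1..3}" for x
      using HL_S1_Nil_q3[of "rev x"] HL_S1_rev[of 3 "rev x" "[]"] that by (simp add: HL_B_rev algebra_simps)
    show "HL_S2 3 x y = int (2 * ((length x + length y + 4) choose (length x + 2))) * HL_B x * HL_B y"
      if "set x \<subseteq> {1..3}" "set y \<subseteq> {1..3}" for x y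
      using HL_S2_q3[OF that] by simp
  qed
qed

section \<open>Cutting words at separators\<close>

primrec segments :: "('a \<Rightarrow> bool) \<Rightarrow> 'a list \<Rightarrow> 'a list list" where
  "segments P [] = [[]]"
| "segments P (x # xs) =
    (if P x then [] # segments P xs else (x # hd (segments P xs)) # tl (segments P xs))"

lemma segments_not_Nil [simp]: "segments P xs \<noteq> []"
  by (cases xs) auto

lemma segments_none: "(\<And>x. x \<in> set xs \<Longrightarrow> \<not> P x) \<Longrightarrow> segments P xs = [xs]"
  by (induction xs) auto

text \<open>Empty segments are kept, also at the ends; otherwise this equation and the one for
  reversal would need case distinctions.\<close>

lemma segments_append: "P c \<Longrightarrow> segments P (xs @ c # ys) = segments P xs @ segments P ys"
  by (induction xs) auto

lemma segments_rev: "segments P (rev xs) = rev (map rev (segments P xs))"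
proof (induction "length xs" arbitrary: xs rule: less_induct)
  case less
  show ?case
  proof (cases "\<exists>c\<in>set xs. P c")
    case True
    then obtain ys c zs where xs: "xs = ys @ c # zs" "P c" by (meson split_list)
    then show ?thesis using less[of ys] less[of zs]
      by (simp add: segments_append)
  next
    case False
    then show ?thesis using segments_none[of "rev xs" P] segments_none[of xs P] by auto
  qed
qed

lemma segments_list_all2:
  assumes "list_all2 R xs ys" "\<And>x y. R x y \<Longrightarrow> P x = Q y"
  shows "list_all2 (list_all2 R) (segments P xs) (segments Q ys)"
  using assms(1)
proof induction
  case (Cons x xs y ys)
  then have "list_all2 R (hd (segments P xs)) (hd (segments Q ys))"
    "list_all2 (list_all2 R) (tl (segments P xs)) (tl (segments Q ys))"
    by (cases "segments P xs"; cases "segments Q ys"; simp)+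
  then show ?case using Cons assms(2)[of x y] by auto
qed simp

lemma maximal_segment:
  assumes "\<And>x. x \<in> set w \<Longrightarrow> \<not> P x" "l = [] \<or> P (last l)" "r = [] \<or> P (hd r)"
  shows "w \<in> set (segments P (l @ w @ r))"
proof -
  have 1: "w \<in> set (segments P (w @ r))"
  proof (cases r)
    case Nil
    then show ?thesis using assms(1) by (simp add: segments_none)
  next
    case (Cons c r')
    then show ?thesis using assms by (simp add: segments_append segments_none)
  qed
  show ?thesis
  proof (cases l rule: rev_cases)
    case (snoc l' c)
    then show ?thesis using 1 assms(2) segments_append[of P c l' "w @ r"] by simp
  qed (use 1 in simp)
qed

section \<open>Transporting uniform bits to a distribution\<close>

definition bit_words :: "nat \<Rightarrow> bool list set" where
  "bit_words B = {bs. length bs = B}"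

lemma finite_bit_words [simp]: "finite (bit_words B)"
  using finite_lists_length_eq[of "UNIV :: bool set" B] by (simp add: bit_words_def)

lemma card_bit_words: "card (bit_words B) = 2 ^ B"
  using card_lists_length_eq[of "UNIV :: bool set" B] by (simp add: bit_words_def)

text \<open>A coupling of the uniform law of \<open>B\<close> bits with \<nu>. The last clause
  bounds the number of bit words that leave the outcome open, and the bound does not involve
  \<open>B\<close>, so additional bits make failure rarer.\<close>

definition transport_plan :: "nat \<Rightarrow> 'w set \<Rightarrow> ('w \<Rightarrow> real) \<Rightarrow> (bool list \<Rightarrow> 'w \<Rightarrow> real) \<Rightarrow> bool" where
  "transport_plan B S \<nu> p \<longleftrightarrow>
    (\<forall>bs u. p bs u \<ge> 0) \<and>
    (\<forall>u\<in>S. (\<Sum>bs\<in>bit_words B. p bs u) = \<nu> u) \<and>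
    (\<forall>bs\<in>bit_words B. (\<Sum>u\<in>S. p bs u) = 1 / 2 ^ B) \<and>
    card {bs\<in>bit_words B. \<not> (\<exists>u. \<forall>v\<in>S. p bs v > 0 \<longrightarrow> v = u)} \<le> card {u\<in>S. \<nu> u > 0}"

text \<open>
  Both the atoms of \<open>\<nu>\<close> and the bit words are laid out as consecutive intervals of \<open>[0, 1]\<close>,
  and \<open>p\<close> is the length of the overlap, written as a mixed second difference of \<open>min\<close> so that
  both marginals telescope. A bit word that meets two atoms contains an endpoint of an atom in
  its interior.
\<close>

lemma transport_plan_exists:
  fixes \<nu> :: "'w \<Rightarrow> real"
  assumes S: "finite S" and nn: "\<And>u. u \<in> S \<Longrightarrow> \<nu> u \<ge> 0" and sum1: "sum \<nu> S = 1"
  shows "\<exists>p. transport_plan B S \<nu> p"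
proof -
  define T where "T = {u\<in>S. \<nu> u > 0}"
  have T: "finite T" "T \<subseteq> S" using S by (auto simp: T_def)
  define m where "m = card T"
  obtain e where e: "bij_betw e {..<m} T"
    using ex_bij_betw_nat_finite[OF T(1)] by (auto simp: m_def atLeast0LessThan)
  define N :: nat where "N = 2 ^ B"
  have N: "N > 0" by (simp add: N_def)
  obtain g where g: "bij_betw g (bit_words B) {..<N}"
    using ex_bij_betw_finite_nat[of "bit_words B"] by (auto simp: card_bit_words N_def atLeast0LessThan)
  define F where "F j = (\<Sum>i<j. \<nu> (e i))" for j
  have eT: "e i \<in> T" if "i < m" for i using e that by (auto simp: bij_betw_def)
  have \<nu>e: "\<nu> (e i) > 0" if "i < m" for i using eT[OF that] by (simp add: T_def)
  have Fmono: "F i \<le> F j" if "i \<le> j" "j \<le> m" for i j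
    unfolding F_def using that \<nu>e by (intro sum_mono2) (auto intro: less_imp_le dest: order.strict_trans2)
  have F0: "F 0 = 0" by (simp add: F_def)
  have Fm: "F m = 1"
  proof -
    have "F m = sum \<nu> T" unfolding F_def using e by (rule sum.reindex_bij_betw)
    also have "\<dots> = sum \<nu> S" using S nn by (intro sum.mono_neutral_left) (auto simp: T_def intro: antisym)
    finally show ?thesis using sum1 by simp
  qed
  have Fle1: "F j \<le> 1" "F j \<ge> 0" if "j \<le> m" for j
    using Fmono[of j m] Fmono[of 0 j] that Fm F0 by auto
  define h where "h d t = min t (real d / N)" for d :: nat and t
  define ov where "ov d j = (h (Suc d) (F (Suc j)) - h (Suc d) (F j)) - (h d (F (Suc j)) - h d (F j))" for d j
  have dN: "real d / N \<le> real (Suc d) / N" for d using N by (simp add: divide_right_mono)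
  have ov_nn: "ov d j \<ge> 0" if "j < m" for d j
    using dN[of d] Fmono[of j "Suc j"] that by (auto simp: ov_def h_def min_def)
  have ov_pos: "F j < real (Suc d) / N \<and> real d / N < F (Suc j)" if "j < m" "ov d j > 0" for d j
    using that dN[of d] Fmono[of j "Suc j"] by (auto simp: ov_def h_def min_def split: if_splits)
  have ov_row: "(\<Sum>j<m. ov d j) = 1 / N" if "d < N" for d
  proof -
    have "real (Suc d) / N \<le> 1" "real d / N \<le> 1" using that by (simp_all add: divide_le_eq)
    moreover have "(\<Sum>j<m. ov d j) = (h (Suc d) (F m) - h (Suc d) (F 0)) - (h d (F m) - h d (F 0))"
      using sum_lessThan_telescope[of "\<lambda>j. h (Suc d) (F j)" m] sum_lessThan_telescope[of "\<lambda>j. h d (F j)" m]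
      unfolding ov_def by (subst sum_subtractf) simp
    ultimately show ?thesis using N by (simp add: h_def Fm F0 min_def add_divide_distrib)
  qed
  have ov_col: "(\<Sum>d<N. ov d j) = \<nu> (e j)" if "j < m" for j
  proof -
    have "(\<Sum>d<N. ov d j) = (\<Sum>d<N. (h (Suc d) (F (Suc j)) - h (Suc d) (F j)) - (h d (F (Suc j)) - h d (F j)))"
      by (simp add: ov_def)
    also have "\<dots> = (h N (F (Suc j)) - h N (F j)) - (h 0 (F (Suc j)) - h 0 (F j))"
      by (rule sum_lessThan_telescope)
    also have "\<dots> = F (Suc j) - F j"
      using N Fle1[of j] Fle1[of "Suc j"] that by (simp add: h_def min_def)
    finally show ?thesis by (simp add: F_def)
  qed
  define ei where "ei = the_inv_into {..<m} e"
  have ei: "ei u < m" "e (ei u) = u" if "u \<in> T" for u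
  proof -
    have "u \<in> e ` {..<m}" using that e by (auto simp: bij_betw_def)
    then show "ei u < m" "e (ei u) = u"
      unfolding ei_def using e f_the_inv_into_f[of e "{..<m}" u] the_inv_into_into[of e "{..<m}" u "{..<m}"]
      by (auto simp: bij_betw_def)
  qed
  have ei': "ei (e j) = j" if "j < m" for j
    unfolding ei_def using that e the_inv_into_f_f[of e "{..<m}" j] by (auto simp: bij_betw_def)
  define p where "p bs u = (if u \<in> T then ov (g bs) (ei u) else 0)" for bs u
  have "transport_plan B S \<nu> p"
    unfolding transport_plan_def
  proof (intro conjI ballI allI)
    fix bs u
    show "p bs u \<ge> 0" using ei ov_nn by (simp add: p_def)
  next
    fix u assume u: "u \<in> S"
    show "(\<Sum>bs\<in>bit_words B. p bs u) = \<nu> u"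
    proof (cases "u \<in> T")
      case True
      have "(\<Sum>bs\<in>bit_words B. p bs u) = (\<Sum>d<N. ov d (ei u))"
        using True sum.reindex_bij_betw[OF g, of "\<lambda>d. ov d (ei u)"] by (simp add: p_def)
      then show ?thesis using True ei ov_col by simp
    next
      case False
      then show ?thesis using u nn[of u] by (auto simp: p_def T_def)
    qed
  next
    fix bs assume bs: "bs \<in> bit_words B"
    have "(\<Sum>u\<in>S. p bs u) = (\<Sum>u\<in>T. ov (g bs) (ei u))"
      using S T by (intro sum.mono_neutral_cong_right) (auto simp: p_def)
    also have "\<dots> = (\<Sum>j<m. ov (g bs) (ei (e j)))"
      using sum.reindex_bij_betw[OF e, of "\<lambda>u. ov (g bs) (ei u)"] by simp
    also have "\<dots> = (\<Sum>j<m. ov (g bs) j)" using ei' by (intro sum.cong) auto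
    also have "\<dots> = 1 / N" using g bs by (intro ov_row) (auto simp: bij_betw_def)
    finally show "(\<Sum>u\<in>S. p bs u) = 1 / 2 ^ B" by (simp add: N_def)
  next
    let ?I = "{bs\<in>bit_words B. \<not> (\<exists>u. \<forall>v\<in>S. p bs v > 0 \<longrightarrow> v = u)}"
    have ex: "\<exists>j<m. real (g bs) / N < F j \<and> F j < real (Suc (g bs)) / N" if "bs \<in> ?I" for bs
    proof -
      from that have *: "\<exists>v\<in>S. p bs v > 0 \<and> v \<noteq> u" for u by blast
      obtain u where u: "p bs u > 0" using * by blast
      obtain v where "p bs v > 0" "v \<noteq> u" using *[of u] by blast
      then have uv: "u \<noteq> v" "p bs u > 0" "p bs v > 0" using u by auto
      then have T: "u \<in> T" "v \<in> T" by (auto simp: p_def split: if_splits)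
      have "ei u \<noteq> ei v" using ei T uv(1) by metis
      moreover have "ov (g bs) (ei u) > 0" "ov (g bs) (ei v) > 0" "ei u < m" "ei v < m"
        using uv T ei(1) by (simp_all add: p_def)
      ultimately obtain a b where ab: "a < b" "b < m" "ov (g bs) a > 0" "ov (g bs) b > 0"
        by (metis linorder_neqE_nat)
      then have "real (g bs) / N < F (Suc a)" "F b < real (Suc (g bs)) / N"
        using ov_pos by auto
      moreover have "F (Suc a) \<le> F b" using ab by (intro Fmono) auto
      ultimately show ?thesis using ab by (intro exI[of _ b]) auto
    qed
    define k where "k bs = (SOME j. j < m \<and> real (g bs) / N < F j \<and> F j < real (Suc (g bs)) / N)" for bs
    have k: "k bs < m \<and> real (g bs) / N < F (k bs) \<and> F (k bs) < real (Suc (g bs)) / N" if "bs \<in> ?I" for bs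
      unfolding k_def using someI_ex[OF ex[OF that]] .
    have "inj_on k ?I"
    proof (rule inj_onI)
      fix b1 b2 assume b: "b1 \<in> ?I" "b2 \<in> ?I" "k b1 = k b2"
      have "real (g b1) < real (Suc (g b2))" "real (g b2) < real (Suc (g b1))"
        using k[OF b(1)] k[OF b(2)] b(3) N by (auto simp: field_simps)
      then have "g b1 = g b2" by linarith
      then show "b1 = b2" using g b by (auto simp: bij_betw_def inj_on_def)
    qed
    then have "card ?I \<le> card {..<m}" using k by (intro card_inj_on_le[of k]) auto
    then show "card ?I \<le> card {u\<in>S. \<nu> u > 0}" by (simp add: m_def T_def)
  qed
  then show ?thesis by (intro exI[of _ p])
qed

text \<open>
  The types are: no decoration, a supply, a bit of a level, and a cutter of a level. A site
  carries a word and a bit whatever its type, so that the labels are independent of the types;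
  only supplies use the word and only bits use the bit.
\<close>

datatype sty = Plain | Sup | Bit nat | Cut nat

type_synonym data = "nat list \<times> bool"
type_synonym site = "sty \<times> data"

section \<open>Levels of cutters, walls and orientation\<close>

fun cutge :: "nat \<Rightarrow> sty \<Rightarrow> bool" where
  "cutge n (Cut m) \<longleftrightarrow> n \<le> m"
| "cutge n _ \<longleftrightarrow> False"

lemma cutge_mono: "cutge n s \<Longrightarrow> m \<le> n \<Longrightarrow> cutge m s"
  by (cases s) auto

lemma cutge_cases: "cutge n s \<longleftrightarrow> (\<exists>m\<ge>n. s = Cut m)"
  by (cases s) auto

text \<open>
  The walls of every level consist of at least two sites, as is needed for the letters on their
  two sides to be independent.
\<close>

definition thick :: "sty list \<Rightarrow> bool" where
  "thick sw \<longleftrightarrow> (\<forall>m i. i + 2 < length sw \<longrightarrow> cutge m (sw ! (i + 1)) \<longrightarrow>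
     cutge m (sw ! i) \<or> cutge m (sw ! (i + 2)))"

lemma thick_appendD:
  assumes "thick (a @ b)" shows "thick a" "thick b"
proof -
  have *: "cutge m ((a @ b) ! i) \<or> cutge m ((a @ b) ! (i + 2))"
    if "i + 2 < length (a @ b)" "cutge m ((a @ b) ! (i + 1))" for m i
    using assms that unfolding thick_def by blast
  show "thick a" unfolding thick_def
  proof (intro allI impI)
    fix m i assume "i + 2 < length a" "cutge m (a ! (i + 1))"
    then show "cutge m (a ! i) \<or> cutge m (a ! (i + 2))" using *[of i m] by (simp add: nth_append)
  qed
  show "thick b" unfolding thick_def
  proof (intro allI impI)
    fix m i assume "i + 2 < length b" "cutge m (b ! (i + 1))"
    then show "cutge m (b ! i) \<or> cutge m (b ! (i + 2))" using *[of "length a + i" m] by (simp add: nth_append)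
  qed
qed

lemma thick_rev: "thick sw \<Longrightarrow> thick (rev sw)"
  unfolding thick_def
proof (intro allI impI)
  fix m i
  assume t: "\<forall>m i. i + 2 < length sw \<longrightarrow> cutge m (sw ! (i + 1)) \<longrightarrow> cutge m (sw ! i) \<or> cutge m (sw ! (i + 2))"
    and i: "i + 2 < length (rev sw)" "cutge m (rev sw ! (i + 1))"
  define j where "j = length sw - 3 - i"
  have "j + 2 < length sw" "rev sw ! i = sw ! (j + 2)" "rev sw ! (i + 1) = sw ! (j + 1)" "rev sw ! (i + 2) = sw ! j"
    using i(1) by (auto simp: j_def rev_nth intro!: arg_cong[of _ _ "(!) sw"])
  then show "cutge m (rev sw ! i) \<or> cutge m (rev sw ! (i + 2))" using t i(2) by metis
qed

definition str :: "(site \<times> nat) list \<Rightarrow> sty list" where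
  "str z = map (fst \<circ> fst) z"

definition pal :: "'a list \<Rightarrow> bool" where
  "pal w \<longleftrightarrow> rev w = w"

text \<open>The choice depends on the unordered pair only, so a word and its reverse give the same
  result.\<close>

definition pick :: "'a list \<Rightarrow> 'a list" where
  "pick w = (SOME u. u \<in> {w, rev w})"

text \<open>Decided by the types alone: turning a cell does not depend on its labels or letters,
  whose laws are invariant under reversal.\<close>

definition orient :: "(site \<times> nat) list \<Rightarrow> (site \<times> nat) list" where
  "orient z = (if pick (str z) = str z then z else rev z)"

lemma str_rev: "str (rev z) = rev (str z)"
  by (simp add: str_def rev_map)

lemma pal_rev [simp]: "pal (rev w) = pal w"
  by (auto simp: pal_def)

lemma pick_rev [simp]: "pick (rev w) = pick w"
  by (simp add: pick_def insert_commute)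

lemma pick_in: "pick w = w \<or> pick w = rev w"
  using someI[of "\<lambda>u. u \<in> {w, rev w}" w] by (auto simp: pick_def)

lemma orient_rev: "\<not> pal (str z) \<Longrightarrow> orient (rev z) = orient z"
  using pick_in[of "str z"] by (auto simp: orient_def str_rev pal_def)

lemma str_zip: "length aw = length u \<Longrightarrow> str (zip aw u) = map fst aw"
  by (simp add: str_def map_map[symmetric] del: map_map)

definition bits_of :: "nat \<Rightarrow> site list \<Rightarrow> bool list" where
  "bits_of n aw = map (snd \<circ> snd) (filter (\<lambda>e. fst e = Bit n) aw)"

text \<open>The coupling in a cell of the next level before its own bits are read. The cells inside
  are coupled separately; the letters on the walls between them contribute no factor.\<close>

definition pre_density :: "((site \<times> nat) list \<Rightarrow> real) \<Rightarrow> nat \<Rightarrow> (site \<times> nat) list \<Rightarrow> real" where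
  "pre_density g n z = prod_list (map g (segments (\<lambda>e. cutge n (fst (fst e))) z))"

lemma pre_density_rev:
  assumes "\<And>z. g (rev z) = g z"
  shows "pre_density g n (rev z) = pre_density g n z"
  unfolding pre_density_def by (simp add: segments_rev rev_map[symmetric] assms comp_def prod_list.rev)

lemma pre_density_nonneg: "(\<And>z. g z \<ge> 0) \<Longrightarrow> pre_density g n z \<ge> 0"
  unfolding pre_density_def by (induction "segments (\<lambda>e. cutge n (fst (fst e))) z" rule: list.induct) (auto intro!: prod_list_nonneg)

lemma pre_density_none: "(\<And>e. e \<in> set z \<Longrightarrow> \<not> cutge n (fst (fst e))) \<Longrightarrow> pre_density g n z = g z"
  by (simp add: pre_density_def segments_none)

lemma pre_density_none_zip:
  "(\<And>s. s \<in> set aw \<Longrightarrow> \<not> cutge n (fst s)) \<Longrightarrow> pre_density g n (zip aw u) = g (zip aw u)"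
  by (rule pre_density_none) (metis prod.collapse set_zip_leftD)

lemma pre_density_append:
  "cutge n (fst (fst c)) \<Longrightarrow> pre_density g n (a @ c # r) = pre_density g n a * pre_density g n r"
  by (simp add: pre_density_def segments_append)

lemma transport_plan_nonneg: "transport_plan B S \<nu> p \<Longrightarrow> p bs u \<ge> 0"
  by (simp add: transport_plan_def)

section \<open>The coupling density and its two marginals\<close>

locale coding = twodep +
  fixes L :: nat
  assumes L: "L > 0"
begin

text \<open>One fixed choice for every \<nu>, so that equal situations are treated alike everywhere.
  The default 0 makes the plan nonnegative without hypotheses.\<close>

definition plan :: "nat \<Rightarrow> nat \<Rightarrow> (nat list \<Rightarrow> real) \<Rightarrow> bool list \<Rightarrow> nat list \<Rightarrow> real" where
  "plan B l \<nu> = (if \<exists>p. transport_plan B (words q l) \<nu> p then SOME p. transport_plan B (words q l) \<nu> p else (\<lambda>_ _. 0))"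

lemma plan_nonneg: "plan B l \<nu> bs u \<ge> 0"
proof (cases "\<exists>p. transport_plan B (words q l) \<nu> p")
  case True
  then show ?thesis
    using transport_plan_nonneg[OF someI_ex[OF True]] by (simp only: plan_def if_True)
qed (simp add: plan_def)

lemma plan:
  assumes "\<And>u. u \<in> words q l \<Longrightarrow> \<nu> u \<ge> 0" "(\<Sum>u\<in>words q l. \<nu> u) = 1"
  shows "transport_plan B (words q l) \<nu> (plan B l \<nu>)"
proof -
  have ex: "\<exists>p. transport_plan B (words q l) \<nu> p"
    using transport_plan_exists[of "words q l" \<nu> B] assms by simp
  show ?thesis unfolding plan_def using ex someI_ex[OF ex] by simp
qed

text \<open>A field may carry a malformed word, or one of weight 0, at a supply. This has
  probability 0, but the sum over letters has to be 1 for all fields, so such supplies are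
  skipped.\<close>

definition valid :: "nat list \<Rightarrow> bool" where
  "valid w \<longleftrightarrow> w \<in> words q L \<and> \<mu> w > 0"

definition sups :: "site list \<Rightarrow> nat list list" where
  "sups aw = map (fst \<circ> snd) (filter (\<lambda>e. fst e = Sup \<and> valid (fst (snd e))) aw)"

text \<open>Two letters are left free after each supplied word, so that the blocks are independent
  under \<mu>. Writing a word once fewer than \<open>L\<close> letters remain is not
  attempted.\<close>

primrec sup_density :: "nat list list \<Rightarrow> nat list \<Rightarrow> real" where
  "sup_density [] u = 1"
| "sup_density (w # ws) u = (if length u < L then 1
     else (if take L u = w then 1 / \<mu> w else 0) * sup_density ws (drop (L + 2) u))"

text \<open>Before the bits of level \<open>n\<close> are read, the letters have the weights
  \<open>\<mu> v * g (zip aw v)\<close>. The plan couples this law with uniform bits; dividing the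
  joint weight by the product of \<open>1 / 2 ^ length bs\<close> and \<open>\<mu> u\<close> gives a
  density.\<close>

definition slice_density :: "nat \<Rightarrow> ((site \<times> nat) list \<Rightarrow> real) \<Rightarrow> (site \<times> nat) list \<Rightarrow> real" where
  "slice_density n g z = (let aw = map fst z; u = map snd z; bs = bits_of n aw in
     2 ^ length bs * plan (length bs) (length u) (\<lambda>v. \<mu> v * g (zip aw v)) bs u / \<mu> u)"

text \<open>
  \<open>dens n z\<close> is the density, with respect to the product of the law of the labels given their
  types and the law of the colouring, of the coupling that is built up to level \<open>n\<close> on a cell \<open>z\<close>.
  A palindromic type word has no orientation and its own labels are ignored.
\<close>

primrec dens :: "nat \<Rightarrow> (site \<times> nat) list \<Rightarrow> real" where
  "dens 0 = (\<lambda>z. if pal (str z) then 1 else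
      sup_density (sups (map fst (orient z))) (map snd (orient z)))"
| "dens (Suc n) = (\<lambda>z. if pal (str z) then pre_density (dens n) n z else
      slice_density (Suc n) (pre_density (dens n) n) (orient z))"

abbreviation pre :: "nat \<Rightarrow> (site \<times> nat) list \<Rightarrow> real" where
  "pre n \<equiv> pre_density (dens n) n"

lemma sup_density_nonneg: "sup_density ws u \<ge> 0"
  by (induction ws arbitrary: u) (auto simp: nonneg)

lemma slice_density_nonneg: "slice_density n g z \<ge> 0"
  by (simp add: slice_density_def Let_def plan_nonneg nonneg)

lemma dens_nonneg: "dens n z \<ge> 0"
proof (induction n arbitrary: z)
  case (Suc n)
  then show ?case by (simp add: slice_density_nonneg pre_density_nonneg)
qed (simp add: sup_density_nonneg)

lemma pre_nonneg: "pre n z \<ge> 0"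
  by (intro pre_density_nonneg dens_nonneg)

lemma dens_rev: "dens n (rev z) = dens n z"
proof (induction n arbitrary: z)
  case 0
  then show ?case by (simp add: str_rev orient_rev)
next
  case (Suc n)
  then show ?case by (simp add: str_rev orient_rev pre_density_rev)
qed

lemma pre_rev: "pre n (rev z) = pre n z"
  by (intro pre_density_rev dens_rev)

lemma pal_Nil [simp]: "pal []" by (simp add: pal_def)

lemma dens_Nil [simp]: "dens n [] = 1"
  by (induction n) (auto simp: str_def pre_density_def)

subsection \<open>Normalisation in the colouring\<close>

lemma sup_density_short: "length u < L \<Longrightarrow> sup_density ws u = 1"
  by (cases ws) auto

text \<open>Forcing a block to equal \<open>w\<close> is conditioning on an event of probability
  \<open>\<mu> w\<close>, hence the factor \<open>1 / \<mu> w\<close>; the two free letters make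
  what follows independent of the block.\<close>

lemma sup_density_norm:
  "(\<And>w. w \<in> set ws \<Longrightarrow> valid w) \<Longrightarrow> (\<Sum>u\<in>words q l. \<mu> u * sup_density ws u) = 1"
proof (induction ws arbitrary: l)
  case Nil
  then show ?case by (simp add: sum_words)
next
  case (Cons w ws)
  have w: "w \<in> words q L" "\<mu> w > 0" using Cons.prems[of w] by (auto simp: valid_def)
  have sel: "(\<Sum>v\<in>words q L. (if v = w then c v / \<mu> w else 0)) = c w / \<mu> w" for c :: "nat list \<Rightarrow> real"
    using w by (simp add: sum.delta)
  \<comment> \<open>In the middle case the block fits but its two free letters do not; nothing is
    written after it.\<close>
  consider "l < L" | r where "l = L + r" "r < 2" | s where "l = L + (2 + s)"
    by (metis add.commute le_Suc_ex not_less)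
  then show ?case
  proof cases
    case 1
    then have "(\<Sum>u\<in>words q l. \<mu> u * sup_density (w # ws) u) = (\<Sum>u\<in>words q l. \<mu> u)"
      by (intro sum.cong) (auto simp: words_iff)
    then show ?thesis by (simp add: sum_words)
  next
    case 2
    have "(\<Sum>u\<in>words q l. \<mu> u * sup_density (w # ws) u)
        = (\<Sum>v\<in>words q L. \<Sum>y\<in>words q r. if v = w then \<mu> (v @ y) / \<mu> w else 0)"
      unfolding 2 sum_words_add using 2 L
      by (intro sum.cong refl) (auto simp: words_iff sup_density_short)
    also have "\<dots> = (\<Sum>v\<in>words q L. if v = w then (\<Sum>y\<in>words q r. \<mu> (v @ y)) / \<mu> w else 0)"
      by (intro sum.cong) (auto simp: sum_divide_distrib)
    finally show ?thesis using w by (simp add: sel sum_append)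
  next
    case 3
    have "(\<Sum>u\<in>words q l. \<mu> u * sup_density (w # ws) u)
        = (\<Sum>v\<in>words q L. \<Sum>c\<in>words q 2. \<Sum>y\<in>words q s. if v = w then \<mu> (v @ c @ y) * sup_density ws y / \<mu> w else 0)"
      unfolding 3 sum_words_add
      by (intro sum.cong refl) (auto simp: words_iff)
    also have "\<dots> = (\<Sum>v\<in>words q L. if v = w then (\<Sum>c\<in>words q 2. \<Sum>y\<in>words q s. \<mu> (v @ c @ y) * sup_density ws y) / \<mu> w else 0)"
      by (intro sum.cong) (auto simp: sum_divide_distrib)
    also have "\<dots> = (\<Sum>c\<in>words q 2. \<Sum>y\<in>words q s. \<mu> (w @ c @ y) * sup_density ws y) / \<mu> w"
      by (rule sel)
    also have "(\<Sum>c\<in>words q 2. \<Sum>y\<in>words q s. \<mu> (w @ c @ y) * sup_density ws y)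
        = (\<Sum>y\<in>words q s. (\<Sum>c\<in>words q 2. \<mu> (w @ c @ y)) * sup_density ws y)"
      by (subst sum.swap) (simp add: sum_distrib_right)
    also have "\<dots> = \<mu> w * (\<Sum>y\<in>words q s. \<mu> y * sup_density ws y)"
      by (simp add: sum_gap sum_distrib_left mult.assoc)
    finally show ?thesis using Cons w by simp
  qed
qed

text \<open>Split at the first cutter. A wall inside the word has at least two sites, and summing
  over the letters on its first two sites factorises \<mu>. At an end of the word a wall may be cut
  down to one site, but there one side is empty and consistency of \<mu> is enough.\<close>

lemma pre_density_norm:
  assumes g: "\<And>aw. thick (map fst aw) \<Longrightarrow> (\<Sum>u\<in>words q (length aw). \<mu> u * g (zip aw u)) = 1"
    and gNil: "g [] = 1" and "thick (map fst aw)"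
  shows "(\<Sum>u\<in>words q (length aw). \<mu> u * pre_density g n (zip aw u)) = 1"
  using assms(3)
proof (induction "length aw" arbitrary: aw rule: less_induct)
  case less
  show ?case
  proof (cases "\<exists>c\<in>set aw. cutge n (fst c)")
    case False
    have "pre_density g n (zip aw u) = g (zip aw u)" for u
      using False by (intro pre_density_none_zip) auto
    then show ?thesis using g less.prems by simp
  next
    case True
    then obtain a c r where aw: "aw = a @ c # r" "cutge n (fst c)" and a: "\<And>x. x \<in> set a \<Longrightarrow> \<not> cutge n (fst x)"
      using split_list_first_prop[of aw "\<lambda>c. cutge n (fst c)"] by blast
    have ta: "thick (map fst a)" and tr: "thick (map fst r)"
      using less.prems thick_appendD[of "map fst a" "map fst (c # r)"]
        thick_appendD[of "[fst c]" "map fst r"] by (auto simp: aw)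
    have pre_a: "pre_density g n (zip a ua) = g (zip a ua)" for ua
      using a by (intro pre_density_none_zip)
    have split: "(\<Sum>u\<in>words q (length aw). \<mu> u * pre_density g n (zip aw u))
      = (\<Sum>ua\<in>words q (length a). \<Sum>x\<in>{1..q}. \<Sum>ur\<in>words q (length r).
          \<mu> (ua @ x # ur) * (g (zip a ua) * pre_density g n (zip r ur)))"
    proof -
      have "length aw = length a + Suc (length r)" by (simp add: aw)
      then have "(\<Sum>u\<in>words q (length aw). \<mu> u * pre_density g n (zip aw u))
        = (\<Sum>ua\<in>words q (length a). \<Sum>x\<in>{1..q}. \<Sum>ur\<in>words q (length r).
          \<mu> (ua @ x # ur) * pre_density g n (zip aw (ua @ x # ur)))"
        by (simp only: sum_words_add sum_words_Suc)
      also have "\<dots> = (\<Sum>ua\<in>words q (length a). \<Sum>x\<in>{1..q}. \<Sum>ur\<in>words q (length r).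
          \<mu> (ua @ x # ur) * (g (zip a ua) * pre_density g n (zip r ur)))"
        using aw(2) by (intro sum.cong refl) (simp add: aw(1) words_iff pre_density_append pre_a)
      finally show ?thesis .
    qed
    consider "a = []" | "r = []" | c' r' where "a \<noteq> []" "r = c' # r'" by (cases r) auto
    then show ?thesis
    proof cases
      case 1
      have "(\<Sum>ua\<in>words q (length a). \<Sum>x\<in>{1..q}. \<Sum>ur\<in>words q (length r).
          \<mu> (ua @ x # ur) * (g (zip a ua) * pre_density g n (zip r ur)))
        = (\<Sum>ur\<in>words q (length r). (\<Sum>x\<in>{1..q}. \<mu> (x # ur)) * pre_density g n (zip r ur))"
        using 1 gNil by (simp add: sum_distrib_right) (rule sum.swap)
      moreover have "(\<Sum>x\<in>{1..q}. \<mu> (x # ur)) = \<mu> ur" for ur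
        using sum_prepend[where n=1 and x=ur] by (simp add: sum_words_Suc)
      ultimately show ?thesis using less(1)[of r] tr split by (simp add: aw)
    next
      case 2
      have "(\<Sum>ua\<in>words q (length a). \<Sum>x\<in>{1..q}. \<Sum>ur\<in>words q (length r).
          \<mu> (ua @ x # ur) * (g (zip a ua) * pre_density g n (zip r ur)))
        = (\<Sum>ua\<in>words q (length a). (\<Sum>x\<in>{1..q}. \<mu> (ua @ [x])) * g (zip a ua))"
        using 2 gNil by (simp add: sum_distrib_right pre_density_def)
      then show ?thesis using g[OF ta] split by (simp only: sum_snoc)
    next
      case 3
      \<comment> \<open>The site before the first cutter is no cutter of this level, so thickness
        makes the site after it one.\<close>
      have c': "cutge n (fst c')"
      proof -
        have la: "a ! (length a - 1) \<in> set a" using 3 by simp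
        have "cutge n (map fst aw ! (length a - 1)) \<or> cutge n (map fst aw ! (length a - 1 + 2))"
          using less.prems[unfolded thick_def, rule_format, of "length a - 1" n] aw 3
          by (cases "length a") (auto simp: nth_append)
        then show ?thesis using a[OF la] 3 by (cases "length a") (auto simp: aw nth_append)
      qed
      \<comment> \<open>Two adjacent cutters enclose an empty segment, whose factor is
        \<open>g [] = 1\<close>.\<close>
      have pr: "pre_density g n (zip r (x' # ur')) = pre_density g n (zip r' ur')" for x' ur'
        using pre_density_append[of n "(c', x')" g "[]" "zip r' ur'"] c' gNil 3
        by (simp add: pre_density_def)
      have tr': "thick (map fst r')"
        using tr thick_appendD(2)[of "[fst c']" "map fst r'"] 3 by simp
      have "(\<Sum>ua\<in>words q (length a). \<Sum>x\<in>{1..q}. \<Sum>ur\<in>words q (length r).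
          \<mu> (ua @ x # ur) * (g (zip a ua) * pre_density g n (zip r ur)))
        = (\<Sum>ua\<in>words q (length a). \<Sum>x\<in>{1..q}. \<Sum>x'\<in>{1..q}. \<Sum>ur'\<in>words q (length r').
          \<mu> (ua @ [x, x'] @ ur') * (g (zip a ua) * pre_density g n (zip r' ur')))"
        by (simp add: 3 sum_words_Suc pr[unfolded 3] del: zip_Cons_Cons)
      also have "\<dots> = (\<Sum>ua\<in>words q (length a). \<Sum>x\<in>{1..q}. \<Sum>ur'\<in>words q (length r'). \<Sum>x'\<in>{1..q}.
          \<mu> (ua @ [x, x'] @ ur') * (g (zip a ua) * pre_density g n (zip r' ur')))"
        by (intro sum.cong refl sum.swap)
      also have "\<dots> = (\<Sum>ua\<in>words q (length a). \<Sum>ur'\<in>words q (length r'). \<Sum>x\<in>{1..q}. \<Sum>x'\<in>{1..q}.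
          \<mu> (ua @ [x, x'] @ ur') * (g (zip a ua) * pre_density g n (zip r' ur')))"
        by (intro sum.cong refl sum.swap)
      also have "\<dots> = (\<Sum>ua\<in>words q (length a). \<Sum>ur'\<in>words q (length r').
          (\<Sum>x\<in>{1..q}. \<Sum>x'\<in>{1..q}. \<mu> (ua @ [x, x'] @ ur')) * (g (zip a ua) * pre_density g n (zip r' ur')))"
        by (simp add: sum_distrib_right)
      also have "\<dots> = (\<Sum>ua\<in>words q (length a). \<Sum>ur'\<in>words q (length r').
          (\<mu> ua * g (zip a ua)) * (\<mu> ur' * pre_density g n (zip r' ur')))"
        by (simp only: dep) (simp add: mult_ac)
      also have "\<dots> = (\<Sum>ua\<in>words q (length a). \<mu> ua * g (zip a ua)) *
          (\<Sum>ur'\<in>words q (length r'). \<mu> ur' * pre_density g n (zip r' ur'))"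
        by (rule sum_product[symmetric])
      also have "\<dots> = 1" using g[OF ta] less(1)[of r'] tr' by (simp add: aw 3)
      finally show ?thesis using split by simp
    qed
  qed
qed

text \<open>Since \<mu> is invariant under reversal, sums over letters do not notice the
  orientation.\<close>

lemma orient_norm:
  assumes H: "\<And>aw. thick (map fst aw) \<Longrightarrow> (\<Sum>u\<in>words q (length aw). \<mu> u * H (zip aw u)) = 1"
    and t: "thick (map fst aw)"
  shows "(\<Sum>u\<in>words q (length aw). \<mu> u * H (orient (zip aw u))) = 1"
proof (cases "pick (map fst aw) = map fst aw")
  case True
  have "(\<Sum>u\<in>words q (length aw). \<mu> u * H (orient (zip aw u))) = (\<Sum>u\<in>words q (length aw). \<mu> u * H (zip aw u))"
    using True by (intro sum.cong) (auto simp: orient_def str_zip words_iff)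
  then show ?thesis using H t by simp
next
  case False
  have "(\<Sum>u\<in>words q (length aw). \<mu> u * H (orient (zip aw u))) = (\<Sum>u\<in>words q (length aw). \<mu> (List.rev u) * H (zip (List.rev aw) (List.rev u)))"
    using False by (intro sum.cong) (auto simp: orient_def str_zip words_iff zip_rev rev)
  also have "\<dots> = (\<Sum>u\<in>words q (length (List.rev aw)). \<mu> u * H (zip (List.rev aw) u))"
    using sum_words_rev[of "\<lambda>u. \<mu> u * H (zip (List.rev aw) u)"] by simp
  also have "\<dots> = 1" using t thick_rev[OF t] by (intro H) (simp add: rev_map)
  finally show ?thesis .
qed

lemma plan_pre:
  assumes "(\<Sum>u\<in>words q (length aw). \<mu> u * g (zip aw u)) = 1" "\<And>z. g z \<ge> 0"
  shows "transport_plan B (words q (length aw)) (\<lambda>v. \<mu> v * g (zip aw v)) (plan B (length aw) (\<lambda>v. \<mu> v * g (zip aw v)))"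
  using assms nonneg by (intro plan) auto

lemma plan_zero:
  assumes "transport_plan B S \<nu> p" "u \<in> S" "bs \<in> bit_words B" "p bs u > 0"
  shows "\<nu> u > 0"
proof -
  have "p bs u \<le> (\<Sum>bs\<in>bit_words B. p bs u)"
    using assms by (intro member_le_sum) (auto simp: transport_plan_def)
  then show ?thesis using assms by (auto simp: transport_plan_def)
qed

lemma slice_density_norm:
  assumes 1: "(\<Sum>u\<in>words q (length aw). \<mu> u * g (zip aw u)) = 1" and nn: "\<And>z. g z \<ge> 0"
  shows "(\<Sum>u\<in>words q (length aw). \<mu> u * slice_density n g (zip aw u)) = 1"
proof -
  let ?bs = "bits_of n aw"
  let ?p = "plan (length ?bs) (length aw) (\<lambda>v. \<mu> v * g (zip aw v))"
  note p = plan_pre[OF 1 nn, of "length ?bs"]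
  have bs: "?bs \<in> bit_words (length ?bs)" by (simp add: bit_words_def)
  have "(\<Sum>u\<in>words q (length aw). \<mu> u * slice_density n g (zip aw u)) = (\<Sum>u\<in>words q (length aw). 2 ^ length ?bs * ?p ?bs u)"
  proof (intro sum.cong refl)
    fix u assume u: "u \<in> words q (length aw)"
    then have "slice_density n g (zip aw u) = 2 ^ length ?bs * ?p ?bs u / \<mu> u"
      by (simp add: slice_density_def words_iff Let_def)
    moreover have "?p ?bs u = 0" if "\<mu> u = 0"
      using plan_zero[OF p u bs] that plan_nonneg[of _ _ _ ?bs u] by (auto simp: order.order_iff_strict)
    ultimately show "\<mu> u * slice_density n g (zip aw u) = 2 ^ length ?bs * ?p ?bs u" by auto
  qed
  also have "\<dots> = 2 ^ length ?bs * (\<Sum>u\<in>words q (length aw). ?p ?bs u)"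
    by (simp add: sum_distrib_left)
  also have "\<dots> = 1" using p bs by (simp add: transport_plan_def)
  finally show ?thesis .
qed

lemma dens_norm:
  "thick (map fst aw) \<Longrightarrow> (\<Sum>u\<in>words q (length aw). \<mu> u * dens n (zip aw u)) = 1"
proof (induction n arbitrary: aw)
  case 0
  show ?case
  proof (cases "pal (map fst aw)")
    case True
    then have "(\<Sum>u\<in>words q (length aw). \<mu> u * dens 0 (zip aw u)) = (\<Sum>u\<in>words q (length aw). \<mu> u)"
      by (intro sum.cong) (auto simp: str_zip words_iff)
    then show ?thesis by (simp add: sum_words)
  next
    case False
    have *: "(\<Sum>u\<in>words q (length aw). \<mu> u * sup_density (sups (map fst (zip aw u))) (map snd (zip aw u))) = 1" for aw
    proof -
      have "(\<Sum>u\<in>words q (length aw). \<mu> u * sup_density (sups (map fst (zip aw u))) (map snd (zip aw u)))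
          = (\<Sum>u\<in>words q (length aw). \<mu> u * sup_density (sups aw) u)"
        by (intro sum.cong) (auto simp: words_iff)
      also have "\<dots> = 1" by (intro sup_density_norm) (auto simp: sups_def)
      finally show ?thesis .
    qed
    have "(\<Sum>u\<in>words q (length aw). \<mu> u * dens 0 (zip aw u))
        = (\<Sum>u\<in>words q (length aw). \<mu> u * (\<lambda>z. sup_density (sups (map fst z)) (map snd z)) (orient (zip aw u)))"
      using False by (intro sum.cong) (auto simp: str_zip words_iff)
    then show ?thesis using orient_norm[OF * 0] by simp
  qed
next
  case (Suc n)
  have pre: "(\<Sum>u\<in>words q (length aw). \<mu> u * pre n (zip aw u)) = 1" if "thick (map fst aw)" for aw
    using Suc.IH that by (intro pre_density_norm) auto
  show ?case
  proof (cases "pal (map fst aw)")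
    case True
    then have "(\<Sum>u\<in>words q (length aw). \<mu> u * dens (Suc n) (zip aw u)) = (\<Sum>u\<in>words q (length aw). \<mu> u * pre n (zip aw u))"
      by (intro sum.cong) (auto simp: str_zip words_iff)
    then show ?thesis using pre Suc.prems by simp
  next
    case False
    then have "(\<Sum>u\<in>words q (length aw). \<mu> u * dens (Suc n) (zip aw u))
        = (\<Sum>u\<in>words q (length aw). \<mu> u * slice_density (Suc n) (pre n) (orient (zip aw u)))"
      by (intro sum.cong) (auto simp: str_zip words_iff)
    also have "\<dots> = 1"
      using Suc.prems by (intro orient_norm slice_density_norm pre pre_nonneg) auto
    finally show ?thesis .
  qed
qed

lemma pre_norm:
  "thick (map fst aw) \<Longrightarrow> (\<Sum>u\<in>words q (length aw). \<mu> u * pre n (zip aw u)) = 1"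
  using dens_norm by (intro pre_density_norm) auto

end

section \<open>What a level reads from the labels\<close>

fun set_bits :: "nat \<Rightarrow> sty list \<Rightarrow> data list \<Rightarrow> bool list \<Rightarrow> data list" where
  "set_bits n (s # sw) (d # dw) bs =
    (if s = Bit n then (fst d, hd bs) # set_bits n sw dw (tl bs) else d # set_bits n sw dw bs)"
| "set_bits n sw dw bs = dw"

definition nbits :: "nat \<Rightarrow> sty list \<Rightarrow> nat" where
  "nbits n sw = length (filter (\<lambda>s. s = Bit n) sw)"

lemma length_set_bits [simp]: "length (set_bits n sw dw bs) = length dw"
  by (induction n sw dw bs rule: set_bits.induct) auto

lemma bits_of_set_bits:
  "length sw = length dw \<Longrightarrow> length bs = nbits n sw \<Longrightarrow> bits_of n (zip sw (set_bits n sw dw bs)) = bs"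
proof (induction n sw dw bs rule: set_bits.induct)
  case (1 n s sw d dw bs)
  then show ?case by (cases bs) (auto simp: bits_of_def nbits_def)
qed (auto simp: bits_of_def nbits_def)

text \<open>Sites that the construction up to level \<open>n\<close> does not distinguish: bits of
  higher levels may differ, and so may data that the type does not use.\<close>

definition site_eqv :: "nat \<Rightarrow> site \<Rightarrow> site \<Rightarrow> bool" where
  "site_eqv n e e' \<longleftrightarrow> fst e = fst e' \<and> (fst e = Sup \<longrightarrow> fst (snd e) = fst (snd e')) \<and>
     (\<forall>m\<le>n. fst e = Bit m \<longrightarrow> snd (snd e) = snd (snd e'))"

definition letter_eqv :: "nat \<Rightarrow> site \<times> nat \<Rightarrow> site \<times> nat \<Rightarrow> bool" where
  "letter_eqv n x y \<longleftrightarrow> site_eqv n (fst x) (fst y) \<and> snd x = snd y"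

lemma site_eqv_refl [simp]: "site_eqv n e e"
  by (simp add: site_eqv_def)

lemma site_eqv_mono: "site_eqv n e e' \<Longrightarrow> m \<le> n \<Longrightarrow> site_eqv m e e'"
  by (auto simp: site_eqv_def)

lemma letter_eqv_mono: "letter_eqv n e e' \<Longrightarrow> m \<le> n \<Longrightarrow> letter_eqv m e e'"
  by (auto simp: letter_eqv_def site_eqv_mono)

lemma list_all2_letter_eqv_zip:
  "list_all2 (site_eqv n) aw aw' \<Longrightarrow> list_all2 (letter_eqv n) (zip aw v) (zip aw' v)"
proof (induction aw aw' arbitrary: v rule: list_all2_induct)
  case (Cons x xs y ys)
  then show ?case by (cases v) (auto simp: letter_eqv_def)
qed simp

lemma list_all2_letter_eqvD:
  assumes "list_all2 (letter_eqv n) z z'"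
  shows "list_all2 (site_eqv n) (map fst z) (map fst z')" "map snd z = map snd z'" "str z = str z'"
  using assms by (induction rule: list_all2_induct) (auto simp: letter_eqv_def str_def site_eqv_def)

lemma list_all2_orient:
  assumes "list_all2 (letter_eqv n) z z'"
  shows "list_all2 (letter_eqv n) (orient z) (orient z')"
  using assms list_all2_letter_eqvD(3)[OF assms] by (simp add: orient_def)

lemma bits_of_eqv:
  assumes "list_all2 (site_eqv n) aw aw'" shows "bits_of n aw = bits_of n aw'"
  using assms by (induction rule: list_all2_induct) (auto simp: bits_of_def site_eqv_def)

lemma list_all2_set_bits:
  "length sw = length dw \<Longrightarrow> list_all2 (site_eqv n) (zip sw dw) (zip sw (set_bits (Suc n) sw dw bs))"
proof (induction "Suc n" sw dw bs rule: set_bits.induct)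
  case (1 s sw d dw bs)
  then show ?case by (auto simp: site_eqv_def)
qed (auto simp: list_all2_refl)

context coding begin

lemma sups_eqv:
  assumes "list_all2 (site_eqv n) aw aw'" shows "sups aw = sups aw'"
  using assms by (induction rule: list_all2_induct) (auto simp: sups_def site_eqv_def)

lemma pre_density_eqv:
  assumes "list_all2 (letter_eqv n) z z'"
    and "\<And>z z'. list_all2 (letter_eqv n) z z' \<Longrightarrow> g z = g z'"
  shows "pre_density g m z = pre_density g m z'"
proof -
  have "list_all2 (list_all2 (letter_eqv n)) (segments (\<lambda>e. cutge m (fst (fst e))) z)
      (segments (\<lambda>e. cutge m (fst (fst e))) z')"
    using assms(1) by (rule segments_list_all2) (auto simp: letter_eqv_def site_eqv_def)
  then have "list_all2 (=) (map g (segments (\<lambda>e. cutge m (fst (fst e))) z))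
      (map g (segments (\<lambda>e. cutge m (fst (fst e))) z'))"
    using assms(2) by (simp add: list.rel_map) (erule list_all2_mono)
  then show ?thesis by (simp add: pre_density_def list.rel_eq)
qed

text \<open>Bits of level \<open>Suc n\<close> are not read up to level \<open>n\<close>, so they
  are still fresh when the plan of level \<open>Suc n\<close> is applied.\<close>

lemma dens_eqv: "list_all2 (letter_eqv n) z z' \<Longrightarrow> dens n z = dens n z'"
proof (induction n arbitrary: z z')
  case 0
  note o = list_all2_orient[OF 0]
  show ?case
    using sups_eqv[OF list_all2_letter_eqvD(1)[OF o]] list_all2_letter_eqvD(2)[OF o]
      list_all2_letter_eqvD(3)[OF 0] by simp
next
  case (Suc n)
  have pre: "pre n z = pre n z'" if "list_all2 (letter_eqv (Suc n)) z z'" for z z'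
  proof (rule pre_density_eqv[OF that])
    fix z z' assume "list_all2 (letter_eqv (Suc n)) z z'"
    then have "list_all2 (letter_eqv n) z z'"
      by (rule list_all2_mono) (rule letter_eqv_mono, auto)
    then show "dens n z = dens n z'" by (rule Suc.IH)
  qed
  note o = list_all2_orient[OF Suc.prems]
  note od = list_all2_letter_eqvD[OF o]
  have *: "pre n (zip (map fst (orient z)) v) = pre n (zip (map fst (orient z')) v)" for v
    by (intro pre list_all2_letter_eqv_zip od)
  have len: "length (orient z) = length (orient z')" using o by (rule list_all2_lengthD)
  show ?case
    using pre[OF Suc.prems] bits_of_eqv[OF od(1)] od(2) len list_all2_letter_eqvD(3)[OF Suc.prems]
    by (simp only: dens.simps slice_density_def Let_def * length_map)
qed

lemma pre_eqv: "list_all2 (letter_eqv n) z z' \<Longrightarrow> pre n z = pre n z'"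
  by (intro pre_density_eqv dens_eqv)

subsection \<open>Averages over the labels\<close>

text \<open>Expectations over the data of labels are kept as finite sums, which permits
  interchanging them without any measurability; they are identified with integrals over
  \<open>data_pmf\<close> later.\<close>

definition E1 :: "(data \<Rightarrow> real) \<Rightarrow> real" where
  "E1 h = (\<Sum>w\<in>words q L. \<mu> w * ((h (w, True) + h (w, False)) / 2))"

primrec Avg :: "nat \<Rightarrow> (data list \<Rightarrow> real) \<Rightarrow> real" where
  "Avg 0 f = f []"
| "Avg (Suc n) f = E1 (\<lambda>d. Avg n (\<lambda>l. f (d # l)))"

lemma E1_const [simp]: "E1 (\<lambda>_. c) = c"
  by (simp add: E1_def sum_words flip: sum_distrib_right)

lemma E1_cmult: "E1 (\<lambda>d. c * h d) = c * E1 h"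
  by (simp add: E1_def sum_distrib_left algebra_simps add_divide_distrib)

lemma E1_mono: "(\<And>d. h d \<le> k d) \<Longrightarrow> E1 h \<le> E1 k"
  unfolding E1_def by (intro sum_mono mult_left_mono divide_right_mono add_mono nonneg) auto

lemma E1_sum: "E1 (\<lambda>d. \<Sum>i\<in>A. h i d) = (\<Sum>i\<in>A. E1 (h i))"
proof -
  have "E1 (\<lambda>d. \<Sum>i\<in>A. h i d) = (\<Sum>w\<in>words q L. \<Sum>i\<in>A. \<mu> w * ((h i (w, True) + h i (w, False)) / 2))"
    by (simp add: E1_def sum.distrib[symmetric] sum_distrib_left sum_divide_distrib)
  also have "\<dots> = (\<Sum>i\<in>A. E1 (h i))" unfolding E1_def by (rule sum.swap)
  finally show ?thesis .
qed

lemma Avg_cong: "(\<And>l. length l = n \<Longrightarrow> f l = g l) \<Longrightarrow> Avg n f = Avg n g"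
proof (induction n arbitrary: f g)
  case (Suc n)
  have "Avg n (\<lambda>l. f (d # l)) = Avg n (\<lambda>l. g (d # l))" for d
    using Suc.prems by (intro Suc.IH) auto
  then show ?case by simp
qed simp

lemma Avg_const [simp]: "Avg n (\<lambda>_. c) = c"
  by (induction n) auto

lemma Avg_cmult: "Avg n (\<lambda>l. c * f l) = c * Avg n f"
  by (induction n arbitrary: f) (auto simp: E1_cmult)

lemma Avg_divide: "Avg n (\<lambda>l. f l / c) = Avg n f / c"
  using Avg_cmult[of n "1 / c" f] by simp

lemma Avg_mono: "(\<And>l. length l = n \<Longrightarrow> f l \<le> g l) \<Longrightarrow> Avg n f \<le> Avg n g"
  by (induction n arbitrary: f g) (auto intro!: E1_mono)

lemma Avg_sum: "Avg n (\<lambda>l. \<Sum>i\<in>A. f i l) = (\<Sum>i\<in>A. Avg n (f i))"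
  by (induction n arbitrary: f) (auto simp: E1_sum)

lemma Avg_append: "Avg (m + n) f = Avg m (\<lambda>x. Avg n (\<lambda>y. f (x @ y)))"
  by (induction m arbitrary: f) auto

lemma E1_swap: "E1 (\<lambda>d. E1 (\<lambda>e. h d e)) = E1 (\<lambda>e. E1 (\<lambda>d. h d e))"
proof -
  have "E1 (\<lambda>d. E1 (\<lambda>e. h d e)) = (\<Sum>w\<in>words q L. E1 (\<lambda>d. \<mu> w * ((h d (w, True) + h d (w, False)) / 2)))"
    unfolding E1_def[of "\<lambda>e. h _ e"] by (rule E1_sum)
  also have "\<dots> = (\<Sum>w\<in>words q L. \<mu> w * ((E1 (\<lambda>d. h d (w, True)) + E1 (\<lambda>d. h d (w, False))) / 2))"
  proof (intro sum.cong refl)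
    fix w
    have "E1 (\<lambda>d. h d (w, True) + h d (w, False)) = E1 (\<lambda>d. h d (w, True)) + E1 (\<lambda>d. h d (w, False))"
      by (simp add: E1_def sum.distrib[symmetric] algebra_simps add_divide_distrib)
    then show "E1 (\<lambda>d. \<mu> w * ((h d (w, True) + h d (w, False)) / 2)) = \<mu> w * ((E1 (\<lambda>d. h d (w, True)) + E1 (\<lambda>d. h d (w, False))) / 2)"
      using E1_cmult[of "\<mu> w / 2" "\<lambda>d. h d (w, True) + h d (w, False)"] by simp
  qed
  finally show ?thesis unfolding E1_def[of "\<lambda>e. E1 (\<lambda>d. h d e)"] .
qed

lemma Avg_E1_swap: "Avg n (\<lambda>l. E1 (\<lambda>d. f l d)) = E1 (\<lambda>d. Avg n (\<lambda>l. f l d))"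
  by (induction n arbitrary: f) (auto intro: E1_swap)

lemma Avg_rev: "Avg n (\<lambda>l. f (List.rev l)) = Avg n f"
proof (induction n arbitrary: f)
  case (Suc n)
  have "Avg (Suc n) (\<lambda>l. f (List.rev l)) = E1 (\<lambda>d. Avg n (\<lambda>l. f (List.rev l @ [d])))" by simp
  also have "\<dots> = E1 (\<lambda>d. Avg n (\<lambda>l. f (l @ [d])))"
    using Suc.IH[of "\<lambda>l. f (l @ [_])"] by simp
  also have "\<dots> = Avg n (\<lambda>l. E1 (\<lambda>d. f (l @ [d])))" by (rule Avg_E1_swap[symmetric])
  also have "\<dots> = Avg (n + 1) f" by (subst Avg_append) simp
  finally show ?case by simp
qed simp

text \<open>The bits of one level are fair and independent of all other data, so they may be
  replaced by fresh ones without changing an average.\<close>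

lemma Avg_set_bits:
  "length sw = l \<Longrightarrow> Avg l f = Avg l (\<lambda>dw. (\<Sum>bs\<in>bit_words (nbits n sw). f (set_bits n sw dw bs)) / 2 ^ nbits n sw)"
proof (induction sw arbitrary: l f)
  case Nil
  have "bit_words 0 = {[]}" by (auto simp: bit_words_def)
  then show ?case using Nil by (simp add: nbits_def)
next
  case (Cons s sw)
  then obtain k where l: "l = Suc k" "length sw = k" by auto
  have bw: "(\<Sum>bs\<in>bit_words (Suc B). h bs) = (\<Sum>bs\<in>bit_words B. h (True # bs) + h (False # bs))"
    for B and h :: "bool list \<Rightarrow> real"
  proof -
    have "bit_words (Suc B) = (#) True ` bit_words B \<union> (#) False ` bit_words B"
      by (auto simp: bit_words_def length_Suc_conv)
    moreover have "((#) True ` bit_words B) \<inter> ((#) False ` bit_words B) = {}" by auto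
    ultimately show ?thesis
      by (simp add: sum.union_disjoint sum.reindex sum.distrib)
  qed
  show ?case
  proof (cases "s = Bit n")
    case False
    have "Avg l f = E1 (\<lambda>d. Avg k (\<lambda>dw. (\<Sum>bs\<in>bit_words (nbits n sw). f (d # set_bits n sw dw bs)) / 2 ^ nbits n sw))"
      unfolding l using Cons.IH[OF l(2), of "\<lambda>l. f (_ # l)"] by simp
    then show ?thesis using False by (simp add: l nbits_def)
  next
    case True
    let ?B = "nbits n sw"
    define h where "h d = Avg k (\<lambda>dw. (\<Sum>bs\<in>bit_words ?B. f (d # set_bits n sw dw bs)) / 2 ^ ?B)" for d
    have "Avg l f = E1 h"
      unfolding l h_def using Cons.IH[OF l(2), of "\<lambda>l. f (_ # l)"] by simp
    also have "\<dots> = E1 (\<lambda>d. (h (fst d, True) + h (fst d, False)) / 2)"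
      by (simp add: E1_def)
    also have "\<dots> = Avg l (\<lambda>dw. (\<Sum>bs\<in>bit_words (nbits n (s # sw)). f (set_bits n (s # sw) dw bs)) / 2 ^ nbits n (s # sw))"
    proof -
      have "Avg k (\<lambda>dw. (\<Sum>bs\<in>bit_words (Suc ?B). f (set_bits n (s # sw) (d # dw) bs)) / 2 ^ Suc ?B)
        = (h (fst d, True) + h (fst d, False)) / 2" for d
      proof -
        have "(\<Sum>bs\<in>bit_words (Suc ?B). f (set_bits n (s # sw) (d # dw) bs)) / 2 ^ Suc ?B
          = (\<Sum>b\<in>{True, False}. (1 / 2) * ((\<Sum>bs\<in>bit_words ?B. f ((fst d, b) # set_bits n sw dw bs)) / 2 ^ ?B))" for dw
          by (simp add: bw True sum.distrib add_divide_distrib)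
        then have "Avg k (\<lambda>dw. (\<Sum>bs\<in>bit_words (Suc ?B). f (set_bits n (s # sw) (d # dw) bs)) / 2 ^ Suc ?B)
          = (\<Sum>b\<in>{True, False}. (1 / 2) * h (fst d, b))"
          by (simp only: Avg_sum Avg_cmult h_def)
        then show ?thesis by simp
      qed
      moreover have "nbits n (s # sw) = Suc ?B" using True by (simp add: nbits_def)
      ultimately show ?thesis by (simp only: l Avg.simps)
    qed
    finally show ?thesis .
  qed
qed

text \<open>Fix the letters \<open>u\<close>. The first supply carries the first block of
  \<open>u\<close> with probability \<mu> of that block, which cancels the factor in the density;
  the next supplies face the rest of \<open>u\<close>. Supplies beyond the end of \<open>u\<close>
  have the factor 1.\<close>

lemma sup_density_average:
  "length sw = l \<Longrightarrow> \<mu> u > 0 \<Longrightarrow> Avg l (\<lambda>dw. sup_density (sups (zip sw dw)) u) = 1"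
proof (induction sw arbitrary: l u)
  case Nil
  then show ?case by (simp add: sups_def)
next
  case (Cons s sw)
  then obtain k where l: "l = Suc k" "length sw = k" by auto
  show ?case
  proof (cases "s = Sup \<and> length u \<ge> L")
    case False
    have "sup_density (sups (zip (s # sw) (d # dw))) u = sup_density (sups (zip sw dw)) u" for d dw
      using False by (auto simp: sups_def sup_density_short)
    then show ?thesis using Cons.IH[OF l(2) Cons.prems(2)] by (simp add: l)
  next
    case True
    define v r where "v = take L u" and "r = drop (L + 2) u"
    have "drop 2 (drop L u) = r" by (simp add: r_def add.commute)
    then have u: "u = v @ take 2 (drop L u) @ r"
      unfolding v_def by (metis append_take_drop_id)
    have v: "\<mu> v > 0" using pos_appendD(1)[of v "take 2 (drop L u) @ r"] u Cons.prems(2) by (simp only: flip: u)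
    have r: "\<mu> r > 0" using pos_appendD(2)[of "v @ take 2 (drop L u)" r] u Cons.prems(2) by (simp only: append.assoc flip: u)
    have vw: "v \<in> words q L" using pos_words[OF v] True by (simp add: v_def min_absorb2)
    have IH: "Avg k (\<lambda>dw. sup_density (sups (zip sw dw)) r) = 1" by (rule Cons.IH[OF l(2) r])
    have *: "\<mu> w * Avg k (\<lambda>dw. sup_density (sups (zip (s # sw) ((w, b) # dw))) u) = (if w = v then 1 else 0)"
      if w: "w \<in> words q L" for w b
    proof (cases "\<mu> w > 0")
      case mw: True
      then have "valid w" using w by (simp add: valid_def)
      then have "sup_density (sups (zip (s # sw) ((w, b) # dw))) u
          = (if w = v then 1 / \<mu> w else 0) * sup_density (sups (zip sw dw)) r" for dw
        using True by (auto simp: sups_def v_def r_def)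
      then show ?thesis using mw by (cases "w = v") (auto simp: Avg_divide IH)
    next
      case False
      then have "\<mu> w = 0" using nonneg[of w] by simp
      then show ?thesis using v by auto
    qed
    have "Avg l (\<lambda>dw. sup_density (sups (zip (s # sw) dw)) u)
        = (\<Sum>w\<in>words q L. (\<mu> w * Avg k (\<lambda>dw. sup_density (sups (zip (s # sw) ((w, True) # dw))) u)
          + \<mu> w * Avg k (\<lambda>dw. sup_density (sups (zip (s # sw) ((w, False) # dw))) u)) / 2)"
      by (simp add: l E1_def distrib_left add_divide_distrib)
    also have "\<dots> = (\<Sum>w\<in>words q L. if w = v then 1 else 0)"
      using * by (intro sum.cong refl) simp
    also have "\<dots> = 1" using vw by simp
    finally show ?thesis .
  qed
qed

text \<open>Unlike the sum over letters, the average over labels factorises at every single cutter,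
  since labels are independent from site to site.\<close>

lemma pre_density_average:
  assumes g: "\<And>sw u. length sw = length u \<Longrightarrow> thick sw \<Longrightarrow> \<mu> u > 0 \<Longrightarrow>
      Avg (length sw) (\<lambda>dw. g (zip (zip sw dw) u)) = 1"
    and gNil: "g [] = 1"
    and "length sw = length u" "thick sw" "\<mu> u > 0"
  shows "Avg (length sw) (\<lambda>dw. pre_density g n (zip (zip sw dw) u)) = 1"
  using assms(3-)
proof (induction "length sw" arbitrary: sw u rule: less_induct)
  case less
  show ?case
  proof (cases "\<exists>c\<in>set sw. cutge n c")
    case False
    have "pre_density g n (zip (zip sw dw) u) = g (zip (zip sw dw) u)" for dw
      using False by (intro pre_density_none_zip) (metis prod.collapse set_zip_leftD)
    then show ?thesis using g less.prems by simp
  next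
    case True
    then obtain a c r where sw: "sw = a @ c # r" "cutge n c" and a: "\<And>x. x \<in> set a \<Longrightarrow> \<not> cutge n x"
      using split_list_first_prop[of sw "cutge n"] by blast
    have ta: "thick a" and tr: "thick r"
      using less.prems thick_appendD[of a "c # r"] thick_appendD[of "[c]" r] by (auto simp: sw)
    define ua x ur where "ua = take (length a) u" and "x = u ! length a" and "ur = drop (Suc (length a)) u"
    have u: "u = ua @ x # ur" and lu: "length ua = length a" "length ur = length r"
      using less.prems by (auto simp: ua_def x_def ur_def sw id_take_nth_drop)
    have pu: "\<mu> ua > 0" "\<mu> ur > 0"
      using pos_appendD[of ua "x # ur"] pos_appendD(2)[of "[x]" ur] less.prems by (auto simp: u)
    have *: "pre_density g n (zip (zip sw (da @ d # dr)) u)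
        = g (zip (zip a da) ua) * pre_density g n (zip (zip r dr) ur)" if "length da = length a" for da d dr
    proof -
      have "pre_density g n (zip (zip a da) ua) = g (zip (zip a da) ua)"
        using a by (intro pre_density_none_zip) (metis prod.collapse set_zip_leftD)
      then show ?thesis using that sw(2) by (simp add: sw(1) u lu pre_density_append)
    qed
    have "Avg (length sw) (\<lambda>dw. pre_density g n (zip (zip sw dw) u))
        = Avg (length a) (\<lambda>da. E1 (\<lambda>d. Avg (length r) (\<lambda>dr. pre_density g n (zip (zip sw (da @ d # dr)) u))))"
      using Avg_append[of "length a" "Suc (length r)"] by (simp add: sw(1))
    also have "\<dots> = Avg (length a) (\<lambda>da. Avg (length r) (\<lambda>dr. pre_density g n (zip (zip r dr) ur)) * g (zip (zip a da) ua))"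
      by (intro Avg_cong) (simp add: * Avg_cmult mult.commute)
    also have "Avg (length r) (\<lambda>dr. pre_density g n (zip (zip r dr) ur)) = 1"
      by (rule less.hyps) (use tr pu lu in \<open>simp_all add: sw(1)\<close>)
    also have "Avg (length a) (\<lambda>da. 1 * g (zip (zip a da) ua)) = 1"
      using g[OF lu(1)[symmetric] ta pu(1)] by simp
    finally show ?thesis .
  qed
qed

lemma orient_average:
  assumes H: "\<And>sw u. length sw = length u \<Longrightarrow> thick sw \<Longrightarrow> \<mu> u > 0 \<Longrightarrow>
      Avg (length sw) (\<lambda>dw. H (zip (zip sw dw) u)) = 1"
    and sw: "length sw = length u" "thick sw" "\<mu> u > 0"
  shows "Avg (length sw) (\<lambda>dw. H (orient (zip (zip sw dw) u))) = 1"
proof (cases "pick sw = sw")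
  case True
  have "Avg (length sw) (\<lambda>dw. H (orient (zip (zip sw dw) u))) = Avg (length sw) (\<lambda>dw. H (zip (zip sw dw) u))"
    using True sw by (intro Avg_cong) (simp add: orient_def str_zip)
  then show ?thesis using H sw by simp
next
  case False
  have "Avg (length sw) (\<lambda>dw. H (orient (zip (zip sw dw) u)))
      = Avg (length sw) (\<lambda>dw. H (zip (zip (List.rev sw) (List.rev dw)) (List.rev u)))"
    using False sw by (intro Avg_cong) (simp add: orient_def str_zip zip_rev)
  also have "\<dots> = Avg (length (List.rev sw)) (\<lambda>dw. H (zip (zip (List.rev sw) dw) (List.rev u)))"
    using Avg_rev[of "length sw" "\<lambda>dw. H (zip (zip (List.rev sw) dw) (List.rev u))"] by simp
  also have "\<dots> = 1" using sw by (intro H) (auto simp: thick_rev rev)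
  finally show ?thesis .
qed

text \<open>The other marginal of the plan: summed over the bits it returns \<mu> times the earlier
  density, whereas \<open>slice_density_norm\<close> sums over words and returns the uniform law of
  the bits.\<close>

lemma slice_density_average:
  assumes g: "Avg (length sw) (\<lambda>dw. g (zip (zip sw dw) u)) = 1"
    and nn: "\<And>z. g z \<ge> 0"
    and norm: "\<And>dw. length dw = length sw \<Longrightarrow> (\<Sum>v\<in>words q (length sw). \<mu> v * g (zip (zip sw dw) v)) = 1"
    and eqv: "\<And>z z'. list_all2 (letter_eqv n) z z' \<Longrightarrow> g z = g z'"
    and sw: "length sw = length u" "\<mu> u > 0"
  shows "Avg (length sw) (\<lambda>dw. slice_density (Suc n) g (zip (zip sw dw) u)) = 1"
proof -
  let ?B = "nbits (Suc n) sw"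
  have "Avg (length sw) (\<lambda>dw. slice_density (Suc n) g (zip (zip sw dw) u))
      = Avg (length sw) (\<lambda>dw. (\<Sum>bs\<in>bit_words ?B. slice_density (Suc n) g (zip (zip sw (set_bits (Suc n) sw dw bs)) u)) / 2 ^ ?B)"
    by (rule Avg_set_bits) simp
  also have "\<dots> = Avg (length sw) (\<lambda>dw. g (zip (zip sw dw) u))"
  proof (rule Avg_cong)
    fix dw :: "data list" assume dw: "length dw = length sw"
    let ?\<nu> = "\<lambda>v. \<mu> v * g (zip (zip sw dw) v)"
    have p: "transport_plan ?B (words q (length sw)) ?\<nu> (plan ?B (length sw) ?\<nu>)"
      using plan_pre[where aw="zip sw dw" and g=g and B="?B"] norm[OF dw] nn dw by simp
    have *: "slice_density (Suc n) g (zip (zip sw (set_bits (Suc n) sw dw bs)) u)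
        = 2 ^ ?B * plan ?B (length sw) ?\<nu> bs u / \<mu> u" if "bs \<in> bit_words ?B" for bs
    proof -
      have "g (zip (zip sw (set_bits (Suc n) sw dw bs)) v) = g (zip (zip sw dw) v)" for v
        using dw by (intro eqv[symmetric] list_all2_letter_eqv_zip list_all2_set_bits) simp
      then show ?thesis
        using that dw sw bits_of_set_bits[of sw dw bs "Suc n"]
        by (simp add: slice_density_def Let_def bit_words_def)
    qed
    have "(\<Sum>bs\<in>bit_words ?B. slice_density (Suc n) g (zip (zip sw (set_bits (Suc n) sw dw bs)) u)) / 2 ^ ?B
        = (\<Sum>bs\<in>bit_words ?B. plan ?B (length sw) ?\<nu> bs u) / \<mu> u"
      by (simp add: * sum_divide_distrib)
    also have "\<dots> = ?\<nu> u / \<mu> u"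
      using p pos_words[OF sw(2)] sw(1) by (simp add: transport_plan_def)
    finally show "(\<Sum>bs\<in>bit_words ?B. slice_density (Suc n) g (zip (zip sw (set_bits (Suc n) sw dw bs)) u)) / 2 ^ ?B
        = g (zip (zip sw dw) u)" using sw by simp
  qed
  finally show ?thesis using g by simp
qed

text \<open>This gives the coupled word the right law: averaged over the labels, its conditional
  weights are those of \<mu>.\<close>

lemma dens_average:
  "length sw = length u \<Longrightarrow> thick sw \<Longrightarrow> \<mu> u > 0 \<Longrightarrow> Avg (length sw) (\<lambda>dw. dens n (zip (zip sw dw) u)) = 1"
proof (induction n arbitrary: sw u)
  case 0
  show ?case
  proof (cases "pal sw")
    case True
    then have "Avg (length sw) (\<lambda>dw. dens 0 (zip (zip sw dw) u)) = Avg (length sw) (\<lambda>dw. 1)"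
      using 0 by (intro Avg_cong) (simp add: str_zip)
    then show ?thesis by simp
  next
    case False
    have *: "Avg (length sw) (\<lambda>dw. sup_density (sups (map fst (zip (zip sw dw) u))) (map snd (zip (zip sw dw) u))) = 1"
      if "length sw = length u" "\<mu> u > 0" for sw u
    proof -
      have "Avg (length sw) (\<lambda>dw. sup_density (sups (map fst (zip (zip sw dw) u))) (map snd (zip (zip sw dw) u)))
        = Avg (length sw) (\<lambda>dw. sup_density (sups (zip sw dw)) u)"
        using that by (intro Avg_cong) simp
      then show ?thesis using sup_density_average that by simp
    qed
    have "Avg (length sw) (\<lambda>dw. dens 0 (zip (zip sw dw) u))
        = Avg (length sw) (\<lambda>dw. (\<lambda>z. sup_density (sups (map fst z)) (map snd z)) (orient (zip (zip sw dw) u)))"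
      using False 0 by (intro Avg_cong) (simp add: str_zip)
    then show ?thesis using orient_average[where H="\<lambda>z. sup_density (sups (map fst z)) (map snd z)"] * 0 by simp
  qed
next
  case (Suc n)
  have pre: "Avg (length sw) (\<lambda>dw. pre n (zip (zip sw dw) u)) = 1"
    if "length sw = length u" "thick sw" "\<mu> u > 0" for sw u
    using Suc.IH that by (intro pre_density_average) auto
  show ?case
  proof (cases "pal sw")
    case True
    then have "Avg (length sw) (\<lambda>dw. dens (Suc n) (zip (zip sw dw) u)) = Avg (length sw) (\<lambda>dw. pre n (zip (zip sw dw) u))"
      using Suc.prems by (intro Avg_cong) (simp add: str_zip)
    then show ?thesis using pre Suc.prems by simp
  next
    case False
    have "Avg (length sw) (\<lambda>dw. dens (Suc n) (zip (zip sw dw) u))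
      = Avg (length sw) (\<lambda>dw. slice_density (Suc n) (pre n) (orient (zip (zip sw dw) u)))"
      using False Suc.prems by (intro Avg_cong) (simp add: str_zip)
    also have "\<dots> = 1"
    proof (rule orient_average)
      fix sw and u :: "nat list" assume sw: "length sw = length u" "thick sw" "\<mu> u > 0"
      show "Avg (length sw) (\<lambda>dw. slice_density (Suc n) (pre n) (zip (zip sw dw) u)) = 1"
      proof (rule slice_density_average)
        fix dw :: "data list" assume "length dw = length sw"
        then show "(\<Sum>v\<in>words q (length sw). \<mu> v * pre n (zip (zip sw dw) v)) = 1"
          using pre_norm[of "zip sw dw" n] sw by simp
      qed (use sw pre pre_nonneg pre_eqv in auto)
    qed (use Suc.prems in auto)
    finally show ?thesis .
  qed
qed

end

section \<open>Cells of a field on the integers\<close>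

lemma suffix_decomp: "\<exists>l1 l2. l = l1 @ l2 \<and> (\<forall>x\<in>set l2. \<not> P x) \<and> (l1 = [] \<or> P (last l1))"
proof (induction l rule: rev_induct)
  case (snoc x xs)
  show ?case
  proof (cases "P x")
    case True
    then show ?thesis by (intro exI[of _ "xs @ [x]"] exI[of _ "[]"]) auto
  next
    case False
    from snoc obtain l1 l2 where "xs = l1 @ l2" "\<forall>x\<in>set l2. \<not> P x" "l1 = [] \<or> P (last l1)" by blast
    then show ?thesis using False by (intro exI[of _ l1] exI[of _ "l2 @ [x]"]) auto
  qed
qed simp

lemma prefix_decomp: "\<exists>r1 r2. r = r1 @ r2 \<and> (\<forall>x\<in>set r1. \<not> P x) \<and> (r2 = [] \<or> P (hd r2))"
proof -
  obtain l1 l2 where "rev r = l1 @ l2" "\<forall>x\<in>set l2. \<not> P x" "l1 = [] \<or> P (last l1)"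
    using suffix_decomp[of "rev r" P] by blast
  then have "r = rev l2 @ rev l1" "\<forall>x\<in>set (rev l2). \<not> P x" "rev l1 = [] \<or> P (hd (rev l1))"
    by (metis rev_append rev_rev_ident, simp, simp add: hd_rev)
  then show ?thesis by blast
qed

definition wd :: "(int \<Rightarrow> 'a) \<Rightarrow> int \<Rightarrow> nat \<Rightarrow> 'a list" where
  "wd y a n = map (\<lambda>i. y (a + int i)) [0..<n]"

lemma length_wd [simp]: "length (wd y a n) = n"
  by (simp add: wd_def)

lemma wd_nth [simp]: "i < n \<Longrightarrow> wd y a n ! i = y (a + int i)"
  by (simp add: wd_def)

lemma wd_append: "wd y a (m + n) = wd y a m @ wd y (a + int m) n"
  by (rule nth_equalityI) (auto simp: nth_append algebra_simps of_nat_diff)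

lemma take_drop_wd: "i + k \<le> n \<Longrightarrow> take k (drop i (wd y a n)) = wd y (a + int i) k"
  by (rule nth_equalityI) (auto simp: algebra_simps)

lemma wd_cong: "(\<And>v. a \<le> v \<Longrightarrow> v < a + int n \<Longrightarrow> y v = y' v) \<Longrightarrow> wd y a n = wd y' a n"
  by (simp add: wd_def)

lemma wd_shift: "wd (y \<circ> (\<lambda>i. s + i)) a n = wd y (s + a) n"
  by (simp add: wd_def algebra_simps)

lemma wd_reflect: "wd (y \<circ> (\<lambda>i. s - i)) a n = rev (wd y (s - a - int n + 1) n)"
  by (rule nth_equalityI) (auto simp: rev_nth algebra_simps of_nat_diff)

definition cell :: "nat \<Rightarrow> (int \<Rightarrow> site) \<Rightarrow> int \<Rightarrow> nat \<Rightarrow> bool" where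
  "cell n y a N \<longleftrightarrow> N > 0 \<and> (\<forall>v. a \<le> v \<and> v < a + int N \<longrightarrow> \<not> cutge n (fst (y v))) \<and>
     cutge n (fst (y (a - 1))) \<and> cutge n (fst (y (a + int N)))"

text \<open>Cutters of a higher level are cutters of all lower levels, so a small cell cannot reach
  across a wall of a large one.\<close>

lemma cell_nest:
  assumes "n \<le> m" "cell n y a N" "cell m y a' N'" "a \<le> v" "v < a + int N" "a' \<le> v" "v < a' + int N'"
  shows "a' \<le> a" "a + int N \<le> a' + int N'"
proof -
  show "a' \<le> a"
  proof (rule ccontr)
    assume "\<not> a' \<le> a"
    then have "\<not> cutge n (fst (y (a' - 1)))" using assms by (auto simp: cell_def)
    moreover have "cutge n (fst (y (a' - 1)))" using assms by (auto simp: cell_def intro: cutge_mono)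
    ultimately show False by simp
  qed
  show "a + int N \<le> a' + int N'"
  proof (rule ccontr)
    assume "\<not> a + int N \<le> a' + int N'"
    then have "\<not> cutge n (fst (y (a' + int N')))" using assms by (auto simp: cell_def)
    moreover have "cutge n (fst (y (a' + int N')))" using assms by (auto simp: cell_def intro: cutge_mono)
    ultimately show False by simp
  qed
qed

lemma cell_unique:
  assumes "cell n y a N" "cell n y a' N'" "a \<le> v" "v < a + int N" "a' \<le> v" "v < a' + int N'"
  shows "a = a'" "N = N'"
  using cell_nest[of n n y a N a' N' v] cell_nest[of n n y a' N' a N v] assms by auto

lemma cell_cong:
  assumes "\<And>v. a - 1 \<le> v \<Longrightarrow> v \<le> a + int N \<Longrightarrow> y v = y' v"
  shows "cell n y a N \<longleftrightarrow> cell n y' a N"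
proof -
  have "cell n y' a N" if "cell n y a N" "\<And>v. a - 1 \<le> v \<Longrightarrow> v \<le> a + int N \<Longrightarrow> y v = y' v" for y y'
    using that(1) that(2)[of "a - 1"] that(2)[of "a + int N"] that(2) by (auto simp: cell_def)
  from this[of y y'] this[of y' y] assms show ?thesis by auto
qed

lemma cell_shift: "cell n (y \<circ> (\<lambda>i. s + i)) a N \<longleftrightarrow> cell n y (s + a) N"
proof -
  have "(\<forall>v. a \<le> v \<and> v < a + int N \<longrightarrow> \<not> cutge n (fst (y (s + v))))
      \<longleftrightarrow> (\<forall>v. s + a \<le> v \<and> v < s + a + int N \<longrightarrow> \<not> cutge n (fst (y v)))" (is "?A \<longleftrightarrow> ?B")
  proof
    assume ?A
    then show ?B by (metis add.commute add.assoc diff_add_cancel add_le_cancel_left add_less_cancel_left)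
  qed auto
  then show ?thesis by (simp add: cell_def algebra_simps)
qed

lemma cell_reflect: "cell n (y \<circ> (\<lambda>i. s - i)) a N \<longleftrightarrow> cell n y (s - a - int N + 1) N"
proof -
  have "(\<forall>v. a \<le> v \<and> v < a + int N \<longrightarrow> \<not> cutge n (fst (y (s - v))))
      \<longleftrightarrow> (\<forall>v. s - a - int N + 1 \<le> v \<and> v < s - a - int N + 1 + int N \<longrightarrow> \<not> cutge n (fst (y v)))" (is "?A \<longleftrightarrow> ?B")
  proof
    assume A: ?A
    show ?B
    proof (intro allI impI)
      fix v assume "s - a - int N + 1 \<le> v \<and> v < s - a - int N + 1 + int N"
      then show "\<not> cutge n (fst (y v))" using A[rule_format, of "s - v"] by simp
    qed
  next
    assume B: ?B
    show ?A
    proof (intro allI impI)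
      fix v assume "a \<le> v \<and> v < a + int N"
      then show "\<not> cutge n (fst (y (s - v)))" using B[rule_format, of "s - v"] by simp
    qed
  qed
  then show ?thesis by (auto simp: cell_def algebra_simps)
qed

definition thick_field :: "(int \<Rightarrow> site) \<Rightarrow> bool" where
  "thick_field y \<longleftrightarrow> (\<forall>m v. cutge m (fst (y v)) \<longrightarrow> cutge m (fst (y (v - 1))) \<or> cutge m (fst (y (v + 1))))"

lemma thick_wd:
  assumes "thick_field y" shows "thick (map fst (wd y a N))"
  unfolding thick_def
proof (intro allI impI)
  fix m i
  assume i: "i + 2 < length (map fst (wd y a N))" "cutge m (map fst (wd y a N) ! (i + 1))"
  then have "cutge m (fst (y (a + int i + 1)))" by (simp add: algebra_simps)
  then have "cutge m (fst (y (a + int i))) \<or> cutge m (fst (y (a + int i + 2)))"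
    using assms[unfolded thick_field_def, rule_format, of m "a + int i + 1"] by (auto simp: algebra_simps)
  then show "cutge m (map fst (wd y a N) ! i) \<or> cutge m (map fst (wd y a N) ! (i + 2))"
    using i by (simp add: algebra_simps)
qed

section \<open>Consistency of the levels\<close>

context coding begin

lemma segment_pos:
  assumes "pre n z > 0" "w \<in> set (segments (\<lambda>e. cutge n (fst (fst e))) z)"
  shows "dens n w > 0"
proof -
  have "dens n w \<noteq> 0"
  proof
    assume "dens n w = 0"
    then have "0 \<in> set (map (dens n) (segments (\<lambda>e. cutge n (fst (fst e))) z))" using assms(2) by force
    then have "pre n z = 0" unfolding pre_density_def by (simp add: prod_list_zero_iff)
    then show False using assms(1) by simp
  qed
  then show ?thesis using dens_nonneg[of n w] by simp
qed

lemma slice_density_pos: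
  assumes "thick (map fst aw)" "u \<in> words q (length aw)" "slice_density k (pre n) (zip aw u) > 0"
  shows "pre n (zip aw u) > 0"
proof -
  let ?\<nu> = "\<lambda>v. \<mu> v * pre n (zip aw v)" and ?bs = "bits_of k aw"
  have len: "length u = length aw" using assms by (simp add: words_iff)
  have "plan (length ?bs) (length aw) ?\<nu> ?bs u \<noteq> 0"
    using assms(3) len by (auto simp: slice_density_def Let_def)
  then have "plan (length ?bs) (length aw) ?\<nu> ?bs u > 0"
    using plan_nonneg[of "length ?bs" "length aw" ?\<nu> ?bs u] by simp
  then have "?\<nu> u > 0"
    by (intro plan_zero[OF plan_pre[OF pre_norm[OF assms(1)] pre_nonneg] assms(2)]) (auto simp: bit_words_def)
  then show ?thesis using nonneg[of u] by (simp add: zero_less_mult_iff)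
qed

lemma zip_map_fst_snd: "zip (map fst z) (map snd z) = z"
  by (simp add: zip_map_fst_snd)

lemma dens_Suc_pos:
  assumes "thick (str z)" "map snd z \<in> words q (length z)" "dens (Suc n) z > 0"
  shows "pre n z > 0"
proof (cases "pal (str z)")
  case False
  then have s: "slice_density (Suc n) (pre n) (orient z) > 0" using assms(3) by simp
  have "pre n (orient z) > 0"
  proof -
    have "str z = map fst (map fst z)" by (simp add: str_def)
    moreover have "thick (map fst (map fst (orient z)))"
      using assms(1) thick_rev[OF assms(1)] by (auto simp: orient_def str_def rev_map)
    moreover have "map snd (orient z) \<in> words q (length (map fst (orient z)))"
      using assms(2) by (auto simp: orient_def words_iff rev_map[symmetric])
    ultimately show ?thesis
      using slice_density_pos[of "map fst (orient z)" "map snd (orient z)" "Suc n" n] s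
      by (simp only: zip_map_fst_snd)
  qed
  then show ?thesis by (auto simp: orient_def pre_rev split: if_splits)
qed (use assms in simp)

lemma dens_mono:
  assumes "n \<le> m" "\<And>e. e \<in> set (l @ w @ r) \<Longrightarrow> \<not> cutge m (fst (fst e))"
    and "\<And>e. e \<in> set w \<Longrightarrow> \<not> cutge n (fst (fst e))"
    and "l = [] \<or> cutge n (fst (fst (last l)))" "r = [] \<or> cutge n (fst (fst (hd r)))"
    and "thick (str (l @ w @ r))" "map snd (l @ w @ r) \<in> words q (length (l @ w @ r))"
    and "dens m (l @ w @ r) > 0"
  shows "dens n w > 0"
  using assms
proof (induction m arbitrary: l r rule: dec_induct)
  case base
  have "l = []" using base(1)[of "last l"] base(3) by (cases "l = []") auto
  moreover have "r = []" using base(1)[of "hd r"] base(4) by (cases "r = []") auto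
  ultimately show ?case using base by simp
next
  case (step m)
  have pre: "pre m (l @ w @ r) > 0" using step.prems by (intro dens_Suc_pos) auto
  obtain l1 l2 where l: "l = l1 @ l2" "\<forall>x\<in>set l2. \<not> cutge m (fst (fst x))" "l1 = [] \<or> cutge m (fst (fst (last l1)))"
    using suffix_decomp[of l "\<lambda>x. cutge m (fst (fst x))"] by blast
  obtain r1 r2 where r: "r = r1 @ r2" "\<forall>x\<in>set r1. \<not> cutge m (fst (fst x))" "r2 = [] \<or> cutge m (fst (fst (hd r2)))"
    using prefix_decomp[of r "\<lambda>x. cutge m (fst (fst x))"] by blast
  have w: "\<not> cutge m (fst (fst e))" if "e \<in> set w" for e
    using step.prems(2)[OF that] step.hyps(1) by (auto intro: cutge_mono)
  have "l2 @ w @ r1 \<in> set (segments (\<lambda>e. cutge m (fst (fst e))) (l1 @ (l2 @ w @ r1) @ r2))"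
    using l r w by (intro maximal_segment) auto
  then have d: "dens m (l2 @ w @ r1) > 0"
    using segment_pos[OF pre] by (simp add: l r)
  show ?case
  proof (rule step.IH)
    show "l2 = [] \<or> cutge n (fst (fst (last l2)))" using step.prems(3) l(1) by (cases "l2 = []") auto
    show "r1 = [] \<or> cutge n (fst (fst (hd r1)))" using step.prems(4) r(1) by (cases "r1 = []") auto
    have "str (l @ w @ r) = str l1 @ str (l2 @ w @ r1) @ str r2" by (simp add: l r str_def)
    then show "thick (str (l2 @ w @ r1))"
      using step.prems(5) thick_appendD by metis
    show "map snd (l2 @ w @ r1) \<in> words q (length (l2 @ w @ r1))"
      using step.prems(6) by (auto simp: words_iff l r)
  qed (use step.prems l r w d in auto)
qed

definition resolved :: "nat \<Rightarrow> site list \<Rightarrow> nat \<Rightarrow> nat \<Rightarrow> bool" where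
  "resolved n aw i c \<longleftrightarrow> i < length aw \<and>
    (\<forall>u. length u = length aw \<longrightarrow> \<mu> u * dens n (zip aw u) > 0 \<longrightarrow> u ! i = c)"

definition RS :: "nat \<Rightarrow> (int \<Rightarrow> site) \<Rightarrow> int \<Rightarrow> nat \<Rightarrow> bool" where
  "RS n y v c \<longleftrightarrow> (\<exists>a N. cell n y a N \<and> a \<le> v \<and> v < a + int N \<and> resolved n (wd y a N) (nat (v - a)) c)"

lemma resolved_rev:
  assumes "i < length aw"
  shows "resolved n (List.rev aw) (length aw - 1 - i) c \<longleftrightarrow> resolved n aw i c"
proof -
  have *: "resolved n (List.rev aw) (length aw - 1 - i) c" if r: "resolved n aw i c" "i < length aw" for aw i
    unfolding resolved_def
  proof (intro conjI allI impI)
    fix u assume u: "length u = length (List.rev aw)" "\<mu> u * dens n (zip (List.rev aw) u) > 0"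
    have "zip (List.rev aw) u = List.rev (zip aw (List.rev u))" using u zip_rev[of aw "List.rev u"] by simp
    then have "\<mu> (List.rev u) * dens n (zip aw (List.rev u)) > 0" using u by (simp add: dens_rev rev)
    then have "List.rev u ! i = c" using r u by (simp add: resolved_def)
    then show "u ! (length aw - 1 - i) = c" using r u by (simp add: rev_nth)
  qed (use r in auto)
  from *[of aw i] *[of "List.rev aw" "length aw - 1 - i"] assms show ?thesis by auto
qed

lemma dens_ex_pos:
  assumes "thick (map fst aw)"
  shows "\<exists>u\<in>words q (length aw). \<mu> u > 0 \<and> dens n (zip aw u) > 0"
proof (rule ccontr)
  assume "\<not> ?thesis"
  then have "\<mu> u * dens n (zip aw u) = 0" if "u \<in> words q (length aw)" for u
    using that nonneg[of u] dens_nonneg[of n "zip aw u"] by (metis mult_zero_left mult_zero_right order.order_iff_strict)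
  then have "(\<Sum>u\<in>words q (length aw). \<mu> u * dens n (zip aw u)) = 0" by (intro sum.neutral) auto
  then show False using dens_norm[OF assms, of n] by simp
qed

lemma sub_cell_zip:
  assumes "a' \<le> a" "a + int N \<le> a' + int N'" "length u = N'"
  defines "i \<equiv> nat (a - a')"
  shows "zip (wd y a' N') u = zip (wd y a' i) (take i u) @ zip (wd y a N) (take N (drop i u))
     @ zip (wd y (a + int N) (N' - i - N)) (drop (i + N) u)"
proof -
  have N': "N' = i + (N + (N' - i - N))" using assms by (auto simp: i_def)
  have u: "u = take i u @ take N (drop i u) @ drop (i + N) u"
    by (metis append_take_drop_id drop_drop add.commute)
  have "wd y a' N' = wd y a' i @ wd y a N @ wd y (a + int N) (N' - i - N)"
    by (subst N', subst wd_append, subst wd_append) (use assms in \<open>simp add: i_def\<close>)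
  then show ?thesis using assms N' by (subst u) simp
qed

lemma sub_word_pos: "\<mu> u > 0 \<Longrightarrow> \<mu> (take N (drop i u)) > 0"
  by (metis append_take_drop_id pos_appendD)

lemma sub_cell:
  assumes y: "thick_field y" and nm: "n \<le> m" and c: "cell n y a N" "a \<le> v" "v < a + int N"
    and c': "cell m y a' N'" "a' \<le> v" "v < a' + int N'"
    and u: "u \<in> words q N'" "dens m (zip (wd y a' N') u) > 0"
  shows "dens n (zip (wd y a N) (take N (drop (nat (a - a')) u))) > 0"
proof -
  note nest = cell_nest[OF nm c(1) c'(1) c(2,3) c'(2,3)]
  have lu: "length u = N'" using u by (simp add: words_iff)
  define i where "i = nat (a - a')"
  note z = sub_cell_zip[OF nest lu, of y, folded i_def]
  let ?l = "zip (wd y a' i) (take i u)" and ?w = "zip (wd y a N) (take N (drop i u))"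
    and ?r = "zip (wd y (a + int N) (N' - i - N)) (drop (i + N) u)"
  have "dens n ?w > 0"
  proof (rule dens_mono[OF nm])
    have *: "\<exists>v. a' \<le> v \<and> v < a' + int N' \<and> fst e = y v" if "e \<in> set (zip (wd y a' N') u)" for e
    proof -
      have "fst e \<in> set (wd y a' N')" using that by (metis prod.collapse set_zip_leftD)
      then obtain j where "j < N'" "fst e = y (a' + int j)" by (auto simp: wd_def)
      then show ?thesis by (intro exI[of _ "a' + int j"]) auto
    qed
    show "\<not> cutge m (fst (fst e))" if "e \<in> set (?l @ ?w @ ?r)" for e
      using *[of e] that c'(1) unfolding z[symmetric] cell_def by metis
    show "\<not> cutge n (fst (fst e))" if "e \<in> set ?w" for e
    proof -
      have "fst e \<in> set (wd y a N)" using that by (metis prod.collapse set_zip_leftD)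
      then show ?thesis using c(1) by (auto simp: wd_def cell_def)
    qed
    show "?l = [] \<or> cutge n (fst (fst (last ?l)))"
    proof (cases "i = 0")
      case False
      have int_i: "int i = a - a'" using nest by (simp add: i_def)
      have li: "length ?l = i" using nest lu int_i by (simp add: min_def)
      then have "last ?l = ?l ! (i - 1)" using False by (metis last_conv_nth length_0_conv)
      moreover have "i - 1 < length ?l" using li False by simp
      ultimately have "fst (last ?l) = y (a' + int (i - 1))" using False by simp
      also have "a' + int (i - 1) = a - 1" using False int_i by (simp add: of_nat_diff)
      finally have "fst (last ?l) = y (a - 1)" .
      then show ?thesis using c(1) by (simp add: cell_def)
    qed (simp add: wd_def)
    show "?r = [] \<or> cutge n (fst (fst (hd ?r)))"
    proof (cases "?r = []")
      case False
      then have "N' - i - N > 0" "i + N < N'" by (auto simp: wd_def)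
      then have "fst (hd ?r) = y (a + int N)" using False lu by (simp add: hd_conv_nth)
      then show ?thesis using c(1) by (simp add: cell_def)
    qed simp
    show "thick (str (?l @ ?w @ ?r))"
      unfolding z[symmetric] using thick_wd[OF y, of a' N'] lu by (simp add: str_zip)
    show "map snd (?l @ ?w @ ?r) \<in> words q (length (?l @ ?w @ ?r))"
      unfolding z[symmetric] using u lu by simp
    show "dens m (?l @ ?w @ ?r) > 0" unfolding z[symmetric] by fact
  qed
  then show ?thesis by (simp add: i_def)
qed

lemma sub_cell_pre:
  assumes y: "thick_field y" and c: "cell n y a N" "a \<le> v" "v < a + int N"
    and c': "cell (Suc n) y a' N'" "a' \<le> v" "v < a' + int N'"
    and u: "u \<in> words q N'" "pre n (zip (wd y a' N') u) > 0"
  shows "dens n (zip (wd y a N) (take N (drop (nat (a - a')) u))) > 0"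
proof -
  note nest = cell_nest[OF le_SucI[OF order_refl] c(1) c'(1) c(2,3) c'(2,3)]
  have lu: "length u = N'" using u by (simp add: words_iff)
  define i where "i = nat (a - a')"
  note z = sub_cell_zip[OF nest lu, of y, folded i_def]
  let ?l = "zip (wd y a' i) (take i u)" and ?w = "zip (wd y a N) (take N (drop i u))"
    and ?r = "zip (wd y (a + int N) (N' - i - N)) (drop (i + N) u)"
  have "?w \<in> set (segments (\<lambda>e. cutge n (fst (fst e))) (?l @ ?w @ ?r))"
  proof (rule maximal_segment)
    show "\<not> cutge n (fst (fst e))" if "e \<in> set ?w" for e
    proof -
      have "fst e \<in> set (wd y a N)" using that by (metis prod.collapse set_zip_leftD)
      then show ?thesis using c(1) by (auto simp: wd_def cell_def)
    qed
    show "?l = [] \<or> cutge n (fst (fst (last ?l)))"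
    proof (cases "i = 0")
      case False
      have int_i: "int i = a - a'" using nest by (simp add: i_def)
      have li: "length ?l = i" using nest lu int_i by (simp add: min_def)
      then have "last ?l = ?l ! (i - 1)" using False by (metis last_conv_nth length_0_conv)
      moreover have "i - 1 < length ?l" using li False by simp
      ultimately have "fst (last ?l) = y (a' + int (i - 1))" using False by simp
      also have "a' + int (i - 1) = a - 1" using False int_i by (simp add: of_nat_diff)
      finally have "fst (last ?l) = y (a - 1)" .
      then show ?thesis using c(1) by (simp add: cell_def)
    qed (simp add: wd_def)
    show "?r = [] \<or> cutge n (fst (fst (hd ?r)))"
    proof (cases "?r = []")
      case False
      then have "N' - i - N > 0" "i + N < N'" by (auto simp: wd_def)
      then have "fst (hd ?r) = y (a + int N)" using False lu by (simp add: hd_conv_nth)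
      then show ?thesis using c(1) by (simp add: cell_def)
    qed simp
  qed
  then have "?w \<in> set (segments (\<lambda>e. cutge n (fst (fst e))) (zip (wd y a' N') u))"
    by (simp only: z)
  then show ?thesis using segment_pos[OF u(2)] by (simp add: i_def)
qed

lemma RS_unique_le:
  assumes y: "thick_field y" and nm: "n \<le> m" and "RS n y v c" "RS m y v c'"
  shows "c = c'"
proof -
  obtain a N where c: "cell n y a N" "a \<le> v" "v < a + int N" and r: "resolved n (wd y a N) (nat (v - a)) c"
    using assms by (auto simp: RS_def)
  obtain a' N' where c': "cell m y a' N'" "a' \<le> v" "v < a' + int N'" and r': "resolved m (wd y a' N') (nat (v - a')) c'"
    using assms by (auto simp: RS_def)
  note nest = cell_nest[OF nm c(1) c'(1) c(2,3) c'(2,3)]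
  obtain u where u: "u \<in> words q N'" "\<mu> u > 0" "dens m (zip (wd y a' N') u) > 0"
    using dens_ex_pos[OF thick_wd[OF y, of a' N']] by auto
  have lu: "length u = N'" using u by (simp add: words_iff)
  let ?w = "take N (drop (nat (a - a')) u)"
  have "\<mu> ?w * dens n (zip (wd y a N) ?w) > 0"
    using sub_cell[OF y nm c c' u(1,3)] sub_word_pos[OF u(2)] by simp
  moreover have "length ?w = N" using nest lu c c' by auto
  ultimately have "?w ! nat (v - a) = c" using r by (simp add: resolved_def)
  moreover have "?w ! nat (v - a) = u ! (nat (a - a') + nat (v - a))" using c nest lu by simp
  moreover have "nat (a - a') + nat (v - a) = nat (v - a')" using c nest by simp
  moreover have "u ! nat (v - a') = c'" using r' u lu by (simp add: resolved_def)
  ultimately show ?thesis by simp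
qed

lemma RS_unique:
  assumes "thick_field y" "RS n y v c" "RS m y v c'"
  shows "c = c'"
  using RS_unique_le[OF assms(1) _ assms(2,3)] RS_unique_le[OF assms(1) _ assms(3,2)]
  by (cases "n \<le> m") auto

lemma RS_letter:
  assumes y: "thick_field y" and "RS n y v c" shows "c \<in> {1..q}"
proof -
  obtain a N where c: "cell n y a N" "a \<le> v" "v < a + int N" and r: "resolved n (wd y a N) (nat (v - a)) c"
    using assms by (auto simp: RS_def)
  obtain u where u: "u \<in> words q N" "\<mu> u > 0" "dens n (zip (wd y a N) u) > 0"
    using dens_ex_pos[OF thick_wd[OF y, of a N]] by auto
  then have "u ! nat (v - a) = c" "nat (v - a) < length u" using r by (auto simp: resolved_def words_iff)
  then show ?thesis using u(1) nth_mem by (fastforce simp: words_iff)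
qed

lemma RS_shift: "RS n (y \<circ> (\<lambda>i. s + i)) v c \<longleftrightarrow> RS n y (s + v) c"
proof -
  have 1: "RS n y (s + v) c" if "RS n (y \<circ> (\<lambda>i. s + i)) v c" for y s v
    using that unfolding RS_def cell_shift wd_shift by (elim exE, intro exI[of _ "s + _"] exI) auto
  have "(y \<circ> (\<lambda>i. s + i)) \<circ> (\<lambda>i. - s + i) = y" by (auto simp: comp_def)
  then show ?thesis using 1[of y s v] 1[of "y \<circ> (\<lambda>i. s + i)" "- s" "s + v"] by auto
qed

lemma RS_reflect: "RS n (y \<circ> (\<lambda>i. s - i)) v c \<longleftrightarrow> RS n y (s - v) c"
proof -
  have 1: "RS n y (s - v) c" if R: "RS n (y \<circ> (\<lambda>i. s - i)) v c" for y s v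
  proof -
    obtain a N where h: "cell n (y \<circ> (\<lambda>i. s - i)) a N" "a \<le> v" "v < a + int N"
      "resolved n (wd (y \<circ> (\<lambda>i. s - i)) a N) (nat (v - a)) c"
      using R by (auto simp: RS_def)
    note * = h[unfolded cell_reflect wd_reflect]
    have "nat (v - a) = N - 1 - nat (s - v - (s - a - int N + 1))" using * by auto
    then have "resolved n (wd y (s - a - int N + 1) N) (nat (s - v - (s - a - int N + 1))) c"
      using *(4) resolved_rev[of "nat (s - v - (s - a - int N + 1))" "wd y (s - a - int N + 1) N" n c] *(2,3) by auto
    then show ?thesis unfolding RS_def using * by (intro exI[of _ "s - a - int N + 1"] exI[of _ N]) auto
  qed
  have "(y \<circ> (\<lambda>i. s - i)) \<circ> (\<lambda>i. s - i) = y" by (auto simp: comp_def)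
  then show ?thesis using 1[of y s v] 1[of "y \<circ> (\<lambda>i. s - i)" s "s - v"] by auto
qed

end

section \<open>Bit words that leave letters open\<close>

context coding begin

definition pre_resolved :: "nat \<Rightarrow> site list \<Rightarrow> nat \<Rightarrow> nat \<Rightarrow> bool" where
  "pre_resolved n aw i c \<longleftrightarrow>
    (\<forall>u. length u = length aw \<longrightarrow> \<mu> u * pre n (zip aw u) > 0 \<longrightarrow> u ! i = c)"

definition pre_unresolved :: "nat \<Rightarrow> site list \<Rightarrow> nat set" where
  "pre_unresolved n aw = {i. i < length aw \<and> \<not> (\<exists>c. pre_resolved n aw i c)}"

lemma card_support_le:
  "card {u\<in>words q (length aw). \<mu> u * pre n (zip aw u) > 0} \<le> q ^ card (pre_unresolved n aw)"
proof -
  let ?I = "pre_unresolved n aw" and ?S = "{u\<in>words q (length aw). \<mu> u * pre n (zip aw u) > 0}"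
  have fin: "finite ?I" by (rule finite_subset[of _ "{..<length aw}"]) (auto simp: pre_unresolved_def)
  have "inj_on (\<lambda>u. \<lambda>i\<in>?I. u ! i) ?S"
  proof (rule inj_onI)
    fix u v assume u: "u \<in> ?S" and v: "v \<in> ?S" and eq: "(\<lambda>i\<in>?I. u ! i) = (\<lambda>i\<in>?I. v ! i)"
    show "u = v"
    proof (rule nth_equalityI)
      show "length u = length v" using u v by (simp add: words_iff)
      fix i assume "i < length u"
      then have i: "i < length aw" using u by (simp add: words_iff)
      show "u ! i = v ! i"
      proof (cases "i \<in> ?I")
        case True
        then show ?thesis using fun_cong[OF eq, of i] by simp
      next
        case False
        then obtain c where "pre_resolved n aw i c" using i by (auto simp: pre_unresolved_def)
        then show ?thesis using u v by (simp add: pre_resolved_def words_iff)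
      qed
    qed
  qed
  moreover have "(\<lambda>u. \<lambda>i\<in>?I. u ! i) ` ?S \<subseteq> ?I \<rightarrow>\<^sub>E {1..q}"
  proof
    fix f assume "f \<in> (\<lambda>u. \<lambda>i\<in>?I. u ! i) ` ?S"
    then obtain u where u: "u \<in> words q (length aw)" and f: "f = (\<lambda>i\<in>?I. u ! i)" by auto
    have "u ! i \<in> {1..q}" if "i \<in> ?I" for i
      using that u nth_mem[of i u] by (auto simp: pre_unresolved_def words_iff simp del: nth_mem)
    then show "f \<in> ?I \<rightarrow>\<^sub>E {1..q}" by (simp add: f)
  qed
  ultimately have "card ?S \<le> card (?I \<rightarrow>\<^sub>E {1..q})"
    using fin by (intro card_inj_on_le) (auto intro!: finite_PiE)
  then show ?thesis using fin by (simp add: card_PiE)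
qed

lemma pre_resolved_rev_support:
  "card {u\<in>words q (length aw). \<mu> u * pre n (zip (List.rev aw) u) > 0} =
   card {u\<in>words q (length aw). \<mu> u * pre n (zip aw u) > 0}"
proof (rule bij_betw_same_card[of List.rev], rule bij_betw_byWitness[where f'=List.rev])
  have *: "pre n (zip (List.rev aw) (List.rev u)) = pre n (zip aw u)" if "length u = length aw" for aw u
    using that by (simp add: zip_rev pre_rev)
  show "List.rev ` {u \<in> words q (length aw). 0 < \<mu> u * pre n (zip (List.rev aw) u)} \<subseteq> {u \<in> words q (length aw). 0 < \<mu> u * pre n (zip aw u)}"
    using *[of _ "List.rev aw"] by (auto simp: words_iff rev)
  show "List.rev ` {u \<in> words q (length aw). 0 < \<mu> u * pre n (zip aw u)} \<subseteq> {u \<in> words q (length aw). 0 < \<mu> u * pre n (zip (List.rev aw) u)}"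
    using *[of _ "aw"] by (auto simp: words_iff rev)
qed auto

lemma bits_of_rev: "bits_of n (List.rev aw) = List.rev (bits_of n aw)"
  by (simp add: bits_of_def rev_filter rev_map)

text \<open>A bit word for which the plan leaves one word resolves the whole cell. An unresolved
  position can therefore be charged to the bit words counted in \<open>transport_plan\<close>;
  \<open>o'\<close> stands for the labels after orientation.\<close>

lemma impure_bits:
  fixes aw :: "site list" and n :: nat
  defines "o' \<equiv> (if pick (map fst aw) = map fst aw then aw else List.rev aw)"
  defines "\<nu> \<equiv> (\<lambda>v. \<mu> v * pre n (zip o' v))"
  assumes np: "\<not> pal (map fst aw)" and i: "i < length aw" and un: "\<nexists>c. resolved (Suc n) aw i c"
    and B: "length (bits_of (Suc n) aw) = B"
  shows "\<not> (\<exists>u. \<forall>v\<in>words q (length aw). plan B (length aw) \<nu> (bits_of (Suc n) o') v > 0 \<longrightarrow> v = u)"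
proof
  assume "\<exists>u. \<forall>v\<in>words q (length aw). plan B (length aw) \<nu> (bits_of (Suc n) o') v > 0 \<longrightarrow> v = u"
  then obtain u0 where u0: "\<And>v. v \<in> words q (length aw) \<Longrightarrow> plan B (length aw) \<nu> (bits_of (Suc n) o') v > 0 \<Longrightarrow> v = u0"
    by blast
  define ow :: "nat list \<Rightarrow> nat list" where "ow u = (if pick (map fst aw) = map fst aw then u else List.rev u)" for u
  have *: "ow u = u0" if u: "length u = length aw" "\<mu> u * dens (Suc n) (zip aw u) > 0" for u
  proof (rule u0)
    have pos: "\<mu> u > 0" "dens (Suc n) (zip aw u) > 0"
      using u(2) nonneg[of u] dens_nonneg[of "Suc n" "zip aw u"] by (auto simp: zero_less_mult_iff)
    have uw: "u \<in> words q (length aw)" using pos_words[OF pos(1)] u(1) by simp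
    then show "ow u \<in> words q (length aw)" by (simp add: ow_def words_iff)
    have "orient (zip aw u) = zip o' (ow u)"
      using u(1) by (simp add: orient_def str_zip o'_def ow_def zip_rev)
    then have "slice_density (Suc n) (pre n) (zip o' (ow u)) > 0"
      using pos(2) np u(1) by (simp add: str_zip)
    moreover have "length (bits_of (Suc n) o') = B" using B by (simp add: o'_def bits_of_rev)
    moreover have "length o' = length aw" "length (ow u) = length aw" using u(1) by (simp_all add: o'_def ow_def)
    ultimately have "plan B (length aw) \<nu> (bits_of (Suc n) o') (ow u) \<noteq> 0"
      by (auto simp: slice_density_def Let_def \<nu>_def)
    then show "plan B (length aw) \<nu> (bits_of (Suc n) o') (ow u) > 0"
      using plan_nonneg[of B "length aw" \<nu> "bits_of (Suc n) o'" "ow u"] by simp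
  qed
  have "u = ow u0" if "length u = length aw" "\<mu> u * dens (Suc n) (zip aw u) > 0" for u
  proof -
    have "ow (ow u) = u" by (simp add: ow_def)
    then show ?thesis using *[OF that] by simp
  qed
  then have "resolved (Suc n) aw i (ow u0 ! i)" using i by (auto simp: resolved_def)
  then show False using un by blast
qed

text \<open>Vary the bits of level \<open>Suc n\<close> and keep all other data. The law \<nu>
  before these bits stays fixed, so the failing bit words are at most as many as the words in its
  support. Orientation only reverses bit words and support, which \<open>f\<close> and
  \<open>pre_resolved_rev_support\<close> take into account.\<close>

lemma card_impure_le:
  assumes dw: "length dw = length sw" and t: "thick sw" and np: "\<not> pal sw" and q: "q \<ge> 1"
  shows "card {bs\<in>bit_words (nbits (Suc n) sw).
      \<exists>i<length sw. \<nexists>c. resolved (Suc n) (zip sw (set_bits (Suc n) sw dw bs)) i c}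
    \<le> q ^ card (pre_unresolved n (zip sw dw))"
proof -
  define B where "B = nbits (Suc n) sw"
  let ?aw = "\<lambda>bs. zip sw (set_bits (Suc n) sw dw bs)"
  define fwd where "fwd \<longleftrightarrow> pick sw = sw"
  define o' where "o' aw = (if fwd then aw else List.rev aw)" for aw :: "site list"
  define \<nu> where "\<nu> v = \<mu> v * pre n (zip (o' (zip sw dw)) v)" for v
  define f where "f bs = (if fwd then bs else List.rev bs)" for bs :: "bool list"
  let ?A = "{bs\<in>bit_words B. \<exists>i<length sw. \<nexists>c. resolved (Suc n) (?aw bs) i c}"
  let ?I = "{bs\<in>bit_words B. \<not> (\<exists>u. \<forall>v\<in>words q (length sw). plan B (length sw) \<nu> bs v > 0 \<longrightarrow> v = u)}"
  have \<nu>: "(\<lambda>v. \<mu> v * pre n (zip (o' (?aw bs)) v)) = \<nu>" for bs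
  proof -
    have "list_all2 (site_eqv n) (o' (?aw bs)) (o' (zip sw dw))"
      using list_all2_set_bits[of sw dw n bs] dw
      by (auto simp: o'_def list_all2_conv_all_nth site_eqv_def rev_nth)
    then show ?thesis unfolding \<nu>_def by (intro ext arg_cong2[of _ _ _ _ "(*)"] refl pre_eqv list_all2_letter_eqv_zip)
  qed
  have "f ` ?A \<subseteq> ?I"
  proof
    fix b assume "b \<in> f ` ?A"
    then obtain bs i where bs: "bs \<in> bit_words B" and i: "i < length sw" "\<nexists>c. resolved (Suc n) (?aw bs) i c" and b: "b = f bs"
      by auto
    have bo: "bits_of (Suc n) (?aw bs) = bs"
      using bs dw by (intro bits_of_set_bits) (auto simp: bit_words_def B_def)
    have "\<not> (\<exists>u. \<forall>v\<in>words q (length (?aw bs)). plan B (length (?aw bs)) \<nu> (bits_of (Suc n) (o' (?aw bs))) v > 0 \<longrightarrow> v = u)"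
      using impure_bits[of "?aw bs" i n B] np i bs bo dw \<nu>[of bs] by (simp add: o'_def fwd_def bit_words_def)
    moreover have "bits_of (Suc n) (o' (?aw bs)) = b" using bo by (simp add: o'_def b f_def bits_of_rev)
    moreover have "b \<in> bit_words B" using bs by (simp add: b f_def bit_words_def)
    ultimately show "b \<in> ?I" using dw by simp
  qed
  moreover have "inj_on f ?A" by (auto simp: inj_on_def f_def)
  ultimately have "card ?A \<le> card ?I" by (intro card_inj_on_le[of f]) auto
  also have "\<dots> \<le> card {u\<in>words q (length sw). \<nu> u > 0}"
  proof -
    have "thick (map fst (o' (zip sw dw)))"
      using t dw thick_rev[OF t] by (simp add: o'_def rev_map[symmetric])
    from plan_pre[where B=B, OF pre_norm[OF this] pre_nonneg]
    have "transport_plan B (words q (length (o' (zip sw dw)))) (\<lambda>v. \<mu> v * pre n (zip (o' (zip sw dw)) v))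
      (plan B (length (o' (zip sw dw))) (\<lambda>v. \<mu> v * pre n (zip (o' (zip sw dw)) v)))" .
    moreover have "(\<lambda>v. \<mu> v * pre n (zip (o' (zip sw dw)) v)) = \<nu>" by (simp add: \<nu>_def fun_eq_iff)
    moreover have "length (o' (zip sw dw)) = length sw" using dw by (simp add: o'_def)
    ultimately have "transport_plan B (words q (length sw)) \<nu> (plan B (length sw) \<nu>)" by simp
    then show ?thesis by (simp only: transport_plan_def)
  qed
  also have "\<dots> = card {u\<in>words q (length (zip sw dw)). \<mu> u * pre n (zip (zip sw dw) u) > 0}"
    using dw pre_resolved_rev_support[of "zip sw dw" n] by (simp add: \<nu>_def o'_def)
  also have "\<dots> \<le> q ^ card (pre_unresolved n (zip sw dw))" by (rule card_support_le)
  finally show ?thesis by (simp add: B_def)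
qed

text \<open>At most \<open>q ^ K\<close> bit words fail, out of equally likely ones. The condition
  on unresolved sites is not affected when the bits of level \<open>Suc n\<close> are drawn
  anew.\<close>

lemma Avg_impure_le:
  assumes t: "thick sw" and np: "\<not> pal sw" and q: "q \<ge> 1"
  shows "Avg (length sw) (\<lambda>dw. of_bool (card (pre_unresolved n (zip sw dw)) \<le> K \<and>
      (\<exists>i<length sw. \<nexists>c. resolved (Suc n) (zip sw dw) i c))) \<le> q ^ K / 2 ^ nbits (Suc n) sw"
proof -
  let ?B = "nbits (Suc n) sw"
  have "Avg (length sw) (\<lambda>dw. of_bool (card (pre_unresolved n (zip sw dw)) \<le> K \<and>
      (\<exists>i<length sw. \<nexists>c. resolved (Suc n) (zip sw dw) i c)))
    = Avg (length sw) (\<lambda>dw. (\<Sum>bs\<in>bit_words ?B. of_bool (card (pre_unresolved n (zip sw (set_bits (Suc n) sw dw bs))) \<le> K \<and>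
      (\<exists>i<length sw. \<nexists>c. resolved (Suc n) (zip sw (set_bits (Suc n) sw dw bs)) i c))) / 2 ^ ?B)"
    by (rule Avg_set_bits) simp
  also have "\<dots> \<le> Avg (length sw) (\<lambda>_. q ^ K / 2 ^ ?B)"
  proof (rule Avg_mono)
    fix dw :: "data list" assume dw: "length dw = length sw"
    have "pre_unresolved n (zip sw (set_bits (Suc n) sw dw bs)) = pre_unresolved n (zip sw dw)" for bs
    proof -
      have "pre n (zip (zip sw (set_bits (Suc n) sw dw bs)) u) = pre n (zip (zip sw dw) u)" for u
        using dw by (intro pre_eqv[symmetric] list_all2_letter_eqv_zip list_all2_set_bits) simp
      then show ?thesis using dw by (simp add: pre_unresolved_def pre_resolved_def)
    qed
    then have "(\<Sum>bs\<in>bit_words ?B. of_bool (card (pre_unresolved n (zip sw (set_bits (Suc n) sw dw bs))) \<le> K \<and>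
      (\<exists>i<length sw. \<nexists>c. resolved (Suc n) (zip sw (set_bits (Suc n) sw dw bs)) i c)))
      = (if card (pre_unresolved n (zip sw dw)) \<le> K then real (card {bs\<in>bit_words ?B.
       \<exists>i<length sw. \<nexists>c. resolved (Suc n) (zip sw (set_bits (Suc n) sw dw bs)) i c}) else 0)"
      by (simp add: of_bool_def sum.If_cases Int_def)
    also have "\<dots> \<le> q ^ K"
    proof (cases "card (pre_unresolved n (zip sw dw)) \<le> K")
      case True
      have "card {bs\<in>bit_words ?B. \<exists>i<length sw. \<nexists>c. resolved (Suc n) (zip sw (set_bits (Suc n) sw dw bs)) i c} \<le> q ^ K"
        using card_impure_le[OF dw t np q, of n] power_increasing[OF True q] by linarith
      then show ?thesis using True by (simp flip: of_nat_power)
    qed simp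
    finally show "(\<Sum>bs\<in>bit_words ?B. of_bool (card (pre_unresolved n (zip sw (set_bits (Suc n) sw dw bs))) \<le> K \<and>
      (\<exists>i<length sw. \<nexists>c. resolved (Suc n) (zip sw (set_bits (Suc n) sw dw bs)) i c))) / 2 ^ ?B \<le> q ^ K / 2 ^ ?B"
      by (intro divide_right_mono) auto
  qed
  finally show ?thesis by simp
qed

end

section \<open>Words of independent letters\<close>

lemma nn_integral_replicate_pmf_add:
  "(\<integral>\<^sup>+l. f l \<partial>replicate_pmf (m + n) p) = (\<integral>\<^sup>+x. \<integral>\<^sup>+y. f (x @ y) \<partial>replicate_pmf n p \<partial>replicate_pmf m p)"
  by (simp add: replicate_pmf_distrib)

lemma nn_integral_replicate_pmf_Suc:
  "(\<integral>\<^sup>+l. f l \<partial>replicate_pmf (Suc n) p) = (\<integral>\<^sup>+x. \<integral>\<^sup>+y. f (x # y) \<partial>replicate_pmf n p \<partial>measure_pmf p)"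
  by simp

lemma nn_integral_replicate_pmf_cong:
  "(\<And>l. length l = n \<Longrightarrow> f l = g l) \<Longrightarrow> (\<integral>\<^sup>+l. f l \<partial>replicate_pmf n p) = (\<integral>\<^sup>+l. g l \<partial>replicate_pmf n p)"
  by (intro nn_integral_cong_AE) (simp add: AE_measure_pmf_iff set_replicate_pmf)

lemma nn_integral_replicate_pmf_mono:
  "(\<And>l. length l = n \<Longrightarrow> f l \<le> g l) \<Longrightarrow> (\<integral>\<^sup>+l. f l \<partial>replicate_pmf n p) \<le> (\<integral>\<^sup>+l. g l \<partial>replicate_pmf n p)"
  by (intro nn_integral_mono_AE) (simp add: AE_measure_pmf_iff set_replicate_pmf)

lemma nn_integral_pmf_swap:
  "(\<integral>\<^sup>+x. \<integral>\<^sup>+y. f x y \<partial>measure_pmf B \<partial>measure_pmf A) = (\<integral>\<^sup>+y. \<integral>\<^sup>+x. f x y \<partial>measure_pmf A \<partial>measure_pmf B)"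
proof -
  have "(\<integral>\<^sup>+x. \<integral>\<^sup>+y. f x y \<partial>measure_pmf B \<partial>measure_pmf A) = (\<integral>\<^sup>+z. f (fst z) (snd z) \<partial>pair_pmf A B)"
    by (simp add: nn_integral_pair_pmf')
  also have "pair_pmf A B = map_pmf (\<lambda>(x, y). (y, x)) (pair_pmf B A)" by (rule pair_commute_pmf)
  finally show ?thesis by (simp add: nn_integral_pair_pmf' case_prod_unfold)
qed

lemma nn_integral_blocks:
  "(\<integral>\<^sup>+l. (\<Prod>j<N. h j (take K (drop (j * K) l))) \<partial>replicate_pmf (N * K) p)
    = (\<Prod>j<N. \<integral>\<^sup>+l. h j l \<partial>replicate_pmf K p)"
proof (induction N arbitrary: h)
  case (Suc N)
  have "(\<integral>\<^sup>+l. (\<Prod>j<Suc N. h j (take K (drop (j * K) l))) \<partial>replicate_pmf (Suc N * K) p)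
      = (\<integral>\<^sup>+x. \<integral>\<^sup>+y. (\<Prod>j<Suc N. h j (take K (drop (j * K) (x @ y)))) \<partial>replicate_pmf (N * K) p \<partial>replicate_pmf K p)"
    by (simp only: mult_Suc nn_integral_replicate_pmf_add)
  also have "\<dots> = (\<integral>\<^sup>+x. h 0 x * (\<Prod>j<N. \<integral>\<^sup>+l. h (Suc j) l \<partial>replicate_pmf K p) \<partial>replicate_pmf K p)"
  proof (rule nn_integral_replicate_pmf_cong)
    fix x :: "'a list" assume x: "length x = K"
    have "(\<Prod>j<Suc N. h j (take K (drop (j * K) (x @ y)))) = h 0 x * (\<Prod>j<N. h (Suc j) (take K (drop (j * K) y)))" for y
      using x by (simp add: prod.lessThan_Suc_shift del: prod.lessThan_Suc)
    then show "(\<integral>\<^sup>+y. (\<Prod>j<Suc N. h j (take K (drop (j * K) (x @ y)))) \<partial>replicate_pmf (N * K) p)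
       = h 0 x * (\<Prod>j<N. \<integral>\<^sup>+l. h (Suc j) l \<partial>replicate_pmf K p)"
      by (simp add: nn_integral_cmult Suc.IH[of "\<lambda>j. h (Suc j)"])
  qed
  also have "\<dots> = (\<Prod>j<Suc N. \<integral>\<^sup>+l. h j l \<partial>replicate_pmf K p)"
    by (simp add: nn_integral_multc prod.lessThan_Suc_shift del: prod.lessThan_Suc)
  finally show ?case .
qed simp

definition wprob :: "nat \<Rightarrow> 'a pmf \<Rightarrow> ('a list \<Rightarrow> bool) \<Rightarrow> real" where
  "wprob n p Q = measure (replicate_pmf n p) {l. Q l}"

lemma wprob_nonneg [simp]: "wprob n p Q \<ge> 0" and wprob_le1 [simp]: "wprob n p Q \<le> 1"
  by (auto simp: wprob_def measure_pmf.prob_le_1)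

lemma wprob_ennreal: "ennreal (wprob n p Q) = (\<integral>\<^sup>+l. indicator {l. Q l} l \<partial>replicate_pmf n p)"
  by (simp add: wprob_def measure_pmf.emeasure_eq_measure)

lemma wprob_add_le:
  assumes "\<And>y. length y = n \<Longrightarrow> wprob m p (\<lambda>x. Q (x @ y)) \<le> c" "c \<ge> 0"
  shows "wprob (m + n) p Q \<le> c"
proof -
  have "ennreal (wprob (m + n) p Q) = (\<integral>\<^sup>+x. \<integral>\<^sup>+y. indicator {l. Q l} (x @ y) \<partial>replicate_pmf n p \<partial>replicate_pmf m p)"
    unfolding wprob_ennreal nn_integral_replicate_pmf_add ..
  also have "\<dots> = (\<integral>\<^sup>+y. \<integral>\<^sup>+x. indicator {l. Q l} (x @ y) \<partial>replicate_pmf m p \<partial>replicate_pmf n p)"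
    by (rule nn_integral_pmf_swap)
  also have "\<dots> = (\<integral>\<^sup>+y. ennreal (wprob m p (\<lambda>x. Q (x @ y))) \<partial>replicate_pmf n p)"
    unfolding wprob_ennreal by (intro nn_integral_cong) (simp only: indicator_def mem_Collect_eq)
  also have "\<dots> \<le> (\<integral>\<^sup>+x. ennreal c \<partial>replicate_pmf n p)"
    using assms by (intro nn_integral_replicate_pmf_mono ennreal_leI) auto
  also have "\<dots> = ennreal c" by simp
  finally show ?thesis using assms(2) by simp
qed

subsection \<open>Large deviations for block codes\<close>

lemma nn_integral_two_valued:
  assumes "a \<ge> 0" "b \<ge> 0"
  shows "(\<integral>\<^sup>+l. ennreal (if Q l then a else b) \<partial>replicate_pmf K p) = ennreal (a * wprob K p Q + b * (1 - wprob K p Q))"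
proof -
  have "(\<integral>\<^sup>+l. ennreal (if Q l then a else b) \<partial>replicate_pmf K p)
      = (\<integral>\<^sup>+l. ennreal a * indicator {l. Q l} l + ennreal b * indicator (- {l. Q l}) l \<partial>replicate_pmf K p)"
    by (intro nn_integral_cong) (auto simp: indicator_def)
  also have "\<dots> = ennreal a * emeasure (replicate_pmf K p) {l. Q l} + ennreal b * emeasure (replicate_pmf K p) (- {l. Q l})"
    by (simp add: nn_integral_add nn_integral_cmult)
  also have "emeasure (replicate_pmf K p) (- {l. Q l}) = ennreal (1 - wprob K p Q)"
    using measure_pmf.prob_compl[of "{l. Q l}" "replicate_pmf K p"]
    by (simp add: measure_pmf.emeasure_eq_measure wprob_def Compl_eq_Diff_UNIV)
  also have "emeasure (replicate_pmf K p) {l. Q l} = ennreal (wprob K p Q)"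
    by (simp add: measure_pmf.emeasure_eq_measure wprob_def)
  finally show ?thesis using assms by (simp add: ennreal_mult[symmetric] ennreal_plus[symmetric] del: ennreal_plus)
qed

lemma card_residue_class:
  fixes K :: nat assumes "K > 0" "r < K"
  shows "{i. i < n \<and> i mod K = r} = (\<lambda>s. r + s * K) ` {..<(n + K - 1 - r) div K}"
proof (intro equalityI subsetI)
  fix i assume i: "i \<in> {i. i < n \<and> i mod K = r}"
  then have "i = r + (i div K) * K" using mod_div_mult_eq[of i K] by simp
  moreover have "i div K < (n + K - 1 - r) div K"
  proof -
    have "r + (i div K) * K < n" using i mod_div_mult_eq[of i K] by auto
    then have "(i div K + 1) * K \<le> n + K - 1 - r" using assms by (simp add: algebra_simps)
    then show ?thesis using assms by (metis Suc_eq_plus1 Suc_le_lessD div_le_mono nonzero_mult_div_cancel_right not_gr0 order.refl)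
  qed
  ultimately show "i \<in> (\<lambda>s. r + s * K) ` {..<(n + K - 1 - r) div K}" by blast
next
  fix i assume "i \<in> (\<lambda>s. r + s * K) ` {..<(n + K - 1 - r) div K}"
  then obtain s where s: "i = r + s * K" "s < (n + K - 1 - r) div K" by auto
  then have "(s + 1) * K \<le> ((n + K - 1 - r) div K) * K" by (intro mult_le_mono1) simp
  also have "\<dots> \<le> n + K - 1 - r" by simp
  finally have "r + s * K < n" using assms by (simp add: algebra_simps)
  then show "i \<in> {i. i < n \<and> i mod K = r}" using s assms by simp
qed

text \<open>Windows of length \<open>K\<close> that start at positions congruent modulo
  \<open>K\<close> are disjoint, hence independent; each contributes the factor
  \<open>1 + (\<theta> - 1) * wprob K p Q\<close>.\<close>

lemma residue_class_mgf:
  assumes K: "K > 0" "r < K" and th: "\<theta> \<ge> 1"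
  shows "(\<integral>\<^sup>+l. ennreal (\<theta> ^ card {i. i < n \<and> i mod K = r \<and> Q (take K (drop i l))}) \<partial>replicate_pmf (n + K) p)
    = ennreal ((1 + (\<theta> - 1) * wprob K p Q) ^ ((n + K - 1 - r) div K))"
proof -
  define N where "N = (n + K - 1 - r) div K"
  have "N * K \<le> n + K - 1 - r" by (simp add: N_def)
  define e where "e = n + K - r - N * K"
  have e: "n + K = r + (N * K + e)"
    using \<open>N * K \<le> n + K - 1 - r\<close> K by (simp add: e_def)
  define h :: "'a list \<Rightarrow> ennreal" where "h l = ennreal (if Q l then \<theta> else 1)" for l
  have card: "ennreal (\<theta> ^ card {i. i < n \<and> i mod K = r \<and> Q (take K (drop i l))})
      = (\<Prod>s<N. h (take K (drop (r + s * K) l)))" for l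
  proof -
    have "{i. i < n \<and> i mod K = r \<and> Q (take K (drop i l))}
       = (\<lambda>s. r + s * K) ` {s\<in>{..<N}. Q (take K (drop (r + s * K) l))}"
    proof -
      have "{i. i < n \<and> i mod K = r \<and> Q (take K (drop i l))} = {i \<in> {i. i < n \<and> i mod K = r}. Q (take K (drop i l))}"
        by auto
      also have "\<dots> = {i \<in> (\<lambda>s. r + s * K) ` {..<N}. Q (take K (drop i l))}"
        by (simp only: card_residue_class[OF K, of n] N_def)
      finally show ?thesis by auto
    qed
    moreover have "inj (\<lambda>s. r + s * K)" using K by (auto simp: inj_on_def)
    ultimately have "card {i. i < n \<and> i mod K = r \<and> Q (take K (drop i l))} = card {s\<in>{..<N}. Q (take K (drop (r + s * K) l))}"
      by (simp add: card_image inj_on_subset)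
    moreover have "(\<Prod>s<N. (if Q (take K (drop (r + s * K) l)) then \<theta> else 1)) = \<theta> ^ card {s\<in>{..<N}. Q (take K (drop (r + s * K) l))}"
      by (subst prod.inter_filter[symmetric]) auto
    moreover have "(\<Prod>s<N. h (take K (drop (r + s * K) l))) = ennreal (\<Prod>s<N. (if Q (take K (drop (r + s * K) l)) then \<theta> else 1))"
      unfolding h_def using th by (intro prod_ennreal) auto
    ultimately show ?thesis by simp
  qed
  have "(\<integral>\<^sup>+l. (\<Prod>s<N. h (take K (drop (r + s * K) l))) \<partial>replicate_pmf (n + K) p)
      = (\<integral>\<^sup>+x. \<integral>\<^sup>+y. \<integral>\<^sup>+z. (\<Prod>s<N. h (take K (drop (r + s * K) (x @ y @ z)))) \<partial>replicate_pmf e p \<partial>replicate_pmf (N * K) p \<partial>replicate_pmf r p)"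
    unfolding e by (simp only: nn_integral_replicate_pmf_add)
  also have "\<dots> = (\<integral>\<^sup>+x. \<integral>\<^sup>+y. (\<Prod>s<N. h (take K (drop (s * K) y))) \<partial>replicate_pmf (N * K) p \<partial>replicate_pmf r p)"
  proof (intro nn_integral_replicate_pmf_cong)
    fix x y :: "'a list" assume xy: "length x = r" "length y = N * K"
    have "take K (drop (r + s * K) (x @ y @ z)) = take K (drop (s * K) y)" if "s < N" for s z
    proof -
      have "(s + 1) * K \<le> N * K" using that by (intro mult_le_mono1) simp
      then show ?thesis using xy by (simp add: algebra_simps)
    qed
    then show "(\<integral>\<^sup>+z. (\<Prod>s<N. h (take K (drop (r + s * K) (x @ y @ z)))) \<partial>replicate_pmf e p) = (\<Prod>s<N. h (take K (drop (s * K) y)))"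
      by simp
  qed
  also have "\<dots> = (\<Prod>s<N. \<integral>\<^sup>+l. h l \<partial>replicate_pmf K p)"
    using nn_integral_blocks[where h="\<lambda>_. h" and K=K and N=N and p=p] by simp
  also have "(\<integral>\<^sup>+l. h l \<partial>replicate_pmf K p) = ennreal (1 + (\<theta> - 1) * wprob K p Q)"
    unfolding h_def using th by (subst nn_integral_two_valued) (auto simp: algebra_simps)
  finally have F: "(\<integral>\<^sup>+l. (\<Prod>s<N. h (take K (drop (r + s * K) l))) \<partial>replicate_pmf (n + K) p)
      = (\<Prod>s<N. ennreal (1 + (\<theta> - 1) * wprob K p Q))" .
  have "1 + (\<theta> - 1) * wprob K p Q \<ge> 0" using th by simp
  then show ?thesis using F by (simp add: card N_def ennreal_power del: ennreal_plus)
qed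

text \<open>Chernoff's bound in each residue class modulo \<open>K\<close>. The constants depend on
  \<open>K\<close>, \<open>pb\<close> and \<open>t\<close> but not on the law or the event, because
  the law of the types is not yet fixed where they are used.\<close>

lemma large_deviations:
  fixes pb t :: real
  assumes K: "K > 0" and pb: "0 < pb" "pb < t"
  shows "\<exists>C \<rho>. 0 \<le> C \<and> 0 < \<rho> \<and> \<rho> < 1 \<and> (\<forall>(p :: 'a pmf) Q n. wprob K p Q \<le> pb \<longrightarrow>
     wprob (n + K) p (\<lambda>l. t * n \<le> card {i. i < n \<and> Q (take K (drop i l))}) \<le> C * \<rho> ^ n)"
proof -
  \<comment> \<open>The midpoint of 1 and \<open>t / pb\<close>, which gives both
    \<open>\<theta> > 1\<close> and \<open>\<theta> * pb < t\<close>.\<close>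
  define \<theta> where "\<theta> = (t / pb + 1) / 2"
  define A where "A = 1 + (\<theta> - 1) * pb"
  \<comment> \<open>A window contributes \<open>A / \<theta> powr t\<close>, and in one residue
    class there is one window for every \<open>K\<close> sites.\<close>
  define \<rho> where "\<rho> = (A / \<theta> powr t) powr (1 / K)"
  have th: "\<theta> > 1" "\<theta> * pb < t" using pb by (auto simp: \<theta>_def field_simps)
  have A: "A \<ge> 1" using th pb by (simp add: A_def)
  have "A < \<theta> powr t"
  proof -
    have "ln A \<le> (\<theta> - 1) * pb" using ln_le_minus_one[of A] A by (simp add: A_def)
    also have "\<dots> < (\<theta> - 1) * (t / \<theta>)" using th pb by (intro mult_strict_left_mono) (auto simp: field_simps)
    also have "\<dots> = t * ((\<theta> - 1) / \<theta>)" by simp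
    also have "\<dots> \<le> t * ln \<theta>"
    proof -
      have "ln (1 / \<theta>) \<le> 1 / \<theta> - 1" using th by (intro ln_le_minus_one) auto
      then have "(\<theta> - 1) / \<theta> \<le> ln \<theta>" using th by (simp add: ln_div diff_divide_distrib)
      then show ?thesis using pb by (intro mult_left_mono) auto
    qed
    finally have "exp (ln A) < exp (t * ln \<theta>)" by simp
    then show ?thesis using A th by (simp add: powr_def)
  qed
  then have rat: "A / \<theta> powr t > 0" "A / \<theta> powr t < 1" using A th by auto
  have \<rho>: "0 < \<rho>" "\<rho> < 1"
    using rat K powr_less_mono2[of "1 / K" "A / \<theta> powr t" 1] by (auto simp: \<rho>_def)
  have bound: "wprob (n + K) p (\<lambda>l. t * n \<le> card {i. i < n \<and> Q (take K (drop i l))}) \<le> (K * A) * \<rho> ^ n"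
    if pQ: "wprob K p Q \<le> pb" for p :: "'a pmf" and Q n
  proof -
    define c where "c r l = card {i. i < n \<and> i mod K = r \<and> Q (take K (drop i l))}" for r and l :: "'a list"
    have csum: "card {i. i < n \<and> Q (take K (drop i l))} = (\<Sum>r<K. c r l)" for l
    proof -
      have "{i. i < n \<and> Q (take K (drop i l))} = (\<Union>r<K. {i. i < n \<and> i mod K = r \<and> Q (take K (drop i l))})"
        using K by auto
      also have "card \<dots> = (\<Sum>r<K. c r l)" unfolding c_def by (intro card_UN_disjoint) auto
      finally show ?thesis .
    qed
    have single: "wprob (n + K) p (\<lambda>l. t * n / K \<le> c r l) \<le> A * \<rho> ^ n" if r: "r < K" for r
    proof -
      let ?x = "t * n / K"
      have "ennreal (wprob (n + K) p (\<lambda>l. ?x \<le> c r l)) \<le> (\<integral>\<^sup>+l. ennreal (1 / \<theta> powr ?x) * ennreal (\<theta> ^ c r l) \<partial>replicate_pmf (n + K) p)"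
        unfolding wprob_ennreal
      proof (intro nn_integral_mono)
        fix l
        have "1 \<le> 1 / \<theta> powr ?x * \<theta> ^ c r l" if "?x \<le> c r l"
        proof -
          have "\<theta> powr ?x \<le> \<theta> powr (c r l)" using that th by (intro powr_mono) auto
          then show ?thesis using th by (simp add: powr_realpow)
        qed
        then show "indicator {l. ?x \<le> c r l} l \<le> ennreal (1 / \<theta> powr ?x) * ennreal (\<theta> ^ c r l)"
          using th by (auto simp: indicator_def ennreal_mult[symmetric] ennreal_1[symmetric] simp del: ennreal_1)
      qed
      also have "\<dots> = ennreal (1 / \<theta> powr ?x) * ennreal ((1 + (\<theta> - 1) * wprob K p Q) ^ ((n + K - 1 - r) div K))"
        unfolding c_def using residue_class_mgf[OF K r, where \<theta>=\<theta> and n=n and Q=Q and p=p] th by (simp add: nn_integral_cmult)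
      also have "\<dots> = ennreal ((1 + (\<theta> - 1) * wprob K p Q) ^ ((n + K - 1 - r) div K) / \<theta> powr ?x)"
        using th by (subst ennreal_mult[symmetric]) auto
      finally have "wprob (n + K) p (\<lambda>l. ?x \<le> c r l) \<le> (1 + (\<theta> - 1) * wprob K p Q) ^ ((n + K - 1 - r) div K) / \<theta> powr ?x"
        using th by (subst (asm) ennreal_le_iff) auto
      also have "\<dots> \<le> A ^ ((n + K - 1 - r) div K) / \<theta> powr ?x"
        using pQ th by (intro divide_right_mono power_mono) (auto simp: A_def intro!: mult_left_mono)
      also have "A ^ ((n + K - 1 - r) div K) \<le> A powr (n / K + 1)"
      proof -
        have "real ((n + K - 1 - r) div K) \<le> real (n + K - 1 - r) / K" by (rule of_nat_div_le_of_nat)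
        also have "\<dots> \<le> (n + K) / K" using K by (intro divide_right_mono) auto
        also have "\<dots> = n / K + 1" using K by (simp add: field_simps)
        finally have "A powr ((n + K - 1 - r) div K) \<le> A powr (n / K + 1)" using A by (intro powr_mono)
        then show ?thesis using A by (simp add: powr_realpow)
      qed
      also have "A powr (n / K + 1) / \<theta> powr ?x = A * \<rho> ^ n"
      proof -
        have "\<rho> ^ n = \<rho> powr n" using \<rho> by (simp add: powr_realpow)
        also have "\<dots> = (A / \<theta> powr t) powr (n / K)" by (simp add: \<rho>_def powr_powr)
        also have "\<dots> = A powr (n / K) / \<theta> powr ?x" using A th by (simp add: powr_divide powr_powr)
        finally show ?thesis using A by (simp add: powr_add)
      qed
      finally show ?thesis using th by (simp add: divide_right_mono)
    qed
    have "wprob (n + K) p (\<lambda>l. t * n \<le> card {i. i < n \<and> Q (take K (drop i l))})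
       \<le> measure (replicate_pmf (n + K) p) (\<Union>r<K. {l. t * n / K \<le> c r l})"
      unfolding wprob_def
    proof (intro measure_pmf.finite_measure_mono subsetI)
      fix l assume "l \<in> {l. t * n \<le> card {i. i < n \<and> Q (take K (drop i l))}}"
      then have l: "t * n \<le> (\<Sum>r<K. real (c r l))" by (simp add: csum)
      \<comment> \<open>Some residue class carries at least the average share of the count.\<close>
      have "\<exists>r<K. t * n / K \<le> c r l"
      proof (rule ccontr)
        assume "\<not> ?thesis"
        then have "(\<Sum>r<K. real (c r l)) < (\<Sum>r<K. t * n / K)" using K by (intro sum_strict_mono) (auto simp: not_le)
        then show False using l K by simp
      qed
      then show "l \<in> (\<Union>r<K. {l. t * n / K \<le> c r l})" by auto
    qed simp
    also have "\<dots> \<le> (\<Sum>r<K. wprob (n + K) p (\<lambda>l. t * n / K \<le> c r l))"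
      unfolding wprob_def by (intro measure_pmf.finite_measure_subadditive_finite) auto
    also have "\<dots> \<le> (\<Sum>r<K. A * \<rho> ^ n)" using single by (intro sum_mono) auto
    finally show ?thesis by simp
  qed
  show ?thesis using A \<rho> bound by (intro exI[of _ "K * A"] exI[of _ \<rho>]) auto
qed

text \<open>Fix the right part of the word. Symmetry then prescribes for disjoint windows of three
  letters in the left half whether \<open>Q\<close> holds; they are independent, and each complies
  with probability at most \<open>1 - b\<close>, since \<open>Q\<close> has probability at most
  \<open>1 / 2\<close> and its negation at most \<open>1 - b\<close>.\<close>

lemma palindrome_bound:
  fixes p :: "'a pmf"
  assumes b: "wprob 3 p Q \<ge> b" "wprob 3 p Q \<le> 1 / 2" "b \<ge> 0"
  shows "wprob (n + 2) p (\<lambda>l. \<forall>i<n. Q (take 3 (drop i l)) = Q (take 3 (drop (n - 1 - i) l))) \<le> (1 - b) ^ (n div 6)"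
proof -
  \<comment> \<open>Six positions for each window: three in the left half and their mirror
    images.\<close>
  define N where "N = n div 6"
  have N6: "6 * N \<le> n" by (simp add: N_def)
  define e where "e = n + 2 - N * 3"
  have e: "n + 2 = N * 3 + e" "e \<ge> N * 3 + 2" using N6 by (auto simp: e_def)
  have "b \<le> 1" using b wprob_le1[of 3 p Q] by simp
  have "wprob (N * 3 + e) p (\<lambda>l. \<forall>i<n. Q (take 3 (drop i l)) = Q (take 3 (drop (n - 1 - i) l))) \<le> (1 - b) ^ N"
  proof (rule wprob_add_le)
    fix y :: "'a list" assume y: "length y = e"
    define c where "c j = Q (take 3 (drop (n - 1 - j * 3 - N * 3) y))" for j
    define h where "h j l = ennreal (if Q l = c j then 1 else 0)" for j and l :: "'a list"
    have "ennreal (wprob (N * 3) p (\<lambda>x. \<forall>i<n. Q (take 3 (drop i (x @ y))) = Q (take 3 (drop (n - 1 - i) (x @ y)))))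
      \<le> (\<integral>\<^sup>+x. (\<Prod>j<N. h j (take 3 (drop (j * 3) x))) \<partial>replicate_pmf (N * 3) p)"
      unfolding wprob_ennreal
    proof (intro nn_integral_replicate_pmf_mono)
      fix x :: "'a list" assume x: "length x = N * 3"
      have "Q (take 3 (drop (j * 3) x)) = c j"
        if *: "\<forall>i<n. Q (take 3 (drop i (x @ y))) = Q (take 3 (drop (n - 1 - i) (x @ y)))" and j: "j < N" for j
      proof -
        have j3: "j * 3 + 3 \<le> N * 3" using j by simp
        have "Q (take 3 (drop (j * 3) (x @ y))) = Q (take 3 (drop (n - 1 - j * 3) (x @ y)))"
          using * j3 N6 by (intro *[rule_format]) linarith
        moreover have "take 3 (drop (j * 3) (x @ y)) = take 3 (drop (j * 3) x)" using x j3 by simp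
        moreover have "drop (n - 1 - j * 3) (x @ y) = drop (n - 1 - j * 3 - N * 3) y"
          using x j3 N6 by simp
        ultimately show ?thesis by (simp only: c_def)
      qed
      then show "indicator {x. \<forall>i<n. Q (take 3 (drop i (x @ y))) = Q (take 3 (drop (n - 1 - i) (x @ y)))} x
         \<le> (\<Prod>j<N. h j (take 3 (drop (j * 3) x)))"
        by (auto simp: indicator_def h_def)
    qed
    also have "\<dots> = (\<Prod>j<N. \<integral>\<^sup>+l. h j l \<partial>replicate_pmf 3 p)" by (rule nn_integral_blocks)
    also have "\<dots> \<le> (\<Prod>j<N. ennreal (1 - b))"
    proof (intro prod_mono_ennreal)
      fix j
      have "h j = (\<lambda>l. ennreal (if Q l then of_bool (c j) else of_bool (\<not> c j)))"
        by (auto simp: h_def fun_eq_iff)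
      then have "(\<integral>\<^sup>+l. h j l \<partial>replicate_pmf 3 p) = ennreal (if c j then wprob 3 p Q else 1 - wprob 3 p Q)"
        using nn_integral_two_valued[of "of_bool (c j)" "of_bool (\<not> c j)", where Q=Q and K=3 and p=p] by simp
      also have "\<dots> \<le> ennreal (1 - b)" using b by (intro ennreal_leI) auto
      finally show "(\<integral>\<^sup>+l. h j l \<partial>replicate_pmf 3 p) \<le> ennreal (1 - b)" .
    qed
    also have "\<dots> = ennreal ((1 - b) ^ N)" using \<open>b \<le> 1\<close> by (simp add: ennreal_power)
    finally show "wprob (N * 3) p (\<lambda>x. \<forall>i<n. Q (take 3 (drop i (x @ y))) = Q (take 3 (drop (n - 1 - i) (x @ y)))) \<le> (1 - b) ^ N"
      using \<open>b \<le> 1\<close> by (subst (asm) ennreal_le_iff) auto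
  qed (use \<open>b \<le> 1\<close> in auto)
  then show ?thesis using e by (simp add: N_def)
qed

section \<open>The product measure\<close>

definition iid :: "nat pmf \<Rightarrow> (int \<Rightarrow> nat) measure" where
  "iid p = PiM UNIV (\<lambda>_. measure_pmf p)"

lemma prob_space_iid: "prob_space (iid p)"
  unfolding iid_def by (intro prob_space_PiM measure_pmf.prob_space_axioms)

lemma space_iid [simp]: "space (iid p) = UNIV"
  by (simp add: iid_def space_PiM)

lemma sets_iid: "sets (iid p) = sets (seq_space (UNIV :: nat set))"
  unfolding iid_def by (intro sets_PiM_cong) auto

lemma measurable_wd [measurable]: "(\<lambda>\<omega>. wd \<omega> a n) \<in> seq_space (UNIV :: nat set) \<rightarrow>\<^sub>M count_space UNIV"
proof (rule measurable_count_space_eq2_countable[THEN iffD2], intro conjI ballI)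
  fix l :: "nat list"
  show "(\<lambda>\<omega>. wd \<omega> a n) -` {l} \<inter> space (seq_space (UNIV :: nat set)) \<in> sets (seq_space UNIV)"
  proof (cases "length l = n")
    case True
    have "(\<lambda>\<omega>. wd \<omega> a n) -` {l} \<inter> space (seq_space (UNIV :: nat set)) = {\<omega>\<in>space (seq_space UNIV). \<forall>i\<in>{..<n}. \<omega> (a + int i) = l ! i}"
      using True by (auto simp: list_eq_iff_nth_eq)
    also have "\<dots> \<in> sets (seq_space UNIV)" by measurable
    finally show ?thesis .
  next
    case False
    then have "(\<lambda>\<omega>. wd \<omega> a n) -` {l} \<inter> space (seq_space (UNIV :: nat set)) = {}" by auto
    then show ?thesis by simp
  qed
qed (auto simp: countable_lists)

lemma sets_wd [measurable (raw), simp]: "{\<omega>. Q (wd \<omega> a n)} \<in> sets (iid p)"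
proof -
  have "(\<lambda>\<omega>. wd \<omega> a n) -` {l. Q l} \<inter> space (seq_space (UNIV :: nat set)) \<in> sets (seq_space UNIV)"
    by (rule measurable_sets[OF measurable_wd]) auto
  then show ?thesis by (simp add: sets_iid space_PiM vimage_def)
qed

lemma pmf_replicate_pmf: "length l = n \<Longrightarrow> pmf (replicate_pmf n p) l = (\<Prod>i<n. pmf p (l ! i))"
proof (induction n arbitrary: l)
  case (Suc n)
  then obtain x l' where l: "l = x # l'" "length l' = n" by (cases l) auto
  have "replicate_pmf (Suc n) p = map_pmf (\<lambda>(x, xs). x # xs) (pair_pmf p (replicate_pmf n p))"
    by (simp add: pair_pmf_def map_bind_pmf)
  moreover have "pmf (map_pmf (\<lambda>(x, xs). x # xs) (pair_pmf p (replicate_pmf n p))) ((\<lambda>(x, xs). x # xs) (x, l')) = pmf (pair_pmf p (replicate_pmf n p)) (x, l')"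
    by (rule pmf_map_inj') (auto simp: inj_on_def)
  ultimately show ?case using Suc.IH[OF l(2)] by (simp add: l pmf_pair prod.lessThan_Suc_shift del: prod.lessThan_Suc)
qed simp

lemma distr_wd: "distr (iid p) (count_space UNIV) (\<lambda>\<omega>. wd \<omega> a n) = measure_pmf (replicate_pmf n p)"
proof (rule measure_eqI_countable[of _ UNIV])
  interpret product_prob_space "\<lambda>_. measure_pmf p" "UNIV :: int set" ..
  fix l :: "nat list"
  have m: "(\<lambda>\<omega>. wd \<omega> a n) \<in> iid p \<rightarrow>\<^sub>M count_space UNIV"
    by (subst measurable_cong_sets[OF sets_iid refl]) (rule measurable_wd)
  have "emeasure (distr (iid p) (count_space UNIV) (\<lambda>\<omega>. wd \<omega> a n)) {l} = emeasure (iid p) {\<omega>. wd \<omega> a n = l}"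
    using m by (subst emeasure_distr) (auto intro!: arg_cong[of _ _ "emeasure (iid p)"])
  also have "\<dots> = emeasure (replicate_pmf n p) {l}"
  proof (cases "length l = n")
    case True
    define J where "J = (\<lambda>i. a + int i) ` {..<n}"
    have "{\<omega>. wd \<omega> a n = l} = prod_emb UNIV (\<lambda>_. measure_pmf p) J (\<Pi>\<^sub>E j\<in>J. {l ! nat (j - a)})"
      using True by (auto simp: prod_emb_def J_def list_eq_iff_nth_eq PiE_iff)
    then have "emeasure (iid p) {\<omega>. wd \<omega> a n = l} = (\<Prod>j\<in>J. emeasure (measure_pmf p) {l ! nat (j - a)})"
      unfolding iid_def by (simp only:) (rule emeasure_PiM_emb, auto simp: J_def)
    also have "\<dots> = (\<Prod>i<n. ennreal (pmf p (l ! i)))"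
      unfolding J_def by (subst prod.reindex) (auto simp: inj_on_def emeasure_pmf_single)
    also have "\<dots> = ennreal (pmf (replicate_pmf n p) l)"
      using True by (simp add: pmf_replicate_pmf prod_ennreal)
    finally show ?thesis by (simp add: emeasure_pmf_single)
  next
    case False
    then have "{\<omega>. wd \<omega> a n = l} = {}" by auto
    moreover have "l \<notin> set_pmf (replicate_pmf n p)" using False by (auto simp: set_replicate_pmf)
    ultimately show ?thesis by (simp add: emeasure_pmf_single pmf_eq_0_set_pmf)
  qed
  finally show "emeasure (distr (iid p) (count_space UNIV) (\<lambda>\<omega>. wd \<omega> a n)) {l} = emeasure (replicate_pmf n p) {l}" .
qed auto

lemma nn_integral_wd: "(\<integral>\<^sup>+\<omega>. f (wd \<omega> a n) \<partial>iid p) = (\<integral>\<^sup>+l. f l \<partial>replicate_pmf n p)"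
proof -
  have m: "(\<lambda>\<omega>. wd \<omega> a n) \<in> iid p \<rightarrow>\<^sub>M count_space UNIV"
    by (subst measurable_cong_sets[OF sets_iid refl]) (rule measurable_wd)
  show ?thesis unfolding distr_wd[symmetric, of n p a] by (subst nn_integral_distr[OF m]) auto
qed

lemma measure_wd: "measure (iid p) {\<omega>. Q (wd \<omega> a n)} = wprob n p Q"
proof -
  have m: "(\<lambda>\<omega>. wd \<omega> a n) \<in> iid p \<rightarrow>\<^sub>M count_space UNIV"
    by (subst measurable_cong_sets[OF sets_iid refl]) (rule measurable_wd)
  show ?thesis unfolding wprob_def distr_wd[symmetric, of n p a]
    by (subst measure_distr[OF m]) (auto simp: vimage_def)
qed

text \<open>With \<open>s = sqrt \<rho>\<close> the bound reads
  \<open>C * s ^ (i + j) * s ^ (i + j)\<close>: one power is at most \<open>s ^ m\<close>, the other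
  is summable over \<open>i\<close> and \<open>j\<close>. The threshold \<open>m\<close> serves all
  laws \<open>p\<close>.\<close>

lemma small_union:
  fixes C \<rho> \<epsilon> :: real
  assumes C: "C \<ge> 0" and \<rho>: "0 < \<rho>" "\<rho> < 1" and \<epsilon>: "\<epsilon> > 0"
  shows "\<exists>m::nat. \<forall>p (E :: nat \<Rightarrow> nat \<Rightarrow> (int \<Rightarrow> nat) set). (\<forall>i j. E i j \<in> sets (iid p)) \<longrightarrow>
     (\<forall>i j. m \<le> i + j \<longrightarrow> measure (iid p) (E i j) \<le> C * \<rho> ^ (i + j)) \<longrightarrow>
     measure (iid p) (\<Union>i. \<Union>j. if m \<le> i + j then E i j else {}) \<le> \<epsilon>"
proof -
  define s where "s = sqrt \<rho>"
  have s: "0 < s" "s < 1" "s * s = \<rho>" using \<rho> by (auto simp: s_def)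
  have "(\<lambda>m. C * s ^ m / (1 - s) ^ 2) \<longlonglongrightarrow> C * 0 / (1 - s) ^ 2"
    using s by (intro tendsto_intros LIMSEQ_power_zero) auto
  then have "\<forall>\<^sub>F m in sequentially. C * s ^ m / (1 - s) ^ 2 < \<epsilon>"
    using \<epsilon> by (intro order_tendstoD) auto
  then obtain m where m: "C * s ^ m / (1 - s) ^ 2 < \<epsilon>"
    using eventually_happens'[OF sequentially_bot] by blast
  have "measure (iid p) (\<Union>i. \<Union>j. if m \<le> i + j then E i j else {}) \<le> \<epsilon>"
    if E: "\<forall>i j. E i j \<in> sets (iid p)" "\<forall>i j. m \<le> i + j \<longrightarrow> measure (iid p) (E i j) \<le> C * \<rho> ^ (i + j)" for p E
  proof -
    interpret prob_space "iid p" by (rule prob_space_iid)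
    let ?E = "\<lambda>i j. if m \<le> i + j then E i j else {}"
    have bnd: "emeasure (iid p) (?E i j) \<le> ennreal (C * s ^ m * s ^ i * s ^ j)" for i j
    proof (cases "m \<le> i + j")
      case True
      have "measure (iid p) (E i j) \<le> C * \<rho> ^ (i + j)" using E True by blast
      also have "\<rho> ^ (i + j) = s ^ (i + j) * s ^ (i + j)" by (simp add: s(3)[symmetric] power_mult_distrib)
      also have "\<dots> \<le> s ^ m * s ^ (i + j)" using s True by (intro mult_right_mono power_decreasing) auto
      finally have "measure (iid p) (E i j) \<le> C * (s ^ m * s ^ (i + j))" using C by (simp add: mult_left_mono)
      then show ?thesis using True by (simp add: emeasure_eq_measure power_add mult.assoc ennreal_leI)
    qed simp
    have geo: "(\<Sum>i. ennreal (c * s ^ i)) = ennreal (c / (1 - s))" if "c \<ge> 0" for c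
    proof -
      have "(\<lambda>i. c * s ^ i) sums (c * (1 / (1 - s)))" using s by (intro sums_mult geometric_sums) auto
      then show ?thesis using that s by (subst suminf_ennreal_eq[of _ "c / (1 - s)"]) auto
    qed
    have "emeasure (iid p) (\<Union>i. \<Union>j. ?E i j) \<le> (\<Sum>i. emeasure (iid p) (\<Union>j. ?E i j))"
      using E(1) by (intro emeasure_subadditive_countably) (auto intro!: sets.countable_UN)
    also have "\<dots> \<le> (\<Sum>i. \<Sum>j. emeasure (iid p) (?E i j))"
      using E(1) by (intro suminf_le emeasure_subadditive_countably) auto
    also have "\<dots> \<le> (\<Sum>i. \<Sum>j. ennreal (C * s ^ m * s ^ i * s ^ j))"
      by (intro suminf_le bnd) auto
    also have "\<dots> = (\<Sum>i. ennreal (C * s ^ m / (1 - s) * s ^ i))"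
      by (subst geo) (use C s in auto)
    also have "\<dots> = ennreal (C * s ^ m / (1 - s) / (1 - s))"
      using C s by (intro geo) auto
    also have "\<dots> \<le> ennreal \<epsilon>" using m by (intro ennreal_leI) (simp add: power2_eq_square)
    finally show ?thesis using \<epsilon> by (simp add: emeasure_eq_measure)
  qed
  then show ?thesis by blast
qed

section \<open>The label field\<close>

instance sty :: countable by countable_datatype

text \<open>The source has natural numbers as letters, and \<open>from_nat\<close> is total, so
  every sequence of numbers decodes to a field of sites.\<close>

definition dec :: "nat \<Rightarrow> site" where
  "dec = from_nat"

text \<open>The label forgets the data that the type of the site does not use, which would cost entropy.\<close>

definition mask :: "site \<Rightarrow> site" where
  "mask e = (fst e, if fst e = Sup then fst (snd e) else [], (\<exists>n. fst e = Bit n) \<and> snd (snd e))"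

text \<open>A cutter also turns its two neighbours into cutters: this makes the walls thick.\<close>

definition wall :: "sty \<Rightarrow> sty \<Rightarrow> sty \<Rightarrow> sty" where
  "wall a b c = (if \<exists>m. Cut m \<in> {a, b, c} then Cut (Max {m. Cut m \<in> {a, b, c}}) else b)"

definition site3 :: "nat \<Rightarrow> nat \<Rightarrow> nat \<Rightarrow> site" where
  "site3 x y z = (wall (fst (dec x)) (fst (dec y)) (fst (dec z)), snd (dec y))"

definition field :: "(int \<Rightarrow> nat) \<Rightarrow> int \<Rightarrow> site" where
  "field \<omega> v = site3 (\<omega> (v - 1)) (\<omega> v) (\<omega> (v + 1))"

lemma finite_cuts: "finite {m. Cut m \<in> {a, b, c}}"
proof -
  have "{m. Cut m \<in> {a, b, c}} = Cut -` {a, b, c}" by auto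
  also have "finite \<dots>" by (intro finite_vimageI) (auto simp: inj_on_def)
  finally show ?thesis .
qed

lemma cutge_wall: "cutge n (wall a b c) \<longleftrightarrow> cutge n a \<or> cutge n b \<or> cutge n c"
proof (cases "\<exists>m. Cut m \<in> {a, b, c}")
  case True
  then have "cutge n (wall a b c) \<longleftrightarrow> n \<le> Max {m. Cut m \<in> {a, b, c}}" by (simp add: wall_def)
  also have "\<dots> \<longleftrightarrow> (\<exists>m\<in>{m. Cut m \<in> {a, b, c}}. n \<le> m)" using True by (intro Max_ge_iff finite_cuts) auto
  also have "\<dots> \<longleftrightarrow> cutge n a \<or> cutge n b \<or> cutge n c" by (auto simp: cutge_cases)
  finally show ?thesis .
next
  case False
  then show ?thesis by (auto simp: wall_def cutge_cases)
qed

lemma wall_commute: "wall a b c = wall c b a"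
  by (simp add: wall_def insert_commute)

lemma wall_eq_not_cut:
  assumes "\<not> cutge 0 s"
  shows "wall a b c = s \<longleftrightarrow> b = s \<and> \<not> cutge 0 a \<and> \<not> cutge 0 c"
proof -
  have ex: "(\<exists>m. Cut m \<in> {a, b, c}) \<longleftrightarrow> cutge 0 a \<or> cutge 0 b \<or> cutge 0 c" by (auto simp: cutge_cases)
  show ?thesis unfolding wall_def ex using assms by (auto simp: cutge_cases)
qed

lemma thick_field_field: "thick_field (field \<omega>)"
  unfolding thick_field_def field_def site3_def by (auto simp: cutge_wall)

lemma field_shift: "field (\<omega> \<circ> (\<lambda>i. s + i)) = field \<omega> \<circ> (\<lambda>i. s + i)"
  by (auto simp: field_def fun_eq_iff algebra_simps)

lemma field_reflect: "field (\<omega> \<circ> (\<lambda>i. s - i)) = field \<omega> \<circ> (\<lambda>i. s - i)"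
proof
  fix v
  have e: "s - (v - 1) = s - v + 1" "s - (v + 1) = s - v - 1" by auto
  show "field (\<omega> \<circ> (\<lambda>i. s - i)) v = (field \<omega> \<circ> (\<lambda>i. s - i)) v"
    unfolding field_def site3_def comp_def e by (simp add: wall_commute)
qed

text \<open>The field on a finite window, which reads two more letters because each site looks at
  both neighbours. It turns events about cells into events about words, which makes them measurable
  and their probabilities computable.\<close>

definition fieldw :: "nat \<Rightarrow> nat list \<Rightarrow> site list" where
  "fieldw n l = map (\<lambda>i. site3 (l ! i) (l ! (i + 1)) (l ! (i + 2))) [0..<n]"

lemma length_fieldw [simp]: "length (fieldw n l) = n"
  by (simp add: fieldw_def)

lemma wd_field: "wd (field \<omega>) a n = fieldw n (wd \<omega> (a - 1) (n + 2))"
  by (rule nth_equalityI) (auto simp: field_def fieldw_def algebra_simps)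

definition cellw :: "nat \<Rightarrow> nat \<Rightarrow> sty list \<Rightarrow> bool" where
  "cellw n N t \<longleftrightarrow> N > 0 \<and> cutge n (t ! 0) \<and> cutge n (t ! (N + 1)) \<and> (\<forall>i<N. \<not> cutge n (t ! (i + 1)))"

lemma cell_iff_cellw: "cell n y a N \<longleftrightarrow> cellw n N (map fst (wd y (a - 1) (N + 2)))"
proof -
  have "(\<forall>v. a \<le> v \<and> v < a + int N \<longrightarrow> \<not> cutge n (fst (y v))) \<longleftrightarrow> (\<forall>i<N. \<not> cutge n (fst (y (a + int i))))" (is "?A \<longleftrightarrow> ?B")
  proof
    assume B: ?B
    show ?A
    proof (intro allI impI)
      fix v assume v: "a \<le> v \<and> v < a + int N"
      then have "nat (v - a) < N" by linarith
      then show "\<not> cutge n (fst (y v))" using B[rule_format, of "nat (v - a)"] v by auto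
    qed
  qed auto
  then show ?thesis by (auto simp: cell_def cellw_def algebra_simps)
qed

lemma inner_wd_field:
  "wd (field \<omega>) a N = take N (drop 1 (fieldw (N + 2) (wd \<omega> (a - 2) (N + 4))))"
proof -
  have "fieldw (N + 2) (wd \<omega> (a - 2) (N + 4)) = wd (field \<omega>) (a - 1) (N + 2)"
    by (subst wd_field) (simp add: algebra_simps numeral_eq_Suc)
  then show ?thesis by (simp add: take_drop_wd)
qed

text \<open>The \<open>N + 4\<close> letters are the cell, a wall site on each side, and one more
  letter on each side because a site looks at its neighbours.\<close>

lemma cell_field_iff:
  "cell n (field \<omega>) a N \<longleftrightarrow> cellw n N (map fst (fieldw (N + 2) (wd \<omega> (a - 2) (N + 4))))"
proof -
  have "fieldw (N + 2) (wd \<omega> (a - 2) (N + 4)) = wd (field \<omega>) (a - 1) (N + 2)"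
    by (subst wd_field) (simp add: algebra_simps numeral_eq_Suc)
  then show ?thesis by (simp only: cell_iff_cellw)
qed

lemma sets_cell_field [simp]: "{\<omega>. cell n (field \<omega>) a N \<and> Q (wd (field \<omega>) a N)} \<in> sets (iid p)"
  unfolding cell_field_iff inner_wd_field by (rule sets_wd)

lemma sets_cell [simp]: "{\<omega>. cell n (field \<omega>) a N} \<in> sets (iid p)"
  unfolding cell_field_iff by (rule sets_wd)

definition walls :: "nat \<Rightarrow> sty list \<Rightarrow> sty list" where
  "walls n sw = map (\<lambda>i. wall (sw ! i) (sw ! (i + 1)) (sw ! (i + 2))) [0..<n]"

lemma length_walls [simp]: "length (walls n sw) = n"
  by (simp add: walls_def)

lemma thick_walls: "length sw = n + 2 \<Longrightarrow> thick (walls n sw)"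
  by (auto simp: thick_def walls_def cutge_wall)

lemma replicate_map_pmf: "replicate_pmf n (map_pmf f p) = map_pmf (map f) (replicate_pmf n p)"
  by (induction n) (simp_all add: map_bind_pmf bind_map_pmf)

lemma wprob_map: "wprob n (map_pmf f p) Q = wprob n p (\<lambda>l. Q (map f l))"
  by (simp add: wprob_def replicate_map_pmf vimage_def)

text \<open>Allows the types and the data of the labels to be integrated in turn.\<close>

lemma nn_integral_replicate_pair:
  "(\<integral>\<^sup>+l. f l \<partial>replicate_pmf n (pair_pmf A B)) = (\<integral>\<^sup>+x. \<integral>\<^sup>+y. f (zip x y) \<partial>replicate_pmf n B \<partial>replicate_pmf n A)"
proof (induction n arbitrary: f)
  case (Suc n)
  have "(\<integral>\<^sup>+l. f l \<partial>replicate_pmf (Suc n) (pair_pmf A B))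
     = (\<integral>\<^sup>+a. \<integral>\<^sup>+b. \<integral>\<^sup>+x. \<integral>\<^sup>+y. f ((a, b) # zip x y) \<partial>replicate_pmf n B \<partial>replicate_pmf n A \<partial>measure_pmf B \<partial>measure_pmf A)"
    by (simp only: nn_integral_replicate_pmf_Suc nn_integral_pair_pmf' Suc)
  also have "\<dots> = (\<integral>\<^sup>+a. \<integral>\<^sup>+x. \<integral>\<^sup>+b. \<integral>\<^sup>+y. f ((a, b) # zip x y) \<partial>replicate_pmf n B \<partial>measure_pmf B \<partial>replicate_pmf n A \<partial>measure_pmf A)"
    by (intro nn_integral_cong nn_integral_pmf_swap)
  also have "\<dots> = (\<integral>\<^sup>+x. \<integral>\<^sup>+y. f (zip x y) \<partial>replicate_pmf (Suc n) B \<partial>replicate_pmf (Suc n) A)"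
    by (simp only: nn_integral_replicate_pmf_Suc zip_Cons_Cons)
  finally show ?case .
qed simp

lemma wprob_3: "wprob 3 S (\<lambda>l. A (l ! 0) \<and> B (l ! 1) \<and> C (l ! 2))
   = measure_pmf.prob S {s. A s} * measure_pmf.prob S {s. B s} * measure_pmf.prob S {s. C s}"
proof -
  have "ennreal (wprob 3 S (\<lambda>l. A (l ! 0) \<and> B (l ! 1) \<and> C (l ! 2)))
     = (\<integral>\<^sup>+x. \<integral>\<^sup>+y. \<integral>\<^sup>+z. indicator {s. A s} x * (indicator {s. B s} y * indicator {s. C s} z) \<partial>measure_pmf S \<partial>measure_pmf S \<partial>measure_pmf S)"
    unfolding wprob_ennreal numeral_3_eq_3 nn_integral_replicate_pmf_Suc replicate_pmf.simps(1)
    by (auto intro!: nn_integral_cong simp: indicator_def)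
  also have "\<dots> = ennreal (measure_pmf.prob S {s. A s} * measure_pmf.prob S {s. B s} * measure_pmf.prob S {s. C s})"
    by (simp add: nn_integral_cmult nn_integral_multc measure_pmf.emeasure_eq_measure ennreal_mult mult.assoc)
  finally show ?thesis by simp
qed

definition site_eq :: "site \<Rightarrow> site \<Rightarrow> bool" where
  "site_eq e e' \<longleftrightarrow> (\<forall>k. site_eqv k e e')"

context coding begin

definition word_pmf :: "nat list pmf" where
  "word_pmf = embed_pmf (\<lambda>w. if w \<in> words q L then \<mu> w else 0)"

lemma pmf_word_pmf: "pmf word_pmf w = (if w \<in> words q L then \<mu> w else 0)"
  unfolding word_pmf_def
proof (rule pmf_embed_pmf)
  have "(\<integral>\<^sup>+w. ennreal (if w \<in> words q L then \<mu> w else 0) \<partial>count_space UNIV) = (\<integral>\<^sup>+w\<in>words q L. ennreal (\<mu> w) \<partial>count_space UNIV)"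
    by (intro nn_integral_cong) (auto simp: indicator_def)
  also have "\<dots> = (\<Sum>w\<in>words q L. ennreal (\<mu> w))"
    by (simp add: nn_integral_count_space_indicator[symmetric] nn_integral_count_space_finite)
  also have "\<dots> = ennreal (\<Sum>w\<in>words q L. \<mu> w)" using nonneg by (intro sum_ennreal) auto
  finally show "(\<integral>\<^sup>+w. ennreal (if w \<in> words q L then \<mu> w else 0) \<partial>count_space UNIV) = 1"
    by (simp add: sum_words)
qed (simp add: nonneg)

definition data_pmf :: "data pmf" where
  "data_pmf = pair_pmf word_pmf (pmf_of_set UNIV)"

lemma nn_integral_data_pmf:
  assumes "\<And>d. f d \<ge> 0"
  shows "(\<integral>\<^sup>+d. ennreal (f d) \<partial>data_pmf) = ennreal (E1 f)"
proof -
  have "(\<integral>\<^sup>+d. ennreal (f d) \<partial>data_pmf) = (\<integral>\<^sup>+w. \<integral>\<^sup>+b. ennreal (f (w, b)) \<partial>measure_pmf (pmf_of_set UNIV) \<partial>word_pmf)"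
    by (simp add: data_pmf_def nn_integral_pair_pmf')
  also have "(\<lambda>w. \<integral>\<^sup>+b. ennreal (f (w, b)) \<partial>measure_pmf (pmf_of_set UNIV)) = (\<lambda>w. ennreal ((f (w, True) + f (w, False)) / 2))"
  proof
    fix w
    have "(\<integral>\<^sup>+b. ennreal (f (w, b)) \<partial>measure_pmf (pmf_of_set UNIV)) = (\<Sum>b\<in>UNIV. ennreal (f (w, b))) / ennreal (real (card (UNIV :: bool set)))"
      by (subst nn_integral_pmf_of_set) auto
    also have "\<dots> = ennreal (f (w, True) + f (w, False)) / ennreal 2"
      using assms by (simp add: UNIV_bool add.commute)
    also have "\<dots> = ennreal ((f (w, True) + f (w, False)) / 2)"
      using assms by (subst divide_ennreal) auto
    finally show "(\<integral>\<^sup>+b. ennreal (f (w, b)) \<partial>measure_pmf (pmf_of_set UNIV)) = ennreal ((f (w, True) + f (w, False)) / 2)" .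
  qed
  also have "(\<integral>\<^sup>+w. ennreal ((f (w, True) + f (w, False)) / 2) \<partial>word_pmf)
     = (\<Sum>w\<in>words q L. ennreal ((f (w, True) + f (w, False)) / 2) * ennreal (pmf word_pmf w))"
    by (intro nn_integral_measure_pmf_support) (auto simp: pmf_word_pmf set_pmf_iff split: if_splits)
  also have "\<dots> = (\<Sum>w\<in>words q L. ennreal (\<mu> w * ((f (w, True) + f (w, False)) / 2)))"
    using assms nonneg by (intro sum.cong) (auto simp: pmf_word_pmf ennreal_mult[symmetric] mult.commute)
  also have "\<dots> = ennreal (E1 f)"
    unfolding E1_def using assms nonneg by (intro sum_ennreal) (auto intro!: mult_nonneg_nonneg divide_nonneg_nonneg add_nonneg_nonneg)
  finally show ?thesis .
qed

lemma Avg_nonneg: "(\<And>l. f l \<ge> 0) \<Longrightarrow> Avg n f \<ge> 0"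
  using Avg_mono[of n "\<lambda>_. 0" f] by simp

lemma nn_integral_replicate_data_pmf:
  "(\<And>l. f l \<ge> 0) \<Longrightarrow> (\<integral>\<^sup>+l. ennreal (f l) \<partial>replicate_pmf n data_pmf) = ennreal (Avg n f)"
proof (induction n arbitrary: f)
  case (Suc n)
  then show ?case
    by (simp add: nn_integral_replicate_pmf_Suc nn_integral_data_pmf Avg_nonneg del: replicate_pmf.simps)
qed simp

definition label :: "sty pmf \<Rightarrow> nat pmf" where
  "label S = map_pmf (to_nat \<circ> mask) (pair_pmf S data_pmf)"

lemma dec_to_nat [simp]: "dec (to_nat e) = e"
  by (simp add: dec_def)

lemma fst_mask [simp]: "fst (mask e) = fst e"
  by (simp add: mask_def)

lemma map_label: "map_pmf (fst \<circ> dec) (label S) = S"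
proof -
  have "map_pmf (fst \<circ> dec) (label S) = map_pmf fst (pair_pmf S data_pmf)"
    unfolding label_def pmf.map_comp by (intro map_pmf_cong) auto
  then show ?thesis by (simp add: map_fst_pair_pmf)
qed

lemma wprob_label: "wprob n (label S) (\<lambda>l. Q (map (fst \<circ> dec) l)) = wprob n S Q"
  by (metis map_label wprob_map)

text \<open>A site that is a supply or a bit after the walls are thickened had the same type before,
  so the mask kept its data; at other sites the data are ignored. Masked and unmasked labels are
  therefore interchangeable.\<close>

lemma fieldw_label:
  assumes len: "length sw = N + 4" "length dw = N + 4"
  shows "map fst (fieldw (N + 2) (map (to_nat \<circ> mask) (zip sw dw))) = walls (N + 2) sw"
    and "list_all2 site_eq (take N (drop 1 (fieldw (N + 2) (map (to_nat \<circ> mask) (zip sw dw)))))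
       (zip (walls N (drop 1 sw)) (take N (drop 2 dw)))"
proof -
  have nth: "fieldw (N + 2) (map (to_nat \<circ> mask) (zip sw dw)) ! i = (wall (sw ! i) (sw ! (i + 1)) (sw ! (i + 2)), snd (mask (sw ! (i + 1), dw ! (i + 1))))"
    if "i < N + 2" for i
    using that len by (simp add: fieldw_def site3_def del: upt_Suc)
  show "map fst (fieldw (N + 2) (map (to_nat \<circ> mask) (zip sw dw))) = walls (N + 2) sw"
    using nth by (intro nth_equalityI) (auto simp: walls_def simp del: upt_Suc)
  show "list_all2 site_eq (take N (drop 1 (fieldw (N + 2) (map (to_nat \<circ> mask) (zip sw dw)))))
       (zip (walls N (drop 1 sw)) (take N (drop 2 dw)))"
    unfolding list_all2_conv_all_nth
  proof (intro conjI allI impI)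
    fix i assume "i < length (take N (drop 1 (fieldw (N + 2) (map (to_nat \<circ> mask) (zip sw dw)))))"
    then have i: "i < N" by simp
    let ?w = "wall (sw ! (i + 1)) (sw ! (i + 2)) (sw ! (i + 3))"
    have "take N (drop 1 (fieldw (N + 2) (map (to_nat \<circ> mask) (zip sw dw)))) ! i = (?w, snd (mask (sw ! (i + 2), dw ! (i + 2))))"
      using i nth[of "i + 1"] by (simp add: numeral_eq_Suc)
    moreover have "zip (walls N (drop 1 sw)) (take N (drop 2 dw)) ! i = (?w, dw ! (i + 2))"
      using i len by (simp add: walls_def numeral_eq_Suc)
    moreover have "site_eq (?w, snd (mask (sw ! (i + 2), dw ! (i + 2)))) (?w, dw ! (i + 2))"
    proof -
      have "sw ! (i + 2) = Sup" if "?w = Sup" using that wall_eq_not_cut[of Sup] by simp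
      moreover have "sw ! (i + 2) = Bit m" if "?w = Bit m" for m using that wall_eq_not_cut[of "Bit m"] by simp
      ultimately show ?thesis by (auto simp: site_eq_def site_eqv_def mask_def)
    qed
    ultimately show "site_eq (take N (drop 1 (fieldw (N + 2) (map (to_nat \<circ> mask) (zip sw dw)))) ! i) (zip (walls N (drop 1 sw)) (take N (drop 2 dw)) ! i)"
      by (simp only:)
  qed (use len in simp)
qed

text \<open>Whether there is a cell depends on the types only, and the data are independent of the
  types. So the data of the cell can be averaged with the types held fixed; the two additional sites
  on each side do not enter \<open>F\<close>.\<close>

lemma nn_integral_cell:
  assumes F: "\<And>aw. F aw \<ge> 0" "\<And>aw aw'. list_all2 site_eq aw aw' \<Longrightarrow> F aw = F aw'"
  shows "(\<integral>\<^sup>+\<omega>. indicator {\<omega>. cell n (field \<omega>) a N} \<omega> * ennreal (F (wd (field \<omega>) a N)) \<partial>iid (label S))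
    = (\<integral>\<^sup>+sw. (if cellw n N (walls (N + 2) sw) then ennreal (Avg N (\<lambda>dw. F (zip (walls N (drop 1 sw)) dw))) else 0) \<partial>replicate_pmf (N + 4) S)"
proof -
  define G where "G l = (if cellw n N (map fst (fieldw (N + 2) l)) then ennreal (F (take N (drop 1 (fieldw (N + 2) l)))) else 0)" for l
  have "(\<integral>\<^sup>+\<omega>. indicator {\<omega>. cell n (field \<omega>) a N} \<omega> * ennreal (F (wd (field \<omega>) a N)) \<partial>iid (label S))
     = (\<integral>\<^sup>+\<omega>. G (wd \<omega> (a - 2) (N + 4)) \<partial>iid (label S))"
    by (intro nn_integral_cong) (auto simp: G_def indicator_def cell_field_iff inner_wd_field)
  also have "\<dots> = (\<integral>\<^sup>+l. G l \<partial>replicate_pmf (N + 4) (label S))" by (rule nn_integral_wd)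
  also have "\<dots> = (\<integral>\<^sup>+l. G (map (to_nat \<circ> mask) l) \<partial>replicate_pmf (N + 4) (pair_pmf S data_pmf))"
    unfolding label_def replicate_map_pmf by simp
  also have "\<dots> = (\<integral>\<^sup>+sw. \<integral>\<^sup>+dw. G (map (to_nat \<circ> mask) (zip sw dw)) \<partial>replicate_pmf (N + 4) data_pmf \<partial>replicate_pmf (N + 4) S)"
    by (rule nn_integral_replicate_pair)
  also have "\<dots> = (\<integral>\<^sup>+sw. (if cellw n N (walls (N + 2) sw) then ennreal (Avg N (\<lambda>dw. F (zip (walls N (drop 1 sw)) dw))) else 0) \<partial>replicate_pmf (N + 4) S)"
  proof (rule nn_integral_replicate_pmf_cong)
    fix sw :: "sty list" assume sw: "length sw = N + 4"
    let ?w = "walls N (drop 1 sw)"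
    have "(\<integral>\<^sup>+dw. G (map (to_nat \<circ> mask) (zip sw dw)) \<partial>replicate_pmf (N + 4) data_pmf)
       = (\<integral>\<^sup>+dw. (if cellw n N (walls (N + 2) sw) then ennreal (F (zip ?w (take N (drop 2 dw)))) else 0) \<partial>replicate_pmf (N + 4) data_pmf)"
    proof (rule nn_integral_replicate_pmf_cong)
      fix dw :: "data list" assume dw: "length dw = N + 4"
      show "G (map (to_nat \<circ> mask) (zip sw dw)) = (if cellw n N (walls (N + 2) sw) then ennreal (F (zip ?w (take N (drop 2 dw)))) else 0)"
        unfolding G_def fieldw_label(1)[OF sw dw] F(2)[OF fieldw_label(2)[OF sw dw]] ..
    qed
    also have "\<dots> = (if cellw n N (walls (N + 2) sw) then ennreal (Avg (N + 4) (\<lambda>dw. F (zip ?w (take N (drop 2 dw))))) else 0)"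
      using F(1) by (simp add: nn_integral_replicate_data_pmf del: replicate_pmf.simps Avg.simps)
    also have "Avg (N + 4) (\<lambda>dw. F (zip ?w (take N (drop 2 dw)))) = Avg 2 (\<lambda>x. Avg N (\<lambda>y. Avg 2 (\<lambda>z. F (zip ?w (take N (drop 2 (x @ y @ z)))))))"
    proof -
      have "N + 4 = 2 + (N + 2)" by simp
      then show ?thesis by (simp only: Avg_append)
    qed
    also have "\<dots> = Avg 2 (\<lambda>x. Avg N (\<lambda>y. Avg 2 (\<lambda>z. F (zip ?w y))))"
      by (intro Avg_cong) simp
    also have "\<dots> = Avg N (\<lambda>dw. F (zip ?w dw))" by (simp only: Avg_const)
    finally show "(\<integral>\<^sup>+dw. G (map (to_nat \<circ> mask) (zip sw dw)) \<partial>replicate_pmf (N + 4) data_pmf)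
       = (if cellw n N (walls (N + 2) sw) then ennreal (Avg N (\<lambda>dw. F (zip ?w dw))) else 0)" .
  qed
  finally show ?thesis .
qed

lemma nn_integral_cell_le:
  assumes F: "\<And>aw. F aw \<ge> 0" "\<And>aw aw'. list_all2 site_eq aw aw' \<Longrightarrow> F aw = F aw'"
    and c: "c \<ge> 0" "\<And>w. length w = N \<Longrightarrow> thick w \<Longrightarrow> Avg N (\<lambda>dw. F (zip w dw)) \<le> c"
  shows "(\<integral>\<^sup>+\<omega>. indicator {\<omega>. cell n (field \<omega>) a N} \<omega> * ennreal (F (wd (field \<omega>) a N)) \<partial>iid (label S))
    \<le> ennreal c * emeasure (iid (label S)) {\<omega>. cell n (field \<omega>) a N}"
proof -
  have 1: "emeasure (iid (label S)) {\<omega>. cell n (field \<omega>) a N}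
     = (\<integral>\<^sup>+sw. (if cellw n N (walls (N + 2) sw) then 1 else 0) \<partial>replicate_pmf (N + 4) S)"
    using nn_integral_cell[where F="\<lambda>_. 1" and n=n and a=a and N=N and S=S] by (simp cong: if_cong)
  have "(\<integral>\<^sup>+\<omega>. indicator {\<omega>. cell n (field \<omega>) a N} \<omega> * ennreal (F (wd (field \<omega>) a N)) \<partial>iid (label S))
     = (\<integral>\<^sup>+sw. (if cellw n N (walls (N + 2) sw) then ennreal (Avg N (\<lambda>dw. F (zip (walls N (drop 1 sw)) dw))) else 0) \<partial>replicate_pmf (N + 4) S)"
    using F by (rule nn_integral_cell)
  also have "\<dots> \<le> (\<integral>\<^sup>+sw. ennreal c * (if cellw n N (walls (N + 2) sw) then 1 else 0) \<partial>replicate_pmf (N + 4) S)"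
  proof (rule nn_integral_replicate_pmf_mono)
    fix sw :: "sty list" assume "length sw = N + 4"
    then have "Avg N (\<lambda>dw. F (zip (walls N (drop 1 sw)) dw)) \<le> c"
    proof -
      have "walls N (drop 1 sw) = walls N (take (N + 2) (drop 1 sw))" using \<open>length sw = N + 4\<close> by (simp add: walls_def)
      then show ?thesis using \<open>length sw = N + 4\<close> by (intro c) (simp_all add: thick_walls)
    qed
    then show "(if cellw n N (walls (N + 2) sw) then ennreal (Avg N (\<lambda>dw. F (zip (walls N (drop 1 sw)) dw))) else 0)
        \<le> ennreal c * (if cellw n N (walls (N + 2) sw) then 1 else 0)"
      by (simp add: ennreal_leI)
  qed
  also have "\<dots> = ennreal c * emeasure (iid (label S)) {\<omega>. cell n (field \<omega>) a N}"
    unfolding 1 by (rule nn_integral_cmult) auto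
  finally show ?thesis .
qed

end

section \<open>Resolution probabilities\<close>

lemma site_eqD:
  assumes "list_all2 site_eq aw aw'"
  shows "list_all2 (site_eqv n) aw aw'" "length aw = length aw'" "map fst aw = map fst aw'"
proof -
  show "list_all2 (site_eqv n) aw aw'" using assms by (rule list_all2_mono) (simp add: site_eq_def)
  show "length aw = length aw'" using assms by (rule list_all2_lengthD)
  show "map fst aw = map fst aw'" using assms
    by (induction rule: list_all2_induct) (auto simp: site_eq_def site_eqv_def)
qed

definition tail :: "nat \<Rightarrow> sty pmf \<Rightarrow> real" where
  "tail n S = measure_pmf.prob S {s. cutge n s}"

lemma tail_nonneg [simp]: "tail n S \<ge> 0" and tail_le1 [simp]: "tail n S \<le> 1"
  by (simp_all add: tail_def measure_pmf.prob_le_1)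

lemma pmf_Cut_le_tail: "pmf S (Cut n) \<le> tail n S"
  unfolding tail_def pmf.rep_eq by (intro measure_pmf.finite_measure_mono) auto

lemma wprob_all: "wprob n p (\<lambda>l. \<forall>x\<in>set l. P x) = (measure_pmf.prob p {x. P x}) ^ n"
proof -
  have "ennreal (wprob n p (\<lambda>l. \<forall>x\<in>set l. P x)) = ennreal ((measure_pmf.prob p {x. P x}) ^ n)"
  proof (induction n)
    case 0
    then show ?case by (simp add: wprob_ennreal)
  next
    case (Suc n)
    have "ennreal (wprob (Suc n) p (\<lambda>l. \<forall>x\<in>set l. P x))
      = (\<integral>\<^sup>+x. \<integral>\<^sup>+l. indicator {x. P x} x * indicator {l. \<forall>x\<in>set l. P x} l \<partial>replicate_pmf n p \<partial>measure_pmf p)"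
      unfolding wprob_ennreal nn_integral_replicate_pmf_Suc by (intro nn_integral_cong) (auto simp: indicator_def)
    also have "\<dots> = (\<integral>\<^sup>+x. indicator {x. P x} x * ennreal (measure_pmf.prob p {x. P x} ^ n) \<partial>measure_pmf p)"
      by (simp add: nn_integral_cmult Suc[symmetric] wprob_def measure_pmf.emeasure_eq_measure)
    also have "\<dots> = ennreal ((measure_pmf.prob p {x. P x}) ^ Suc n)"
      by (simp add: nn_integral_multc measure_pmf.emeasure_eq_measure ennreal_mult)
    finally show ?case .
  qed
  then show ?thesis by simp
qed

lemma wprob_not: "wprob n p (\<lambda>l. \<not> Q l) = 1 - wprob n p Q"
  using measure_pmf.prob_compl[of "{l. Q l}" "replicate_pmf n p"]
  by (simp add: wprob_def Collect_neg_eq Compl_eq_Diff_UNIV)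

lemma wprob_ex_le: "wprob n p (\<lambda>l. \<exists>x\<in>set l. P x) \<le> n * measure_pmf.prob p {x. P x}"
proof -
  let ?a = "measure_pmf.prob p {x. P x}"
  have "wprob n p (\<lambda>l. \<exists>x\<in>set l. P x) = 1 - wprob n p (\<lambda>l. \<forall>x\<in>set l. \<not> P x)"
    using wprob_not[of n p "\<lambda>l. \<forall>x\<in>set l. \<not> P x"] by simp
  also have "\<dots> = 1 - (1 - ?a) ^ n"
    using measure_pmf.prob_compl[of "{x. P x}" p] by (simp add: wprob_all Collect_neg_eq Compl_eq_Diff_UNIV)
  also have "\<dots> \<le> n * ?a"
    using Bernoulli_inequality[of "- ?a" n] by (simp add: measure_pmf.prob_le_1)
  finally show ?thesis .
qed

lemma measure_union_le3:
  assumes "A \<in> sets (iid p)" "B \<in> sets (iid p)" "C \<in> sets (iid p)"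
  shows "measure (iid p) (A \<union> B \<union> C) \<le> measure (iid p) A + measure (iid p) B + measure (iid p) C"
proof -
  interpret prob_space "iid p" by (rule prob_space_iid)
  have "measure (iid p) (A \<union> B \<union> C) \<le> measure (iid p) (A \<union> B) + measure (iid p) C"
    using assms by (intro measure_Un_le) auto
  also have "measure (iid p) (A \<union> B) \<le> measure (iid p) A + measure (iid p) B"
    using assms by (intro measure_Un_le) auto
  finally show ?thesis by simp
qed

context coding begin

text \<open>Rare cutters produce long cells, so a property of cells that fails with a probability
  exponentially small in the length holds for the cell of the origin with high probability.\<close>

lemma origin_cell_good:
  fixes C \<rho> \<delta> :: real
  assumes C: "C \<ge> 0" and \<rho>: "0 < \<rho>" "\<rho> < 1" and \<delta>: "\<delta> > 0"
  shows "\<exists>p>0. \<forall>c. 0 < c \<longrightarrow> c \<le> p \<longrightarrow> (\<exists>R. \<forall>S F n. c \<le> pmf S (Cut n) \<longrightarrow> tail n S \<le> 2 * c \<longrightarrow>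
     (\<forall>a N. measure (iid (label S)) {\<omega>. cell n (field \<omega>) a N \<and> F (wd (field \<omega>) a N)} \<le> C * \<rho> ^ N) \<longrightarrow>
     (\<exists>B\<in>sets (iid (label S)). measure (iid (label S)) B \<le> \<delta> \<and> (\<forall>\<omega>. \<omega> \<notin> B \<longrightarrow>
        (\<exists>i j. i \<le> R \<and> j \<le> R \<and> cell n (field \<omega>) (- int i) (i + j + 1) \<and> \<not> F (wd (field \<omega>) (- int i) (i + j + 1))))))"
proof -
  obtain m where m: "\<And>p (E :: nat \<Rightarrow> nat \<Rightarrow> (int \<Rightarrow> nat) set). (\<forall>i j. E i j \<in> sets (iid p)) \<Longrightarrow>
     (\<forall>i j. m \<le> i + j \<longrightarrow> measure (iid p) (E i j) \<le> C * \<rho> ^ (i + j)) \<Longrightarrow>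
     measure (iid p) (\<Union>i. \<Union>j. if m \<le> i + j then E i j else {}) \<le> \<delta> / 3"
    using small_union[OF C \<rho>, of "\<delta> / 3"] \<delta> by auto
  \<comment> \<open>Each of the \<open>2 * m + 3\<close> sites examined by \<open>B1\<close> is a
    cutter with probability at most \<open>2 * p\<close>; this adds up to
    \<open>\<delta> / 3\<close>.\<close>
  define p where "p = \<delta> / (6 * (2 * m + 3))"
  have "p > 0" using \<delta> by (simp add: p_def)
  moreover have "\<exists>R. \<forall>S F n. c \<le> pmf S (Cut n) \<longrightarrow> tail n S \<le> 2 * c \<longrightarrow>
     (\<forall>a N. measure (iid (label S)) {\<omega>. cell n (field \<omega>) a N \<and> F (wd (field \<omega>) a N)} \<le> C * \<rho> ^ N) \<longrightarrow>
     (\<exists>B\<in>sets (iid (label S)). measure (iid (label S)) B \<le> \<delta> \<and> (\<forall>\<omega>. \<omega> \<notin> B \<longrightarrow>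
        (\<exists>i j. i \<le> R \<and> j \<le> R \<and> cell n (field \<omega>) (- int i) (i + j + 1) \<and> \<not> F (wd (field \<omega>) (- int i) (i + j + 1)))))"
    if c: "0 < c" "c \<le> p" for c
  proof -
    \<comment> \<open>As a mere number \<open>c\<close> may exceed 1; the minimum keeps
      \<open>1 - c'\<close> nonnegative.\<close>
    define c' where "c' = min c 1"
    have c': "0 < c'" "c' \<le> 1" "c' \<le> c" using c by (auto simp: c'_def)
    have "(\<lambda>R. 2 * (1 - c') ^ R) \<longlonglongrightarrow> 2 * 0"
      using c' by (intro tendsto_mult tendsto_const LIMSEQ_power_zero) auto
    then have "(\<lambda>R. 2 * (1 - c') ^ R) \<longlonglongrightarrow> 0" by simp
    then have "\<forall>\<^sub>F R in sequentially. 2 * (1 - c') ^ R < \<delta> / 3" by (rule order_tendstoD(2)) (use \<delta> in simp)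
    then obtain R where R: "2 * (1 - c') ^ R < \<delta> / 3" using eventually_happens'[OF sequentially_bot] by blast
    show ?thesis
    proof (rule exI[of _ R], intro allI impI)
      fix S :: "sty pmf" and F n
      assume S: "c \<le> pmf S (Cut n)" "tail n S \<le> 2 * c"
        and F: "\<forall>a N. measure (iid (label S)) {\<omega>. cell n (field \<omega>) a N \<and> F (wd (field \<omega>) a N)} \<le> C * \<rho> ^ N"
      let ?M = "iid (label S)" and ?c = "\<lambda>x. cutge n (fst (dec x))"
      interpret prob_space ?M by (rule prob_space_iid)
      \<comment> \<open>\<open>B1\<close>: a cutter is near, so the cell may be short.
        \<open>B2\<close>: there is no cutter within \<open>R\<close> on one side.
        \<open>B3\<close>: the cell is long but has the bad property \<open>F\<close>. Outside of
        these the cell of the origin is as desired.\<close>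
      define B1 where "B1 = {\<omega>. \<exists>x\<in>set (wd \<omega> (- int m - 1) (2 * m + 3)). ?c x}"
      define B2 where "B2 = {\<omega>. \<forall>x\<in>set (wd \<omega> 1 R). \<not> ?c x} \<union> {\<omega>. \<forall>x\<in>set (wd \<omega> (- int R) R). \<not> ?c x}"
      define E where "E i j = {\<omega>. cell n (field \<omega>) (- int i) (i + j + 1) \<and> F (wd (field \<omega>) (- int i) (i + j + 1))}" for i j
      define B3 where "B3 = (\<Union>i. \<Union>j. if m \<le> i + j then E i j else {})"
      have sets: "B1 \<in> sets ?M" "B2 \<in> sets ?M" "B3 \<in> sets ?M"
      proof -
        have "E i j \<in> sets ?M" for i j unfolding E_def by (rule sets_cell_field)
        then have "(\<Union>j. if m \<le> i + j then E i j else {}) \<in> sets ?M" for i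
          by (intro sets.countable_UN) auto
        then show "B3 \<in> sets ?M" unfolding B3_def by (intro sets.countable_UN) blast
      qed (auto simp: B1_def B2_def)
      have tl: "measure_pmf.prob (label S) {x. ?c x} = tail n S"
      proof -
        have "measure_pmf.prob (map_pmf (fst \<circ> dec) (label S)) {s. cutge n s} = measure_pmf.prob (label S) {x. ?c x}"
          by (simp add: vimage_def)
        then show ?thesis by (simp add: map_label tail_def)
      qed
      have b1: "measure ?M B1 \<le> \<delta> / 3"
      proof -
        have "measure ?M B1 = wprob (2 * m + 3) (label S) (\<lambda>l. \<exists>x\<in>set l. ?c x)"
          unfolding B1_def by (rule measure_wd)
        also have "\<dots> \<le> real (2 * m + 3) * tail n S"
          using wprob_ex_le[of "2 * m + 3" "label S" ?c] by (simp only: tl)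
        also have "\<dots> \<le> real (2 * m + 3) * (2 * p)" using S c by (intro mult_left_mono) auto
        also have "\<dots> = \<delta> / 3" by (simp add: p_def field_simps)
        finally show ?thesis .
      qed
      have b2: "measure ?M B2 \<le> \<delta> / 3"
      proof -
        have cut: "c' \<le> tail n S" using S pmf_Cut_le_tail[of S n] c' by linarith
        have "measure_pmf.prob (label S) {x. \<not> ?c x} = 1 - tail n S"
          using measure_pmf.prob_compl[of "{x. ?c x}" "label S"] tl
          by (simp add: Collect_neg_eq Compl_eq_Diff_UNIV)
        then have "measure ?M {\<omega>. \<forall>x\<in>set (wd \<omega> a R). \<not> ?c x} = (1 - tail n S) ^ R" for a
          using measure_wd[of "label S" "\<lambda>l. \<forall>x\<in>set l. \<not> ?c x" a R] by (simp add: wprob_all)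
        moreover have "(1 - tail n S) ^ R \<le> (1 - c') ^ R" using cut c' by (intro power_mono) auto
        moreover have "measure ?M B2 \<le> measure ?M {\<omega>. \<forall>x\<in>set (wd \<omega> 1 R). \<not> ?c x} + measure ?M {\<omega>. \<forall>x\<in>set (wd \<omega> (- int R) R). \<not> ?c x}"
          unfolding B2_def by (intro measure_Un_le sets_wd)
        ultimately show ?thesis using R by simp
      qed
      have b3: "measure ?M B3 \<le> \<delta> / 3"
        unfolding B3_def
      proof (rule m)
        show "\<forall>i j. E i j \<in> sets ?M" by (simp add: E_def)
        show "\<forall>i j. m \<le> i + j \<longrightarrow> measure ?M (E i j) \<le> C * \<rho> ^ (i + j)"
        proof (intro allI impI)
          fix i j
          have "measure ?M (E i j) \<le> C * \<rho> ^ (i + j + 1)" unfolding E_def using F by blast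
          also have "\<dots> \<le> C * \<rho> ^ (i + j)" using C \<rho> by (intro mult_left_mono power_decreasing) auto
          finally show "measure ?M (E i j) \<le> C * \<rho> ^ (i + j)" .
        qed
      qed
      have "measure ?M (B1 \<union> B2 \<union> B3) \<le> \<delta>"
        using measure_union_le3[OF sets] b1 b2 b3 by simp
      moreover have "\<exists>i j. i \<le> R \<and> j \<le> R \<and> cell n (field \<omega>) (- int i) (i + j + 1) \<and> \<not> F (wd (field \<omega>) (- int i) (i + j + 1))"
        if \<omega>: "\<omega> \<notin> B1 \<union> B2 \<union> B3" for \<omega>
      proof -
        have fcut: "cutge n (fst (field \<omega> v)) \<longleftrightarrow> ?c (\<omega> (v - 1)) \<or> ?c (\<omega> v) \<or> ?c (\<omega> (v + 1))" for v
          by (auto simp: field_def site3_def cutge_wall)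
        have inner: "\<not> cutge n (fst (field \<omega> v))" if v: "- int m \<le> v" "v \<le> int m" for v
        proof -
          have "\<not> ?c (\<omega> w)" if w: "- int m - 1 \<le> w" "w \<le> int m + 1" for w
          proof -
            have "\<omega> w \<in> set (wd \<omega> (- int m - 1) (2 * m + 3))"
              unfolding wd_def using w by (auto intro!: image_eqI[of _ _ "nat (w + int m + 1)"])
            then show ?thesis using \<omega> by (auto simp: B1_def)
          qed
          then show ?thesis using v by (simp add: fcut)
        qed
        have "\<exists>k. k \<le> R \<and> cutge n (fst (field \<omega> (int k)))"
        proof -
          from \<omega> obtain x where "x \<in> set (wd \<omega> 1 R)" "?c x" by (auto simp: B2_def)
          then obtain k where "k < R" "?c (\<omega> (1 + int k))" by (auto simp: wd_def)
          then show ?thesis by (intro exI[of _ "Suc k"]) (auto simp: fcut)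
        qed
        then obtain r where r: "r \<le> R" "cutge n (fst (field \<omega> (int r)))" "\<And>k. k < r \<Longrightarrow> \<not> cutge n (fst (field \<omega> (int k)))"
          using exists_least_iff[of "\<lambda>k. k \<le> R \<and> cutge n (fst (field \<omega> (int k)))"] by (metis less_imp_le order.trans)
        have "\<exists>k. k \<le> R \<and> cutge n (fst (field \<omega> (- int k)))"
        proof -
          from \<omega> obtain x where "x \<in> set (wd \<omega> (- int R) R)" "?c x" by (auto simp: B2_def)
          then obtain k where "k < R" "?c (\<omega> (- int R + int k))" by (auto simp: wd_def)
          then show ?thesis by (intro exI[of _ "R - k"]) (auto simp: fcut of_nat_diff)
        qed
        then obtain l where l: "l \<le> R" "cutge n (fst (field \<omega> (- int l)))" "\<And>k. k < l \<Longrightarrow> \<not> cutge n (fst (field \<omega> (- int k)))"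
          using exists_least_iff[of "\<lambda>k. k \<le> R \<and> cutge n (fst (field \<omega> (- int k)))"] by (metis less_imp_le order.trans)
        have rm: "r > m"
        proof (rule ccontr)
          assume "\<not> m < r" then show False using inner[of "int r"] r(2) by simp
        qed
        have lm: "l > m"
        proof (rule ccontr)
          assume "\<not> m < l" then show False using inner[of "- int l"] l(2) by simp
        qed
        obtain i j where ij: "l = Suc i" "r = Suc j" using rm lm by (metis less_imp_Suc_add)
        have c: "cell n (field \<omega>) (- int i) (i + j + 1)"
          unfolding cell_def
        proof (intro conjI allI impI)
          fix v assume v: "- int i \<le> v \<and> v < - int i + int (i + j + 1)"
          show "\<not> cutge n (fst (field \<omega> v))"
          proof (cases "v \<ge> 0")
            case True
            then show ?thesis using r(3)[of "nat v"] v ij by auto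
          next
            case False
            then show ?thesis using l(3)[of "nat (- v)"] v ij by auto
          qed
        next
          have "- int i - 1 = - int l" using ij by simp
          then show "cutge n (fst (field \<omega> (- int i - 1)))" using l(2) by (simp only:)
          have "- int i + int (i + j + 1) = int r" using ij by simp
          then show "cutge n (fst (field \<omega> (- int i + int (i + j + 1))))" using r(2) by (simp only:)
        qed simp
        have "\<omega> \<notin> E i j"
        proof -
          have "m \<le> i + j" using rm ij by simp
          then have "E i j \<subseteq> B3" unfolding B3_def by (intro SUP_upper2[of i] SUP_upper2[of j]) auto
          then show ?thesis using \<omega> by auto
        qed
        then show ?thesis using c r(1) l(1) ij by (intro exI[of _ i] exI[of _ j]) (auto simp: E_def)
      qed
      ultimately show "\<exists>B\<in>sets ?M. measure ?M B \<le> \<delta> \<and> (\<forall>\<omega>. \<omega> \<notin> B \<longrightarrow>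
        (\<exists>i j. i \<le> R \<and> j \<le> R \<and> cell n (field \<omega>) (- int i) (i + j + 1) \<and> \<not> F (wd (field \<omega>) (- int i) (i + j + 1))))"
        using sets by (intro bexI[of _ "B1 \<union> B2 \<union> B3"]) auto
    qed
  qed
  ultimately show ?thesis by blast
qed

section \<open>Resolution within a bounded radius\<close>

definition cell_res :: "nat \<Rightarrow> nat \<Rightarrow> nat \<Rightarrow> nat \<Rightarrow> nat list \<Rightarrow> bool" where
  "cell_res n N i c l \<longleftrightarrow> cellw n N (map fst (fieldw (N + 2) l)) \<and> resolved n (take N (drop 1 (fieldw (N + 2) l))) i c"

text \<open>\<open>loc_res n R l\<close> says that the centre of the word \<open>l\<close> of length \<open>2 * R + 5\<close> is resolved
  by a cell of radius at most \<open>R\<close>; two further sites on each side determine the cell.\<close>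

definition loc_res :: "nat \<Rightarrow> nat \<Rightarrow> nat list \<Rightarrow> bool" where
  "loc_res n R l \<longleftrightarrow> (\<exists>i j c. i \<le> R \<and> j \<le> R \<and> cell_res n (i + j + 1) i c (take (i + j + 5) (drop (R - i) l)))"

lemma cell_res_iff:
  "cell_res n N i c (wd \<omega> (a - 2) (N + 4)) \<longleftrightarrow> cell n (field \<omega>) a N \<and> resolved n (wd (field \<omega>) a N) i c"
  by (simp only: cell_res_def cell_field_iff inner_wd_field)

lemma loc_res_iff:
  "loc_res n R (wd \<omega> (v - int R - 2) (2 * R + 5)) \<longleftrightarrow>
    (\<exists>i j c. i \<le> R \<and> j \<le> R \<and> cell n (field \<omega>) (v - int i) (i + j + 1) \<and> resolved n (wd (field \<omega>) (v - int i) (i + j + 1)) i c)"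
proof -
  have "take (i + j + 5) (drop (R - i) (wd \<omega> (v - int R - 2) (2 * R + 5))) = wd \<omega> (v - int i - 2) (i + j + 1 + 4)"
    if "i \<le> R" "j \<le> R" for i j
    using that by (subst take_drop_wd) (auto simp: of_nat_diff algebra_simps)
  then show ?thesis unfolding loc_res_def using cell_res_iff by (metis (no_types, lifting))
qed

lemma loc_res_RS:
  assumes "loc_res n R (wd \<omega> (v - int R - 2) (2 * R + 5))" shows "\<exists>c. RS n (field \<omega>) v c"
proof -
  obtain i j c where "cell n (field \<omega>) (v - int i) (i + j + 1)" "resolved n (wd (field \<omega>) (v - int i) (i + j + 1)) i c"
    using assms by (auto simp: loc_res_iff)
  then show ?thesis unfolding RS_def by (intro exI[of _ c] exI[of _ "v - int i"] exI[of _ "i + j + 1"]) auto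
qed

lemma dens_site_eq: "list_all2 site_eq aw aw' \<Longrightarrow> dens n (zip aw u) = dens n (zip aw' u)"
  by (intro dens_eqv list_all2_letter_eqv_zip site_eqD)

lemma pre_site_eq: "list_all2 site_eq aw aw' \<Longrightarrow> pre n (zip aw u) = pre n (zip aw' u)"
  by (intro pre_eqv list_all2_letter_eqv_zip site_eqD)

lemma resolved_site_eq: "list_all2 site_eq aw aw' \<Longrightarrow> resolved n aw i c = resolved n aw' i c"
  by (simp add: resolved_def dens_site_eq site_eqD(2)[of aw aw'])

lemma pre_unresolved_site_eq: "list_all2 site_eq aw aw' \<Longrightarrow> pre_unresolved n aw = pre_unresolved n aw'"
  by (simp add: pre_unresolved_def pre_resolved_def pre_site_eq site_eqD(2)[of aw aw'])

text \<open>A type other than a cutter is visible in the field only if neither neighbour is a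
  cutter, which gives the squared factor.\<close>

lemma wprob_site3:
  assumes "\<not> cutge 0 s"
  shows "wprob 3 (label S) (\<lambda>l. fst (site3 (l ! 0) (l ! 1) (l ! 2)) = s) = pmf S s * (1 - tail 0 S) ^ 2"
proof -
  have "wprob 3 (label S) (\<lambda>l. fst (site3 (l ! 0) (l ! 1) (l ! 2)) = s)
     = wprob 3 (label S) (\<lambda>l. (\<lambda>t. wall (t ! 0) (t ! 1) (t ! 2) = s) (map (fst \<circ> dec) l))"
    unfolding wprob_def by (intro measure_pmf.finite_measure_eq_AE)
      (auto simp: AE_measure_pmf_iff set_replicate_pmf site3_def)
  also have "\<dots> = wprob 3 S (\<lambda>t. wall (t ! 0) (t ! 1) (t ! 2) = s)" by (rule wprob_label)
  also have "\<dots> = wprob 3 S (\<lambda>t. \<not> cutge 0 (t ! 0) \<and> t ! 1 = s \<and> \<not> cutge 0 (t ! 2))"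
    unfolding wall_eq_not_cut[OF assms] by (intro arg_cong[of _ _ "wprob 3 S"]) auto
  also have "\<dots> = (1 - tail 0 S) * pmf S s * (1 - tail 0 S)"
    using wprob_3[of S "\<lambda>s. \<not> cutge 0 s" "\<lambda>t. t = s" "\<lambda>s. \<not> cutge 0 s"]
      measure_pmf.prob_compl[of "{s. cutge 0 s}" S]
    by (simp add: tail_def Collect_neg_eq Compl_eq_Diff_UNIV pmf.rep_eq)
  finally show ?thesis by (simp add: power2_eq_square)
qed

text \<open>The constant \<open>1 / x\<close> absorbs the rounding in \<open>N div 6\<close> and
  leaves an exponential in \<open>N\<close>.\<close>

lemma div6_bound:
  fixes x :: real assumes "0 < x" "x < 1"
  shows "x ^ (N div 6) \<le> (1 / x) * (x powr (1 / 6)) ^ N"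
proof -
  have "real N < 6 * real (N div 6) + 6" by linarith
  then have "x powr (N div 6) \<le> x powr (N / 6 - 1)" using assms by (intro powr_mono') auto
  also have "\<dots> = (1 / x) * (x powr (1 / 6)) powr N"
    using assms by (simp add: powr_diff powr_powr)
  finally show ?thesis using assms by (simp add: powr_realpow)
qed

lemma wd_3: "take 3 (drop k (wd \<omega> (a - 1) n)) ! 0 = \<omega> (a + int k - 1)"
    "take 3 (drop k (wd \<omega> (a - 1) n)) ! 1 = \<omega> (a + int k)"
    "take 3 (drop k (wd \<omega> (a - 1) n)) ! 2 = \<omega> (a + int k + 1)" if "k + 3 \<le> n"
  using that by (auto simp: algebra_simps)

lemma card_bits_ge:
  assumes "\<not> (1 - \<beta> / 4) * N \<le> card {k. k < N \<and> fst (y (a + int k)) \<noteq> Bit m}"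
  shows "\<beta> / 4 * N \<le> nbits m (map fst (wd y a N))"
proof -
  have "nbits m (map fst (wd y a N)) = card {k. k < N \<and> fst (y (a + int k)) = Bit m}"
    unfolding nbits_def length_filter_conv_card by (intro arg_cong[of _ _ card]) auto
  moreover have "card {k. k < N \<and> fst (y (a + int k)) = Bit m} + card {k. k < N \<and> fst (y (a + int k)) \<noteq> Bit m} = N"
  proof -
    have "{k. k < N \<and> fst (y (a + int k)) = Bit m} \<union> {k. k < N \<and> fst (y (a + int k)) \<noteq> Bit m} = {..<N}" by auto
    then show ?thesis by (subst card_Un_disjoint[symmetric]) auto
  qed
  ultimately have "real (nbits m (map fst (wd y a N))) = N - real (card {k. k < N \<and> fst (y (a + int k)) \<noteq> Bit m})"
    by (simp flip: of_nat_add)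
  then show ?thesis using assms by (simp add: algebra_simps)
qed

text \<open>A site that some cell of level \<open>n\<close> resolves has that cell inside the larger
  one, so its letter is fixed before the bits of level \<open>Suc n\<close> are read. This bounds
  the open letters by a number of failing windows, to which \<open>large_deviations\<close>
  applies.\<close>

lemma pre_unresolved_le:
  assumes c: "cell (Suc n) (field \<omega>) a N"
  shows "card (pre_unresolved n (wd (field \<omega>) a N))
     \<le> card {k. k < N \<and> \<not> loc_res n R (take (2 * R + 5) (drop k (wd \<omega> (a - int R - 2) (N + (2 * R + 5)))))}"
proof (intro card_mono subsetI)
  fix k assume k: "k \<in> pre_unresolved n (wd (field \<omega>) a N)"
  then have kN: "k < N" by (simp add: pre_unresolved_def)
  have "\<not> loc_res n R (wd \<omega> (a + int k - int R - 2) (2 * R + 5))"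
  proof
    assume "loc_res n R (wd \<omega> (a + int k - int R - 2) (2 * R + 5))"
    then obtain i j c where ij: "cell n (field \<omega>) (a + int k - int i) (i + j + 1)"
      "resolved n (wd (field \<omega>) (a + int k - int i) (i + j + 1)) i c"
      by (auto simp: loc_res_iff)
    let ?a = "a + int k - int i" and ?N = "i + j + 1"
    have "pre_resolved n (wd (field \<omega>) a N) k c"
      unfolding pre_resolved_def
    proof (intro allI impI)
      fix u assume u: "length u = length (wd (field \<omega>) a N)" "\<mu> u * pre n (zip (wd (field \<omega>) a N) u) > 0"
      have pos: "\<mu> u > 0" "pre n (zip (wd (field \<omega>) a N) u) > 0"
        using u(2) nonneg[of u] pre_nonneg[of n "zip (wd (field \<omega>) a N) u"] by (auto simp: zero_less_mult_iff)
      have uw: "u \<in> words q N" using pos_words[OF pos(1)] u(1) by simp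
      have sub: "dens n (zip (wd (field \<omega>) ?a ?N) (take ?N (drop (nat (?a - a)) u))) > 0"
        using sub_cell_pre[OF thick_field_field ij(1) _ _ c _ _ uw pos(2), of "a + int k"] kN by simp
      have nest: "a \<le> ?a" "?a + int ?N \<le> a + int N"
        using cell_nest[of n "Suc n" "field \<omega>" ?a ?N a N "a + int k"] ij(1) c kN by auto
      have "take ?N (drop (nat (?a - a)) u) ! i = c"
        using ij(2) sub sub_word_pos[OF pos(1)] nest u(1) by (auto simp: resolved_def)
      moreover have "take ?N (drop (nat (?a - a)) u) ! i = u ! (nat (?a - a) + i)"
        using nest u(1) by simp
      moreover have "nat (?a - a) + i = k" using nest by simp
      ultimately show "u ! k = c" by simp
    qed
    then show False using k by (auto simp: pre_unresolved_def)
  qed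
  moreover have "take (2 * R + 5) (drop k (wd \<omega> (a - int R - 2) (N + (2 * R + 5)))) = wd \<omega> (a + int k - int R - 2) (2 * R + 5)"
    using kN by (subst take_drop_wd) (auto simp: algebra_simps)
  ultimately show "k \<in> {k. k < N \<and> \<not> loc_res n R (take (2 * R + 5) (drop k (wd \<omega> (a - int R - 2) (N + (2 * R + 5)))))}"
    using kN by simp
qed auto

end

context coding begin

lemma wprob_fst_site3_neq:
  assumes "0 < \<beta>" "pmf S (Bit m) = \<beta>" "tail 0 S \<le> 1 / 4"
  shows "wprob 3 (label S) (\<lambda>l. fst (site3 (l ! 0) (l ! 1) (l ! 2)) = Bit m) \<in> {\<beta> / 2..\<beta>}"
proof -
  have "wprob 3 (label S) (\<lambda>l. fst (site3 (l ! 0) (l ! 1) (l ! 2)) = Bit m) = \<beta> * (1 - tail 0 S) ^ 2"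
    using wprob_site3[of "Bit m" S] assms by simp
  moreover have "(3 / 4) ^ 2 \<le> (1 - tail 0 S) ^ 2" using assms by (intro power_mono) auto
  then have "\<beta> * (1 / 2) \<le> \<beta> * (1 - tail 0 S) ^ 2" using assms(1)
    by (intro mult_left_mono) (auto simp: power2_eq_square)
  moreover have "(1 - tail 0 S) ^ 2 \<le> 1 ^ 2" by (intro power_mono) auto
  then have "\<beta> * (1 - tail 0 S) ^ 2 \<le> \<beta> * 1" using assms(1) by (intro mult_left_mono) auto
  ultimately show ?thesis by simp
qed

lemma site3_at:
  assumes "k + 3 \<le> n"
  shows "(let l = take 3 (drop k (wd \<omega> (a - 1) n)) in site3 (l ! 0) (l ! 1) (l ! 2)) = field \<omega> (a + int k)"
  using wd_3[OF assms, of \<omega> a] by (simp add: field_def Let_def)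

text \<open>The origin of the exponent: \<open>q \<le> 4\<close> gives
  \<open>q ^ K \<le> 2 ^ (2 * K)\<close> with \<open>2 * K \<le> \<beta> / 16 * N\<close>, against
  at least \<open>\<beta> / 4 * N\<close> bits. The difference is
  \<open>3 / 16 * \<beta> * N\<close>.\<close>

lemma Avg_bad_le:
  assumes q: "1 \<le> q" "q \<le> 4" and \<beta>: "\<beta> > 0" and w: "length w = N" "thick w"
  shows "Avg N (\<lambda>dw. of_bool (\<not> pal w \<and> \<beta> / 4 * N \<le> nbits (Suc n) w \<and>
      card (pre_unresolved n (zip w dw)) \<le> \<beta> / 32 * N \<and> (\<exists>i<N. \<nexists>c. resolved (Suc n) (zip w dw) i c)))
    \<le> (2 powr (- (3 / 16) * \<beta>)) ^ N"
proof (cases "\<not> pal w \<and> \<beta> / 4 * N \<le> nbits (Suc n) w")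
  case True
  define K where "K = nat \<lfloor>\<beta> / 32 * N\<rfloor>"
  have K: "real K \<le> \<beta> / 32 * N" unfolding K_def using \<beta> by (intro of_nat_floor) simp
  have Kiff: "real c \<le> \<beta> / 32 * N \<longleftrightarrow> c \<le> K" for c :: nat
    using le_nat_floor[of c "\<beta> / 32 * N"] K unfolding K_def by linarith
  have "Avg N (\<lambda>dw. of_bool (\<not> pal w \<and> \<beta> / 4 * N \<le> nbits (Suc n) w \<and>
      card (pre_unresolved n (zip w dw)) \<le> \<beta> / 32 * N \<and> (\<exists>i<N. \<nexists>c. resolved (Suc n) (zip w dw) i c)))
    = Avg (length w) (\<lambda>dw. of_bool (card (pre_unresolved n (zip w dw)) \<le> K \<and> (\<exists>i<length w. \<nexists>c. resolved (Suc n) (zip w dw) i c)))"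
    unfolding Kiff using True w(1) by simp
  also have "\<dots> \<le> q ^ K / 2 ^ nbits (Suc n) w"
    using True w q by (intro Avg_impure_le) auto
  also have "\<dots> \<le> 4 ^ K / 2 ^ nbits (Suc n) w"
    using q by (intro divide_right_mono) (simp_all add: power_mono flip: of_nat_power)
  also have "\<dots> = 2 powr (2 * real K) / 2 powr nbits (Suc n) w"
    by (simp add: powr_realpow powr_powr[symmetric])
  also have "\<dots> = 2 powr (2 * real K - nbits (Suc n) w)" by (simp add: powr_diff)
  also have "\<dots> \<le> 2 powr (- (3 / 16) * \<beta> * N)"
    using True K by (intro powr_mono) (auto simp: algebra_simps)
  also have "\<dots> = (2 powr (- (3 / 16) * \<beta>)) ^ N" by (simp add: powr_powr powr_realpow[symmetric])
  finally show ?thesis .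
next
  case False
  then have "Avg N (\<lambda>dw. of_bool (\<not> pal w \<and> \<beta> / 4 * N \<le> nbits (Suc n) w \<and>
      card (pre_unresolved n (zip w dw)) \<le> \<beta> / 32 * N \<and> (\<exists>i<N. \<nexists>c. resolved (Suc n) (zip w dw) i c))) = Avg N (\<lambda>_. 0)"
    by (intro Avg_cong) auto
  then show ?thesis by simp
qed

lemma cell_failure_impure:
  assumes q: "1 \<le> q" "q \<le> 4" and \<beta>: "\<beta> > 0"
  shows "measure (iid (label S)) {\<omega>. cell (Suc n) (field \<omega>) a N \<and>
      (let aw = wd (field \<omega>) a N in \<not> pal (map fst aw) \<and> \<beta> / 4 * N \<le> nbits (Suc n) (map fst aw) \<and>
      card (pre_unresolved n aw) \<le> \<beta> / 32 * N \<and> (\<exists>i<N. \<nexists>c. resolved (Suc n) aw i c))}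
    \<le> (2 powr (- (3 / 16) * \<beta>)) ^ N"
proof -
  let ?M = "iid (label S)"
  interpret prob_space ?M by (rule prob_space_iid)
  define P where "P aw \<longleftrightarrow> length aw = N \<and> \<not> pal (map fst aw) \<and> \<beta> / 4 * N \<le> nbits (Suc n) (map fst aw) \<and>
      card (pre_unresolved n aw) \<le> \<beta> / 32 * N \<and> (\<exists>i<N. \<nexists>c. resolved (Suc n) aw i c)" for aw
  define F :: "site list \<Rightarrow> real" where "F aw = of_bool (P aw)" for aw
  let ?E = "{\<omega>. cell (Suc n) (field \<omega>) a N \<and> P (wd (field \<omega>) a N)}"
  have "emeasure ?M ?E = (\<integral>\<^sup>+\<omega>. indicator ?E \<omega> \<partial>?M)" by simp
  also have "\<dots> = (\<integral>\<^sup>+\<omega>. indicator {\<omega>. cell (Suc n) (field \<omega>) a N} \<omega> * ennreal (F (wd (field \<omega>) a N)) \<partial>?M)"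
    by (intro nn_integral_cong) (auto simp: indicator_def F_def)
  also have "\<dots> \<le> ennreal ((2 powr (- (3 / 16) * \<beta>)) ^ N) * emeasure ?M {\<omega>. cell (Suc n) (field \<omega>) a N}"
  proof (rule nn_integral_cell_le)
    show "F aw = F aw'" if "list_all2 site_eq aw aw'" for aw aw'
      unfolding F_def P_def resolved_site_eq[OF that] pre_unresolved_site_eq[OF that] site_eqD(2,3)[OF that] ..
    fix w :: "sty list" assume w: "length w = N" "thick w"
    have "Avg N (\<lambda>dw. F (zip w dw)) = Avg N (\<lambda>dw. of_bool (\<not> pal w \<and> \<beta> / 4 * N \<le> nbits (Suc n) w \<and>
      card (pre_unresolved n (zip w dw)) \<le> \<beta> / 32 * N \<and> (\<exists>i<N. \<nexists>c. resolved (Suc n) (zip w dw) i c)))"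
      using w by (intro Avg_cong) (simp add: F_def P_def)
    then show "Avg N (\<lambda>dw. F (zip w dw)) \<le> (2 powr (- (3 / 16) * \<beta>)) ^ N"
      using Avg_bad_le[OF q \<beta> w, of n] by simp
  qed (auto simp: F_def)
  also have "\<dots> \<le> ennreal ((2 powr (- (3 / 16) * \<beta>)) ^ N) * 1"
    by (intro mult_left_mono) (auto simp: emeasure_le_1)
  finally have "measure ?M ?E \<le> (2 powr (- (3 / 16) * \<beta>)) ^ N"
    by (simp add: emeasure_eq_measure)
  then show ?thesis by (simp add: P_def Let_def)
qed

text \<open>A cell fails only in one of four events: too many sites are open after level
  \<open>n\<close> (\<open>A1\<close>), there are too few bits (\<open>A2\<close>), the bits lie
  symmetrically (\<open>A3\<close>), or the bits do not determine the word (\<open>A4\<close>). Each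
  is exponentially unlikely in the length, with constants that do not depend on
  \<open>S\<close>.\<close>

lemma cell_failure:
  assumes q: "1 \<le> q" "q \<le> 4" and \<beta>: "0 < \<beta>" "\<beta> \<le> 1 / 2"
  shows "\<exists>C \<rho>. 0 \<le> C \<and> 0 < \<rho> \<and> \<rho> < 1 \<and> (\<forall>S. pmf S (Bit (Suc n)) = \<beta> \<longrightarrow> tail 0 S \<le> 1 / 4 \<longrightarrow>
     wprob (2 * R + 5) (label S) (\<lambda>l. \<not> loc_res n R l) \<le> \<beta> / 64 \<longrightarrow>
     (\<forall>a N. measure (iid (label S)) {\<omega>. cell (Suc n) (field \<omega>) a N \<and>
        (\<exists>i<length (wd (field \<omega>) a N). \<nexists>c. resolved (Suc n) (wd (field \<omega>) a N) i c)} \<le> C * \<rho> ^ N))"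
proof -
  obtain C1 \<rho>1 where 1: "0 \<le> C1" "0 < \<rho>1" "\<rho>1 < 1"
    "\<forall>(p :: nat pmf) Q N. wprob (2 * R + 5) p Q \<le> \<beta> / 64 \<longrightarrow>
      wprob (N + (2 * R + 5)) p (\<lambda>l. \<beta> / 32 * N \<le> card {k. k < N \<and> Q (take (2 * R + 5) (drop k l))}) \<le> C1 * \<rho>1 ^ N"
  proof -
    \<comment> \<open>Sites are open with probability at most \<open>\<beta> / 64\<close>, while a
      fraction \<open>\<beta> / 32\<close> of them is tolerated.\<close>
    have "0 < 2 * R + 5" "0 < \<beta> / 64" "\<beta> / 64 < \<beta> / 32" using \<beta> by auto
    from large_deviations[OF this, where 'a=nat] that show ?thesis by blast
  qed
  obtain C2 \<rho>2 where 2: "0 \<le> C2" "0 < \<rho>2" "\<rho>2 < 1"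
    "\<forall>(p :: nat pmf) Q N. wprob 3 p Q \<le> 1 - \<beta> / 2 \<longrightarrow>
      wprob (N + 3) p (\<lambda>l. (1 - \<beta> / 4) * N \<le> card {k. k < N \<and> Q (take 3 (drop k l))}) \<le> C2 * \<rho>2 ^ N"
  proof -
    \<comment> \<open>Bits have a rate of at least \<open>\<beta> / 2\<close>, while a fraction
      \<open>\<beta> / 4\<close> is enough.\<close>
    have "0 < (3 :: nat)" "0 < 1 - \<beta> / 2" "1 - \<beta> / 2 < 1 - \<beta> / 4" using \<beta> by auto
    from large_deviations[OF this, where 'a=nat] that show ?thesis by blast
  qed
  define x where "x = 1 - \<beta> / 2"
  have x: "0 < x" "x < 1" using \<beta> by (auto simp: x_def)
  define \<rho>3 where "\<rho>3 = x powr (1 / 6)"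
  have \<rho>3: "0 < \<rho>3" "\<rho>3 < 1" using x powr_less_mono2[of "1 / 6" x 1] by (auto simp: \<rho>3_def)
  define \<rho>4 where "\<rho>4 = 2 powr (- (3 / 16) * \<beta>)"
  have \<rho>4: "0 < \<rho>4" "\<rho>4 < 1" using \<beta> powr_less_mono[of "- (3 / 16) * \<beta>" 0 2] by (auto simp: \<rho>4_def)
  define C where "C = C1 + C2 + 1 / x + 1"
  define \<rho> where "\<rho> = Max {\<rho>1, \<rho>2, \<rho>3, \<rho>4}"
  have \<rho>: "\<rho>1 \<le> \<rho>" "\<rho>2 \<le> \<rho>" "\<rho>3 \<le> \<rho>" "\<rho>4 \<le> \<rho>" "0 < \<rho>" "\<rho> < 1"
    using 1 2 \<rho>3 \<rho>4 by (auto simp: \<rho>_def)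
  have "measure (iid (label S)) {\<omega>. cell (Suc n) (field \<omega>) a N \<and>
        (\<exists>i<length (wd (field \<omega>) a N). \<nexists>c. resolved (Suc n) (wd (field \<omega>) a N) i c)} \<le> C * \<rho> ^ N"
    if S: "pmf S (Bit (Suc n)) = \<beta>" "tail 0 S \<le> 1 / 4" "wprob (2 * R + 5) (label S) (\<lambda>l. \<not> loc_res n R l) \<le> \<beta> / 64"
    for S a N
  proof -
    let ?M = "iid (label S)"
    interpret prob_space ?M by (rule prob_space_iid)
    let ?b = "\<lambda>l. fst (site3 (l ! 0) (l ! 1) (l ! 2)) = Bit (Suc n)"
    define A1 where "A1 = {\<omega>. \<beta> / 32 * N \<le> card {k. k < N \<and> \<not> loc_res n R (take (2 * R + 5) (drop k (wd \<omega> (a - int R - 2) (N + (2 * R + 5)))))}}"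
    define A2 where "A2 = {\<omega>. (1 - \<beta> / 4) * N \<le> card {k. k < N \<and> \<not> ?b (take 3 (drop k (wd \<omega> (a - 1) (N + 3))))}}"
    define A3 where "A3 = {\<omega>. \<forall>k<N. ?b (take 3 (drop k (wd \<omega> (a - 1) (N + 2)))) = ?b (take 3 (drop (N - 1 - k) (wd \<omega> (a - 1) (N + 2))))}"
    define A4 where "A4 = {\<omega>. cell (Suc n) (field \<omega>) a N \<and>
      (let aw = wd (field \<omega>) a N in \<not> pal (map fst aw) \<and> \<beta> / 4 * N \<le> nbits (Suc n) (map fst aw) \<and>
      card (pre_unresolved n aw) \<le> \<beta> / 32 * N \<and> (\<exists>i<N. \<nexists>c. resolved (Suc n) aw i c))}"
    note wb = wprob_fst_site3_neq[OF \<beta>(1) S(1,2)]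
    have sets: "A1 \<in> sets ?M" "A2 \<in> sets ?M" "A3 \<in> sets ?M" "A4 \<in> sets ?M"
    proof -
      show "A1 \<in> sets ?M" unfolding A1_def by (rule sets_wd)
      show "A2 \<in> sets ?M" unfolding A2_def by (rule sets_wd)
      show "A3 \<in> sets ?M" unfolding A3_def by (rule sets_wd)
      show "A4 \<in> sets ?M" unfolding A4_def by (rule sets_cell_field)
    qed
    have m1: "measure ?M A1 \<le> C1 * \<rho> ^ N"
    proof -
      have "measure ?M A1 = wprob (N + (2 * R + 5)) (label S) (\<lambda>l. \<beta> / 32 * N \<le> card {k. k < N \<and> \<not> loc_res n R (take (2 * R + 5) (drop k l))})"
        unfolding A1_def by (rule measure_wd)
      also have "\<dots> \<le> C1 * \<rho>1 ^ N" using 1(4) S(3) by blast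
      also have "\<dots> \<le> C1 * \<rho> ^ N" using 1 \<rho> by (intro mult_left_mono power_mono) auto
      finally show ?thesis .
    qed
    have m2: "measure ?M A2 \<le> C2 * \<rho> ^ N"
    proof -
      have "measure ?M A2 = wprob (N + 3) (label S) (\<lambda>l. (1 - \<beta> / 4) * N \<le> card {k. k < N \<and> \<not> ?b (take 3 (drop k l))})"
        unfolding A2_def by (rule measure_wd)
      also have "\<dots> \<le> C2 * \<rho>2 ^ N"
        using wb by (intro 2(4)[rule_format, where Q="\<lambda>l. \<not> ?b l"]) (simp add: wprob_not)
      also have "\<dots> \<le> C2 * \<rho> ^ N" using 2 \<rho> by (intro mult_left_mono power_mono) auto
      finally show ?thesis .
    qed
    have m3: "measure ?M A3 \<le> (1 / x) * \<rho> ^ N"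
    proof -
      have "measure ?M A3 = wprob (N + 2) (label S) (\<lambda>l. \<forall>k<N. ?b (take 3 (drop k l)) = ?b (take 3 (drop (N - 1 - k) l)))"
        unfolding A3_def by (rule measure_wd)
      also have "\<dots> \<le> (1 - \<beta> / 2) ^ (N div 6)" using wb \<beta> by (intro palindrome_bound) auto
      also have "\<dots> \<le> (1 / x) * \<rho>3 ^ N" using div6_bound[OF x, of N] by (simp add: x_def \<rho>3_def)
      also have "\<dots> \<le> (1 / x) * \<rho> ^ N" using x \<rho> \<rho>3 by (intro mult_left_mono power_mono) auto
      finally show ?thesis .
    qed
    have m4: "measure ?M A4 \<le> 1 * \<rho> ^ N"
    proof -
      have "measure ?M A4 \<le> \<rho>4 ^ N" unfolding A4_def \<rho>4_def by (rule cell_failure_impure[OF q \<beta>(1)])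
      also have "\<dots> \<le> \<rho> ^ N" using \<rho> \<rho>4 by (intro power_mono) auto
      finally show ?thesis by simp
    qed
    have "{\<omega>. cell (Suc n) (field \<omega>) a N \<and>
        (\<exists>i<length (wd (field \<omega>) a N). \<nexists>c. resolved (Suc n) (wd (field \<omega>) a N) i c)} \<subseteq> (A1 \<union> A2 \<union> A3) \<union> A4"
    proof (intro subsetI, rule ccontr)
      fix \<omega> assume \<omega>: "\<omega> \<in> {\<omega>. cell (Suc n) (field \<omega>) a N \<and>
          (\<exists>i<length (wd (field \<omega>) a N). \<nexists>c. resolved (Suc n) (wd (field \<omega>) a N) i c)}"
        and nA: "\<omega> \<notin> (A1 \<union> A2 \<union> A3) \<union> A4"
      let ?aw = "wd (field \<omega>) a N"
      have c: "cell (Suc n) (field \<omega>) a N" using \<omega> by simp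
      have b2: "?b (take 3 (drop k (wd \<omega> (a - 1) (N + 2)))) \<longleftrightarrow> fst (field \<omega> (a + int k)) = Bit (Suc n)" if "k < N" for k
        using site3_at[of k "N + 2" \<omega> a] that by (simp add: Let_def)
      have b3: "?b (take 3 (drop k (wd \<omega> (a - 1) (N + 3)))) \<longleftrightarrow> fst (field \<omega> (a + int k)) = Bit (Suc n)" if "k < N" for k
        using site3_at[of k "N + 3" \<omega> a] that by (simp add: Let_def)
      have "card (pre_unresolved n ?aw) \<le> \<beta> / 32 * N"
        using pre_unresolved_le[OF c, of R] nA by (simp add: A1_def)
      moreover have "\<beta> / 4 * N \<le> nbits (Suc n) (map fst ?aw)"
      proof (rule card_bits_ge)
        have "{k. k < N \<and> \<not> ?b (take 3 (drop k (wd \<omega> (a - 1) (N + 3))))} = {k. k < N \<and> fst (field \<omega> (a + int k)) \<noteq> Bit (Suc n)}"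
          using b3 by auto
        moreover have "\<omega> \<notin> A2" using nA by simp
        ultimately show "\<not> (1 - \<beta> / 4) * real N \<le> real (card {k. k < N \<and> fst (field \<omega> (a + int k)) \<noteq> Bit (Suc n)})"
          unfolding A2_def by simp
      qed
      moreover have "\<not> pal (map fst ?aw)"
      proof
        assume p: "pal (map fst ?aw)"
        have sym: "(fst (field \<omega> (a + int k)) = Bit (Suc n)) = (fst (field \<omega> (a + int (N - 1 - k))) = Bit (Suc n))" if k: "k < N" for k
        proof -
          have "map fst ?aw ! k = rev (map fst ?aw) ! k" using p by (simp add: pal_def)
          then show ?thesis using k by (simp add: rev_nth)
        qed
        have "\<omega> \<in> A3"
          unfolding A3_def
        proof (intro CollectI allI impI)
          fix k assume k: "k < N"
          then have "N - 1 - k < N" by simp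
          then show "?b (take 3 (drop k (wd \<omega> (a - 1) (N + 2)))) = ?b (take 3 (drop (N - 1 - k) (wd \<omega> (a - 1) (N + 2))))"
            using b2[OF k] b2[of "N - 1 - k"] sym[OF k] by (simp only:)
        qed
        then show False using nA by simp
      qed
      ultimately have "\<omega> \<in> A4" using \<omega> by (simp add: A4_def Let_def)
      then show False using nA by simp
    qed
    then have "measure ?M {\<omega>. cell (Suc n) (field \<omega>) a N \<and>
        (\<exists>i<length (wd (field \<omega>) a N). \<nexists>c. resolved (Suc n) (wd (field \<omega>) a N) i c)} \<le> measure ?M ((A1 \<union> A2 \<union> A3) \<union> A4)"
      using sets by (intro finite_measure_mono) auto
    also have "\<dots> \<le> measure ?M (A1 \<union> A2 \<union> A3) + measure ?M A4" using sets by (intro measure_Un_le) auto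
    also have "\<dots> \<le> C1 * \<rho> ^ N + C2 * \<rho> ^ N + (1 / x) * \<rho> ^ N + 1 * \<rho> ^ N"
      using measure_union_le3[OF sets(1-3)] m1 m2 m3 m4 by linarith
    also have "\<dots> = C * \<rho> ^ N" by (simp add: C_def algebra_simps)
    finally show ?thesis .
  qed
  moreover have "0 \<le> C" using 1 2 x by (simp add: C_def)
  ultimately show ?thesis using \<rho> by blast
qed

text \<open>The order of the quantifiers is the point: \<open>p\<close> depends on the radius
  \<open>R\<close> of level \<open>n\<close>, and \<open>R'\<close> on the cutter rate
  \<open>c\<close>, but neither depends on \<open>S\<close>. So \<open>c\<close> can be chosen
  before the rates of later levels are known.\<close>

lemma resolution_step:
  assumes q: "1 \<le> q" "q \<le> 4" and \<beta>: "0 < \<beta>" "\<beta> \<le> 1 / 2" and \<delta>: "\<delta> > 0"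
  shows "\<exists>p>0. \<forall>c. 0 < c \<longrightarrow> c \<le> p \<longrightarrow> (\<exists>R'. \<forall>S. pmf S (Bit (Suc n)) = \<beta> \<longrightarrow> tail 0 S \<le> 1 / 4 \<longrightarrow>
     c \<le> pmf S (Cut (Suc n)) \<longrightarrow> tail (Suc n) S \<le> 2 * c \<longrightarrow>
     wprob (2 * R + 5) (label S) (\<lambda>l. \<not> loc_res n R l) \<le> \<beta> / 64 \<longrightarrow>
     wprob (2 * R' + 5) (label S) (\<lambda>l. \<not> loc_res (Suc n) R' l) \<le> \<delta>)"
proof -
  obtain C \<rho> where C: "0 \<le> C" "0 < \<rho>" "\<rho> < 1" and fail: "\<And>S a N. pmf S (Bit (Suc n)) = \<beta> \<Longrightarrow> tail 0 S \<le> 1 / 4 \<Longrightarrow>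
     wprob (2 * R + 5) (label S) (\<lambda>l. \<not> loc_res n R l) \<le> \<beta> / 64 \<Longrightarrow>
     measure (iid (label S)) {\<omega>. cell (Suc n) (field \<omega>) a N \<and>
        (\<exists>i<length (wd (field \<omega>) a N). \<nexists>c. resolved (Suc n) (wd (field \<omega>) a N) i c)} \<le> C * \<rho> ^ N"
    using cell_failure[OF q \<beta>, of n R] by blast
  obtain p where p: "p > 0" "\<And>c. 0 < c \<Longrightarrow> c \<le> p \<Longrightarrow> \<exists>R. \<forall>S F n. c \<le> pmf S (Cut n) \<longrightarrow> tail n S \<le> 2 * c \<longrightarrow>
     (\<forall>a N. measure (iid (label S)) {\<omega>. cell n (field \<omega>) a N \<and> F (wd (field \<omega>) a N)} \<le> C * \<rho> ^ N) \<longrightarrow>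
     (\<exists>B\<in>sets (iid (label S)). measure (iid (label S)) B \<le> \<delta> \<and> (\<forall>\<omega>. \<omega> \<notin> B \<longrightarrow>
        (\<exists>i j. i \<le> R \<and> j \<le> R \<and> cell n (field \<omega>) (- int i) (i + j + 1) \<and> \<not> F (wd (field \<omega>) (- int i) (i + j + 1)))))"
    using origin_cell_good[OF C \<delta>] by blast
  show ?thesis
  proof (intro exI[of _ p] conjI p(1) allI impI)
    fix c assume c: "0 < c" "c \<le> p"
    obtain R' where R': "\<And>S F n. c \<le> pmf S (Cut n) \<Longrightarrow> tail n S \<le> 2 * c \<Longrightarrow>
     (\<forall>a N. measure (iid (label S)) {\<omega>. cell n (field \<omega>) a N \<and> F (wd (field \<omega>) a N)} \<le> C * \<rho> ^ N) \<Longrightarrow>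
     (\<exists>B\<in>sets (iid (label S)). measure (iid (label S)) B \<le> \<delta> \<and> (\<forall>\<omega>. \<omega> \<notin> B \<longrightarrow>
        (\<exists>i j. i \<le> R' \<and> j \<le> R' \<and> cell n (field \<omega>) (- int i) (i + j + 1) \<and> \<not> F (wd (field \<omega>) (- int i) (i + j + 1)))))"
      using p(2)[OF c] by blast
    show "\<exists>R'. \<forall>S. pmf S (Bit (Suc n)) = \<beta> \<longrightarrow> tail 0 S \<le> 1 / 4 \<longrightarrow>
     c \<le> pmf S (Cut (Suc n)) \<longrightarrow> tail (Suc n) S \<le> 2 * c \<longrightarrow>
     wprob (2 * R + 5) (label S) (\<lambda>l. \<not> loc_res n R l) \<le> \<beta> / 64 \<longrightarrow>
     wprob (2 * R' + 5) (label S) (\<lambda>l. \<not> loc_res (Suc n) R' l) \<le> \<delta>"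
    proof (intro exI[of _ R'] allI impI)
      fix S assume S: "pmf S (Bit (Suc n)) = \<beta>" "tail 0 S \<le> 1 / 4" "c \<le> pmf S (Cut (Suc n))" "tail (Suc n) S \<le> 2 * c"
        "wprob (2 * R + 5) (label S) (\<lambda>l. \<not> loc_res n R l) \<le> \<beta> / 64"
      let ?F = "\<lambda>aw. \<exists>i<length aw. \<nexists>c. resolved (Suc n) aw i c"
      obtain B where B: "B \<in> sets (iid (label S))" "measure (iid (label S)) B \<le> \<delta>"
        "\<And>\<omega>. \<omega> \<notin> B \<Longrightarrow> \<exists>i j. i \<le> R' \<and> j \<le> R' \<and> cell (Suc n) (field \<omega>) (- int i) (i + j + 1) \<and> \<not> ?F (wd (field \<omega>) (- int i) (i + j + 1))"
        using R'[of S "Suc n" ?F] S fail[OF S(1,2,5)] by blast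
      interpret prob_space "iid (label S)" by (rule prob_space_iid)
      have "{\<omega>. \<not> loc_res (Suc n) R' (wd \<omega> (- int R' - 2) (2 * R' + 5))} \<subseteq> B"
      proof (intro subsetI, rule ccontr)
        fix \<omega> assume \<omega>: "\<omega> \<in> {\<omega>. \<not> loc_res (Suc n) R' (wd \<omega> (- int R' - 2) (2 * R' + 5))}" "\<omega> \<notin> B"
        obtain i j where ij: "i \<le> R'" "j \<le> R'" "cell (Suc n) (field \<omega>) (- int i) (i + j + 1)" "\<not> ?F (wd (field \<omega>) (- int i) (i + j + 1))"
          using B(3)[OF \<omega>(2)] by blast
        moreover have "i < length (wd (field \<omega>) (- int i) (i + j + 1))" by simp
        ultimately obtain c where "resolved (Suc n) (wd (field \<omega>) (- int i) (i + j + 1)) i c" by blast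
        then have "loc_res (Suc n) R' (wd \<omega> (0 - int R' - 2) (2 * R' + 5))"
          unfolding loc_res_iff using ij by auto
        then show False using \<omega> by simp
      qed
      then have "measure (iid (label S)) {\<omega>. \<not> loc_res (Suc n) R' (wd \<omega> (- int R' - 2) (2 * R' + 5))} \<le> measure (iid (label S)) B"
        using B(1) by (rule finite_measure_mono)
      then show "wprob (2 * R' + 5) (label S) (\<lambda>l. \<not> loc_res (Suc n) R' l) \<le> \<delta>"
        using B(2) measure_wd[of "label S" "\<lambda>l. \<not> loc_res (Suc n) R' l"] by simp
    qed
  qed
qed

end

section \<open>Level 0: writing the supplied words\<close>

context coding begin

lemma sup_density_block:
  assumes "sup_density ws u > 0" "j < length ws" "j * (L + 2) + L \<le> length u" "r < L"
  shows "u ! (j * (L + 2) + r) = (ws ! j) ! r"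
  using assms
proof (induction ws arbitrary: u j)
  case (Cons w ws)
  have len: "\<not> length u < L" using Cons.prems(3) by simp
  have t: "take L u = w" and s: "sup_density ws (drop (L + 2) u) > 0"
    using Cons.prems(1) len nonneg[of w] sup_density_nonneg[of ws "drop (L + 2) u"]
    by (auto split: if_splits simp: zero_less_mult_iff)
  show ?case
  proof (cases j)
    case 0
    then show ?thesis using t Cons.prems(4) by auto
  next
    case (Suc j')
    have "drop (L + 2) u ! (j' * (L + 2) + r) = (ws ! j') ! r"
      using Cons.prems Suc s by (intro Cons.IH) auto
    then show ?thesis using Suc Cons.prems(3) len by (simp add: algebra_simps)
  qed
qed simp

text \<open>The second condition provides a word for every block. The third makes the cell so long
  that the at most \<open>L + 1\<close> letters after the last block are at most a fraction
  \<open>1 / L\<close> of it.\<close>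

definition good0 :: "site list \<Rightarrow> bool" where
  "good0 aw \<longleftrightarrow> \<not> pal (map fst aw) \<and> length aw div (L + 2) \<le> length (sups aw) \<and> L * (L + 1) \<le> length aw"

lemma sups_rev: "sups (List.rev aw) = List.rev (sups aw)"
  by (simp add: sups_def rev_filter rev_map)

lemma sup_resolved:
  fixes aw :: "site list"
  defines "fwd \<equiv> pick (map fst aw) = map fst aw"
  assumes g: "\<not> pal (map fst aw)" "length aw div (L + 2) \<le> length (sups aw)"
    and i: "i < (length aw div (L + 2)) * (L + 2)" "i mod (L + 2) < L"
  shows "\<exists>c. resolved 0 aw (if fwd then i else length aw - 1 - i) c"
proof -
  define j r where "j = i div (L + 2)" and "r = i mod (L + 2)"
  have ijr: "i = j * (L + 2) + r" unfolding j_def r_def by (rule mod_div_mult_eq[symmetric, unfolded add.commute[of "_ mod _"]])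
  have j: "j < length aw div (L + 2)" using i(1) by (simp add: j_def less_mult_imp_div_less)
  then have "(j + 1) * (L + 2) \<le> (length aw div (L + 2)) * (L + 2)" by (intro mult_le_mono1) simp
  also have "\<dots> \<le> length aw" by (rule div_times_less_eq_dividend)
  finally have jl: "j * (L + 2) + L \<le> length aw" by simp
  have iN: "i < length aw" using i(1) by (meson div_times_less_eq_dividend order.strict_trans2)
  define o' where "o' = (if fwd then aw else List.rev aw)"
  have js: "j < length (sups o')" using j g by (simp add: o'_def sups_rev)
  have "resolved 0 aw (if fwd then i else length aw - 1 - i) ((sups o' ! j) ! r)"
    unfolding resolved_def
  proof (intro conjI allI impI)
    show "(if fwd then i else length aw - 1 - i) < length aw" 
      using iN order.strict_trans1[OF le0 iN] by simp
    fix u assume u: "length u = length aw" "\<mu> u * dens 0 (zip aw u) > 0"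
    define ow where "ow = (if fwd then u else List.rev u)"
    have "orient (zip aw u) = zip o' ow"
      using u(1) by (simp add: orient_def str_zip o'_def ow_def fwd_def zip_rev)
    moreover have "length o' = length ow" using u(1) by (simp add: o'_def ow_def)
    ultimately have "dens 0 (zip aw u) = sup_density (sups o') ow"
      using g u(1) by (simp add: str_zip)
    then have "sup_density (sups o') ow > 0"
      using u(2) nonneg[of u] sup_density_nonneg[of "sups o'" ow] by (auto simp: zero_less_mult_iff)
    then have "ow ! i = (sups o' ! j) ! r"
      unfolding ijr using js jl i(2) u(1) by (intro sup_density_block) (auto simp: ow_def r_def)
    then show "u ! (if fwd then i else length aw - 1 - i) = (sups o' ! j) ! r"
      using iN u(1) by (auto simp: ow_def rev_nth)
  qed
  then show ?thesis by blast
qed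

text \<open>Only the two free letters after each block and the rest after the last one can be open:
  at most \<open>2 / L\<close> and \<open>1 / L\<close> of the cell.\<close>

lemma good0_unresolved:
  assumes "good0 aw"
  shows "real (card {i. i < length aw \<and> (\<nexists>c. resolved 0 aw i c)}) \<le> 3 / L * length aw"
proof -
  let ?N = "length aw" let ?K = "length aw div (L + 2)"
  have g: "\<not> pal (map fst aw)" "?K \<le> length (sups aw)" "L * (L + 1) \<le> ?N"
    using assms by (auto simp: good0_def)
  define fwd where "fwd \<longleftrightarrow> pick (map fst aw) = map fst aw"
  define f where "f i = (if fwd then i else ?N - 1 - i)" for i
  let ?X = "(\<lambda>(j, e). j * (L + 2) + e) ` ({..<?K} \<times> {L, L + 1}) \<union> {?K * (L + 2)..<?N}"
  have "{i. i < ?N \<and> (\<nexists>c. resolved 0 aw i c)} \<subseteq> f ` ?X"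
  proof
    fix i assume i: "i \<in> {i. i < ?N \<and> (\<nexists>c. resolved 0 aw i c)}"
    then have fi: "f (f i) = i" "f i < ?N" by (auto simp: f_def)
    have "f i \<in> ?X"
    proof (cases "f i < ?K * (L + 2)")
      case True
      then have "\<not> f i mod (L + 2) < L"
        using sup_resolved[OF g(1,2), of "f i"] i fi by (auto simp: f_def fwd_def split: if_splits)
      moreover have "f i mod (L + 2) < L + 2" by simp
      moreover have "x \<in> {L, L + 1}" if "\<not> x < L" "x < L + 2" for x using that by auto
      ultimately have "f i mod (L + 2) \<in> {L, L + 1}" by blast
      moreover have "f i div (L + 2) < ?K" using True by (simp add: less_mult_imp_div_less)
      moreover have "f i = f i div (L + 2) * (L + 2) + f i mod (L + 2)" by (simp only: div_mult_mod_eq)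
      ultimately have "f i \<in> (\<lambda>(j, e). j * (L + 2) + e) ` ({..<?K} \<times> {L, L + 1})"
        by (intro image_eqI[of _ _ "(f i div (L + 2), f i mod (L + 2))"]) auto
      then show ?thesis by blast
    qed (use fi in auto)
    then show "i \<in> f ` ?X" using fi by (metis imageI)
  qed
  then have "card {i. i < ?N \<and> (\<nexists>c. resolved 0 aw i c)} \<le> card (f ` ?X)" by (intro card_mono) auto
  also have "\<dots> \<le> card ?X" by (intro card_image_le) auto
  also have "\<dots> \<le> card ((\<lambda>(j, e). j * (L + 2) + e) ` ({..<?K} \<times> {L, L + 1})) + card {?K * (L + 2)..<?N}" by (rule card_Un_le)
  also have "card ((\<lambda>(j, e). j * (L + 2) + e) ` ({..<?K} \<times> {L, L + 1})) \<le> card ({..<?K} \<times> {L, L + 1})" by (intro card_image_le) auto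
  also have "card ({..<?K} \<times> {L, L + 1}) = 2 * ?K" by (simp add: card_cartesian_product)
  also have "card {?K * (L + 2)..<?N} \<le> L + 1"
  proof -
    have "card {?K * (L + 2)..<?N} = ?N mod (L + 2)"
      by (simp only: card_atLeastLessThan minus_div_mult_eq_mod)
    moreover have "?N mod (L + 2) < L + 2" by simp
    ultimately show ?thesis by linarith
  qed
  finally have "real (card {i. i < ?N \<and> (\<nexists>c. resolved 0 aw i c)}) \<le> real (2 * ?K + (L + 1))" by simp
  also have "\<dots> \<le> 2 / L * ?N + 1 / L * ?N"
  proof -
    have "?K * (L + 2) \<le> ?N" by (rule div_times_less_eq_dividend)
    then have "?K * L \<le> ?N" by (simp add: algebra_simps)
    then have "real ?K * L \<le> ?N" by (metis of_nat_le_iff of_nat_mult)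
    then have "2 * real ?K \<le> 2 / L * ?N" using L by (simp add: field_simps)
    moreover have "real (L * (L + 1)) \<le> ?N" using g(3) by (simp only: of_nat_le_iff)
    then have "real (L + 1) \<le> 1 / L * ?N" using L by (simp add: field_simps)
    ultimately show ?thesis by simp
  qed
  finally show ?thesis by (simp add: field_simps)
qed

lemma label_Sup_valid:
  assumes "x \<in> set_pmf (label S)" "fst (dec x) = Sup" shows "valid (fst (snd (dec x)))"
proof -
  obtain s w b where x: "x = to_nat (mask (s, w, b))" "w \<in> set_pmf word_pmf"
    using assms(1) by (auto simp: label_def data_pmf_def)
  then have "s = Sup" using assms(2) by simp
  moreover have "valid w" using x(2) nonneg[of w] by (auto simp: set_pmf_iff pmf_word_pmf valid_def split: if_splits)
  ultimately show ?thesis using x by (simp add: mask_def)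
qed

lemma wprob_sup_site:
  "wprob 3 (label S) (\<lambda>l. fst (site3 (l ! 0) (l ! 1) (l ! 2)) = Sup \<and> valid (fst (snd (site3 (l ! 0) (l ! 1) (l ! 2)))))
    = pmf S Sup * (1 - tail 0 S) ^ 2"
proof -
  have "wprob 3 (label S) (\<lambda>l. fst (site3 (l ! 0) (l ! 1) (l ! 2)) = Sup \<and> valid (fst (snd (site3 (l ! 0) (l ! 1) (l ! 2)))))
    = wprob 3 (label S) (\<lambda>l. fst (site3 (l ! 0) (l ! 1) (l ! 2)) = Sup)"
    unfolding wprob_def
  proof (intro measure_pmf.finite_measure_eq_AE)
    show "AE x in replicate_pmf 3 (label S). (x \<in> {l. fst (site3 (l ! 0) (l ! 1) (l ! 2)) = Sup \<and> valid (fst (snd (site3 (l ! 0) (l ! 1) (l ! 2))))})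
       = (x \<in> {l. fst (site3 (l ! 0) (l ! 1) (l ! 2)) = Sup})"
      unfolding AE_measure_pmf_iff
    proof
      fix l assume "l \<in> set_pmf (replicate_pmf 3 (label S))"
      then have "l ! 1 \<in> set_pmf (label S)" by (auto simp: set_replicate_pmf in_lists_conv_set)
      moreover have "fst (dec (l ! 1)) = Sup" if "fst (site3 (l ! 0) (l ! 1) (l ! 2)) = Sup"
        using that by (simp add: site3_def wall_eq_not_cut)
      ultimately show "(l \<in> {l. fst (site3 (l ! 0) (l ! 1) (l ! 2)) = Sup \<and> valid (fst (snd (site3 (l ! 0) (l ! 1) (l ! 2))))})
         = (l \<in> {l. fst (site3 (l ! 0) (l ! 1) (l ! 2)) = Sup})"
        using label_Sup_valid[of "l ! 1" S] by (auto simp: site3_def)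
    qed
  qed auto
  also have "\<dots> = pmf S Sup * (1 - tail 0 S) ^ 2" by (rule wprob_site3) simp
  finally show ?thesis .
qed

text \<open>Supplies occur at a rate of at least \<open>1 / (L + 1)\<close>, slightly more than the
  \<open>1 / (L + 2)\<close> at which blocks consume them. The upper bound \<open>1 / L\<close>
  serves the estimate for palindromes.\<close>

lemma sup_rate:
  assumes "pmf S Sup = 1 / L" "tail 0 S \<le> 1 / (2 * (L + 1))"
  shows "pmf S Sup * (1 - tail 0 S) ^ 2 \<in> {1 / (L + 1)..1 / L}"
proof -
  have "1 - 2 * tail 0 S \<le> (1 - tail 0 S) ^ 2" by (simp add: power2_eq_square algebra_simps)
  moreover have "real L / (L + 1) = 1 - 1 / (L + 1)" by (simp add: field_simps)
  moreover have "2 * tail 0 S \<le> 1 / (L + 1)" using assms(2) by (simp add: field_simps)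
  ultimately have "real L / (L + 1) \<le> (1 - tail 0 S) ^ 2" by linarith
  then have "1 / L * (real L / (L + 1)) \<le> 1 / L * (1 - tail 0 S) ^ 2" by (intro mult_left_mono) auto
  moreover have "(1 - tail 0 S) ^ 2 \<le> 1 ^ 2" by (intro power_mono) auto
  then have "1 / L * (1 - tail 0 S) ^ 2 \<le> 1 / L * 1" by (intro mult_left_mono) auto
  ultimately show ?thesis using assms(1) L by simp
qed

lemma cell_failure0:
  assumes L2: "L \<ge> 2"
  shows "\<exists>C \<rho>. 0 \<le> C \<and> 0 < \<rho> \<and> \<rho> < 1 \<and> (\<forall>S. pmf S Sup = 1 / L \<longrightarrow> tail 0 S \<le> 1 / (2 * (L + 1)) \<longrightarrow>
     (\<forall>a N. measure (iid (label S)) {\<omega>. cell 0 (field \<omega>) a N \<and> \<not> good0 (wd (field \<omega>) a N)} \<le> C * \<rho> ^ N))"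
proof -
  \<comment> \<open>If fewer than a fraction \<open>t\<close> of the sites fail to be supplies,
    there is a supply for each of the \<open>N div (L + 2)\<close> blocks. Each site fails with
    probability at most \<open>1 - 1 / (L + 1)\<close>, which is below \<open>t\<close>.\<close>
  define t :: real where "t = 1 - 1 / (L + 2)"
  obtain C2 \<rho>2 where 2: "0 \<le> C2" "0 < \<rho>2" "\<rho>2 < 1"
    "\<forall>(p :: nat pmf) Q N. wprob 3 p Q \<le> 1 - 1 / (L + 1) \<longrightarrow>
      wprob (N + 3) p (\<lambda>l. t * N \<le> card {k. k < N \<and> Q (take 3 (drop k l))}) \<le> C2 * \<rho>2 ^ N"
  proof -
    have "0 < (3 :: nat)" "0 < 1 - 1 / real (L + 1)" "1 - 1 / real (L + 1) < t" using L by (auto simp: field_simps t_def)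
    from large_deviations[OF this, where 'a=nat] that show ?thesis by auto
  qed
  define x where "x = 1 - 1 / real (L + 1)"
  have x: "0 < x" "x < 1" using L by (auto simp: x_def field_simps)
  define \<rho>3 where "\<rho>3 = x powr (1 / 6)"
  have \<rho>3: "0 < \<rho>3" "\<rho>3 < 1" using x powr_less_mono2[of "1 / 6" x 1] by (auto simp: \<rho>3_def)
  define \<rho> where "\<rho> = max \<rho>2 \<rho>3"
  have \<rho>: "\<rho>2 \<le> \<rho>" "\<rho>3 \<le> \<rho>" "0 < \<rho>" "\<rho> < 1" using 2 \<rho>3 by (auto simp: \<rho>_def)
  \<comment> \<open>The last term covers the cells that are too short to be good: for
    \<open>N < L * (L + 1)\<close> it makes the bound at least 1.\<close>
  define C where "C = C2 + 1 / x + (1 / \<rho>) ^ (L * (L + 1))"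
  have "measure (iid (label S)) {\<omega>. cell 0 (field \<omega>) a N \<and> \<not> good0 (wd (field \<omega>) a N)} \<le> C * \<rho> ^ N"
    if S: "pmf S Sup = 1 / L" "tail 0 S \<le> 1 / (2 * (L + 1))" for S a N
  proof -
    let ?M = "iid (label S)"
    interpret prob_space ?M by (rule prob_space_iid)
    show ?thesis
    proof (cases "N < L * (L + 1)")
      case True
      have "measure ?M {\<omega>. cell 0 (field \<omega>) a N \<and> \<not> good0 (wd (field \<omega>) a N)} \<le> 1" by simp
      also have "1 \<le> (1 / \<rho>) ^ (L * (L + 1) - N)" using \<rho> by (intro one_le_power) auto
      also have "\<dots> = (1 / \<rho>) ^ (L * (L + 1)) * \<rho> ^ N"
        using True \<rho> by (simp add: power_diff power_one_over field_simps)
      also have "\<dots> \<le> C * \<rho> ^ N"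
        unfolding C_def using 2 x \<rho> by (intro mult_right_mono) auto
      finally show ?thesis .
    next
      case False
      let ?s = "\<lambda>l. site3 (l ! 0) (l ! 1) (l ! 2)"
      let ?b = "\<lambda>l. fst (?s l) = Sup" and ?v = "\<lambda>l. fst (?s l) = Sup \<and> valid (fst (snd (?s l)))"
      define A2 where "A2 = {\<omega>. t * N \<le> card {k. k < N \<and> \<not> ?v (take 3 (drop k (wd \<omega> (a - 1) (N + 3))))}}"
      define A3 where "A3 = {\<omega>. \<forall>k<N. ?b (take 3 (drop k (wd \<omega> (a - 1) (N + 2)))) = ?b (take 3 (drop (N - 1 - k) (wd \<omega> (a - 1) (N + 2))))}"
      have sets: "A2 \<in> sets ?M" "A3 \<in> sets ?M"
      proof -
        show "A2 \<in> sets ?M" unfolding A2_def by (rule sets_wd)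
        show "A3 \<in> sets ?M" unfolding A3_def by (rule sets_wd)
      qed
      have m2: "measure ?M A2 \<le> C2 * \<rho> ^ N"
      proof -
        have "measure ?M A2 = wprob (N + 3) (label S) (\<lambda>l. t * N \<le> card {k. k < N \<and> \<not> ?v (take 3 (drop k l))})"
          unfolding A2_def by (rule measure_wd)
        also have "\<dots> \<le> C2 * \<rho>2 ^ N"
          using sup_rate[OF S] by (intro 2(4)[rule_format, where Q="\<lambda>l. \<not> ?v l"]) (simp only: wprob_not wprob_sup_site, simp)
        also have "\<dots> \<le> C2 * \<rho> ^ N" using 2 \<rho> by (intro mult_left_mono power_mono) auto
        finally show ?thesis .
      qed
      have m3: "measure ?M A3 \<le> (1 / x) * \<rho> ^ N"
      proof -
        have wb: "wprob 3 (label S) ?b \<in> {1 / (L + 1)..1 / L}" using sup_rate[OF S] wprob_site3[of Sup S] by simp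
        have half: "1 / real L \<le> 1 / 2" using L2 by (simp add: field_simps)
        have "measure ?M A3 = wprob (N + 2) (label S) (\<lambda>l. \<forall>k<N. ?b (take 3 (drop k l)) = ?b (take 3 (drop (N - 1 - k) l)))"
          unfolding A3_def by (rule measure_wd)
        also have "\<dots> \<le> (1 - 1 / (L + 1)) ^ (N div 6)"
          using wb half by (intro palindrome_bound) auto
        also have "\<dots> \<le> (1 / x) * \<rho>3 ^ N" using div6_bound[OF x, of N] by (simp add: x_def \<rho>3_def)
        also have "\<dots> \<le> (1 / x) * \<rho> ^ N" using x \<rho> \<rho>3 by (intro mult_left_mono power_mono) auto
        finally show ?thesis .
      qed
      have "{\<omega>. cell 0 (field \<omega>) a N \<and> \<not> good0 (wd (field \<omega>) a N)} \<subseteq> A2 \<union> A3"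
      proof (intro subsetI, rule ccontr)
        fix \<omega> assume \<omega>: "\<omega> \<in> {\<omega>. cell 0 (field \<omega>) a N \<and> \<not> good0 (wd (field \<omega>) a N)}" and nA: "\<omega> \<notin> A2 \<union> A3"
        let ?aw = "wd (field \<omega>) a N"
        have b2: "?s (take 3 (drop k (wd \<omega> (a - 1) (N + 2)))) = field \<omega> (a + int k)" if "k < N" for k
          using site3_at[of k "N + 2" \<omega> a] that by (simp add: Let_def)
        have b3: "?s (take 3 (drop k (wd \<omega> (a - 1) (N + 3)))) = field \<omega> (a + int k)" if "k < N" for k
          using site3_at[of k "N + 3" \<omega> a] that by (simp add: Let_def)
        let ?g = "\<lambda>e. fst e = Sup \<and> valid (fst (snd e))"
        have ls: "length (sups ?aw) = card {k. k < N \<and> ?g (field \<omega> (a + int k))}"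
          unfolding sups_def length_map length_filter_conv_card by (intro arg_cong[of _ _ card]) auto
        have "card {k. k < N \<and> ?g (field \<omega> (a + int k))} + card {k. k < N \<and> \<not> ?g (field \<omega> (a + int k))} = N"
        proof -
          have "{k. k < N \<and> ?g (field \<omega> (a + int k))} \<union> {k. k < N \<and> \<not> ?g (field \<omega> (a + int k))} = {..<N}" by auto
          then show ?thesis by (subst card_Un_disjoint[symmetric]) auto
        qed
        moreover have "{k. k < N \<and> \<not> ?v (take 3 (drop k (wd \<omega> (a - 1) (N + 3))))} = {k. k < N \<and> \<not> ?g (field \<omega> (a + int k))}"
          using b3 by auto
        then have "real (card {k. k < N \<and> \<not> ?g (field \<omega> (a + int k))}) < t * N" using nA by (simp add: A2_def)
        ultimately have "real N - t * N \<le> length (sups ?aw)" unfolding ls by linarith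
        moreover have "real (N div (L + 2)) \<le> real N - t * N"
          using of_nat_div_le_of_nat[of N "L + 2", where 'a=real] by (simp add: t_def algebra_simps)
        ultimately have "N div (L + 2) \<le> length (sups ?aw)" by linarith
        then have "pal (map fst ?aw)" using \<omega> False by (auto simp: good0_def)
        have sym: "(fst (field \<omega> (a + int k)) = Sup) = (fst (field \<omega> (a + int (N - 1 - k))) = Sup)" if k: "k < N" for k
        proof -
          have "map fst ?aw ! k = rev (map fst ?aw) ! k" using \<open>pal (map fst ?aw)\<close> by (simp add: pal_def)
          then show ?thesis using k by (simp add: rev_nth)
        qed
        have "\<omega> \<in> A3"
          unfolding A3_def
        proof (intro CollectI allI impI)
          fix k assume k: "k < N"
          then have "N - 1 - k < N" by simp
          then show "?b (take 3 (drop k (wd \<omega> (a - 1) (N + 2)))) = ?b (take 3 (drop (N - 1 - k) (wd \<omega> (a - 1) (N + 2))))"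
            using b2[OF k] b2[of "N - 1 - k"] sym[OF k] by (simp only:)
        qed
        then show False using nA by simp
      qed
      then have "measure ?M {\<omega>. cell 0 (field \<omega>) a N \<and> \<not> good0 (wd (field \<omega>) a N)} \<le> measure ?M (A2 \<union> A3)"
        using sets by (intro finite_measure_mono) auto
      also have "\<dots> \<le> measure ?M A2 + measure ?M A3" using sets by (intro measure_Un_le) auto
      also have "\<dots> \<le> C2 * \<rho> ^ N + (1 / x) * \<rho> ^ N" using m2 m3 by simp
      also have "\<dots> = (C2 + 1 / x) * \<rho> ^ N" by (simp add: distrib_right)
      also have "\<dots> \<le> C * \<rho> ^ N" unfolding C_def using \<rho> by (intro mult_right_mono) auto
      finally show ?thesis .
    qed
  qed
  moreover have "0 \<le> C" using 2 x \<rho> by (simp add: C_def)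
  ultimately show ?thesis using \<rho> by blast
qed

lemma sum_wprob_le:
  fixes p :: "'a pmf" and Q :: "'i \<Rightarrow> 'a list \<Rightarrow> bool"
  assumes "finite I" "c \<ge> 0" "\<And>l. length l = n \<Longrightarrow> real (card {i\<in>I. Q i l}) \<le> c * of_bool (P l)"
  shows "(\<Sum>i\<in>I. wprob n p (Q i)) \<le> c * wprob n p P"
proof -
  have "ennreal (\<Sum>i\<in>I. wprob n p (Q i)) = (\<Sum>i\<in>I. \<integral>\<^sup>+l. indicator {l. Q i l} l \<partial>replicate_pmf n p)"
    by (subst sum_ennreal[symmetric]) (simp_all only: wprob_ennreal wprob_nonneg)
  also have "\<dots> = (\<integral>\<^sup>+l. (\<Sum>i\<in>I. indicator {l. Q i l} l) \<partial>replicate_pmf n p)"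
    by (rule nn_integral_sum[symmetric]) auto
  also have "\<dots> \<le> (\<integral>\<^sup>+l. ennreal c * indicator {l. P l} l \<partial>replicate_pmf n p)"
  proof (rule nn_integral_replicate_pmf_mono)
    fix l :: "'a list" assume l: "length l = n"
    have "(\<Sum>i\<in>I. indicator {l. Q i l} l :: ennreal) = ennreal (real (card {i\<in>I. Q i l}))"
      using assms(1) by (simp add: indicator_def sum.If_cases Int_def ennreal_of_nat_eq_real_of_nat)
    also have "\<dots> \<le> ennreal (c * of_bool (P l))" by (intro ennreal_leI assms(3) l)
    also have "\<dots> = ennreal c * indicator {l. P l} l" by (simp add: indicator_def)
    finally show "(\<Sum>i\<in>I. indicator {l. Q i l} l :: ennreal) \<le> ennreal c * indicator {l. P l} l" .
  qed
  also have "\<dots> = ennreal (c * wprob n p P)"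
    using assms(2) by (simp add: nn_integral_cmult wprob_def measure_pmf.emeasure_eq_measure ennreal_mult)
  finally show ?thesis using assms(2) by simp
qed

text \<open>Mass transport: the probability that the origin is an unresolved site of a good cell is the
  average proportion of unresolved sites in good cells.\<close>

lemma unresolved_mass_transport:
  fixes S R
  defines "T i j \<equiv> {\<omega>. cell 0 (field \<omega>) (- int i) (i + j + 1) \<and> good0 (wd (field \<omega>) (- int i) (i + j + 1)) \<and>
      (\<nexists>c. resolved 0 (wd (field \<omega>) (- int i) (i + j + 1)) i c)}"
  shows "measure (iid (label S)) (\<Union>(i, j)\<in>{..R} \<times> {..R}. T i j) \<le> 3 / L"
proof -
  let ?M = "iid (label S)"
  interpret prob_space ?M by (rule prob_space_iid)
  define cw where "cw N l = cellw 0 N (map fst (fieldw (N + 2) l))" for N l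
  define f where "f N i l \<longleftrightarrow> cw N l \<and> good0 (take N (drop 1 (fieldw (N + 2) l))) \<and>
      (\<nexists>c. resolved 0 (take N (drop 1 (fieldw (N + 2) l))) i c)" for N i l
  have Tf: "T i j = {\<omega>. f (i + j + 1) i (wd \<omega> (- int i - 2) (i + j + 1 + 4))}" for i j
    unfolding T_def f_def cw_def cell_field_iff inner_wd_field by simp
  have Tsets: "T i j \<in> sets ?M" for i j unfolding Tf by (rule sets_wd)
  have Tm: "measure ?M (T i j) = wprob (i + j + 1 + 4) (label S) (f (i + j + 1) i)" for i j
    unfolding Tf by (rule measure_wd)
  let ?I = "Sigma {1..2 * R + 1} (\<lambda>N. {..<N})"
  have "measure ?M (\<Union>(i, j)\<in>{..R} \<times> {..R}. T i j) \<le> (\<Sum>(i, j)\<in>{..R} \<times> {..R}. measure ?M (T i j))"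
    unfolding case_prod_unfold using Tsets by (intro finite_measure_subadditive_finite) auto
  also have "\<dots> = (\<Sum>(N, i)\<in>(\<lambda>(i, j). (i + j + 1, i)) ` ({..R} \<times> {..R}). wprob (N + 4) (label S) (f N i))"
    by (subst sum.reindex) (auto simp: inj_on_def Tm intro!: sum.cong)
  also have "\<dots> \<le> (\<Sum>(N, i)\<in>?I. wprob (N + 4) (label S) (f N i))"
    by (intro sum_mono2) auto
  also have "\<dots> = (\<Sum>N\<in>{1..2 * R + 1}. \<Sum>i<N. wprob (N + 4) (label S) (f N i))"
    by (rule sum.Sigma[symmetric]) auto
  also have "\<dots> \<le> (\<Sum>N\<in>{1..2 * R + 1}. 3 / L * N * wprob (N + 4) (label S) (cw N))"
  proof (intro sum_mono sum_wprob_le)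
    fix N and l :: "nat list"
    show "real (card {i\<in>{..<N}. f N i l}) \<le> 3 / L * N * of_bool (cw N l)"
    proof (cases "cw N l \<and> good0 (take N (drop 1 (fieldw (N + 2) l)))")
      case True
      then show ?thesis using good0_unresolved[of "take N (drop 1 (fieldw (N + 2) l))"] by (simp add: f_def)
    next
      case False
      then have e: "{i\<in>{..<N}. f N i l} = {}" by (auto simp: f_def)
      show ?thesis unfolding e by simp
    qed
  qed auto
  \<comment> \<open>All placements of a cell of length \<open>N\<close> are equally likely, so
    \<open>N\<close> times this probability is the sum over the possible positions of the origin in
    the cell. These events are disjoint.\<close>
  also have "\<dots> = 3 / L * (\<Sum>N\<in>{1..2 * R + 1}. \<Sum>i<N. measure ?M {\<omega>. cell 0 (field \<omega>) (- int i) N})"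
  proof -
    have e: "measure ?M {\<omega>. cell 0 (field \<omega>) a N} = wprob (N + 4) (label S) (cw N)" for a N
      unfolding cell_field_iff cw_def by (rule measure_wd)
    show ?thesis by (simp only: e sum_constant card_lessThan sum_distrib_left mult.assoc)
  qed
  also have "(\<Sum>N\<in>{1..2 * R + 1}. \<Sum>i<N. measure ?M {\<omega>. cell 0 (field \<omega>) (- int i) N})
      = (\<Sum>x\<in>?I. measure ?M {\<omega>. cell 0 (field \<omega>) (- int (snd x)) (fst x)})"
    by (subst sum.Sigma) (auto simp: case_prod_unfold)
  also have "\<dots> = measure ?M (\<Union>x\<in>?I. {\<omega>. cell 0 (field \<omega>) (- int (snd x)) (fst x)})"
  proof (rule finite_measure_finite_Union[symmetric])
    show "disjoint_family_on (\<lambda>x. {\<omega>. cell 0 (field \<omega>) (- int (snd x)) (fst x)}) ?I"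
      unfolding disjoint_family_on_def
    proof (intro ballI impI, rule ccontr)
      fix x x' assume x: "x \<in> ?I" "x' \<in> ?I" "x \<noteq> x'"
        "{\<omega>. cell 0 (field \<omega>) (- int (snd x)) (fst x)} \<inter> {\<omega>. cell 0 (field \<omega>) (- int (snd x')) (fst x')} \<noteq> {}"
      then obtain \<omega> where "cell 0 (field \<omega>) (- int (snd x)) (fst x)" "cell 0 (field \<omega>) (- int (snd x')) (fst x')" by blast
      from cell_unique[OF this, of 0] x show False by (auto simp: prod_eq_iff)
    qed
  qed auto
  also have "3 / L * \<dots> \<le> 3 / L * 1" by (intro mult_left_mono) auto
  finally show ?thesis by simp
qed

text \<open>The bound consists of \<open>3 / L\<close> for open sites of good cells and
  \<open>1 / L\<close> for the exceptional set of \<open>origin_cell_good\<close>.\<close>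

lemma resolution_base:
  assumes L2: "L \<ge> 2"
  shows "\<exists>p>0. \<forall>c. 0 < c \<longrightarrow> c \<le> p \<longrightarrow> (\<exists>R. \<forall>S. pmf S Sup = 1 / L \<longrightarrow>
     c \<le> pmf S (Cut 0) \<longrightarrow> tail 0 S \<le> 2 * c \<longrightarrow>
     wprob (2 * R + 5) (label S) (\<lambda>l. \<not> loc_res 0 R l) \<le> 4 / L)"
proof -
  obtain C \<rho> where C: "0 \<le> C" "0 < \<rho>" "\<rho> < 1" and fail: "\<And>S a N. pmf S Sup = 1 / L \<Longrightarrow> tail 0 S \<le> 1 / (2 * (L + 1)) \<Longrightarrow>
     measure (iid (label S)) {\<omega>. cell 0 (field \<omega>) a N \<and> \<not> good0 (wd (field \<omega>) a N)} \<le> C * \<rho> ^ N"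
    using cell_failure0[OF L2] by blast
  have Lpos: "0 < 1 / real L" using L by simp
  obtain p where p: "p > 0" "\<And>c. 0 < c \<Longrightarrow> c \<le> p \<Longrightarrow> \<exists>R. \<forall>S F n. c \<le> pmf S (Cut n) \<longrightarrow> tail n S \<le> 2 * c \<longrightarrow>
     (\<forall>a N. measure (iid (label S)) {\<omega>. cell n (field \<omega>) a N \<and> F (wd (field \<omega>) a N)} \<le> C * \<rho> ^ N) \<longrightarrow>
     (\<exists>B\<in>sets (iid (label S)). measure (iid (label S)) B \<le> 1 / L \<and> (\<forall>\<omega>. \<omega> \<notin> B \<longrightarrow>
        (\<exists>i j. i \<le> R \<and> j \<le> R \<and> cell n (field \<omega>) (- int i) (i + j + 1) \<and> \<not> F (wd (field \<omega>) (- int i) (i + j + 1)))))"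
    using origin_cell_good[OF C Lpos] by blast
  show ?thesis
  \<comment> \<open>The second term of the minimum turns \<open>tail 0 S \<le> 2 * c\<close> into
    the bound on cutters that \<open>cell_failure0\<close> needs.\<close>
  proof (intro exI[of _ "min p (1 / (4 * real (L + 1)))"] conjI allI impI)
    show "0 < min p (1 / (4 * real (L + 1)))" using p(1) by simp
    fix c assume c: "0 < c" "c \<le> min p (1 / (4 * real (L + 1)))"
    then have cp: "c \<le> p" and c4: "2 * c \<le> 1 / (2 * (L + 1))" by (auto simp: field_simps)
    obtain R where R: "\<And>S F n. c \<le> pmf S (Cut n) \<Longrightarrow> tail n S \<le> 2 * c \<Longrightarrow>
     (\<forall>a N. measure (iid (label S)) {\<omega>. cell n (field \<omega>) a N \<and> F (wd (field \<omega>) a N)} \<le> C * \<rho> ^ N) \<Longrightarrow>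
     (\<exists>B\<in>sets (iid (label S)). measure (iid (label S)) B \<le> 1 / L \<and> (\<forall>\<omega>. \<omega> \<notin> B \<longrightarrow>
        (\<exists>i j. i \<le> R \<and> j \<le> R \<and> cell n (field \<omega>) (- int i) (i + j + 1) \<and> \<not> F (wd (field \<omega>) (- int i) (i + j + 1)))))"
      using p(2)[OF c(1) cp] by blast
    show "\<exists>R. \<forall>S. pmf S Sup = 1 / L \<longrightarrow> c \<le> pmf S (Cut 0) \<longrightarrow> tail 0 S \<le> 2 * c \<longrightarrow>
       wprob (2 * R + 5) (label S) (\<lambda>l. \<not> loc_res 0 R l) \<le> 4 / L"
    proof (intro exI[of _ R] allI impI)
      fix S assume S: "pmf S Sup = 1 / L" "c \<le> pmf S (Cut 0)" "tail 0 S \<le> 2 * c"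
      let ?M = "iid (label S)"
      interpret prob_space ?M by (rule prob_space_iid)
      have t: "tail 0 S \<le> 1 / (2 * (L + 1))" using S(3) c4 by linarith
      obtain B where B: "B \<in> sets ?M" "measure ?M B \<le> 1 / L"
        "\<And>\<omega>. \<omega> \<notin> B \<Longrightarrow> \<exists>i j. i \<le> R \<and> j \<le> R \<and> cell 0 (field \<omega>) (- int i) (i + j + 1) \<and> \<not> \<not> good0 (wd (field \<omega>) (- int i) (i + j + 1))"
        using R[of S 0 "\<lambda>aw. \<not> good0 aw"] S fail[OF S(1) t] by blast
      define T where "T i j = {\<omega>. cell 0 (field \<omega>) (- int i) (i + j + 1) \<and> good0 (wd (field \<omega>) (- int i) (i + j + 1)) \<and>
         (\<nexists>c. resolved 0 (wd (field \<omega>) (- int i) (i + j + 1)) i c)}" for i j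
      have Tsets: "(\<Union>(i, j)\<in>{..R} \<times> {..R}. T i j) \<in> sets ?M"
      proof -
        have "T i j \<in> sets ?M" for i j
          unfolding T_def by (rule sets_cell_field[where Q="\<lambda>aw. good0 aw \<and> (\<nexists>c. resolved 0 aw i c)"])
        then show ?thesis by (intro sets.finite_UN) auto
      qed
      have "{\<omega>. \<not> loc_res 0 R (wd \<omega> (- int R - 2) (2 * R + 5))} \<subseteq> B \<union> (\<Union>(i, j)\<in>{..R} \<times> {..R}. T i j)"
      proof (intro subsetI, rule ccontr)
        fix \<omega> assume \<omega>: "\<omega> \<in> {\<omega>. \<not> loc_res 0 R (wd \<omega> (- int R - 2) (2 * R + 5))}" "\<omega> \<notin> B \<union> (\<Union>(i, j)\<in>{..R} \<times> {..R}. T i j)"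
        obtain i j where ij: "i \<le> R" "j \<le> R" "cell 0 (field \<omega>) (- int i) (i + j + 1)" "good0 (wd (field \<omega>) (- int i) (i + j + 1))"
          using B(3)[of \<omega>] \<omega>(2) by blast
        have "\<omega> \<notin> T i j" using \<omega>(2) ij by blast
        then obtain c where "resolved 0 (wd (field \<omega>) (- int i) (i + j + 1)) i c" using ij unfolding T_def by blast
        then have "loc_res 0 R (wd \<omega> (0 - int R - 2) (2 * R + 5))"
          unfolding loc_res_iff using ij by auto
        then show False using \<omega> by simp
      qed
      then have "measure ?M {\<omega>. \<not> loc_res 0 R (wd \<omega> (- int R - 2) (2 * R + 5))} \<le> measure ?M (B \<union> (\<Union>(i, j)\<in>{..R} \<times> {..R}. T i j))"
        using B(1) Tsets by (intro finite_measure_mono) auto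
      also have "\<dots> \<le> measure ?M B + measure ?M (\<Union>(i, j)\<in>{..R} \<times> {..R}. T i j)"
        using B(1) Tsets by (intro measure_Un_le)
      also have "\<dots> \<le> 1 / L + 3 / L"
        using B(2) unresolved_mass_transport[of S R] unfolding T_def by (intro add_mono)
      finally show "wprob (2 * R + 5) (label S) (\<lambda>l. \<not> loc_res 0 R l) \<le> 4 / L"
        using measure_wd[of "label S" "\<lambda>l. \<not> loc_res 0 R l"] by simp
    qed
  qed
qed

end

section \<open>The law of the types\<close>

lemma nn_integral_sty:
  fixes f :: "sty \<Rightarrow> ennreal"
  shows "(\<integral>\<^sup>+x. f x \<partial>count_space UNIV) = f Plain + f Sup + (\<Sum>n. f (Bit n)) + (\<Sum>n. f (Cut n))"
proof -
  have bij: "(\<integral>\<^sup>+x. f x * indicator (range g) x \<partial>count_space UNIV) = (\<Sum>n. f (g n))" if "inj g" for g :: "nat \<Rightarrow> sty"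
  proof -
    have "(\<integral>\<^sup>+x. f x * indicator (range g) x \<partial>count_space UNIV) = (\<integral>\<^sup>+x. f x \<partial>count_space (range g))"
      by (simp add: nn_integral_count_space_indicator)
    also have "\<dots> = (\<integral>\<^sup>+n. f (g n) \<partial>count_space UNIV)"
      using that by (intro nn_integral_bij_count_space[symmetric]) (simp add: bij_betw_def)
    finally show ?thesis by (simp add: nn_integral_count_space_nat)
  qed
  have "(\<integral>\<^sup>+x. f x \<partial>count_space UNIV)
      = (\<integral>\<^sup>+x. f x * indicator {Plain} x + f x * indicator {Sup} x + f x * indicator (range Bit) x + f x * indicator (range Cut) x \<partial>count_space UNIV)"
  proof (intro nn_integral_cong)
    fix x show "f x = f x * indicator {Plain} x + f x * indicator {Sup} x + f x * indicator (range Bit) x + f x * indicator (range Cut) x"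
      by (cases x) (auto simp: indicator_def)
  qed
  also have "\<dots> = f Plain + f Sup + (\<Sum>n. f (Bit n)) + (\<Sum>n. f (Cut n))"
    by (simp add: nn_integral_add bij inj_on_def)
  finally show ?thesis .
qed

text \<open>Level 0 works with supplies and has no bits, so \<open>Bit 0\<close> has weight 0 and
  \<open>\<beta> n\<close> is the rate of the bits of level \<open>Suc n\<close>.\<close>

definition type_weight :: "real \<Rightarrow> (nat \<Rightarrow> real) \<Rightarrow> (nat \<Rightarrow> real) \<Rightarrow> sty \<Rightarrow> real" where
  "type_weight s \<beta> c x = (case x of Plain \<Rightarrow> 1 - s - suminf \<beta> - suminf c | Sup \<Rightarrow> s
     | Bit n \<Rightarrow> (case n of 0 \<Rightarrow> 0 | Suc m \<Rightarrow> \<beta> m) | Cut n \<Rightarrow> c n)"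

definition type_pmf :: "real \<Rightarrow> (nat \<Rightarrow> real) \<Rightarrow> (nat \<Rightarrow> real) \<Rightarrow> sty pmf" where
  "type_pmf s \<beta> c = embed_pmf (type_weight s \<beta> c)"

lemma pmf_type_pmf:
  assumes "0 \<le> s" "\<And>n. 0 \<le> \<beta> n" "\<And>n. 0 \<le> c n" "summable \<beta>" "summable c" "s + suminf \<beta> + suminf c \<le> 1"
  shows "pmf (type_pmf s \<beta> c) x = type_weight s \<beta> c x"
  unfolding type_pmf_def
proof (rule pmf_embed_pmf)
  show "0 \<le> type_weight s \<beta> c x" for x
    using assms by (auto simp: type_weight_def split: sty.splits nat.splits)
  have "(\<Sum>n. ennreal (type_weight s \<beta> c (Bit n))) = (\<Sum>n. ennreal (\<beta> n))"
    by (subst suminf_offset[of _ 1]) (auto simp: type_weight_def)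
  also have "\<dots> = ennreal (suminf \<beta>)" using assms by (intro suminf_ennreal2) auto
  finally have b: "(\<Sum>n. ennreal (type_weight s \<beta> c (Bit n))) = ennreal (suminf \<beta>)" .
  have c: "(\<Sum>n. ennreal (type_weight s \<beta> c (Cut n))) = ennreal (suminf c)"
    using assms by (simp add: type_weight_def suminf_ennreal2)
  have nn: "0 \<le> suminf \<beta>" "0 \<le> suminf c" using assms by (auto intro!: suminf_nonneg)
  show "(\<integral>\<^sup>+x. ennreal (type_weight s \<beta> c x) \<partial>count_space UNIV) = 1"
    unfolding nn_integral_sty b c using nn assms
    by (simp add: type_weight_def ennreal_plus[symmetric] del: ennreal_plus)
qed

text \<open>Rates that fall by a factor of at least 4 have a tail of at most \<open>4 / 3\<close>
  times its first term.\<close>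

lemma tail_le:
  assumes S: "\<And>n. pmf S (Cut n) = c n" and c: "\<And>n. 0 \<le> c n" "\<And>n. c (Suc n) \<le> c n / 4"
  shows "tail n S \<le> 2 * c n"
proof -
  have ck: "c (n + k) \<le> c n * (1 / 4) ^ k" for k
  proof (induction k)
    case (Suc k)
    then show ?case using c(2)[of "n + k"] by simp
  qed simp
  have "{s. cutge n s} = (\<lambda>k. Cut (n + k)) ` UNIV"
    by (auto simp: cutge_cases le_iff_add image_iff)
  then have "ennreal (tail n S) = (\<integral>\<^sup>+k. ennreal (pmf S (Cut (n + k))) \<partial>count_space UNIV)"
    unfolding tail_def measure_pmf.emeasure_eq_measure[symmetric] by (subst nn_integral_pmf') (auto simp: inj_on_def)
  also have "\<dots> = (\<Sum>k. ennreal (c (n + k)))" by (simp add: nn_integral_count_space_nat S)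
  also have "\<dots> \<le> (\<Sum>k. ennreal (c n * (1 / 4) ^ k))" using ck by (intro suminf_le ennreal_leI) auto
  also have "\<dots> = ennreal (c n * (1 / (1 - 1 / 4)))"
  proof -
    have "(\<lambda>k. c n * (1 / 4) ^ k) sums (c n * (1 / (1 - 1 / 4)))" by (intro sums_mult geometric_sums) auto
    then show ?thesis using c(1)[of n] by (intro suminf_ennreal_eq) auto
  qed
  also have "\<dots> \<le> ennreal (2 * c n)" using c(1)[of n] by (intro ennreal_leI) simp
  finally show ?thesis using c(1)[of n] by simp
qed

context coding begin

text \<open>The law of the types involves all rates, but the estimate for each level holds for every
  law with the right rates at that level and small tails. Rates and radii can therefore be found by
  dependent choice. Failures at level \<open>n\<close> stay below \<open>\<beta> n / 64\<close>, a
  fraction of the rate of the bits of level \<open>Suc n\<close> that will repair them.\<close>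

lemma cut_rates_exist:
  fixes \<beta> :: "nat \<Rightarrow> real" and \<gamma> :: real
  assumes q: "1 \<le> q" "q \<le> 4" and L2: "L \<ge> 2" and \<beta>: "\<And>n. 0 < \<beta> n" "\<And>n. \<beta> n \<le> 1 / 2"
    and base: "4 / L \<le> \<beta> 0 / 64" and \<gamma>: "0 < \<gamma>" "\<gamma> \<le> 1 / 8"
  shows "\<exists>c R. (\<forall>n. 0 < c n) \<and> c 0 \<le> \<gamma> \<and> (\<forall>n. c (Suc n) \<le> c n / 4) \<and>
    (\<forall>S. pmf S Sup = 1 / real L \<longrightarrow> (\<forall>n. pmf S (Bit (Suc n)) = \<beta> n) \<longrightarrow> (\<forall>n. pmf S (Cut n) = c n) \<longrightarrow>
      (\<forall>n. wprob (2 * R n + 5) (label S) (\<lambda>l. \<not> loc_res n (R n) l) \<le> \<beta> n / 64))"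
proof -
  define ok where "ok S n = (\<lambda>(c :: real, R). wprob (2 * R + 5) (label S) (\<lambda>l. \<not> loc_res n R l) \<le> \<beta> n / 64)" for S and n :: nat
  define P where "P n = (\<lambda>(c :: real, R :: nat). 0 < c \<and> c \<le> \<gamma> \<and>
    (n = (0::nat) \<longrightarrow> (\<forall>S. pmf S Sup = 1 / real L \<longrightarrow> c \<le> pmf S (Cut 0) \<longrightarrow> tail 0 S \<le> 2 * c \<longrightarrow> ok S 0 (c, R))))" for n
  define Q where "Q n x y \<longleftrightarrow> fst y \<le> fst x / 4 \<and> (\<forall>S. pmf S (Bit (Suc n)) = \<beta> n \<longrightarrow> tail 0 S \<le> 1 / 4 \<longrightarrow>
     fst y \<le> pmf S (Cut (Suc n)) \<longrightarrow> tail (Suc n) S \<le> 2 * fst y \<longrightarrow> ok S n x \<longrightarrow> ok S (Suc n) y)" for n and x y :: "real \<times> nat"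
  have "\<exists>f. \<forall>n. P n (f n) \<and> Q n (f n) (f (Suc n))"
  proof (rule dependent_nat_choice)
    obtain p where p: "p > 0" "\<And>c. 0 < c \<Longrightarrow> c \<le> p \<Longrightarrow> \<exists>R. \<forall>S. pmf S Sup = 1 / real L \<longrightarrow>
       c \<le> pmf S (Cut 0) \<longrightarrow> tail 0 S \<le> 2 * c \<longrightarrow> wprob (2 * R + 5) (label S) (\<lambda>l. \<not> loc_res 0 R l) \<le> 4 / L"
      using resolution_base[OF L2] by blast
    define c where "c = min p \<gamma>"
    have c: "0 < c" "c \<le> p" "c \<le> \<gamma>" using p(1) \<gamma> by (auto simp: c_def)
    obtain R where "\<forall>S. pmf S Sup = 1 / real L \<longrightarrow>
       c \<le> pmf S (Cut 0) \<longrightarrow> tail 0 S \<le> 2 * c \<longrightarrow> wprob (2 * R + 5) (label S) (\<lambda>l. \<not> loc_res 0 R l) \<le> 4 / L"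
      using p(2)[OF c(1,2)] by blast
    then have "P 0 (c, R)" using c base by (auto simp: P_def ok_def intro: order.trans)
    then show "\<exists>x. P 0 x" by blast
  next
    fix x n assume "P n x"
    then obtain c R where x: "x = (c, R)" "0 < c" "c \<le> \<gamma>" by (auto simp: P_def)
    have \<delta>: "0 < \<beta> (Suc n) / 64" using \<beta> by simp
    obtain p where p: "p > 0" "\<And>c. 0 < c \<Longrightarrow> c \<le> p \<Longrightarrow> \<exists>R'. \<forall>S. pmf S (Bit (Suc n)) = \<beta> n \<longrightarrow> tail 0 S \<le> 1 / 4 \<longrightarrow>
       c \<le> pmf S (Cut (Suc n)) \<longrightarrow> tail (Suc n) S \<le> 2 * c \<longrightarrow>
       wprob (2 * R + 5) (label S) (\<lambda>l. \<not> loc_res n R l) \<le> \<beta> n / 64 \<longrightarrow>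
       wprob (2 * R' + 5) (label S) (\<lambda>l. \<not> loc_res (Suc n) R' l) \<le> \<beta> (Suc n) / 64"
      using resolution_step[OF q \<beta>(1) \<beta>(2) \<delta>, of n n R] by blast
    define c' where "c' = min p (c / 4)"
    have c': "0 < c'" "c' \<le> p" "c' \<le> c / 4" using p(1) x by (auto simp: c'_def)
    obtain R' where R': "\<forall>S. pmf S (Bit (Suc n)) = \<beta> n \<longrightarrow> tail 0 S \<le> 1 / 4 \<longrightarrow>
       c' \<le> pmf S (Cut (Suc n)) \<longrightarrow> tail (Suc n) S \<le> 2 * c' \<longrightarrow>
       wprob (2 * R + 5) (label S) (\<lambda>l. \<not> loc_res n R l) \<le> \<beta> n / 64 \<longrightarrow>
       wprob (2 * R' + 5) (label S) (\<lambda>l. \<not> loc_res (Suc n) R' l) \<le> \<beta> (Suc n) / 64"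
      using p(2)[OF c'(1,2)] by blast
    have "P (Suc n) (c', R')" using c' x by (simp add: P_def)
    moreover have "Q n x (c', R')" using R' c' x by (simp add: Q_def ok_def)
    ultimately show "\<exists>y. P (Suc n) y \<and> Q n x y" by blast
  qed
  then obtain f where f: "\<And>n. P n (f n)" "\<And>n. Q n (f n) (f (Suc n))" by blast
  define c where "c n = fst (f n)" for n
  define R where "R n = snd (f n)" for n
  have c: "0 < c n" "c n \<le> \<gamma>" "c (Suc n) \<le> c n / 4" for n
    using f(1)[of n] f(2)[of n] by (auto simp: P_def Q_def c_def case_prod_unfold)
  have "wprob (2 * R n + 5) (label S) (\<lambda>l. \<not> loc_res n (R n) l) \<le> \<beta> n / 64"
    if S: "pmf S Sup = 1 / real L" "\<And>n. pmf S (Bit (Suc n)) = \<beta> n" "\<And>n. pmf S (Cut n) = c n" for S n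
  proof -
    have t: "tail n S \<le> 2 * c n" for n using c(1,3) S(3) by (intro tail_le) (auto intro: less_imp_le)
    have t0: "tail 0 S \<le> 1 / 4" using t[of 0] c(2)[of 0] \<gamma> by simp
    have "ok S n (f n)"
    proof (induction n)
      case 0
      show ?case using f(1)[of 0] S t[of 0] by (auto simp: P_def c_def case_prod_unfold)
    next
      case (Suc n)
      then show ?case using f(2)[of n] S t[of "Suc n"] t0 by (auto simp: Q_def c_def)
    qed
    then show ?thesis by (simp add: ok_def R_def case_prod_unfold)
  qed
  then show ?thesis using c by (intro exI[of _ c] exI[of _ R]) auto
qed

section \<open>The factor map\<close>

text \<open>The colour 1 at unresolved sites is a default that keeps the map total and
  equivariant.\<close>

definition coder :: "(int \<Rightarrow> nat) \<Rightarrow> int \<Rightarrow> nat" where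
  "coder \<omega> v = (if \<exists>n c. RS n (field \<omega>) v c then SOME c. \<exists>n. RS n (field \<omega>) v c else 1)"

lemma coder_eq: "RS n (field \<omega>) v c \<Longrightarrow> coder \<omega> v = c"
proof -
  assume R: "RS n (field \<omega>) v c"
  then have "\<exists>c n. RS n (field \<omega>) v c" by blast
  then have "\<exists>n. RS n (field \<omega>) v (SOME c. \<exists>n. RS n (field \<omega>) v c)" by (rule someI_ex)
  then have "(SOME c. \<exists>n. RS n (field \<omega>) v c) = c" using RS_unique[OF thick_field_field] R by blast
  then show ?thesis using R by (auto simp: coder_def)
qed

lemma coder_cases: "(\<exists>n. RS n (field \<omega>) v (coder \<omega> v)) \<or> (\<nexists>n c. RS n (field \<omega>) v c) \<and> coder \<omega> v = 1"
  using coder_eq by (metis coder_def)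

lemma coder_letter: "1 \<le> q \<Longrightarrow> coder \<omega> v \<in> {1..q}"
  using coder_cases[of \<omega> v] RS_letter[OF thick_field_field] by auto

lemma coder_shift: "coder (\<omega> \<circ> (\<lambda>i. s + i)) = coder \<omega> \<circ> (\<lambda>i. s + i)"
proof -
  have "RS n (field \<omega> \<circ> (\<lambda>i. s + i)) v = RS n (field \<omega>) (s + v)" for n v
    by (simp add: fun_eq_iff RS_shift)
  then show ?thesis by (simp add: coder_def fun_eq_iff field_shift)
qed

lemma coder_reflect: "coder (\<omega> \<circ> (\<lambda>i. s - i)) = coder \<omega> \<circ> (\<lambda>i. s - i)"
proof -
  have "RS n (field \<omega> \<circ> (\<lambda>i. s - i)) v = RS n (field \<omega>) (s - v)" for n v
    by (simp add: fun_eq_iff RS_reflect)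
  then show ?thesis by (simp add: coder_def fun_eq_iff field_reflect)
qed

lemma sets_RS: "{\<omega>. RS n (field \<omega>) v c} \<in> sets (iid p)"
proof -
  define E where "E a N = {\<omega>. cell n (field \<omega>) a N \<and>
      (\<lambda>aw. a \<le> v \<and> v < a + int N \<and> resolved n aw (nat (v - a)) c) (wd (field \<omega>) a N)}" for a N
  have "E a N \<in> sets (iid p)" for a N unfolding E_def by (rule sets_cell_field)
  then have "(\<Union>N. E a N) \<in> sets (iid p)" for a by (intro sets.countable_UN) blast
  then have "(\<Union>a. \<Union>N. E a N) \<in> sets (iid p)" by (intro sets.countable_UN) blast
  moreover have "{\<omega>. RS n (field \<omega>) v c} = (\<Union>a. \<Union>N. E a N)"
    by (auto simp: RS_def E_def)
  ultimately show ?thesis by simp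
qed

lemma sets_coder: "{\<omega>. coder \<omega> v = k} \<in> sets (iid p)"
proof -
  have 1: "{\<omega>. \<exists>n. RS n (field \<omega>) v c} \<in> sets (iid p)" for c
  proof -
    have "{\<omega>. \<exists>n. RS n (field \<omega>) v c} = (\<Union>n. {\<omega>. RS n (field \<omega>) v c})" by auto
    also have "\<dots> \<in> sets (iid p)" by (intro sets.countable_UN) (auto simp: sets_RS)
    finally show ?thesis .
  qed
  have "{\<omega>. \<nexists>n c. RS n (field \<omega>) v c} = space (iid p) - (\<Union>c. {\<omega>. \<exists>n. RS n (field \<omega>) v c})" by auto
  also have "\<dots> \<in> sets (iid p)" using 1 by (intro sets.compl_sets sets.countable_UN) auto
  finally have 2: "{\<omega>. \<nexists>n c. RS n (field \<omega>) v c} \<in> sets (iid p)" .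
  have "{\<omega>. coder \<omega> v = k} = {\<omega>. \<exists>n. RS n (field \<omega>) v k} \<union> (if k = 1 then {\<omega>. \<nexists>n c. RS n (field \<omega>) v c} else {})"
    using coder_cases coder_eq by (auto split: if_splits) metis+
  also have "\<dots> \<in> sets (iid p)" using 1 2 by auto
  finally show ?thesis .
qed

lemma measurable_coder:
  assumes "1 \<le> q" shows "coder \<in> seq_space (UNIV :: nat set) \<rightarrow>\<^sub>M seq_space {1..q}"
proof (rule measurable_PiM_single')
  fix v :: int
  show "(\<lambda>\<omega>. coder \<omega> v) \<in> seq_space (UNIV :: nat set) \<rightarrow>\<^sub>M count_space {1..q}"
  proof (rule measurable_count_space_eq2_countable[THEN iffD2], intro conjI ballI)
    fix k
    show "(\<lambda>\<omega>. coder \<omega> v) -` {k} \<inter> space (seq_space (UNIV :: nat set)) \<in> sets (seq_space UNIV)"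
      using sets_coder[of v k] by (simp add: sets_iid space_PiM vimage_def)
  qed (use coder_letter[OF assms] in auto)
qed (use coder_letter[OF assms] in \<open>auto simp: space_PiM\<close>)

text \<open>A resolved site lies in a cell and hence is no cutter. So consecutive resolved sites
  share one cell, and their letters are read from the same coupled word.\<close>

lemma loc_res_common_cell:
  assumes "f > 0" and r: "\<And>k. k < f \<Longrightarrow> loc_res n R (wd \<omega> (s + int k - int R - 2) (2 * R + 5))"
  shows "\<exists>i j. i \<le> R \<and> j \<le> R \<and> f \<le> j + 1 \<and> cell n (field \<omega>) (s - int i) (i + j + 1) \<and>
     (\<forall>k<f. resolved n (wd (field \<omega>) (s - int i) (i + j + 1)) (i + k) (coder \<omega> (s + int k)))"
proof -
  have ex: "\<exists>i j c. i \<le> R \<and> j \<le> R \<and> cell n (field \<omega>) (s + int k - int i) (i + j + 1) \<and>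
      resolved n (wd (field \<omega>) (s + int k - int i) (i + j + 1)) i c" if "k < f" for k
    using r[OF that] by (simp only: loc_res_iff)
  obtain i j where ij: "i \<le> R" "j \<le> R" "cell n (field \<omega>) (s - int i) (i + j + 1)"
    using ex[of 0] assms(1) by auto
  have nc: "\<not> cutge n (fst (field \<omega> (s + int k)))" if k: "k < f" for k
  proof -
    obtain i' j' where "cell n (field \<omega>) (s + int k - int i') (i' + j' + 1)" using ex[OF k] by blast
    then show ?thesis by (auto simp: cell_def)
  qed
  have fj: "f \<le> j + 1"
  proof (rule ccontr)
    assume "\<not> f \<le> j + 1"
    then have "\<not> cutge n (fst (field \<omega> (s + int (j + 1))))" by (intro nc) simp
    moreover have "s - int i + int (i + j + 1) = s + int (j + 1)" by simp
    ultimately show False using ij(3) unfolding cell_def by metis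
  qed
  have "resolved n (wd (field \<omega>) (s - int i) (i + j + 1)) (i + k) (coder \<omega> (s + int k))" if k: "k < f" for k
  proof -
    obtain i' j' c where c: "cell n (field \<omega>) (s + int k - int i') (i' + j' + 1)"
      "resolved n (wd (field \<omega>) (s + int k - int i') (i' + j' + 1)) i' c"
      using ex[OF k] by blast
    have eq: "s + int k - int i' = s - int i" "i' + j' + 1 = i + j + 1"
      using cell_unique[OF c(1) ij(3), of "s + int k"] k fj by auto
    then have i': "i' = i + k" by simp
    have r': "resolved n (wd (field \<omega>) (s - int i) (i + j + 1)) (i + k) c" using c(2) unfolding eq by (simp add: i')
    have "RS n (field \<omega>) (s + int k) c"
      unfolding RS_def using ij(3) r' k fj
      by (intro exI[of _ "s - int i"] exI[of _ "i + j + 1"]) (auto simp: nat_add_distrib add.commute[of k i])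
    then show ?thesis using r' coder_eq by simp
  qed
  then show ?thesis using ij fj by blast
qed

text \<open>By \<open>dens_average\<close> the density averages out for each word, and consistency
  of \<mu> sums out the letters beside the window.\<close>

lemma Avg_window:
  assumes x: "x \<in> words q f" and w: "thick w" "length w = i + f + e"
  shows "Avg (i + f + e) (\<lambda>dw. \<Sum>u\<in>words q (i + f + e). if take f (drop i u) = x then \<mu> u * dens n (zip (zip w dw) u) else 0) = \<mu> x"
proof -
  let ?N = "i + f + e"
  have "Avg ?N (\<lambda>dw. \<Sum>u\<in>words q ?N. if take f (drop i u) = x then \<mu> u * dens n (zip (zip w dw) u) else 0)
     = (\<Sum>u\<in>words q ?N. if take f (drop i u) = x then \<mu> u else 0)"
    unfolding Avg_sum
  proof (intro sum.cong refl)
    fix u assume u: "u \<in> words q ?N"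
    show "Avg ?N (\<lambda>dw. if take f (drop i u) = x then \<mu> u * dens n (zip (zip w dw) u) else 0) = (if take f (drop i u) = x then \<mu> u else 0)"
    proof (cases "\<mu> u > 0")
      case True
      then have "Avg ?N (\<lambda>dw. dens n (zip (zip w dw) u)) = 1"
        using dens_average[of w u n] w u by (simp add: words_iff)
      then show ?thesis by (simp add: Avg_cmult)
    next
      case False
      then have "\<mu> u = 0" using nonneg[of u] by simp
      then show ?thesis by (simp cong: if_cong)
    qed
  qed
  also have "\<dots> = (\<Sum>a\<in>words q i. \<Sum>b\<in>words q f. \<Sum>c\<in>words q e. if b = x then \<mu> (a @ b @ c) else 0)"
    unfolding add.assoc sum_words_add by (intro sum.cong refl) (auto simp: words_iff)
  also have "\<dots> = (\<Sum>a\<in>words q i. \<Sum>b\<in>words q f. if b = x then \<mu> (a @ b) else 0)"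
  proof (intro sum.cong refl)
    fix a b show "(\<Sum>c\<in>words q e. if b = x then \<mu> (a @ b @ c) else 0) = (if b = x then \<mu> (a @ b) else 0)"
      using sum_append[of "a @ x" e] by simp
  qed
  also have "\<dots> = (\<Sum>a\<in>words q i. \<mu> (a @ x))" using x by simp
  finally show ?thesis by (simp add: sum_prepend)
qed

text \<open>Given the labels, \<open>F\<close> is the probability that the window of the coupled
  word reads \<open>x\<close>. It is 1 when the window is resolved and the coder writes
  \<open>x\<close>, and its average over the labels is \<open>\<mu> x\<close>. The second summand
  pays for unresolved sites.\<close>

lemma coder_window_le:
  assumes x: "x \<in> words q f" and f: "f > 0"
  shows "measure (iid (label S)) {\<omega>. wd (coder \<omega>) s f = x}
    \<le> \<mu> x + f * wprob (2 * R + 5) (label S) (\<lambda>l. \<not> loc_res n R l)"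
proof -
  let ?M = "iid (label S)"
  interpret prob_space ?M by (rule prob_space_iid)
  define B where "B k = {\<omega>. \<not> loc_res n R (wd \<omega> (s + int k - int R - 2) (2 * R + 5))}" for k
  have B: "B k \<in> sets ?M" "measure ?M (B k) = wprob (2 * R + 5) (label S) (\<lambda>l. \<not> loc_res n R l)" for k
    unfolding B_def by (rule sets_wd, rule measure_wd)
  define F where "F i j aw = (\<Sum>u\<in>words q (length aw). if take f (drop i u) = x then \<mu> u * dens n (zip aw u) else 0)"
    for i j :: nat and aw :: "site list"
  define I where "I = {(i, j). i \<le> R \<and> j \<le> R \<and> f \<le> j + 1}"
  have fI: "finite I" by (rule finite_subset[of _ "{..R} \<times> {..R}"]) (auto simp: I_def)
  define ce where "ce i j = {\<omega>. cell n (field \<omega>) (s - int i) (i + j + 1)}" for i j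
  have ce: "ce i j \<in> sets ?M" for i j unfolding ce_def by (rule sets_cell)
  define W where "W = {\<omega>. wd (coder \<omega>) s f = x}"
  have Wsets: "W \<in> sets ?M"
  proof -
    have "W = (\<Inter>k\<in>{..<f}. {\<omega>. coder \<omega> (s + int k) = x ! k})"
      using x by (auto simp: W_def words_iff list_eq_iff_nth_eq)
    also have "\<dots> \<in> sets ?M" using f by (intro sets.finite_INT sets_coder) auto
    finally show ?thesis .
  qed
  have Fnn: "F i j aw \<ge> 0" for i j aw
    unfolding F_def by (intro sum_nonneg) (auto intro!: mult_nonneg_nonneg nonneg dens_nonneg)
  have Fcong: "F i j aw = F i j aw'" if "list_all2 site_eq aw aw'" for i j aw aw'
    unfolding F_def using dens_site_eq[OF that] site_eqD(2)[OF that] by (simp cong: if_cong)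
  have F1: "F i j (wd (field \<omega>) (s - int i) (i + j + 1)) = 1"
    if "cell n (field \<omega>) (s - int i) (i + j + 1)" "f \<le> j + 1" "\<omega> \<in> W"
      "\<forall>k<f. resolved n (wd (field \<omega>) (s - int i) (i + j + 1)) (i + k) (coder \<omega> (s + int k))" for \<omega> i j
  proof -
    let ?aw = "wd (field \<omega>) (s - int i) (i + j + 1)"
    have "F i j ?aw = (\<Sum>u\<in>words q (length ?aw). \<mu> u * dens n (zip ?aw u))"
      unfolding F_def
    proof (intro sum.cong refl)
      fix u assume u: "u \<in> words q (length ?aw)"
      show "(if take f (drop i u) = x then \<mu> u * dens n (zip ?aw u) else 0) = \<mu> u * dens n (zip ?aw u)"
      proof (cases "\<mu> u * dens n (zip ?aw u) > 0")
        case True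
        have "take f (drop i u) = x"
        proof (rule nth_equalityI)
          show "length (take f (drop i u)) = length x" using u x that(2) by (simp add: words_iff)
          fix k assume "k < length (take f (drop i u))"
          then have k: "k < f" "i + k < length u" by auto
          have "u ! (i + k) = coder \<omega> (s + int k)"
            using that(4) k True u by (auto simp: resolved_def words_iff)
          also have "\<dots> = wd (coder \<omega>) s f ! k" using k by simp
          also have "\<dots> = x ! k" using that(3) by (simp add: W_def)
          finally show "take f (drop i u) ! k = x ! k" using k by simp
        qed
        then show ?thesis by simp
      next
        case False
        then have "\<mu> u * dens n (zip ?aw u) = 0" using nonneg[of u] dens_nonneg[of n "zip ?aw u"]
          by (metis mult_nonneg_nonneg order.order_iff_strict)
        then show ?thesis by simp
      qed
    qed
    also have "\<dots> = 1" by (rule dens_norm) (rule thick_wd[OF thick_field_field])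
    finally show ?thesis .
  qed
  have "emeasure ?M (W - (\<Union>k<f. B k)) = (\<integral>\<^sup>+\<omega>. indicator (W - (\<Union>k<f. B k)) \<omega> \<partial>?M)"
    using Wsets B by (intro nn_integral_indicator[symmetric]) auto
  also have "\<dots> \<le> (\<integral>\<^sup>+\<omega>. (\<Sum>(i, j)\<in>I. indicator (ce i j) \<omega> * ennreal (F i j (wd (field \<omega>) (s - int i) (i + j + 1)))) \<partial>?M)"
  proof (intro nn_integral_mono)
    fix \<omega>
    show "indicator (W - (\<Union>k<f. B k)) \<omega> \<le> (\<Sum>(i, j)\<in>I. indicator (ce i j) \<omega> * ennreal (F i j (wd (field \<omega>) (s - int i) (i + j + 1))))"
    proof (cases "\<omega> \<in> W - (\<Union>k<f. B k)")
      case True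
      then have "loc_res n R (wd \<omega> (s + int k - int R - 2) (2 * R + 5))" if "k < f" for k
        using that by (auto simp: B_def)
      from loc_res_common_cell[OF f this] obtain i j where ij: "(i, j) \<in> I" "cell n (field \<omega>) (s - int i) (i + j + 1)" "f \<le> j + 1"
        "\<forall>k<f. resolved n (wd (field \<omega>) (s - int i) (i + j + 1)) (i + k) (coder \<omega> (s + int k))"
        by (auto simp: I_def)
      have "indicator (W - (\<Union>k<f. B k)) \<omega> = (\<lambda>(i, j). indicator (ce i j) \<omega> * ennreal (F i j (wd (field \<omega>) (s - int i) (i + j + 1)))) (i, j)"
        using True ij F1[OF ij(2,3) _ ij(4)] by (simp add: ce_def)
      also have "\<dots> \<le> (\<Sum>(i, j)\<in>I. indicator (ce i j) \<omega> * ennreal (F i j (wd (field \<omega>) (s - int i) (i + j + 1))))"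
        by (rule member_le_sum[OF ij(1)]) (use fI in auto)
      finally show ?thesis .
    qed simp
  qed
  also have "\<dots> = (\<Sum>(i, j)\<in>I. (\<integral>\<^sup>+\<omega>. indicator (ce i j) \<omega> * ennreal (F i j (wd (field \<omega>) (s - int i) (i + j + 1))) \<partial>?M))"
    unfolding case_prod_unfold
  proof (rule nn_integral_sum)
    fix z :: "nat \<times> nat"
    let ?i = "fst z" and ?j = "snd z"
    have "(\<lambda>\<omega>. ennreal (F ?i ?j (wd (field \<omega>) (s - int ?i) (?i + ?j + 1)))) \<in> borel_measurable ?M"
    proof -
      have "(\<lambda>\<omega>. wd \<omega> (s - int ?i - 2) (?i + ?j + 1 + 4)) \<in> ?M \<rightarrow>\<^sub>M count_space UNIV"
        by (subst measurable_cong_sets[OF sets_iid refl]) (rule measurable_wd)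
      from measurable_compose[OF this, of "\<lambda>l. ennreal (F ?i ?j (take (?i + ?j + 1) (drop 1 (fieldw (?i + ?j + 1 + 2) l))))" borel]
      show ?thesis unfolding inner_wd_field by simp
    qed
    then show "(\<lambda>\<omega>. indicator (ce ?i ?j) \<omega> * ennreal (F ?i ?j (wd (field \<omega>) (s - int ?i) (?i + ?j + 1)))) \<in> borel_measurable ?M"
      using ce[of ?i ?j] by simp
  qed
  also have "\<dots> \<le> (\<Sum>(i, j)\<in>I. ennreal (\<mu> x) * emeasure ?M (ce i j))"
  proof (intro sum_mono, clarify)
    fix i j assume "(i, j) \<in> I"
    then obtain e where e: "i + j + 1 = i + f + e" by (auto simp: I_def le_iff_add)
    show "(\<integral>\<^sup>+\<omega>. indicator (ce i j) \<omega> * ennreal (F i j (wd (field \<omega>) (s - int i) (i + j + 1))) \<partial>?M) \<le> ennreal (\<mu> x) * emeasure ?M (ce i j)"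
      unfolding ce_def
    proof (rule nn_integral_cell_le)
      fix w :: "sty list" assume w: "length w = i + j + 1" "thick w"
      have lw: "length w = i + f + e" using w(1) e by simp
      have "Avg (i + j + 1) (\<lambda>dw. F i j (zip w dw)) = Avg (i + f + e) (\<lambda>dw. \<Sum>u\<in>words q (i + f + e). if take f (drop i u) = x then \<mu> u * dens n (zip (zip w dw) u) else 0)"
        unfolding e by (intro Avg_cong) (simp add: F_def lw)
      then show "Avg (i + j + 1) (\<lambda>dw. F i j (zip w dw)) \<le> \<mu> x"
        using Avg_window[OF x w(2) lw, of n] by simp
    qed (use Fnn Fcong nonneg in auto)
  qed
  also have "\<dots> = ennreal (\<mu> x) * (\<Sum>z\<in>I. emeasure ?M (ce (fst z) (snd z)))"
    by (simp add: sum_distrib_left case_prod_unfold)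
  \<comment> \<open>At most one cell contains \<open>s\<close>, so the probabilities of the possible
    cells add up to at most 1.\<close>
  also have "(\<Sum>z\<in>I. emeasure ?M (ce (fst z) (snd z))) = emeasure ?M (\<Union>z\<in>I. ce (fst z) (snd z))"
  proof (rule sum_emeasure)
    show "disjoint_family_on (\<lambda>z. ce (fst z) (snd z)) I"
      unfolding disjoint_family_on_def
    proof (intro ballI impI, rule ccontr)
      fix z z' assume z: "z \<in> I" "z' \<in> I" "z \<noteq> z'" "ce (fst z) (snd z) \<inter> ce (fst z') (snd z') \<noteq> {}"
      then obtain \<omega> where "cell n (field \<omega>) (s - int (fst z)) (fst z + snd z + 1)" "cell n (field \<omega>) (s - int (fst z')) (fst z' + snd z' + 1)"
        by (auto simp: ce_def)
      from cell_unique[OF this, of s] z show False by (auto simp: prod_eq_iff)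
    qed
  qed (use fI ce in auto)
  also have "ennreal (\<mu> x) * \<dots> \<le> ennreal (\<mu> x) * 1"
    by (intro mult_left_mono emeasure_le_1) auto
  finally have main: "measure ?M (W - (\<Union>k<f. B k)) \<le> \<mu> x"
    using nonneg[of x] by (simp add: emeasure_eq_measure)
  have "measure ?M W \<le> measure ?M ((W - (\<Union>k<f. B k)) \<union> (\<Union>k<f. B k))"
    using Wsets B by (intro finite_measure_mono) auto
  also have "\<dots> \<le> measure ?M (W - (\<Union>k<f. B k)) + measure ?M (\<Union>k<f. B k)"
    using Wsets B by (intro measure_Un_le) auto
  also have "measure ?M (\<Union>k<f. B k) \<le> (\<Sum>k<f. measure ?M (B k))"
    using B by (intro finite_measure_subadditive_finite) auto
  also have "\<dots> = f * wprob (2 * R + 5) (label S) (\<lambda>l. \<not> loc_res n R l)" by (simp add: B(2))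
  finally show ?thesis using main by (simp add: W_def)
qed

end

section \<open>Entropy of finite windows\<close>

text \<open>The entropy of \<open>f\<close>, written as a mean over \<Omega> instead of a sum over
  values. It visibly depends on the partition induced by \<open>f\<close> only, and entropies of
  different variables can be compared pointwise.\<close>

definition fent :: "'w set \<Rightarrow> ('w \<Rightarrow> real) \<Rightarrow> ('w \<Rightarrow> 'z) \<Rightarrow> real" where
  "fent \<Omega> p f = - (\<Sum>\<omega>\<in>\<Omega>. p \<omega> * log 2 (\<Sum>\<omega>'\<in>{\<omega>'\<in>\<Omega>. f \<omega>' = f \<omega>}. p \<omega>'))"

lemma fent_cong:
  assumes "\<And>\<omega> \<omega>'. \<omega> \<in> \<Omega> \<Longrightarrow> \<omega>' \<in> \<Omega> \<Longrightarrow> f \<omega>' = f \<omega> \<longleftrightarrow> g \<omega>' = g \<omega>"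
  shows "fent \<Omega> p f = fent \<Omega> p g"
proof -
  have "{\<omega>'\<in>\<Omega>. f \<omega>' = f \<omega>} = {\<omega>'\<in>\<Omega>. g \<omega>' = g \<omega>}" if "\<omega> \<in> \<Omega>" for \<omega>
    using assms[OF that] by auto
  then show ?thesis unfolding fent_def by (intro arg_cong[of _ _ uminus] sum.cong) auto
qed

lemma fent_image:
  assumes "finite \<Omega>"
  shows "fent \<Omega> p f = (\<Sum>z\<in>f ` \<Omega>. - ((\<Sum>\<omega>\<in>{\<omega>\<in>\<Omega>. f \<omega> = z}. p \<omega>) * log 2 (\<Sum>\<omega>\<in>{\<omega>\<in>\<Omega>. f \<omega> = z}. p \<omega>)))"
proof -
  have "(\<Sum>\<omega>\<in>\<Omega>. p \<omega> * log 2 (\<Sum>\<omega>'\<in>{\<omega>'\<in>\<Omega>. f \<omega>' = f \<omega>}. p \<omega>'))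
      = (\<Sum>z\<in>f ` \<Omega>. \<Sum>\<omega>\<in>{\<omega>\<in>\<Omega>. f \<omega> = z}. p \<omega> * log 2 (\<Sum>\<omega>'\<in>{\<omega>'\<in>\<Omega>. f \<omega>' = f \<omega>}. p \<omega>'))"
    by (rule sum.group[symmetric]) (use assms in auto)
  also have "\<dots> = (\<Sum>z\<in>f ` \<Omega>. (\<Sum>\<omega>\<in>{\<omega>\<in>\<Omega>. f \<omega> = z}. p \<omega>) * log 2 (\<Sum>\<omega>\<in>{\<omega>\<in>\<Omega>. f \<omega> = z}. p \<omega>))"
    unfolding sum_distrib_right by (intro sum.cong refl) auto
  finally show ?thesis by (simp add: fent_def sum_negf)
qed

text \<open>Expand the two numerators over \<alpha> and \<beta>. The \<omega> with the value of
  \<alpha> under \<open>a\<close> and that of \<beta> under \<open>b\<close> form one class of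
  \<open>d\<close>, over which \<open>p \<omega>\<close> divided by the weight of the class sums to
  1. There are none unless \<alpha> and \<beta> agree under \<open>c\<close>, and then summing over
  \<beta> cancels the weight of the class of \<open>c\<close>.\<close>

lemma submodularity_sum:
  fixes p :: "'w \<Rightarrow> real"
  assumes fin: "finite \<Omega>" and pos: "\<And>\<omega>. \<omega> \<in> \<Omega> \<Longrightarrow> p \<omega> > 0"
    and d: "\<And>\<omega> \<omega>'. \<omega> \<in> \<Omega> \<Longrightarrow> \<omega>' \<in> \<Omega> \<Longrightarrow> d \<omega>' = d \<omega> \<longleftrightarrow> a \<omega>' = a \<omega> \<and> b \<omega>' = b \<omega>"
    and ac: "\<And>\<omega> \<omega>'. \<omega> \<in> \<Omega> \<Longrightarrow> \<omega>' \<in> \<Omega> \<Longrightarrow> a \<omega>' = a \<omega> \<Longrightarrow> c \<omega>' = c \<omega>"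
    and bc: "\<And>\<omega> \<omega>'. \<omega> \<in> \<Omega> \<Longrightarrow> \<omega>' \<in> \<Omega> \<Longrightarrow> b \<omega>' = b \<omega> \<Longrightarrow> c \<omega>' = c \<omega>"
  shows "(\<Sum>\<omega>\<in>\<Omega>. p \<omega> * ((\<Sum>\<omega>'\<in>{\<omega>'\<in>\<Omega>. a \<omega>' = a \<omega>}. p \<omega>') * (\<Sum>\<omega>'\<in>{\<omega>'\<in>\<Omega>. b \<omega>' = b \<omega>}. p \<omega>') /
      ((\<Sum>\<omega>'\<in>{\<omega>'\<in>\<Omega>. d \<omega>' = d \<omega>}. p \<omega>') * (\<Sum>\<omega>'\<in>{\<omega>'\<in>\<Omega>. c \<omega>' = c \<omega>}. p \<omega>')))) \<le> (\<Sum>\<omega>\<in>\<Omega>. p \<omega>)"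
proof -
  define D where "D \<omega> = (\<Sum>\<omega>'\<in>{\<omega>'\<in>\<Omega>. d \<omega>' = d \<omega>}. p \<omega>')" for \<omega>
  define C where "C \<omega> = (\<Sum>\<omega>'\<in>{\<omega>'\<in>\<Omega>. c \<omega>' = c \<omega>}. p \<omega>')" for \<omega>
  have Dpos: "D \<omega> > 0" and Cpos: "C \<omega> > 0" if "\<omega> \<in> \<Omega>" for \<omega>
    unfolding D_def C_def using that fin pos by (auto intro!: sum_pos2[of _ \<omega>] less_imp_le)
  have filt: "(\<Sum>x\<in>{x\<in>\<Omega>. P x}. h x) = (\<Sum>x\<in>\<Omega>. if P x then h x else 0)" for P and h :: "'w \<Rightarrow> real"
    using fin by (rule sum.inter_filter)
  have "(\<Sum>\<omega>\<in>\<Omega>. p \<omega> * ((\<Sum>\<omega>'\<in>{\<omega>'\<in>\<Omega>. a \<omega>' = a \<omega>}. p \<omega>') * (\<Sum>\<omega>'\<in>{\<omega>'\<in>\<Omega>. b \<omega>' = b \<omega>}. p \<omega>') / (D \<omega> * C \<omega>)))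
      = (\<Sum>\<omega>\<in>\<Omega>. \<Sum>\<alpha>\<in>\<Omega>. \<Sum>\<beta>\<in>\<Omega>. if a \<alpha> = a \<omega> \<and> b \<beta> = b \<omega> then p \<omega> / D \<omega> * (p \<alpha> * p \<beta> / C \<omega>) else 0)"
  proof (intro sum.cong refl)
    fix \<omega>
    have "(\<Sum>\<alpha>\<in>\<Omega>. if a \<alpha> = a \<omega> then p \<alpha> else 0) * (\<Sum>\<beta>\<in>\<Omega>. if b \<beta> = b \<omega> then p \<beta> else 0)
        = (\<Sum>\<alpha>\<in>\<Omega>. \<Sum>\<beta>\<in>\<Omega>. if a \<alpha> = a \<omega> \<and> b \<beta> = b \<omega> then p \<alpha> * p \<beta> else 0)"
      unfolding sum_product by (intro sum.cong refl) auto
    then have "p \<omega> * ((\<Sum>\<omega>'\<in>{\<omega>'\<in>\<Omega>. a \<omega>' = a \<omega>}. p \<omega>') * (\<Sum>\<omega>'\<in>{\<omega>'\<in>\<Omega>. b \<omega>' = b \<omega>}. p \<omega>') / (D \<omega> * C \<omega>))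
        = p \<omega> / (D \<omega> * C \<omega>) * (\<Sum>\<alpha>\<in>\<Omega>. \<Sum>\<beta>\<in>\<Omega>. if a \<alpha> = a \<omega> \<and> b \<beta> = b \<omega> then p \<alpha> * p \<beta> else 0)"
      unfolding filt by simp
    also have "\<dots> = (\<Sum>\<alpha>\<in>\<Omega>. \<Sum>\<beta>\<in>\<Omega>. if a \<alpha> = a \<omega> \<and> b \<beta> = b \<omega> then p \<omega> / D \<omega> * (p \<alpha> * p \<beta> / C \<omega>) else 0)"
      unfolding sum_distrib_left by (intro sum.cong refl) auto
    finally show "p \<omega> * ((\<Sum>\<omega>'\<in>{\<omega>'\<in>\<Omega>. a \<omega>' = a \<omega>}. p \<omega>') * (\<Sum>\<omega>'\<in>{\<omega>'\<in>\<Omega>. b \<omega>' = b \<omega>}. p \<omega>') / (D \<omega> * C \<omega>))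
        = (\<Sum>\<alpha>\<in>\<Omega>. \<Sum>\<beta>\<in>\<Omega>. if a \<alpha> = a \<omega> \<and> b \<beta> = b \<omega> then p \<omega> / D \<omega> * (p \<alpha> * p \<beta> / C \<omega>) else 0)" .
  qed
  also have "\<dots> = (\<Sum>\<alpha>\<in>\<Omega>. \<Sum>\<omega>\<in>\<Omega>. \<Sum>\<beta>\<in>\<Omega>. if a \<alpha> = a \<omega> \<and> b \<beta> = b \<omega> then p \<omega> / D \<omega> * (p \<alpha> * p \<beta> / C \<omega>) else 0)"
    by (rule sum.swap)
  also have "\<dots> = (\<Sum>\<alpha>\<in>\<Omega>. \<Sum>\<beta>\<in>\<Omega>. \<Sum>\<omega>\<in>\<Omega>. if a \<alpha> = a \<omega> \<and> b \<beta> = b \<omega> then p \<omega> / D \<omega> * (p \<alpha> * p \<beta> / C \<omega>) else 0)"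
    by (intro sum.cong refl sum.swap)
  also have "\<dots> \<le> (\<Sum>\<alpha>\<in>\<Omega>. \<Sum>\<beta>\<in>\<Omega>. if c \<beta> = c \<alpha> then p \<alpha> * p \<beta> / C \<alpha> else 0)"
  proof (intro sum_mono)
    fix \<alpha> \<beta> assume ab: "\<alpha> \<in> \<Omega>" "\<beta> \<in> \<Omega>"
    define K where "K = {\<omega>\<in>\<Omega>. a \<alpha> = a \<omega> \<and> b \<beta> = b \<omega>}"
    have "(\<Sum>\<omega>\<in>\<Omega>. if a \<alpha> = a \<omega> \<and> b \<beta> = b \<omega> then p \<omega> / D \<omega> * (p \<alpha> * p \<beta> / C \<omega>) else 0) = (\<Sum>\<omega>\<in>K. p \<omega> / D \<omega> * (p \<alpha> * p \<beta> / C \<omega>))"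
      unfolding K_def filt ..
    also have "\<dots> \<le> (if c \<beta> = c \<alpha> then p \<alpha> * p \<beta> / C \<alpha> else 0)"
    proof (cases "K = {}")
      case True
      then show ?thesis using pos ab Cpos[of \<alpha>] by (simp add: less_imp_le)
    next
      case False
      then obtain \<omega>0 where w0: "\<omega>0 \<in> \<Omega>" "a \<alpha> = a \<omega>0" "b \<beta> = b \<omega>0" by (auto simp: K_def)
      have cc: "c \<beta> = c \<alpha>" using ac[of \<omega>0 \<alpha>] bc[of \<omega>0 \<beta>] w0 ab by simp
      have DK: "D \<omega> = sum p K" if "\<omega> \<in> K" for \<omega>
      proof -
        have "{\<omega>'\<in>\<Omega>. d \<omega>' = d \<omega>} = K" using that d[of \<omega>] by (auto simp: K_def)
        then show ?thesis by (simp add: D_def)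
      qed
      have CK: "C \<omega> = C \<alpha>" if "\<omega> \<in> K" for \<omega>
        using ac[of \<alpha> \<omega>] that ab by (simp add: K_def C_def)
      have "sum p K > 0"
        using w0 fin pos by (intro sum_pos2[of _ \<omega>0]) (auto simp: K_def less_imp_le)
      have "(\<Sum>\<omega>\<in>K. p \<omega> / D \<omega> * (p \<alpha> * p \<beta> / C \<omega>)) = (\<Sum>\<omega>\<in>K. p \<omega> / sum p K * (p \<alpha> * p \<beta> / C \<alpha>))"
        using DK CK by (intro sum.cong) auto
      also have "\<dots> = p \<alpha> * p \<beta> / C \<alpha>"
        using \<open>sum p K > 0\<close> by (simp flip: sum_distrib_right sum_divide_distrib)
      finally show ?thesis using cc by simp
    qed
    finally show "(\<Sum>\<omega>\<in>\<Omega>. if a \<alpha> = a \<omega> \<and> b \<beta> = b \<omega> then p \<omega> / D \<omega> * (p \<alpha> * p \<beta> / C \<omega>) else 0) \<le> (if c \<beta> = c \<alpha> then p \<alpha> * p \<beta> / C \<alpha> else 0)" .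
  qed
  also have "\<dots> = (\<Sum>\<alpha>\<in>\<Omega>. p \<alpha>)"
  proof (intro sum.cong refl)
    fix \<alpha> assume "\<alpha> \<in> \<Omega>"
    have "(\<Sum>\<beta>\<in>\<Omega>. if c \<beta> = c \<alpha> then p \<alpha> * p \<beta> / C \<alpha> else 0) = (\<Sum>\<beta>\<in>{\<beta>\<in>\<Omega>. c \<beta> = c \<alpha>}. p \<alpha> * p \<beta> / C \<alpha>)"
      unfolding filt ..
    also have "\<dots> = p \<alpha> / C \<alpha> * (\<Sum>\<beta>\<in>{\<beta>\<in>\<Omega>. c \<beta> = c \<alpha>}. p \<beta>)" unfolding sum_distrib_left by simp
    also have "\<dots> = p \<alpha>" using Cpos[OF \<open>\<alpha> \<in> \<Omega>\<close>] by (simp add: C_def)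
    finally show "(\<Sum>\<beta>\<in>\<Omega>. if c \<beta> = c \<alpha> then p \<alpha> * p \<beta> / C \<alpha> else 0) = p \<alpha>" .
  qed
  finally show ?thesis by (simp add: D_def C_def)
qed

text \<open>With \<open>d\<close> the pair of \<open>a\<close> and \<open>b\<close>, this says that
  the mutual information of \<open>a\<close> and \<open>b\<close> given \<open>c\<close> is
  nonnegative. It is the inequality \<open>ln x \<le> x - 1\<close> for the ratio whose mean is
  bounded in \<open>submodularity_sum\<close>.\<close>

lemma fent_submodular:
  fixes p :: "'w \<Rightarrow> real"
  assumes fin: "finite \<Omega>" and pos: "\<And>\<omega>. \<omega> \<in> \<Omega> \<Longrightarrow> p \<omega> > 0"
    and d: "\<And>\<omega> \<omega>'. \<omega> \<in> \<Omega> \<Longrightarrow> \<omega>' \<in> \<Omega> \<Longrightarrow> d \<omega>' = d \<omega> \<longleftrightarrow> a \<omega>' = a \<omega> \<and> b \<omega>' = b \<omega>"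
    and ac: "\<And>\<omega> \<omega>'. \<omega> \<in> \<Omega> \<Longrightarrow> \<omega>' \<in> \<Omega> \<Longrightarrow> a \<omega>' = a \<omega> \<Longrightarrow> c \<omega>' = c \<omega>"
    and bc: "\<And>\<omega> \<omega>'. \<omega> \<in> \<Omega> \<Longrightarrow> \<omega>' \<in> \<Omega> \<Longrightarrow> b \<omega>' = b \<omega> \<Longrightarrow> c \<omega>' = c \<omega>"
  shows "fent \<Omega> p d + fent \<Omega> p c \<le> fent \<Omega> p a + fent \<Omega> p b"
proof -
  define A where "A \<omega> = (\<Sum>\<omega>'\<in>{\<omega>'\<in>\<Omega>. a \<omega>' = a \<omega>}. p \<omega>')" for \<omega>
  define B where "B \<omega> = (\<Sum>\<omega>'\<in>{\<omega>'\<in>\<Omega>. b \<omega>' = b \<omega>}. p \<omega>')" for \<omega>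
  define C where "C \<omega> = (\<Sum>\<omega>'\<in>{\<omega>'\<in>\<Omega>. c \<omega>' = c \<omega>}. p \<omega>')" for \<omega>
  define D where "D \<omega> = (\<Sum>\<omega>'\<in>{\<omega>'\<in>\<Omega>. d \<omega>' = d \<omega>}. p \<omega>')" for \<omega>
  have P: "A \<omega> > 0" "B \<omega> > 0" "C \<omega> > 0" "D \<omega> > 0" if "\<omega> \<in> \<Omega>" for \<omega>
    unfolding A_def B_def C_def D_def using that fin pos by (auto intro!: sum_pos2[of _ \<omega>] less_imp_le)
  have "fent \<Omega> p d + fent \<Omega> p c - (fent \<Omega> p a + fent \<Omega> p b)
      = (\<Sum>\<omega>\<in>\<Omega>. p \<omega> * (log 2 (A \<omega>) + log 2 (B \<omega>) - log 2 (D \<omega>) - log 2 (C \<omega>)))"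
    unfolding fent_def A_def[symmetric] B_def[symmetric] C_def[symmetric] D_def[symmetric]
    by (simp add: algebra_simps sum.distrib sum_subtractf)
  also have "\<dots> \<le> (\<Sum>\<omega>\<in>\<Omega>. (p \<omega> * (A \<omega> * B \<omega> / (D \<omega> * C \<omega>)) - p \<omega>) / ln 2)"
  proof (intro sum_mono)
    fix \<omega> assume w: "\<omega> \<in> \<Omega>"
    have "log 2 (A \<omega>) + log 2 (B \<omega>) - log 2 (D \<omega>) - log 2 (C \<omega>) = ln (A \<omega> * B \<omega> / (D \<omega> * C \<omega>)) / ln 2"
      using P[OF w] by (simp add: log_def ln_mult ln_div diff_divide_distrib add_divide_distrib)
    also have "\<dots> \<le> (A \<omega> * B \<omega> / (D \<omega> * C \<omega>) - 1) / ln 2"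
      using P[OF w] by (intro divide_right_mono ln_le_minus_one) auto
    finally have "p \<omega> * (log 2 (A \<omega>) + log 2 (B \<omega>) - log 2 (D \<omega>) - log 2 (C \<omega>)) \<le> p \<omega> * ((A \<omega> * B \<omega> / (D \<omega> * C \<omega>) - 1) / ln 2)"
      using pos[OF w] by (intro mult_left_mono) auto
    also have "\<dots> = (p \<omega> * (A \<omega> * B \<omega> / (D \<omega> * C \<omega>)) - p \<omega>) / ln 2" by (simp add: right_diff_distrib)
    finally show "p \<omega> * (log 2 (A \<omega>) + log 2 (B \<omega>) - log 2 (D \<omega>) - log 2 (C \<omega>)) \<le> (p \<omega> * (A \<omega> * B \<omega> / (D \<omega> * C \<omega>)) - p \<omega>) / ln 2" .
  qed
  also have "\<dots> = ((\<Sum>\<omega>\<in>\<Omega>. p \<omega> * (A \<omega> * B \<omega> / (D \<omega> * C \<omega>))) - (\<Sum>\<omega>\<in>\<Omega>. p \<omega>)) / ln 2"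
    by (simp add: sum_subtractf flip: sum_divide_distrib)
  also have "\<dots> \<le> 0"
    using submodularity_sum[OF fin pos d ac bc] unfolding A_def B_def C_def D_def
    by (intro divide_nonpos_pos) auto
  finally show ?thesis by simp
qed

section \<open>Entropy of windows of the colouring\<close>

context twodep begin

lemma sum_window:
  fixes g :: "nat list \<Rightarrow> real"
  shows "(\<Sum>u\<in>words q (s + j + e). \<mu> u * g (take j (drop s u))) = (\<Sum>v\<in>words q j. \<mu> v * g v)"
proof -
  have "(\<Sum>u\<in>words q (s + j + e). \<mu> u * g (take j (drop s u)))
     = (\<Sum>x\<in>words q s. \<Sum>v\<in>words q j. \<Sum>y\<in>words q e. \<mu> (x @ v @ y) * g v)"
    unfolding add.assoc sum_words_add by (intro sum.cong refl) (auto simp: words_iff)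
  also have "\<dots> = (\<Sum>x\<in>words q s. \<Sum>v\<in>words q j. \<mu> (x @ v) * g v)"
  proof (intro sum.cong refl)
    fix x v show "(\<Sum>y\<in>words q e. \<mu> (x @ v @ y) * g v) = \<mu> (x @ v) * g v"
      using sum_append[of "x @ v" e] by (simp flip: sum_distrib_right)
  qed
  also have "\<dots> = (\<Sum>v\<in>words q j. \<Sum>x\<in>words q s. \<mu> (x @ v) * g v)" by (rule sum.swap)
  also have "\<dots> = (\<Sum>v\<in>words q j. \<mu> v * g v)"
    by (simp add: sum_prepend flip: sum_distrib_right)
  finally show ?thesis .
qed

definition supp :: "nat \<Rightarrow> nat list set" where
  "supp l = {u\<in>words q l. \<mu> u > 0}"

definition went :: "nat \<Rightarrow> nat set \<Rightarrow> real" where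
  "went l A = fent (supp l) \<mu> (\<lambda>u. \<lambda>i\<in>A. u ! i)"

definition Hw :: "nat \<Rightarrow> real" where
  "Hw j = - (\<Sum>w\<in>words q j. \<mu> w * log 2 (\<mu> w))"

lemma sum_supp: "(\<Sum>u\<in>{u\<in>supp l. P u}. \<mu> u * h u) = (\<Sum>u\<in>{u\<in>words q l. P u}. \<mu> u * h u)"
  using nonneg by (intro sum.mono_neutral_left) (auto simp: supp_def less_le)

lemma restrict_eq_iff: "(\<lambda>i\<in>A. f i) = (\<lambda>i\<in>A. g i) \<longleftrightarrow> (\<forall>i\<in>A. f i = g i)"
  by (metis restrict_apply' restrict_ext)

lemma went_interval:
  assumes "s + j \<le> l" shows "went l {s..<s + j} = Hw j"
proof -
  obtain e where l: "l = s + j + e" using assms by (auto simp: le_iff_add)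
  have cls: "(\<Sum>u'\<in>{u'\<in>supp l. (\<lambda>i\<in>{s..<s + j}. u' ! i) = (\<lambda>i\<in>{s..<s + j}. u ! i)}. \<mu> u') = \<mu> (take j (drop s u))"
    if u: "u \<in> supp l" for u
  proof -
    have uw: "u \<in> words q l" using u by (simp add: supp_def)
    have eq: "(\<lambda>i\<in>{s..<s + j}. u' ! i) = (\<lambda>i\<in>{s..<s + j}. u ! i) \<longleftrightarrow> take j (drop s u') = take j (drop s u)"
      if "u' \<in> words q l" for u'
    proof
      assume "(\<lambda>i\<in>{s..<s + j}. u' ! i) = (\<lambda>i\<in>{s..<s + j}. u ! i)"
      then have h: "\<And>i. i \<in> {s..<s + j} \<Longrightarrow> u' ! i = u ! i" unfolding restrict_eq_iff by blast
      show "take j (drop s u') = take j (drop s u)"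
        using that uw assms h by (intro nth_equalityI) (auto simp: words_iff)
    next
      assume h: "take j (drop s u') = take j (drop s u)"
      have "u' ! i = u ! i" if "i \<in> {s..<s + j}" for i
      proof -
        have *: "take j (drop s w) ! (i - s) = w ! i" if "w \<in> words q l" for w
          using that \<open>i \<in> {s..<s + j}\<close> assms by (auto simp: words_iff)
        show ?thesis using *[OF \<open>u' \<in> words q l\<close>] *[OF uw] h by simp
      qed
      then show "(\<lambda>i\<in>{s..<s + j}. u' ! i) = (\<lambda>i\<in>{s..<s + j}. u ! i)" unfolding restrict_eq_iff by blast
    qed
    have "(\<Sum>u'\<in>{u'\<in>supp l. (\<lambda>i\<in>{s..<s + j}. u' ! i) = (\<lambda>i\<in>{s..<s + j}. u ! i)}. \<mu> u')
       = (\<Sum>u'\<in>{u'\<in>words q l. (\<lambda>i\<in>{s..<s + j}. u' ! i) = (\<lambda>i\<in>{s..<s + j}. u ! i)}. \<mu> u')"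
      using sum_supp[where h="\<lambda>_. 1"] by simp
    also have "\<dots> = (\<Sum>u'\<in>words q l. \<mu> u' * of_bool (take j (drop s u') = take j (drop s u)))"
      unfolding sum.inter_filter[OF finite_words] using eq by (intro sum.cong refl) simp
    also have "\<dots> = (\<Sum>v\<in>words q j. \<mu> v * of_bool (v = take j (drop s u)))"
      unfolding l by (rule sum_window)
    also have "\<dots> = \<mu> (take j (drop s u))"
    proof -
      have "take j (drop s u) \<in> words q j"
        using uw assms by (auto simp: words_iff dest: in_set_takeD in_set_dropD)
      then show ?thesis by (simp add: of_bool_def if_distrib cong: if_cong)
    qed
    finally show ?thesis .
  qed
  have "went l {s..<s + j} = - (\<Sum>u\<in>supp l. \<mu> u * log 2 (\<mu> (take j (drop s u))))"
    unfolding went_def fent_def using cls by (intro arg_cong[of _ _ uminus] sum.cong) auto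
  also have "(\<Sum>u\<in>supp l. \<mu> u * log 2 (\<mu> (take j (drop s u)))) = (\<Sum>u\<in>words q l. \<mu> u * log 2 (\<mu> (take j (drop s u))))"
    using sum_supp[where l=l and P="\<lambda>_. True"] by simp
  also have "\<dots> = (\<Sum>v\<in>words q j. \<mu> v * log 2 (\<mu> v))" unfolding l by (rule sum_window)
  finally show ?thesis by (simp add: Hw_def)
qed

lemma went_submodular: "went l (A \<union> B) + went l (A \<inter> B) \<le> went l A + went l B"
  unfolding went_def
  by (rule fent_submodular) (auto simp: restrict_eq_iff supp_def)

lemma went_empty: "went l {} = 0"
  using went_interval[of 0 0 l] Nil by (simp add: Hw_def)

text \<open>The entropy of a letter given the \<open>j\<close> letters before it.\<close>

definition cent :: "nat \<Rightarrow> real" where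
  "cent j = Hw (Suc j) - Hw j"

text \<open>Conditioning on more letters lowers the entropy: submodularity for two intervals of
  length \<open>Suc j\<close>, one shifted by one site.\<close>

lemma cent_decreasing: "i \<le> j \<Longrightarrow> cent j \<le> cent i"
proof (induction j rule: dec_induct)
  case (step j)
  let ?l = "Suc (Suc j)"
  have "{0..<Suc j} \<union> {1..<?l} = {0..<0 + ?l}" "{0..<Suc j} \<inter> {1..<?l} = {1..<1 + j}" by auto
  then have "went ?l {0..<0 + ?l} + went ?l {1..<1 + j} \<le> went ?l {0..<0 + Suc j} + went ?l {1..<1 + Suc j}"
    using went_submodular[of ?l "{0..<Suc j}" "{1..<?l}"] by simp
  then have "Hw ?l + Hw j \<le> 2 * Hw (Suc j)"
    by (subst (asm) (1 2 3 4) went_interval) auto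
  then show ?case using step by (simp add: cent_def)
qed simp

text \<open>The chain rule with the sites of \<open>V\<close> in increasing order: each letter is
  conditioned on a part of the letters before it and so contributes at least \<open>cent v\<close>,
  which is at least \<open>cent l\<close>.\<close>

lemma went_ge:
  assumes "finite V" "V \<subseteq> {..<l}" shows "card V * cent l \<le> went l V"
  using assms
proof (induction V rule: finite_linorder_max_induct)
  case empty
  then show ?case by (simp add: went_empty)
next
  case (insert v V)
  have "insert v V \<union> {0..<v} = {0..<0 + Suc v}" "insert v V \<inter> {0..<0 + v} = V" using insert by auto
  then have "went l {0..<0 + Suc v} + went l V \<le> went l (insert v V) + went l {0..<0 + v}"
    using went_submodular[of l "insert v V" "{0..<v}"] by simp
  then have "cent v + went l V \<le> went l (insert v V)"
    using insert.prems by (subst (asm) (1 2) went_interval) (auto simp: cent_def)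
  moreover have "cent l \<le> cent v" using insert.prems by (intro cent_decreasing) auto
  moreover have "v \<notin> V" using insert by auto
  ultimately show ?case using insert by (simp add: algebra_simps)
qed

text \<open>The entropy of a process is an infimum over all finite sets, while supplies are
  intervals. By \<open>went_ge\<close> the increments of \<open>Hw\<close> are eventually at most
  the entropy per site of \<open>V\<close>, and the initial part becomes negligible.\<close>

lemma Hw_le:
  assumes V: "finite V" "V \<noteq> {}" "V \<subseteq> {..<l}" and \<epsilon>: "\<epsilon> > 0"
  shows "\<exists>L0. \<forall>n\<ge>L0. Hw n \<le> n * (went l V / card V + \<epsilon>)"
proof -
  have c: "card V > 0" using V by (simp add: card_gt_0_iff)
  have cl: "cent l \<le> went l V / card V" using went_ge[OF V(1,3)] c by (simp add: field_simps)
  have Hsum: "Hw n = (\<Sum>j<n. cent j)" for n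
    unfolding cent_def by (subst sum_lessThan_telescope) (simp add: Hw_def Nil)
  define K where "K = Hw l + l * \<bar>cent l\<bar>"
  have bound: "Hw n \<le> K + n * cent l" if nl: "n \<ge> l" for n
  proof -
    obtain k where n: "n = l + k" using nl by (auto simp: le_iff_add)
    have "(\<Sum>j<k. cent (l + j)) \<le> (\<Sum>j<k. cent l)" by (intro sum_mono cent_decreasing) auto
    then have "Hw n \<le> Hw l + k * cent l" unfolding Hsum n sum_lessThan_add by simp
    moreover have "- (l * cent l) \<le> l * \<bar>cent l\<bar>" by (metis abs_ge_minus_self mult_left_mono mult_minus_right of_nat_0_le_iff)
    ultimately show ?thesis by (simp add: K_def n algebra_simps)
  qed
  obtain L1 :: nat where L1: "K / \<epsilon> \<le> L1" using real_arch_simple by blast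
  have "Hw n \<le> n * (went l V / card V + \<epsilon>)" if "n \<ge> max l L1" for n
  proof -
    have "K \<le> n * \<epsilon>"
    proof -
      have "K / \<epsilon> \<le> n" using L1 that by simp
      then show ?thesis using \<epsilon> by (simp add: field_simps)
    qed
    then have "Hw n \<le> n * \<epsilon> + n * cent l" using bound[of n] that by simp
    also have "\<dots> \<le> n * \<epsilon> + n * (went l V / card V)" using cl by (intro add_left_mono mult_left_mono) auto
    finally show ?thesis by (simp add: algebra_simps)
  qed
  then show ?thesis by blast
qed

lemma Hw_nonneg: "Hw n \<ge> 0"
proof -
  have "\<mu> w * log 2 (\<mu> w) \<le> 0" for w
    using nonneg[of w] le_1[of w] by (cases "\<mu> w = 0") (auto simp: mult_le_0_iff less_le)
  then show ?thesis unfolding Hw_def by (simp add: sum_nonpos)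
qed

end

section \<open>Equality of laws on sequences\<close>

lemma sets_words:
  assumes "length x = f"
  shows "{\<omega>\<in>space (seq_space A). wd \<omega> s f = x} \<in> sets (seq_space (A :: nat set))"
proof -
  have "{\<omega>\<in>space (seq_space A). wd \<omega> s f = x} = {\<omega>\<in>space (seq_space A). \<forall>i\<in>{..<f}. \<omega> (s + int i) = x ! i}"
    using assms by (auto simp: list_eq_iff_nth_eq)
  also have "\<dots> \<in> sets (seq_space A)" by measurable
  finally show ?thesis .
qed

lemma seq_space_eqI:
  fixes P Q :: "(int \<Rightarrow> nat) measure"
  assumes "finite_measure P" and sP: "sets P = sets (seq_space {1..q})" and sQ: "sets Q = sets (seq_space {1..q})"
    and eq: "\<And>s f x. x \<in> words q f \<Longrightarrow> f > 0 \<Longrightarrow>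
       emeasure P {\<omega>\<in>space (seq_space {1..q}). wd \<omega> s f = x} = emeasure Q {\<omega>\<in>space (seq_space {1..q}). wd \<omega> s f = x}"
  shows "P = Q"
proof (rule measure_eqI_PiM_infinite[OF sP sQ _ assms(1)])
  fix A :: "int \<Rightarrow> nat set" and J :: "int set"
  assume J: "finite J" and A: "\<And>j. j \<in> J \<Longrightarrow> A j \<in> sets (count_space {1..q})"
  \<comment> \<open>Including 0 provides a minimum also when \<open>J\<close> is empty.\<close>
  define s where "s = Min (insert 0 J)"
  define f where "f = nat (Max (insert 0 J) - s) + 1"
  have J_int: "s \<le> j" "j < s + int f" if "j \<in> J" for j
  proof -
    show "s \<le> j" using J that by (simp add: s_def)
    have "j \<le> Max (insert 0 J)" using J that by (intro Max_ge) auto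
    then show "j < s + int f" using \<open>s \<le> j\<close> by (simp add: f_def)
  qed
  define I where "I = {x\<in>words q f. \<forall>j\<in>J. x ! nat (j - s) \<in> A j}"
  define E where "E x = {\<omega>\<in>space (seq_space {1..q}). wd \<omega> s f = x}" for x
  have sets_E: "E x \<in> sets (seq_space {1..q})" if "x \<in> I" for x
    unfolding E_def using that by (intro sets_words) (auto simp: I_def words_iff)
  have "prod_emb UNIV (\<lambda>_. count_space {1..q}) J (\<Pi>\<^sub>E j\<in>J. A j) = (\<Union>x\<in>I. E x)"
  proof (intro equalityI subsetI)
    fix \<omega> assume w: "\<omega> \<in> prod_emb UNIV (\<lambda>_. count_space {1..q}) J (\<Pi>\<^sub>E j\<in>J. A j)"
    have "wd \<omega> s f \<in> I"
      unfolding I_def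
    proof (intro CollectI conjI ballI)
      show "wd \<omega> s f \<in> words q f"
        using w by (auto simp: words_iff wd_def prod_emb_def PiE_iff)
      show "wd \<omega> s f ! nat (j - s) \<in> A j" if "j \<in> J" for j
        using w that J_int[OF that] by (auto simp: prod_emb_def PiE_iff)
    qed
    then show "\<omega> \<in> (\<Union>x\<in>I. E x)" using w by (auto simp: E_def prod_emb_def space_PiM)
  next
    fix \<omega> assume "\<omega> \<in> (\<Union>x\<in>I. E x)"
    then have w: "\<omega> \<in> space (seq_space {1..q})" "wd \<omega> s f \<in> I" by (auto simp: E_def)
    have "\<omega> j \<in> A j" if "j \<in> J" for j
    proof -
      have "wd \<omega> s f ! nat (j - s) \<in> A j" using w(2) that by (simp add: I_def)
      then show ?thesis using J_int[OF that] by (subst (asm) wd_nth) auto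
    qed
    then show "\<omega> \<in> prod_emb UNIV (\<lambda>_. count_space {1..q}) J (\<Pi>\<^sub>E j\<in>J. A j)"
      using w(1) by (auto simp: prod_emb_def space_PiM)
  qed
  moreover have "emeasure P' (\<Union>x\<in>I. E x) = (\<Sum>x\<in>I. emeasure P' (E x))" if "sets P' = sets (seq_space {1..q})" for P'
    using sets_E by (intro sum_emeasure[symmetric]) (auto simp: that disjoint_family_on_def E_def I_def)
  moreover have "(\<Sum>x\<in>I. emeasure P (E x)) = (\<Sum>x\<in>I. emeasure Q (E x))"
    unfolding E_def by (intro sum.cong refl eq) (auto simp: I_def f_def)
  ultimately show "emeasure P (prod_emb UNIV (\<lambda>_. count_space {1..q}) J (Pi\<^sub>E J A)) = emeasure Q (prod_emb UNIV (\<lambda>_. count_space {1..q}) J (Pi\<^sub>E J A))"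
    by (simp only: sP sQ)
qed

lemma measure_HL_coloring:
  assumes "HL_coloring q M X" "x \<in> words q n" "n > 0"
  shows "measure M {\<omega> \<in> space M. \<forall>i<n. X (a + int i) \<omega> = x ! i} = HL_mu q x"
proof -
  have "\<forall>m n. n \<ge> 1 \<longrightarrow> (\<forall>x\<in>words q n. measure M {\<omega> \<in> space M. \<forall>i<n. X (m + 1 + int i) \<omega> = x ! i}
      = real (HL_B x) / real (\<Sum>y\<in>words q n. HL_B y))"
    using assms(1) unfolding HL_coloring_def by (elim conjE)
  from this[rule_format, where m="a - 1" and n=n and x=x]
  have "measure M {\<omega> \<in> space M. \<forall>i<n. X (a + int i) \<omega> = x ! i} = real (HL_B x) / real (\<Sum>y\<in>words q n. HL_B y)"
    using assms by simp
  then show ?thesis using assms(2) by (simp add: HL_mu_def HL_Z_def words_iff del: of_nat_sum)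
qed

lemma iid_process_iid: "iid_process (iid p) UNIV (\<lambda>i \<omega>. \<omega> i)"
proof -
  interpret I: product_prob_space "\<lambda>_. measure_pmf p" "UNIV :: int set" ..
  interpret prob_space "iid p" by (rule prob_space_iid)
  have comp: "distr (iid p) (count_space UNIV) (\<lambda>\<omega>. \<omega> i) = measure_pmf p" for i
  proof -
    have "distr (iid p) (count_space UNIV) (\<lambda>\<omega>. \<omega> i) = distr (iid p) (measure_pmf p) (\<lambda>\<omega>. \<omega> i)"
      by (rule distr_cong) auto
    also have "\<dots> = measure_pmf p" unfolding iid_def by (rule I.PiM_component) simp
    finally show ?thesis .
  qed
  have rv: "random_variable (count_space UNIV) (\<lambda>\<omega>. \<omega> i)" for i
    by (subst measurable_cong_sets[OF sets_iid refl]) (rule measurable_component_singleton, simp)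
  have "indep_vars (\<lambda>_. count_space UNIV) (\<lambda>i \<omega>. \<omega> i) UNIV"
  proof (subst indep_vars_iff_distr_eq_PiM')
    have "distr (iid p) (seq_space UNIV) (\<lambda>\<omega>. \<lambda>i\<in>UNIV. \<omega> i) = distr (iid p) (seq_space UNIV) (\<lambda>\<omega>. \<omega>)"
      by (rule distr_cong) (auto simp: fun_eq_iff)
    also have "\<dots> = iid p" by (rule distr_id2) (simp add: sets_iid)
    finally show "distr (iid p) (seq_space UNIV) (\<lambda>\<omega>. \<lambda>i\<in>UNIV. \<omega> i) = (\<Pi>\<^sub>M i\<in>UNIV. distr (iid p) (count_space UNIV) (\<lambda>\<omega>. \<omega> i))"
      by (simp only: comp) (simp add: iid_def)
  qed (use rv in auto)
  then show ?thesis by (simp add: iid_process_def prob_space_iid comp)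
qed

section \<open>Law and locality of the coder\<close>

context coding begin

lemma sets_coder_word:
  assumes "length x = f" shows "{\<omega>. wd (coder \<omega>) s f = x} \<in> sets (iid p)"
proof -
  have "{\<omega>. wd (coder \<omega>) s f = x} = {\<omega>\<in>space (iid p). \<forall>i\<in>{..<f}. coder \<omega> (s + int i) = x ! i}"
    using assms by (auto simp: list_eq_iff_nth_eq)
  also have "\<dots> \<in> sets (iid p)" by (intro sets.sets_Collect_finite_All) (auto simp: sets_coder)
  finally show ?thesis .
qed

definition resolving :: "sty pmf \<Rightarrow> bool" where
  "resolving S \<longleftrightarrow> (\<forall>e>0. \<exists>n R. wprob (2 * R + 5) (label S) (\<lambda>l. \<not> loc_res n R l) \<le> e)"

text \<open>Upper bounds are enough: both sides have the sum 1 over all words, so the inequalities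
  from \<open>coder_window_le\<close> are equalities in the limit.\<close>

lemma measure_coder_word:
  assumes q: "1 \<le> q" and S: "resolving S" and x: "x \<in> words q f" "f > 0"
  shows "measure (iid (label S)) {\<omega>. wd (coder \<omega>) s f = x} = \<mu> x"
proof -
  let ?M = "iid (label S)" and ?W = "\<lambda>x. {\<omega>. wd (coder \<omega>) s f = x}"
  interpret prob_space ?M by (rule prob_space_iid)
  have le: "measure ?M (?W x) \<le> \<mu> x" if "x \<in> words q f" for x
  proof (rule field_le_epsilon)
    fix e :: real assume "e > 0"
    then have "e / f > 0" using x(2) by simp
    then obtain n R where nR: "wprob (2 * R + 5) (label S) (\<lambda>l. \<not> loc_res n R l) \<le> e / f"
      using S unfolding resolving_def by blast
    have "measure ?M (?W x) \<le> \<mu> x + f * wprob (2 * R + 5) (label S) (\<lambda>l. \<not> loc_res n R l)"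
      by (rule coder_window_le[OF that x(2)])
    also have "\<dots> \<le> \<mu> x + f * (e / f)" using nR by (intro add_left_mono mult_left_mono) auto
    finally show "measure ?M (?W x) \<le> \<mu> x + e" using x(2) by simp
  qed
  have sW: "?W x \<in> sets ?M" if "x \<in> words q f" for x using that by (intro sets_coder_word) (simp add: words_iff)
  have "(\<Sum>x\<in>words q f. measure ?M (?W x)) = measure ?M (\<Union>x\<in>words q f. ?W x)"
    using sW by (intro finite_measure_finite_Union[symmetric]) (auto simp: disjoint_family_on_def)
  also have "(\<Union>x\<in>words q f. ?W x) = space ?M"
    using coder_letter[OF q] by (auto simp: words_iff wd_def)
  also have "measure ?M \<dots> = (\<Sum>x\<in>words q f. \<mu> x)" by (simp add: prob_space sum_words del: space_iid)
  finally have "(\<Sum>x\<in>words q f. measure ?M (?W x)) = (\<Sum>x\<in>words q f. \<mu> x)" .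
  from sum_mono_inv[OF this le x(1) finite_words] show ?thesis .
qed

lemma AE_resolved:
  assumes S: "resolving S"
  shows "AE \<omega> in iid (label S). \<exists>n c. RS n (field \<omega>) v c"
proof (rule AE_I')
  let ?M = "iid (label S)"
  interpret prob_space ?M by (rule prob_space_iid)
  define B where "B = space ?M - (\<Union>n. \<Union>c. {\<omega>. RS n (field \<omega>) v c})"
  have sB: "B \<in> sets ?M"
    unfolding B_def by (intro sets.compl_sets sets.countable_UN) (auto intro!: sets.countable_UN sets_RS)
  have "measure ?M B \<le> 0"
  proof (rule field_le_epsilon)
    fix e :: real assume "e > 0"
    then obtain n R where nR: "wprob (2 * R + 5) (label S) (\<lambda>l. \<not> loc_res n R l) \<le> e"
      using S unfolding resolving_def by blast
    have "measure ?M B \<le> measure ?M {\<omega>. \<not> loc_res n R (wd \<omega> (v - int R - 2) (2 * R + 5))}"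
      by (intro finite_measure_mono) (auto simp: B_def dest: loc_res_RS)
    also have "\<dots> = wprob (2 * R + 5) (label S) (\<lambda>l. \<not> loc_res n R l)" by (rule measure_wd)
    also have "\<dots> \<le> e" by (rule nR)
    finally show "measure ?M B \<le> 0 + e" by simp
  qed
  then show "B \<in> null_sets ?M" using sB by (intro null_setsI) (auto simp: emeasure_eq_measure measure_le_0_iff)
  show "{\<omega>\<in>space ?M. \<not> (\<exists>n c. RS n (field \<omega>) v c)} \<subseteq> B" by (auto simp: B_def)
qed

lemma RS_local:
  assumes "RS n (field \<omega>) 0 c"
  shows "\<exists>r::nat. \<forall>\<omega>'. (\<forall>i\<in>{- int r..int r}. \<omega>' i = \<omega> i) \<longrightarrow> RS n (field \<omega>') 0 c"
proof -
  obtain a N where aN: "cell n (field \<omega>) a N" "a \<le> 0" "0 < a + int N" "resolved n (wd (field \<omega>) a N) (nat (0 - a)) c"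
    using assms by (auto simp: RS_def)
  \<comment> \<open>The cell, its walls and the neighbours of the walls lie within this
    radius.\<close>
  define r where "r = nat (\<bar>a\<bar> + int N + 2)"
  have "RS n (field \<omega>') 0 c" if h: "\<forall>i\<in>{- int r..int r}. \<omega>' i = \<omega> i" for \<omega>'
  proof -
    have eq: "field \<omega> v = field \<omega>' v" if "a - 1 \<le> v" "v \<le> a + int N" for v
    proof -
      have "\<omega>' (v - 1) = \<omega> (v - 1)" "\<omega>' v = \<omega> v" "\<omega>' (v + 1) = \<omega> (v + 1)"
        using h aN(2,3) that by (auto simp: r_def)
      then show ?thesis by (simp add: field_def)
    qed
    have "cell n (field \<omega>') a N" using cell_cong[of a N "field \<omega>" "field \<omega>'" n] eq aN(1) by simp
    moreover have "wd (field \<omega>') a N = wd (field \<omega>) a N" using eq by (intro wd_cong) auto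
    ultimately show ?thesis using aN unfolding RS_def by (intro exI[of _ a] exI[of _ N]) auto
  qed
  then show ?thesis by blast
qed

lemma finitary_coder:
  assumes "resolving S"
  shows "finitary (iid (label S)) UNIV (\<lambda>i \<omega>. \<omega> i) coder"
  unfolding finitary_def
  using AE_resolved[OF assms, of 0]
proof eventually_elim
  case (elim \<omega>)
  then obtain n c where R: "RS n (field \<omega>) 0 c" by blast
  obtain r :: nat where r: "\<And>\<omega>'. (\<forall>i\<in>{- int r..int r}. \<omega>' i = \<omega> i) \<Longrightarrow> RS n (field \<omega>') 0 c"
    using RS_local[OF R] by blast
  show ?case
    by (intro exI[of _ r] ballI impI) (use r coder_eq coder_eq[OF R] in metis)
qed

lemma factor_map_coder:
  assumes q: "1 \<le> q" and \<mu>: "\<mu> = HL_mu q" and S: "resolving S" and X: "HL_coloring q M X"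
  shows "factor_map int_automorphisms (iid (label S)) UNIV (\<lambda>i \<omega>. \<omega> i) M {1..q} X coder"
  unfolding factor_map_def
proof (intro conjI ballI)
  show m: "coder \<in> seq_space UNIV \<rightarrow>\<^sub>M seq_space {1..q}" by (rule measurable_coder[OF q])
  show "coder (y \<circ> g) = coder y \<circ> g" if "g \<in> int_automorphisms" for g y
    using that coder_shift coder_reflect by (auto simp: int_automorphisms_def)
  let ?N = "iid (label S)"
  interpret N: prob_space ?N by (rule prob_space_iid)
  interpret M: prob_space M using X by (simp add: HL_coloring_def)
  have mN: "(\<lambda>\<omega>. coder \<omega>) \<in> ?N \<rightarrow>\<^sub>M seq_space {1..q}"
    using m by (subst measurable_cong_sets[OF sets_iid refl])
  have Xi: "X i \<in> M \<rightarrow>\<^sub>M count_space {1..q}" for i using X by (simp add: HL_coloring_def)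
  have mX: "(\<lambda>\<omega> i. X i \<omega>) \<in> M \<rightarrow>\<^sub>M seq_space {1..q}"
    using Xi measurable_space[OF Xi] by (intro measurable_PiM_single') auto
  show "distr ?N (seq_space {1..q}) (\<lambda>\<omega>. coder (\<lambda>i. \<omega> i)) = distr M (seq_space {1..q}) (\<lambda>\<omega> i. X i \<omega>)"
  proof (rule seq_space_eqI[where q=q])
    show "finite_measure (distr ?N (seq_space {1..q}) (\<lambda>\<omega>. coder (\<lambda>i. \<omega> i)))"
      using N.prob_space_distr[OF mN] by (simp add: prob_space.finite_measure)
    fix s :: int and f :: nat and x assume x: "x \<in> words q f" "f > 0"
    let ?E = "{\<omega>\<in>space (seq_space {1..q}). wd \<omega> s f = x}"
    have E: "?E \<in> sets (seq_space {1..q})" using x by (intro sets_words) (simp add: words_iff)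
    have "emeasure (distr ?N (seq_space {1..q}) (\<lambda>\<omega>. coder (\<lambda>i. \<omega> i))) ?E = emeasure ?N {\<omega>. wd (coder \<omega>) s f = x}"
      using coder_letter[OF q] by (subst emeasure_distr[OF mN E]) (auto intro!: arg_cong[of _ _ "emeasure ?N"] simp: space_PiM)
    also have "\<dots> = ennreal (\<mu> x)" using measure_coder_word[OF q S x] by (simp add: N.emeasure_eq_measure)
    also have "\<mu> x = measure M {\<omega> \<in> space M. \<forall>i<f. X (s + int i) \<omega> = x ! i}"
      using measure_HL_coloring[OF X x] by (simp add: \<mu>)
    also have "{\<omega> \<in> space M. \<forall>i<f. X (s + int i) \<omega> = x ! i} = (\<lambda>\<omega> i. X i \<omega>) -` ?E \<inter> space M"
    proof -
      have wd: "(wd y s f = x) = (\<forall>i<f. y (s + int i) = x ! i)" for y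
        using x(1) by (simp add: list_eq_iff_nth_eq words_iff)
      have "(\<lambda>\<omega> i. X i \<omega>) -` ?E \<inter> space M = {\<omega>\<in>space M. wd (\<lambda>i. X i \<omega>) s f = x}"
        using measurable_space[OF mX] by (intro set_eqI) (simp add: conj_commute conj_left_commute cong: conj_cong)
      then show ?thesis unfolding wd by simp
    qed
    also have "ennreal (measure M \<dots>) = emeasure (distr M (seq_space {1..q}) (\<lambda>\<omega> i. X i \<omega>)) ?E"
      by (subst emeasure_distr[OF mX E]) (simp add: M.emeasure_eq_measure)
    finally show "emeasure (distr ?N (seq_space {1..q}) (\<lambda>\<omega>. coder (\<lambda>i. \<omega> i))) ?E = emeasure (distr M (seq_space {1..q}) (\<lambda>\<omega> i. X i \<omega>)) ?E" .
  qed auto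
qed

end

section \<open>Shannon entropies\<close>

definition eta :: "real \<Rightarrow> real" where
  "eta x = - (x * log 2 x)"

lemma eta_0 [simp]: "eta 0 = 0" and eta_1 [simp]: "eta 1 = 0"
  by (simp_all add: eta_def)

lemma eta_nonneg: "0 \<le> x \<Longrightarrow> x \<le> 1 \<Longrightarrow> 0 \<le> eta x"
  by (cases "x = 0") (auto simp: eta_def mult_le_0_iff)

lemma eta_pmf [simp]: "0 \<le> eta (pmf p x)"
  by (simp add: eta_nonneg pmf_le_1)

lemma eta_mult: "0 \<le> x \<Longrightarrow> 0 \<le> y \<Longrightarrow> eta (x * y) = y * eta x + x * eta y"
  by (cases "x = 0 \<or> y = 0") (auto simp: eta_def log_mult algebra_simps)

lemma inverse_ln2_le: "0 \<le> x \<Longrightarrow> x / ln 2 \<le> 3 / 2 * (x :: real)"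
proof -
  assume "0 \<le> x"
  have "x / ln 2 \<le> x / (2 / 3)" using \<open>0 \<le> x\<close> ln2_ge_two_thirds by (intro divide_left_mono) auto
  then show ?thesis by simp
qed

lemma eta_le_1_minus:
  assumes "0 \<le> x" "x \<le> 1" shows "eta x \<le> 3 / 2 * (1 - x)"
proof (cases "x = 0")
  case False
  then have x: "x > 0" using assms by simp
  have "- ln x \<le> 1 / x - 1" using ln_le_minus_one[of "1 / x"] x by (simp add: ln_div)
  then have "x * (- ln x) \<le> x * (1 / x - 1)" using x by (intro mult_left_mono) auto
  also have "\<dots> = 1 - x" using x by (simp add: field_simps)
  finally have "x * (- ln x) / ln 2 \<le> (1 - x) / ln 2" by (intro divide_right_mono) auto
  also have "\<dots> \<le> 3 / 2 * (1 - x)" using assms by (intro inverse_ln2_le) simp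
  finally show ?thesis by (simp add: eta_def log_def)
qed (use assms in simp)

text \<open>Rates that decay like \<open>(1 / 4) ^ n\<close> thus have entropies that decay like
  \<open>(1 / 2) ^ n\<close>, so infinitely many types cost little. The constant is 2, from the
  square root in the logarithm, times the bound \<open>3 / 2\<close> for
  \<open>1 / ln 2\<close>.\<close>

lemma eta_le_sqrt:
  assumes "0 \<le> y" "0 \<le> x" "x \<le> y ^ 2" shows "eta x \<le> 3 * y"
proof (cases "x = 0")
  case False
  define r where "r = sqrt x"
  have x: "x > 0" using False assms by simp
  then have r: "r > 0" "x = r * r" by (simp_all add: r_def)
  have "- ln r \<le> 1 / r" using ln_le_minus_one[of "1 / r"] r(1) by (simp add: ln_div)
  then have "2 * x * (- ln r) \<le> 2 * x * (1 / r)" using x by (intro mult_left_mono) auto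
  also have "\<dots> = 2 * r" using r by simp
  finally have "2 * x * (- ln r) / ln 2 \<le> 2 * r / ln 2" by (intro divide_right_mono) auto
  also have "\<dots> \<le> 3 / 2 * (2 * r)" using r by (intro inverse_ln2_le) simp
  finally have "2 * x * (- ln r) / ln 2 \<le> 3 * r" by simp
  moreover have "eta x = 2 * x * (- ln r) / ln 2" unfolding eta_def log_def r(2) using r(1) by (simp add: ln_mult)
  moreover have "r \<le> y" unfolding r_def using assms by (intro real_le_lsqrt) auto
  ultimately show ?thesis by simp
qed (use assms in simp)

lemma fent_support:
  assumes "finite \<Omega>" "\<And>\<omega>. \<omega> \<in> \<Omega> \<Longrightarrow> p \<omega> \<ge> (0 :: real)"
  shows "fent {\<omega>\<in>\<Omega>. p \<omega> > 0} p f = fent \<Omega> p f"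
proof -
  have 1: "(\<Sum>\<omega>'\<in>{\<omega>'\<in>{\<omega>\<in>\<Omega>. p \<omega> > 0}. f \<omega>' = z}. p \<omega>') = (\<Sum>\<omega>'\<in>{\<omega>'\<in>\<Omega>. f \<omega>' = z}. p \<omega>')" for z
    using assms by (intro sum.mono_neutral_left) (auto simp: less_le)
  show ?thesis unfolding fent_def 1
    using assms by (intro arg_cong[of _ _ uminus] sum.mono_neutral_left) (auto simp: less_le)
qed

lemma shannon_entropy_fent:
  assumes "prob_space M" and fin: "finite \<Omega>" and W: "\<And>\<omega>. \<omega> \<in> space M \<Longrightarrow> W \<omega> \<in> \<Omega>"
    and sW: "\<And>u. u \<in> \<Omega> \<Longrightarrow> {\<omega> \<in> space M. W \<omega> = u} \<in> sets M"
    and p: "\<And>u. u \<in> \<Omega> \<Longrightarrow> measure M {\<omega> \<in> space M. W \<omega> = u} = p u"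
  shows "shannon_entropy M (\<lambda>\<omega>. f (W \<omega>)) = ennreal (fent \<Omega> p f)"
proof -
  interpret prob_space M by fact
  have P: "measure M {\<omega> \<in> space M. f (W \<omega>) = z} = (\<Sum>u\<in>{u\<in>\<Omega>. f u = z}. p u)" for z
  proof -
    have "{\<omega> \<in> space M. f (W \<omega>) = z} = (\<Union>u\<in>{u\<in>\<Omega>. f u = z}. {\<omega> \<in> space M. W \<omega> = u})"
      using W by auto
    also have "measure M \<dots> = (\<Sum>u\<in>{u\<in>\<Omega>. f u = z}. measure M {\<omega> \<in> space M. W \<omega> = u})"
      using fin sW by (intro finite_measure_finite_Union) (auto simp: disjoint_family_on_def)
    finally show ?thesis using p by simp
  qed
  have "shannon_entropy M (\<lambda>\<omega>. f (W \<omega>)) = (\<Sum>\<^sub>\<infinity>z. ennreal (eta (\<Sum>u\<in>{u\<in>\<Omega>. f u = z}. p u)))"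
    by (simp add: shannon_entropy_def P eta_def Let_def)
  also have "\<dots> = (\<Sum>\<^sub>\<infinity>z\<in>f ` \<Omega>. ennreal (eta (\<Sum>u\<in>{u\<in>\<Omega>. f u = z}. p u)))"
  proof (rule infsum_cong_neutral)
    fix z assume "z \<in> UNIV - f ` \<Omega>"
    then have "{u\<in>\<Omega>. f u = z} = {}" by auto
    then show "ennreal (eta (\<Sum>u\<in>{u\<in>\<Omega>. f u = z}. p u)) = 0" by (simp only:) simp
  qed auto
  also have "\<dots> = (\<Sum>z\<in>f ` \<Omega>. ennreal (eta (\<Sum>u\<in>{u\<in>\<Omega>. f u = z}. p u)))"
    using fin by simp
  also have "\<dots> = ennreal (\<Sum>z\<in>f ` \<Omega>. eta (\<Sum>u\<in>{u\<in>\<Omega>. f u = z}. p u))"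
    by (intro sum_ennreal) (simp add: eta_nonneg flip: P)
  also have "(\<Sum>z\<in>f ` \<Omega>. eta (\<Sum>u\<in>{u\<in>\<Omega>. f u = z}. p u)) = fent \<Omega> p f"
    by (simp add: fent_image[OF fin] eta_def)
  finally show ?thesis .
qed

text \<open>By stationarity \<open>V\<close> may be moved into a window that starts at 0, where its
  entropy is that of finitely many weights.\<close>

lemma (in twodep) shannon_entropy_HL_coloring:
  assumes \<mu>: "\<mu> = HL_mu q" and X: "HL_coloring q M X" and V: "finite V" "V \<noteq> {}"
  shows "\<exists>l V'. finite V' \<and> V' \<noteq> {} \<and> V' \<subseteq> {..<l} \<and> card V' = card V \<and>
    shannon_entropy M (\<lambda>\<omega>. \<lambda>v\<in>V. X v \<omega>) = ennreal (went l V')"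
proof -
  interpret M: prob_space M using X by (simp add: HL_coloring_def)
  have Xi: "X i \<in> M \<rightarrow>\<^sub>M count_space {1..q}" for i using X by (simp add: HL_coloring_def)
  define a where "a = Min V"
  define l where "l = nat (Max V - a) + 1"
  define V' where "V' = (\<lambda>v. nat (v - a)) ` V"
  have Va: "a \<le> v" "v < a + int l" if "v \<in> V" for v
  proof -
    show "a \<le> v" using V that by (simp add: a_def)
    have "v \<le> Max V" using V that by (intro Max_ge) auto
    then show "v < a + int l" using \<open>a \<le> v\<close> by (simp add: l_def)
  qed
  define W where "W \<omega> = wd (\<lambda>i. X i \<omega>) a l" for \<omega>
  define f where "f u = (\<lambda>v\<in>V. u ! nat (v - a))" for u :: "nat list"
  have fW: "f (W \<omega>) = (\<lambda>v\<in>V. X v \<omega>)" for \<omega>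
    unfolding f_def W_def
  proof (rule restrict_ext)
    fix v assume "v \<in> V"
    then have "nat (v - a) < l" "a + int (nat (v - a)) = v" using Va[of v] by auto
    then show "wd (\<lambda>i. X i \<omega>) a l ! nat (v - a) = X v \<omega>" by simp
  qed
  have W_eq: "(W \<omega> = u) = (\<forall>i<l. X (a + int i) \<omega> = u ! i)" if "u \<in> words q l" for \<omega> u
    using that by (simp add: W_def list_eq_iff_nth_eq words_iff)
  have sW: "{\<omega> \<in> space M. W \<omega> = u} \<in> sets M" if "u \<in> words q l" for u
  proof -
    have "{\<omega> \<in> space M. X (a + int i) \<omega> = u ! i} \<in> sets M" for i
    proof -
      have "X (a + int i) -` ({u ! i} \<inter> {1..q}) \<inter> space M = {\<omega> \<in> space M. X (a + int i) \<omega> = u ! i}"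
        using measurable_space[OF Xi[of "a + int i"]] by (intro set_eqI) (simp, metis)
      then show ?thesis using measurable_sets[OF Xi, of "{u ! i} \<inter> {1..q}" "a + int i"] by simp
    qed
    then have "{\<omega> \<in> space M. \<forall>i\<in>{..<l}. X (a + int i) \<omega> = u ! i} \<in> sets M"
      by (rule sets.sets_Collect_finite_All) simp
    then show ?thesis unfolding W_eq[OF that] by (simp only: Ball_def lessThan_iff)
  qed
  have "shannon_entropy M (\<lambda>\<omega>. f (W \<omega>)) = ennreal (fent (words q l) \<mu> f)"
  proof (rule shannon_entropy_fent)
    show "W \<omega> \<in> words q l" if "\<omega> \<in> space M" for \<omega>
      using measurable_space[OF Xi that] by (auto simp: W_def words_iff wd_def)
    show "measure M {\<omega> \<in> space M. W \<omega> = u} = \<mu> u" if "u \<in> words q l" for u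
      using measure_HL_coloring[OF X that, of a] by (simp add: W_eq[OF that] \<mu> l_def)
  qed (use sW M.prob_space_axioms in auto)
  also have "fent (words q l) \<mu> f = fent (supp l) \<mu> f"
    unfolding supp_def using nonneg by (intro fent_support[symmetric]) auto
  also have "\<dots> = went l V'"
    unfolding went_def f_def V'_def by (intro fent_cong) (simp only: restrict_eq_iff, blast)
  finally have "shannon_entropy M (\<lambda>\<omega>. \<lambda>v\<in>V. X v \<omega>) = ennreal (went l V')" by (simp only: fW)
  moreover have "card V' = card V"
    unfolding V'_def
  proof (intro card_image inj_onI)
    fix v w assume "v \<in> V" "w \<in> V" "nat (v - a) = nat (w - a)"
    then show "v = w" using Va(1)[of v] Va(1)[of w] by simp
  qed
  moreover have "V' \<subseteq> {..<l}"
  proof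
    fix i assume "i \<in> V'"
    then obtain v where "v \<in> V" "i = nat (v - a)" by (auto simp: V'_def)
    then show "i \<in> {..<l}" using Va[of v] by auto
  qed
  ultimately show ?thesis using V by (intro exI[of _ l] exI[of _ V']) (auto simp: V'_def)
qed

section \<open>Entropy of the source\<close>

definition pent :: "'a pmf \<Rightarrow> ennreal" where
  "pent p = (\<integral>\<^sup>+x. ennreal (eta (pmf p x)) \<partial>count_space UNIV)"

lemma pent_map_inj:
  assumes "inj f" shows "pent (map_pmf f p) = pent p"
proof -
  have "pent (map_pmf f p) = (\<integral>\<^sup>+x. ennreal (eta (pmf (map_pmf f p) x)) * indicator (range f) x \<partial>count_space UNIV)"
    unfolding pent_def
  proof (intro nn_integral_cong)
    fix x
    have "pmf (map_pmf f p) x = 0" if "x \<notin> range f" using that by (auto simp: pmf_eq_0_set_pmf)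
    then show "ennreal (eta (pmf (map_pmf f p) x)) = ennreal (eta (pmf (map_pmf f p) x)) * indicator (range f) x"
      by (cases "x \<in> range f") auto
  qed
  also have "\<dots> = (\<integral>\<^sup>+x. ennreal (eta (pmf (map_pmf f p) x)) \<partial>count_space (range f))"
    by (simp add: nn_integral_count_space_indicator)
  also have "\<dots> = (\<integral>\<^sup>+x. ennreal (eta (pmf (map_pmf f p) (f x))) \<partial>count_space UNIV)"
    using assms by (intro nn_integral_bij_count_space[symmetric]) (simp add: bij_betw_def)
  also have "\<dots> = pent p" using assms by (simp add: pent_def pmf_map_inj')
  finally show ?thesis .
qed

lemma pent_return [simp]: "pent (return_pmf x) = 0"
proof -
  have "eta (pmf (return_pmf x) y) = 0" for y by (auto simp: indicator_def)
  then show ?thesis by (simp add: pent_def)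
qed

lemma pent_bool: "pent (pmf_of_set (UNIV :: bool set)) = 1"
proof -
  have "eta (pmf (pmf_of_set UNIV) b) = 1 / 2" for b :: bool by (simp add: eta_def log_divide)
  then have "pent (pmf_of_set (UNIV :: bool set)) = (\<Sum>b\<in>(UNIV :: bool set). ennreal (1 / 2))"
    by (simp only: pent_def nn_integral_count_space_finite[OF finite])
  also have "\<dots> = ennreal (\<Sum>b\<in>(UNIV :: bool set). 1 / 2)" by (rule sum_ennreal) simp
  finally show ?thesis by simp
qed

lemma pmf_bind_Pair: "pmf (bind_pmf S (\<lambda>s. map_pmf (Pair s) (K s))) (s, d) = pmf S s * pmf (K s) d"
proof -
  have "pmf (map_pmf (Pair s') (K s')) (s, d) = indicator {s} s' * pmf (K s) d" for s'
  proof (cases "s' = s")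
    case True
    then show ?thesis by (simp add: pmf_map_inj' inj_on_def)
  next
    case False
    then show ?thesis by (auto simp: pmf_eq_0_set_pmf)
  qed
  then show ?thesis by (simp add: pmf_bind measure_pmf_single)
qed

lemma nn_integral_pmf_UNIV: "(\<integral>\<^sup>+x. ennreal (pmf p x) \<partial>count_space UNIV) = 1"
  using measure_pmf.emeasure_space_1[of p] by (simp add: nn_integral_pmf)

text \<open>The chain rule: the entropy of the type plus the mean entropy of the data given the
  type.\<close>

lemma pent_bind_Pair:
  "pent (bind_pmf S (\<lambda>s. map_pmf (Pair s) (K s))) =
    (\<integral>\<^sup>+s. ennreal (eta (pmf S s)) + ennreal (pmf S s) * pent (K s) \<partial>count_space UNIV)"
proof -
  have "pent (bind_pmf S (\<lambda>s. map_pmf (Pair s) (K s)))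
      = (\<integral>\<^sup>+s. \<integral>\<^sup>+d. ennreal (eta (pmf S s * pmf (K s) d)) \<partial>count_space UNIV \<partial>count_space UNIV)"
    unfolding pent_def by (subst nn_integral_fst_count_space[symmetric]) (simp add: pmf_bind_Pair)
  also have "\<dots> = (\<integral>\<^sup>+s. ennreal (eta (pmf S s)) + ennreal (pmf S s) * pent (K s) \<partial>count_space UNIV)"
  proof (intro nn_integral_cong)
    fix s
    have "(\<integral>\<^sup>+d. ennreal (eta (pmf S s * pmf (K s) d)) \<partial>count_space UNIV)
       = (\<integral>\<^sup>+d. ennreal (eta (pmf S s)) * ennreal (pmf (K s) d) + ennreal (pmf S s) * ennreal (eta (pmf (K s) d)) \<partial>count_space UNIV)"
      by (intro nn_integral_cong) (simp add: eta_mult ennreal_mult[symmetric] ennreal_plus[symmetric] mult.commute del: ennreal_plus)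
    also have "\<dots> = ennreal (eta (pmf S s)) + ennreal (pmf S s) * pent (K s)"
      by (simp add: nn_integral_add nn_integral_cmult nn_integral_pmf_UNIV pent_def)
    finally show "(\<integral>\<^sup>+d. ennreal (eta (pmf S s * pmf (K s) d)) \<partial>count_space UNIV) = ennreal (eta (pmf S s)) + ennreal (pmf S s) * pent (K s)" .
  qed
  finally show ?thesis .
qed

text \<open>A single site bounds the infimum, and only an upper bound for the source is
  wanted.\<close>

lemma process_entropy_iid_le: "process_entropy (iid p) (\<lambda>i \<omega>. \<omega> i) \<le> pent p"
proof -
  define h :: "nat \<Rightarrow> int \<Rightarrow> nat" where "h k = (\<lambda>v\<in>{0}. k)" for k
  have h0: "h k 0 = k" for k by (simp add: h_def)
  have P: "measure (iid p) {\<omega>. (\<lambda>v\<in>{0}. \<omega> v) = h k} = pmf p k" for k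
  proof -
    have "{\<omega>. (\<lambda>v\<in>{0}. \<omega> v) = h k} = {\<omega>. wd \<omega> 0 1 = [k]}"
      by (auto simp: h_def wd_def fun_eq_iff)
    also have "measure (iid p) \<dots> = measure (replicate_pmf 1 p) {l. l = [k]}"
      using measure_wd[where Q="\<lambda>l. l = [k]"] by (simp add: wprob_def)
    also have "\<dots> = pmf p k" using pmf_replicate_pmf[of "[k]" 1 p] by (simp add: measure_pmf_single del: replicate_pmf.simps)
    finally show ?thesis .
  qed
  have "process_entropy (iid p) (\<lambda>i \<omega>. \<omega> i) \<le> shannon_entropy (iid p) (\<lambda>\<omega>. \<lambda>v\<in>{0}. \<omega> v) / of_nat (card {0 :: int})"
    unfolding process_entropy_def by (rule INF_lower) auto
  also have "\<dots> = (\<Sum>\<^sub>\<infinity>z. ennreal (eta (measure (iid p) {\<omega>. (\<lambda>v\<in>{0}. \<omega> v) = z})))"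
    by (simp add: shannon_entropy_def eta_def Let_def divide_ennreal_def)
  also have "\<dots> = (SUP F\<in>{F. finite F \<and> F \<subseteq> UNIV}. \<Sum>z\<in>F. ennreal (eta (measure (iid p) {\<omega>. (\<lambda>v\<in>{0}. \<omega> v) = z})))"
    by (rule nonneg_infsum_complete) simp
  also have "\<dots> \<le> pent p"
  proof (rule SUP_least)
    fix F :: "(int \<Rightarrow> nat) set" assume "F \<in> {F. finite F \<and> F \<subseteq> UNIV}"
    then have F: "finite F" by simp
    have "(\<Sum>z\<in>F. ennreal (eta (measure (iid p) {\<omega>. (\<lambda>v\<in>{0}. \<omega> v) = z})))
       = (\<Sum>z\<in>F \<inter> range h. ennreal (eta (measure (iid p) {\<omega>. (\<lambda>v\<in>{0}. \<omega> v) = z})))"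
    proof (rule sum.mono_neutral_right[OF F])
      show "\<forall>z\<in>F - F \<inter> range h. ennreal (eta (measure (iid p) {\<omega>. (\<lambda>v\<in>{0}. \<omega> v) = z})) = 0"
      proof
        fix z assume "z \<in> F - F \<inter> range h"
        then have "z \<noteq> h (\<omega> 0)" for \<omega> :: "int \<Rightarrow> nat" by auto
        moreover have "(\<lambda>v\<in>{0}. \<omega> v) = h (\<omega> 0)" for \<omega> by (auto simp: h_def fun_eq_iff)
        ultimately have "{\<omega>. (\<lambda>v\<in>{0}. \<omega> v) = z} = {}" by auto
        then show "ennreal (eta (measure (iid p) {\<omega>. (\<lambda>v\<in>{0}. \<omega> v) = z})) = 0" by (simp only:) simp
      qed
    qed auto
    also have "\<dots> = (\<Sum>z\<in>F \<inter> range h. ennreal (eta (pmf p (z 0))))"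
      by (intro sum.cong refl) (auto simp: P h0)
    also have "\<dots> = (\<Sum>k\<in>(\<lambda>z. z 0) ` (F \<inter> range h). ennreal (eta (pmf p k)))"
      by (subst sum.reindex) (auto simp: inj_on_def h0)
    also have "\<dots> = (\<integral>\<^sup>+k. ennreal (eta (pmf p k)) \<partial>count_space ((\<lambda>z. z 0) ` (F \<inter> range h)))"
      using F by (subst nn_integral_count_space_finite) auto
    also have "\<dots> = (\<integral>\<^sup>+k. ennreal (eta (pmf p k)) * indicator ((\<lambda>z. z 0) ` (F \<inter> range h)) k \<partial>count_space UNIV)"
      by (simp add: nn_integral_count_space_indicator)
    also have "\<dots> \<le> pent p"
      unfolding pent_def by (intro nn_integral_mono) (auto simp: indicator_def)
    finally show "(\<Sum>z\<in>F. ennreal (eta (measure (iid p) {\<omega>. (\<lambda>v\<in>{0}. \<omega> v) = z}))) \<le> pent p" .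
  qed
  finally show ?thesis .
qed

context coding begin

lemma map_mask:
  "map_pmf mask (pair_pmf S data_pmf) = bind_pmf S (\<lambda>s. map_pmf (Pair s) (map_pmf (\<lambda>d. snd (mask (s, d))) data_pmf))"
proof -
  have "mask (s, d) = (s, snd (mask (s, d)))" for s d by (simp add: mask_def)
  then have "mask = (\<lambda>(s, d). (s, snd (mask (s, d))))" by auto
  then have "map_pmf mask (pair_pmf S data_pmf) = map_pmf (\<lambda>(s, d). (s, snd (mask (s, d)))) (pair_pmf S data_pmf)"
    by simp
  then show ?thesis
    by (simp add: pair_pmf_def map_bind_pmf map_pmf_def bind_assoc_pmf bind_return_pmf)
qed

lemma pent_word_pmf: "pent word_pmf = ennreal (Hw L)"
proof -
  have "pent word_pmf = (\<Sum>w\<in>words q L. ennreal (eta (pmf word_pmf w)))"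
    unfolding pent_def by (rule nn_integral_count_space') (auto simp: pmf_word_pmf)
  also have "\<dots> = ennreal (\<Sum>w\<in>words q L. eta (pmf word_pmf w))" by (intro sum_ennreal) simp
  also have "(\<Sum>w\<in>words q L. eta (pmf word_pmf w)) = Hw L"
    by (simp add: pmf_word_pmf eta_def Hw_def sum_negf)
  finally show ?thesis .
qed

lemma pent_mask:
  "pent (map_pmf (\<lambda>d. snd (mask (s, d))) data_pmf) = (case s of Sup \<Rightarrow> ennreal (Hw L) | Bit n \<Rightarrow> 1 | _ \<Rightarrow> 0)"
proof (cases s)
  case Sup
  have "map_pmf (\<lambda>d. snd (mask (Sup, d))) data_pmf = map_pmf (\<lambda>w. (w, False)) (map_pmf fst data_pmf)"
    unfolding pmf.map_comp by (intro map_pmf_cong) (auto simp: mask_def)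
  also have "map_pmf fst data_pmf = word_pmf" by (simp add: data_pmf_def map_fst_pair_pmf)
  finally show ?thesis using Sup by (simp add: pent_map_inj inj_on_def pent_word_pmf)
next
  case (Bit n)
  have "map_pmf (\<lambda>d. snd (mask (Bit n, d))) data_pmf = map_pmf (\<lambda>b. ([], b)) (map_pmf snd data_pmf)"
    unfolding pmf.map_comp by (intro map_pmf_cong) (auto simp: mask_def)
  also have "map_pmf snd data_pmf = pmf_of_set UNIV" by (simp add: data_pmf_def map_snd_pair_pmf)
  finally show ?thesis using Bit by (simp add: pent_map_inj inj_on_def pent_bool)
qed (simp_all add: mask_def map_pmf_const)

lemma pent_label:
  "pent (label S) = ennreal (eta (pmf S Plain)) + (ennreal (eta (pmf S Sup)) + ennreal (pmf S Sup * Hw L))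
    + (\<Sum>n. ennreal (eta (pmf S (Bit n)) + pmf S (Bit n))) + (\<Sum>n. ennreal (eta (pmf S (Cut n))))"
proof -
  have "pent (label S) = pent (map_pmf to_nat (map_pmf mask (pair_pmf S data_pmf)))"
    by (simp add: label_def pmf.map_comp)
  also have "\<dots> = pent (map_pmf mask (pair_pmf S data_pmf))" by (rule pent_map_inj) simp
  also have "\<dots> = (\<integral>\<^sup>+s. ennreal (eta (pmf S s)) + ennreal (pmf S s) * (case s of Sup \<Rightarrow> ennreal (Hw L) | Bit n \<Rightarrow> 1 | _ \<Rightarrow> 0) \<partial>count_space UNIV)"
    unfolding map_mask pent_bind_Pair pent_mask ..
  also have "\<dots> = ennreal (eta (pmf S Plain)) + (ennreal (eta (pmf S Sup)) + ennreal (pmf S Sup * Hw L))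
    + (\<Sum>n. ennreal (eta (pmf S (Bit n)) + pmf S (Bit n))) + (\<Sum>n. ennreal (eta (pmf S (Cut n))))"
    unfolding nn_integral_sty by (simp add: ennreal_mult Hw_nonneg)
  finally show ?thesis .
qed

text \<open>The budget: plain sites cost \<open>3 / 2 * t\<close>, the positions of supplies
  \<open>3 * t\<close>, bits \<open>8 * t\<close>, cutters \<open>6 * t\<close>, and the supplied
  words \<open>Hw L / L\<close>; 25 leaves room. The square in the rates compensates for the square
  root lost in \<open>eta_le_sqrt\<close>.\<close>

lemma pent_label_le:
  assumes t: "0 < t" "t \<le> 1 / 4" and L: "256 / t\<^sup>2 \<le> real L"
    and c: "\<And>n. 0 \<le> c n" "\<And>n. c n \<le> t\<^sup>2 * (1 / 4) ^ n"
  defines "\<beta> \<equiv> \<lambda>n. t\<^sup>2 * (1 / 4) ^ n"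
  defines "S \<equiv> type_pmf (1 / real L) \<beta> c"
  shows "pmf S x = type_weight (1 / real L) \<beta> c x" and "pent (label S) \<le> ennreal (Hw L / L + 25 * t)"
proof -
  have t2: "0 < t\<^sup>2" "t\<^sup>2 \<le> t / 4" using t by (auto simp: power2_eq_square)
  have s: "0 \<le> 1 / real L" "1 / real L \<le> t\<^sup>2"
  proof -
    have "1 / t\<^sup>2 \<le> 256 / t\<^sup>2" using t2 by (intro divide_right_mono) auto
    then have "1 / t\<^sup>2 \<le> real L" using L by simp
    then show "1 / real L \<le> t\<^sup>2" using t2 coding.L[OF coding_axioms] by (simp add: field_simps)
  qed simp
  have geo: "(\<lambda>n. t\<^sup>2 * (1 / 4) ^ n) sums (t\<^sup>2 * (4 / 3))" "(\<lambda>n. t * (1 / 2) ^ n) sums (t * 2)"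
    using sums_mult[OF geometric_sums[of "1 / 4 :: real"], of "t\<^sup>2"] sums_mult[OF geometric_sums[of "1 / 2 :: real"], of t] by auto
  have \<beta>: "0 \<le> \<beta> n" "summable \<beta>" "suminf \<beta> = t\<^sup>2 * (4 / 3)" for n
    using geo(1) t2 by (auto simp: \<beta>_def sums_iff)
  have cs: "summable c"
    using c \<beta>(2) by (intro summable_comparison_test'[of \<beta> 0 c]) (auto simp: \<beta>_def)
  have cm: "0 \<le> suminf c" "suminf c \<le> suminf \<beta>"
    using c cs \<beta>(2) by (auto intro!: suminf_nonneg suminf_le simp: \<beta>_def)
  have "1 / real L + suminf \<beta> + suminf c \<le> 1" using s cm \<beta>(3) t2 t by auto
  then show S: "pmf S x = type_weight (1 / real L) \<beta> c x" for x
    unfolding S_def using s(1) \<beta> c cs by (intro pmf_type_pmf) auto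
  have "eta (pmf S Plain) \<le> 3 / 2 * (1 - pmf S Plain)" by (intro eta_le_1_minus) (auto simp: pmf_le_1)
  \<comment> \<open>Supplies, bits and cutters together have a rate of at most
    \<open>1 + 4 / 3 + 4 / 3\<close> times \<open>t\<^sup>2\<close>.\<close>
  also have "\<dots> \<le> 3 / 2 * (4 * t\<^sup>2)" using s cm \<beta>(3) by (simp add: S type_weight_def)
  also have "\<dots> \<le> 3 / 2 * t" using t2 by simp
  finally have 1: "ennreal (eta (pmf S Plain)) \<le> ennreal (3 / 2 * t)" by (rule ennreal_leI)
  have 2: "ennreal (eta (pmf S Sup)) \<le> ennreal (3 * t)"
    using s t by (intro ennreal_leI eta_le_sqrt) (auto simp: S type_weight_def)
  have sq: "t\<^sup>2 * (1 / 4) ^ n = (t * (1 / 2) ^ n)\<^sup>2" for n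
  proof -
    have "((1 / 2 :: real) ^ n)\<^sup>2 = ((1 / 2)\<^sup>2) ^ n" by (simp only: power_mult[symmetric] mult.commute)
    also have "(1 / 2 :: real)\<^sup>2 = 1 / 4" by (simp add: power2_eq_square)
    finally show ?thesis by (simp only: power_mult_distrib)
  qed
  have "(\<Sum>n. ennreal (eta (pmf S (Bit n)) + pmf S (Bit n))) = (\<Sum>n. ennreal (eta (\<beta> n) + \<beta> n))"
    by (subst suminf_offset[of _ 1]) (auto simp: S type_weight_def)
  also have "\<dots> \<le> (\<Sum>n. ennreal (3 * (t * (1 / 2) ^ n) + t\<^sup>2 * (1 / 4) ^ n))"
    using t by (intro suminf_le ennreal_leI add_mono eta_le_sqrt) (auto simp: \<beta>_def sq)
  also have "\<dots> = ennreal (3 * (t * 2) + t\<^sup>2 * (4 / 3))"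
    using t by (intro suminf_ennreal_eq sums_add sums_mult geo) auto
  also have "\<dots> \<le> ennreal (8 * t)" using t2 t by (intro ennreal_leI) simp
  finally have 3: "(\<Sum>n. ennreal (eta (pmf S (Bit n)) + pmf S (Bit n))) \<le> ennreal (8 * t)" .
  have "(\<Sum>n. ennreal (eta (pmf S (Cut n)))) \<le> (\<Sum>n. ennreal (3 * (t * (1 / 2) ^ n)))"
    using t c by (intro suminf_le ennreal_leI eta_le_sqrt) (auto simp: S type_weight_def simp flip: sq)
  also have "\<dots> = ennreal (3 * (t * 2))"
    using t by (intro suminf_ennreal_eq sums_mult geo) auto
  finally have 4: "(\<Sum>n. ennreal (eta (pmf S (Cut n)))) \<le> ennreal (6 * t)" by simp
  have "pent (label S) \<le> ennreal (3 / 2 * t) + (ennreal (3 * t) + ennreal (Hw L / L)) + ennreal (8 * t) + ennreal (6 * t)"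
    unfolding pent_label by (intro add_mono 1 2 3 4) (simp add: S type_weight_def)
  also have "\<dots> = ennreal (3 / 2 * t + (3 * t + Hw L / L) + 8 * t + 6 * t)"
    using t Hw_nonneg[of L] by (simp add: ennreal_plus[symmetric] del: ennreal_plus)
  also have "\<dots> \<le> ennreal (Hw L / L + 25 * t)" using t by (intro ennreal_leI) simp
  finally show "pent (label S) \<le> ennreal (Hw L / L + 25 * t)" .
qed

end

theorem mainTheorem3:
  fixes k q :: nat and M :: "'a measure" and X :: "int \<Rightarrow> 'a \<Rightarrow> nat" and \<epsilon> :: real
  assumes "(k, q) \<in> {(1, 4), (2, 3)}"
    and "HL_coloring q M X"
    and "\<epsilon> > 0"
  shows "\<exists>(N :: (int \<Rightarrow> nat) measure) (T :: nat set) (Y :: int \<Rightarrow> (int \<Rightarrow> nat) \<Rightarrow> nat)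
           (\<phi> :: (int \<Rightarrow> nat) \<Rightarrow> (int \<Rightarrow> nat)).
           iid_process N T Y \<and>
           process_entropy N Y < process_entropy M X + ennreal \<epsilon> \<and>
           factor_map int_automorphisms N T Y M {1..q} X \<phi> \<and>
           finitary N T Y \<phi>"
proof -
  interpret twodep q "HL_mu q" by (rule twodep_HL_mu[OF assms(1)])
  have q: "1 \<le> q" "q \<le> 4" using assms(1) by auto
  have window: "\<exists>l V'. finite V' \<and> V' \<noteq> {} \<and> V' \<subseteq> {..<l} \<and>
      shannon_entropy M (\<lambda>\<omega>. \<lambda>v\<in>V. X v \<omega>) / of_nat (card V) = ennreal (went l V' / card V')"
    if V: "finite V" "V \<noteq> {}" for V
  proof -
    obtain l V' where h: "finite V'" "V' \<noteq> {}" "V' \<subseteq> {..<l}" "card V' = card V"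
      "shannon_entropy M (\<lambda>\<omega>. \<lambda>v\<in>V. X v \<omega>) = ennreal (went l V')"
      using shannon_entropy_HL_coloring[OF refl assms(2) V] by blast
    have "card V > 0" using V by (simp add: card_gt_0_iff)
    then have "ennreal (went l V') / of_nat (card V) = ennreal (went l V' / card V)"
      by (cases "went l V' \<ge> 0") (simp_all add: divide_ennreal ennreal_neg divide_nonpos_pos ennreal_of_nat_eq_real_of_nat)
    then show ?thesis using h by (intro exI[of _ l] exI[of _ V']) simp
  qed
  \<comment> \<open>The strict inequality for \<open>\<epsilon> / 4\<close> requires a finite
    entropy, which one site provides.\<close>
  have "process_entropy M X \<le> shannon_entropy M (\<lambda>\<omega>. \<lambda>v\<in>{0}. X v \<omega>) / of_nat (card {0 :: int})"
    unfolding process_entropy_def by (rule INF_lower) auto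
  also have "\<dots> < \<top>" using window[of "{0}"] by (auto simp: less_top)
  finally have "process_entropy M X < process_entropy M X + ennreal (\<epsilon> / 4)"
    using assms(3) by (simp add: ennreal_add_left_cancel_less)
  then obtain V where "finite V" "V \<noteq> {}"
    "shannon_entropy M (\<lambda>\<omega>. \<lambda>v\<in>V. X v \<omega>) / of_nat (card V) < process_entropy M X + ennreal (\<epsilon> / 4)"
    unfolding process_entropy_def[of M X] INF_less_iff by blast
  then obtain l V' where V': "finite V'" "V' \<noteq> {}" "V' \<subseteq> {..<l}"
    and w: "ennreal (went l V' / card V') < process_entropy M X + ennreal (\<epsilon> / 4)"
    using window[of V] by metis
  obtain L0 where L0: "\<And>n. n \<ge> L0 \<Longrightarrow> Hw n \<le> n * (went l V' / card V' + \<epsilon> / 4)"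
    using Hw_le[OF V', of "\<epsilon> / 4"] assms(3) by auto
  \<comment> \<open>The overhead of the source is \<open>25 * t\<close> by
    \<open>pent_label_le\<close>; it is to stay below \<open>\<epsilon> / 4\<close>.\<close>
  define t where "t = min (1 / 4) (\<epsilon> / 100)"
  have t: "0 < t" "t \<le> 1 / 4" "25 * t \<le> \<epsilon> / 4" using assms(3) by (auto simp: t_def)
  obtain L1 :: nat where L1: "256 / t\<^sup>2 \<le> L1" using real_arch_simple by blast
  \<comment> \<open>\<open>L0\<close> brings \<open>Hw L / L\<close> near the entropy per site of
    \<open>V'\<close>; \<open>L1\<close> makes the failures at level 0 rare compared with the bits
    of level 1; and \<open>L \<ge> 2\<close> keeps the rate of supplies below \<open>1 / 2\<close>,
    as the estimate for palindromes requires.\<close>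
  define L where "L = max 2 (max L0 L1)"
  have Lge: "L \<ge> 2" "L \<ge> L0" "256 / t\<^sup>2 \<le> L" using L1 by (auto simp: L_def)
  interpret coding q "HL_mu q" L by unfold_locales (use Lge in simp)
  define \<beta> where "\<beta> n = t\<^sup>2 * (1 / 4) ^ n" for n :: nat
  have t2: "0 < t\<^sup>2" "t\<^sup>2 \<le> 1 / 8"
  proof -
    have "t\<^sup>2 \<le> (1 / 4)\<^sup>2" using t by (intro power_mono) auto
    then show "t\<^sup>2 \<le> 1 / 8" by (simp add: power2_eq_square)
  qed (use t in simp)
  have \<beta>: "0 < \<beta> n" "\<beta> n \<le> 1 / 2" for n
  proof -
    have "t\<^sup>2 * (1 / 4) ^ n \<le> t\<^sup>2 * 1" using t2 by (intro mult_left_mono power_le_one) auto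
    then show "\<beta> n \<le> 1 / 2" using t2(2) unfolding \<beta>_def by linarith
  qed (use t in \<open>simp add: \<beta>_def\<close>)
  have base: "4 / real L \<le> \<beta> 0 / 64" using Lge(1,3) t2 by (simp add: \<beta>_def field_simps)
  obtain c R where c: "\<And>n. 0 < c n" "c 0 \<le> t\<^sup>2" "\<And>n. c (Suc n) \<le> c n / 4"
    and R: "\<And>S n. pmf S Sup = 1 / real L \<Longrightarrow> (\<And>n. pmf S (Bit (Suc n)) = \<beta> n) \<Longrightarrow> (\<And>n. pmf S (Cut n) = c n) \<Longrightarrow>
      wprob (2 * R n + 5) (label S) (\<lambda>l. \<not> loc_res n (R n) l) \<le> \<beta> n / 64"
    using cut_rates_exist[where \<beta>=\<beta>, OF q Lge(1) \<beta> base t2] by metis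
  have cn: "c n \<le> t\<^sup>2 * (1 / 4) ^ n" for n
  proof (induction n)
    case (Suc n)
    then show ?case using c(3)[of n] by simp
  qed (use c in simp)
  define S where "S = type_pmf (1 / real L) \<beta> c"
  have \<beta>': "\<beta> = (\<lambda>n. t\<^sup>2 * (1 / 4) ^ n)" by (simp add: \<beta>_def fun_eq_iff)
  have S: "pmf S x = type_weight (1 / real L) \<beta> c x" for x
    unfolding S_def \<beta>' using c(1) by (intro pent_label_le t Lge cn) (simp add: less_imp_le)
  have ent: "pent (label S) \<le> ennreal (Hw L / L + 25 * t)"
    unfolding S_def \<beta>' using c(1) by (intro pent_label_le t Lge cn) (simp add: less_imp_le)
  have "resolving S"
    unfolding resolving_def
  proof (intro allI impI)
    fix e :: real assume "e > 0"
    have "\<beta> \<longlonglongrightarrow> 0" unfolding \<beta>' by (intro tendsto_mult_right_zero LIMSEQ_realpow_zero) auto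
    then obtain n where "\<beta> n < e" using order_tendstoD(2)[of \<beta> 0 sequentially e] \<open>e > 0\<close>
      by (auto dest: eventually_happens)
    moreover have "wprob (2 * R n + 5) (label S) (\<lambda>l. \<not> loc_res n (R n) l) \<le> \<beta> n / 64"
      by (rule R) (simp_all add: S type_weight_def)
    ultimately have "wprob (2 * R n + 5) (label S) (\<lambda>l. \<not> loc_res n (R n) l) \<le> e" using \<beta>(1)[of n] by simp
    then show "\<exists>n R. wprob (2 * R + 5) (label S) (\<lambda>l. \<not> loc_res n R l) \<le> e" by blast
  qed
  moreover have "process_entropy (iid (label S)) (\<lambda>i \<omega>. \<omega> i) < process_entropy M X + ennreal \<epsilon>"
  proof -
    \<comment> \<open>\<open>ennreal\<close> truncates at 0; the maximum with 0 allows the sum to be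
      split afterwards.\<close>
    have "Hw L / L + 25 * t \<le> max 0 (went l V' / card V') + \<epsilon> / 2"
    proof -
      have "Hw L / L \<le> went l V' / card V' + \<epsilon> / 4" using L0[OF Lge(2)] Lge(1) by (simp add: pos_divide_le_eq mult.commute)
      then show ?thesis using t(3) by simp
    qed
    then have "process_entropy (iid (label S)) (\<lambda>i \<omega>. \<omega> i) \<le> ennreal (max 0 (went l V' / card V') + \<epsilon> / 2)"
      using process_entropy_iid_le[of "label S"] ent by (meson ennreal_leI order.trans)
    also have "\<dots> = ennreal (went l V' / card V') + ennreal (\<epsilon> / 2)"
      using assms(3) by (subst ennreal_plus) (auto simp: max_def ennreal_neg)
    also have "\<dots> < process_entropy M X + ennreal (\<epsilon> / 4) + ennreal (\<epsilon> / 2)"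
      using w by (simp add: ennreal_add_left_cancel_less add.commute)
    also have "\<dots> \<le> process_entropy M X + ennreal \<epsilon>"
      using assms(3) by (simp add: add.assoc ennreal_plus[symmetric] add_left_mono ennreal_leI del: ennreal_plus)
    finally show ?thesis .
  qed
  ultimately show ?thesis
    using iid_process_iid finitary_coder factor_map_coder[OF q(1) refl _ assms(2)] by blast
qed

end
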